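(* Let $\phi=\varphi\circ|\cdot|\in C^0(\mathbb{R}^d)\cap C^2(\mathbb{R}^d\setminus\{0\})$, where $\varphi\colon\mathbb{R}_{\ge0}\to\mathbb{R}_{\ge0}$ is an $N$-function such that $\varphi$ satisfies the $\Delta_2$-condition and the $\nabla_2$-condition, $\varphi\in C^2(0,\infty)$, and $\varphi'(t)\sim t\,\varphi''(t)$ uniformly with respect to $t\ge0$. Then there exists a constant $c>0$, depending only on $\omega_0$, $\Delta_2(\varphi)$ and $\nabla_2(\varphi)$, such that for every $v_h\in\mathcal{S}^{1,cr}_D(\mathcal{T}_h)$, every $v\in W^{1,1}_D(\Omega)$ with $F(\nabla v)\in L^2(\Omega;\mathbb{R}^d)$, and every $T\in\mathcal{T}_h$, $$\|F(\nabla\Pi_h^{av}v_h)-F(\nabla v)\|_{L^2(T)}^2\le c\,\|F(\nabla_hv_h)-F(\nabla v)\|_{L^2(\omega_T)}^2+c\inf_{r\in\mathbb{R}^d}\|F(\nabla v)-F(r)\|_{L^2(\omega_T)}^2,$$ and if, in addition, $F(\nabla v)\in N^{\beta,2}(\mathrm{int}(\omega_T);\mathbb{R}^d)$ with $\beta\in(0,1]$, then $$\|F(\nabla\Pi_h^{av}v_h)-F(\nabla v)\|_{L^2(T)}^2\le c\,\|F(\nabla_hv_h)-F(\nabla v)\|_{L^2(\omega_T)}^2+c\,h_T^{2\beta}\,[F(\nabla v)]_{N^{\beta,2}(\mathrm{int}(\omega_T))}^2 .$$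
   Context: Setting. $\Omega\subseteq\mathbb{R}^d$, $d\in\mathbb{N}$, is a bounded simplicial (polyhedral) Lipschitz domain; $\partial\Omega=\Gamma_D\,\dot\cup\,\Gamma_N$ (disjoint), each of $\Gamma_D,\Gamma_N$ being empty or of positive surface measure. $W^{1,1}_D(\Omega)$ is the space of $W^{1,1}(\Omega)$-functions with zero trace on $\Gamma_D$. $\{\mathcal{T}_h\}_{h>0}$ is a family of conforming simplicial triangulations of $\Omega$ with vertex set $\mathcal{N}_h$; $h_T=\mathrm{diam}(T)$, $\rho_T$ is the supremum of diameters of balls inscribed in $T$, and $\omega_0$ (the chunkiness) is the smallest constant, independent of $h$, with $\max_{T\in\mathcal{T}_h}h_T\rho_T^{-1}\le\omega_0$. The element patch is $\omega_T=\bigcup\{T'\in\mathcal{T}_h: T\cap T'\ne\emptyset\}$. $\mathcal{S}_h^i$ denotes the interior sides, $\mathcal{S}_h^{\Gamma_D}$ the boundary sides with interior in $\Gamma_D$ (every boundary side lies in $\Gamma_D$ or $\Gamma_N$). Discrete spaces. $\mathcal{L}^1(\mathcal{T}_h)$: element-wise affine functions; $\mathcal{S}^1(\mathcal{T}_h)=\mathcal{L}^1(\mathcal{T}_h)\cap C^0(\overline\Omega)$ with nodal basis $(\varphi_\nu)_{\nu\in\mathcal{N}_h}$; $\mathcal{S}^1_D(\mathcal{T}_h)$ its subspace of functions vanishing on $\Gamma_D$; $\nabla_h$ the element-wise gradient. $\mathcal{S}^{1,cr}_D(\mathcal{T}_h)$: functions $v_h\in\mathcal{L}^1(\mathcal{T}_h)$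 whose jump $[\![v_h]\!]_S$ has zero mean over every $S\in\mathcal{S}_h^i\cup\mathcal{S}_h^{\Gamma_D}$ (on boundary sides the jump is the trace). Node-averaging operator $\Pi_h^{av}\colon\mathcal{L}^1(\mathcal{T}_h)\to\mathcal{S}^1_D(\mathcal{T}_h)$: $\Pi_h^{av}v_h=\sum_{\nu\in\mathcal{N}_h}\langle v_h\rangle_\nu\varphi_\nu$, where, with $\mathcal{T}_h(\nu)=\{T\in\mathcal{T}_h:\nu\in T\}$, $\langle v_h\rangle_\nu=\frac{1}{\mathrm{card}(\mathcal{T}_h(\nu))}\sum_{T\in\mathcal{T}_h(\nu)}(v_h|_T)(\nu)$ if $\nu\in\Omega\cup\Gamma_N$ and $\langle v_h\rangle_\nu=0$ if $\nu\in\Gamma_D$. $N$-functions. A convex $\varphi\colon\mathbb{R}_{\ge0}\to\mathbb{R}_{\ge0}$ is an $N$-function if $\varphi(0)=0$, $\varphi(t)>0$ for $t>0$, $\lim_{t\to0}\varphi(t)/t=0$, $\lim_{t\to\infty}\varphi(t)/t=\infty$. It satisfies the $\Delta_2$-condition if $\varphi(2t)\le c\,\varphi(t)$ for all $t\ge0$ with some $c>0$; $\Delta_2(\varphi)$ is the smallest such $c$. It satisfies the $\nabla_2$-condition if its conjugate $\varphi^*(s)=\sup_{t\ge0}(st-\varphi(t))$ is an $N$-function satisfying the $\Delta_2$-condition; $\nabla_2(\varphi):=\Delta_2(\varphi^* )$. $\varphi'(t)\sim t\varphi''(t)$ means there is a constant $c_0>0$ with $c_0^{-1}\varphi'(t)\le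 t\varphi''(t)\le c_0\varphi'(t)$ for all $t$. $F\colon\mathbb{R}^d\to\mathbb{R}^d$, $F(r)=\sqrt{\varphi'(|r|)/|r|}\;r$ (with $F(0)=0$). Nikolskii spaces. For $p\in[1,\infty)$, $\beta\in(0,1]$, $G\subseteq\mathbb{R}^d$ open and $v\in L^p(G)$ (also vector-valued), $[v]_{N^{\beta,p}(G)}=\sup_{h\in\mathbb{R}^d\setminus\{0\}}|h|^{-\beta}\big(\int_{G\cap(G-h)}|v(\cdot+h)-v|^p\,\mathrm{d}x\big)^{1/p}$, and $N^{\beta,p}(G)=\{v\in L^p(G):[v]_{N^{\beta,p}(G)}<\infty\}$.
   Formalization: The constant c may also depend on the equivalence constant c_0 in φ'(t) ~ tφ''(t) (independence of c_0 is false), and every node in Γ_D is required to lie on a closed side whose relative interior is in Γ_D (an isolated Dirichlet vertex would break the claim). *)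

theory Defs
  imports "HOL-Analysis.Analysis"
begin

section \<open>N-functions\<close>

text \<open>Functions on the half-line are modelled by functions on \<^typ>\<open>real\<close>; no definition below
  depends on the values at negative arguments.\<close>

definition N_function :: "(real \<Rightarrow> real) \<Rightarrow> bool" where
  "N_function \<phi> \<longleftrightarrow>
     convex_on {0..} \<phi> \<and> \<phi> 0 = 0 \<and> (\<forall>t>0. \<phi> t > 0) \<and>
     ((\<lambda>t. \<phi> t / t) \<longlongrightarrow> 0) (at_right 0) \<and>
     filterlim (\<lambda>t. \<phi> t / t) at_top at_top"

definition Delta2_bounds :: "(real \<Rightarrow> real) \<Rightarrow> real set" where
  "Delta2_bounds \<phi> = {c. c > 0 \<and> (\<forall>t\<ge>0. \<phi> (2 * t) \<le> c * \<phi> t)}"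

definition Delta2_condition :: "(real \<Rightarrow> real) \<Rightarrow> bool" where
  "Delta2_condition \<phi> \<longleftrightarrow> Delta2_bounds \<phi> \<noteq> {}"

definition Delta2 :: "(real \<Rightarrow> real) \<Rightarrow> real" where
  "Delta2 \<phi> = Inf (Delta2_bounds \<phi>)"

definition conjugate :: "(real \<Rightarrow> real) \<Rightarrow> real \<Rightarrow> real" where
  "conjugate \<phi> s = (SUP t\<in>{0..}. s * t - \<phi> t)"

definition Nabla2_condition :: "(real \<Rightarrow> real) \<Rightarrow> bool" where
  "Nabla2_condition \<phi> \<longleftrightarrow> N_function (conjugate \<phi>) \<and> Delta2_condition (conjugate \<phi>)"

definition Nabla2 :: "(real \<Rightarrow> real) \<Rightarrow> real" where
  "Nabla2 \<phi> = Delta2 (conjugate \<phi>)"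

text \<open>\<open>\<phi>'(t) \<sim> t \<phi>''(t)\<close> with equivalence constant \<open>c\<^sub>0\<close>; only \<open>t > 0\<close> matters, as \<open>\<phi>\<close> is
  twice differentiable on the open half-line only.  The constant is explicit because estimates for
  \<open>F\<close> depend on it, and \<open>\<Delta>\<^sub>2(\<phi>)\<close>, \<open>\<nabla>\<^sub>2(\<phi>)\<close> do not control it.\<close>

definition deriv_equivalence :: "real \<Rightarrow> (real \<Rightarrow> real) \<Rightarrow> bool" where
  "deriv_equivalence c\<^sub>0 \<phi> \<longleftrightarrow> c\<^sub>0 > 0 \<and>
     (\<forall>t>0. inverse c\<^sub>0 * deriv \<phi> t \<le> t * deriv (deriv \<phi>) t \<and>
            t * deriv (deriv \<phi>) t \<le> c\<^sub>0 * deriv \<phi> t)"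

definition F_map :: "(real \<Rightarrow> real) \<Rightarrow> 'a::euclidean_space \<Rightarrow> 'a" where
  "F_map \<phi> r = sqrt (deriv \<phi> (norm r) / norm r) *\<^sub>R r"


section \<open>Differentiability classes and test functions\<close>

primrec C_on :: "nat \<Rightarrow> 'a::euclidean_space set \<Rightarrow> ('a \<Rightarrow> real) \<Rightarrow> bool" where
  "C_on 0 U f \<longleftrightarrow> continuous_on U f"
| "C_on (Suc k) U f \<longleftrightarrow>
     (\<exists>g. (\<forall>x\<in>U. GDERIV f x :> g x) \<and> (\<forall>b\<in>Basis. C_on k U (\<lambda>x. g x \<bullet> b)))"

definition smooth :: "('a::euclidean_space \<Rightarrow> real) \<Rightarrow> bool" where
  "smooth f \<longleftrightarrow> (\<forall>k. C_on k UNIV f)"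

definition test_function :: "'a::euclidean_space set \<Rightarrow> ('a \<Rightarrow> real) \<Rightarrow> bool" where
  "test_function \<Omega> \<psi> \<longleftrightarrow>
     smooth \<psi> \<and> compact (closure {x. \<psi> x \<noteq> 0}) \<and> closure {x. \<psi> x \<noteq> 0} \<subseteq> \<Omega>"

definition grad :: "('a::euclidean_space \<Rightarrow> real) \<Rightarrow> 'a \<Rightarrow> 'a" where
  "grad f x = (THE D. GDERIV f x :> D)"


section \<open>Surface measure\<close>

text \<open>The \<open>(d-1)\<close>-dimensional Lebesgue measure on a hyperplane \<open>H\<close>.  Since Lebesgue measure is the
  product of the measure on \<open>H\<close> and of length in the normal direction, the measure of \<open>A \<subseteq> H\<close> is
  the volume of the cylinder of height one over \<open>A\<close>.  For \<open>d = 1\<close> this is a unit point mass.\<close>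

definition hyperplane_measure :: "'a::euclidean_space set \<Rightarrow> 'a measure" where
  "hyperplane_measure H =
     distr (restrict_space lborel {x. infdist x H \<le> 1/2}) borel (closest_point H)"

definition hyperplanes :: "'a::euclidean_space set set" where
  "hyperplanes = {H. affine H \<and> aff_dim H = int DIM('a) - 1}"

text \<open>The sum of the measures of all hyperplanes.  On a set that is contained in a finite union of
  hyperplanes, such as the boundary of a polyhedral domain, only these contribute, because distinct
  hyperplanes intersect in null sets; there it is the usual surface measure.\<close>

definition surface_measure :: "'a::euclidean_space measure" where
  "surface_measure = measure_of UNIV (sets borel)
     (\<lambda>A. \<integral>\<^sup>+H. emeasure (hyperplane_measure H) A \<partial>count_space hyperplanes)"

lemma sets_surface_measure: "sets (surface_measure :: 'a::euclidean_space measure) = sets borel"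
  unfolding surface_measure_def using sets.sigma_sets_eq[of "borel :: 'a measure"] by simp

lemma emeasure_surface_measure:
  fixes A :: "'a::euclidean_space set"
  assumes "A \<in> sets borel"
  shows "emeasure surface_measure A =
           (\<integral>\<^sup>+H. emeasure (hyperplane_measure H) A \<partial>count_space hyperplanes)"
proof -
  let ?\<mu> = "\<lambda>A::'a set. \<integral>\<^sup>+H. emeasure (hyperplane_measure H) A \<partial>count_space hyperplanes"
  have s: "sigma_sets (UNIV :: 'a set) (sets borel) = sets borel"
    using sets.sigma_sets_eq[of "borel :: 'a measure"] by simp
  have "countably_additive (sets borel) ?\<mu>"
  proof (rule countably_additiveI)
    fix B :: "nat \<Rightarrow> 'a set"
    assume B: "range B \<subseteq> sets borel" "disjoint_family B"
    have "(\<Sum>i. ?\<mu> (B i)) =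
            (\<integral>\<^sup>+H. (\<Sum>i. emeasure (hyperplane_measure H) (B i)) \<partial>count_space hyperplanes)"
      by (intro nn_integral_suminf[symmetric]) simp
    also have "\<dots> = ?\<mu> (\<Union>i. B i)"
      using B by (intro nn_integral_cong suminf_emeasure) (auto simp: hyperplane_measure_def)
    finally show "(\<Sum>i. ?\<mu> (B i)) = ?\<mu> (\<Union>i. B i)" .
  qed
  moreover have "positive (sets borel) ?\<mu>"
    by (auto simp: positive_def)
  ultimately show ?thesis
    using assms by (intro emeasure_measure_of[OF surface_measure_def])
      (auto simp: s sets_surface_measure)
qed

lemma emeasure_hyperplane_measure:
  fixes H :: "'a::euclidean_space set"
  assumes "H \<in> hyperplanes" "A \<in> sets borel"
  shows "emeasure (hyperplane_measure H) A =
           emeasure lborel {x. infdist x H \<le> 1/2 \<and> closest_point H x \<in> A}"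
proof -
  have H: "convex H" "closed H" "H \<noteq> {}"
    using assms(1) DIM_positive[where 'a='a]
    by (auto simp: hyperplanes_def affine_imp_convex affine_closed)
  have m: "closest_point H \<in> borel_measurable borel"
    using H by (intro borel_measurable_continuous_onI continuous_on_closest_point)
  have slab: "{x. infdist x H \<le> 1/2} \<in> sets borel"
    by (intro borel_closed closed_Collect_le continuous_intros)
  have m': "closest_point H \<in> measurable (restrict_space lborel {x. infdist x H \<le> 1/2}) borel"
    using m by (intro measurable_restrict_space1) simp
  show ?thesis
    unfolding hyperplane_measure_def
    using slab assms(2) m'
    by (subst emeasure_distr, simp, simp, subst emeasure_restrict_space)
       (auto simp: space_restrict_space intro!: arg_cong[where f = "emeasure lborel"])
qed


section \<open>Function spaces\<close>

definition Lp_norm :: "real \<Rightarrow> 'a::euclidean_space set \<Rightarrow> ('a \<Rightarrow> 'b::euclidean_space) \<Rightarrow> real" where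
  "Lp_norm p A f = (LINT x:A|lebesgue. norm (f x) powr p) powr (1 / p)"

definition Lp_space :: "real \<Rightarrow> 'a::euclidean_space set \<Rightarrow> ('a \<Rightarrow> 'b::euclidean_space) set" where
  "Lp_space p A = {f. set_borel_measurable lebesgue A f \<and>
     set_integrable lebesgue A (\<lambda>x. norm (f x) powr p)}"

definition has_weak_gradient ::
    "'a::euclidean_space set \<Rightarrow> ('a \<Rightarrow> real) \<Rightarrow> ('a \<Rightarrow> 'a) \<Rightarrow> bool" where
  "has_weak_gradient \<Omega> v G \<longleftrightarrow>
     (\<forall>K. compact K \<and> K \<subseteq> \<Omega> \<longrightarrow> set_integrable lebesgue K v \<and> set_integrable lebesgue K G) \<and>
     (\<forall>\<psi> b. test_function \<Omega> \<psi> \<and> b \<in> Basis \<longrightarrow>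
        (LINT x:\<Omega>|lebesgue. v x * (grad \<psi> x \<bullet> b)) = - (LINT x:\<Omega>|lebesgue. (G x \<bullet> b) * \<psi> x))"

definition W11 :: "'a::euclidean_space set \<Rightarrow> ('a \<Rightarrow> real) set" where
  "W11 \<Omega> = {v. v \<in> Lp_space 1 \<Omega> \<and> (\<exists>G. has_weak_gradient \<Omega> v G \<and> G \<in> Lp_space 1 \<Omega>)}"

text \<open>The trace operator on a Lipschitz domain is the continuous extension, from \<open>W\<^sup>1\<^sup>,\<^sup>1(\<Omega>)\<close> to
  \<open>L\<^sup>1(\<partial>\<Omega>)\<close>, of the restriction of functions that are smooth up to the boundary;
  \<open>has_trace \<Omega> v g\<close> is its graph.\<close>

definition has_trace :: "'a::euclidean_space set \<Rightarrow> ('a \<Rightarrow> real) \<Rightarrow> ('a \<Rightarrow> real) \<Rightarrow> bool" where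
  "has_trace \<Omega> v g \<longleftrightarrow>
     set_integrable surface_measure (frontier \<Omega>) g \<and>
     (\<exists>w G. (\<forall>k::nat. smooth (w k)) \<and> has_weak_gradient \<Omega> v G \<and>
        v \<in> Lp_space 1 \<Omega> \<and> G \<in> Lp_space 1 \<Omega> \<and>
        (\<lambda>k. Lp_norm 1 \<Omega> (\<lambda>x. w k x - v x)) \<longlonglongrightarrow> 0 \<and>
        (\<lambda>k. Lp_norm 1 \<Omega> (\<lambda>x. grad (w k) x - G x)) \<longlonglongrightarrow> 0 \<and>
        (\<lambda>k. LINT x:frontier \<Omega>|surface_measure. \<bar>w k x - g x\<bar>) \<longlonglongrightarrow> 0)"

definition W11_D :: "'a::euclidean_space set \<Rightarrow> 'a set \<Rightarrow> ('a \<Rightarrow> real) set" where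
  "W11_D \<Omega> \<Gamma>\<^sub>D = {v \<in> W11 \<Omega>. \<exists>g. has_trace \<Omega> v g \<and> (AE x in surface_measure. x \<in> \<Gamma>\<^sub>D \<longrightarrow> g x = 0)}"

definition nikolskii_quotients ::
    "real \<Rightarrow> real \<Rightarrow> 'a::euclidean_space set \<Rightarrow> ('a \<Rightarrow> 'b::euclidean_space) \<Rightarrow> real set" where
  "nikolskii_quotients \<beta> p U v =
     {norm h powr (-\<beta>) * Lp_norm p {x \<in> U. x + h \<in> U} (\<lambda>x. v (x + h) - v x) | h. h \<noteq> 0}"

definition nikolskii_seminorm ::
    "real \<Rightarrow> real \<Rightarrow> 'a::euclidean_space set \<Rightarrow> ('a \<Rightarrow> 'b::euclidean_space) \<Rightarrow> real" where
  "nikolskii_seminorm \<beta> p U v = Sup (nikolskii_quotients \<beta> p U v)"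

definition nikolskii_space ::
    "real \<Rightarrow> real \<Rightarrow> 'a::euclidean_space set \<Rightarrow> ('a \<Rightarrow> 'b::euclidean_space) set" where
  "nikolskii_space \<beta> p U = {v \<in> Lp_space p U. bdd_above (nikolskii_quotients \<beta> p U v)}"


section \<open>Domains and triangulations\<close>

definition conforming_triangulation :: "'a::euclidean_space set \<Rightarrow> 'a set set \<Rightarrow> bool" where
  "conforming_triangulation \<Omega> \<T> \<longleftrightarrow>
     triangulation \<T> \<and> (\<forall>T\<in>\<T>. int DIM('a) simplex T) \<and> \<Union>\<T> = closure \<Omega>"

text \<open>Near each boundary point, \<open>\<Omega>\<close> is the strict epigraph, in some direction \<open>e\<close>, of a Lipschitz
  function on the orthogonal complement of \<open>e\<close>.\<close>

definition simplicial_lipschitz_domain :: "'a::euclidean_space set \<Rightarrow> bool" where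
  "simplicial_lipschitz_domain \<Omega> \<longleftrightarrow>
     open \<Omega> \<and> connected \<Omega> \<and> \<Omega> \<noteq> {} \<and> bounded \<Omega> \<and>
     (\<exists>\<T>. conforming_triangulation \<Omega> \<T>) \<and>
     (\<forall>p\<in>frontier \<Omega>. \<exists>e r L g. norm e = 1 \<and> r > 0 \<and> L-lipschitz_on {y. y \<bullet> e = 0} g \<and>
        (\<forall>x\<in>ball p r. x \<in> \<Omega> \<longleftrightarrow> g (x - (x \<bullet> e) *\<^sub>R e) < x \<bullet> e))"

definition inradius_diam :: "'a::euclidean_space set \<Rightarrow> real" where
  "inradius_diam T = Sup {diameter (ball x r) | x r. ball x r \<subseteq> T}"

definition aspect_ratios :: "(real \<Rightarrow> 'a::euclidean_space set set) \<Rightarrow> real set" where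
  "aspect_ratios \<T> = {diameter T / inradius_diam T | h T. h > 0 \<and> T \<in> \<T> h}"

definition chunkiness :: "(real \<Rightarrow> 'a::euclidean_space set set) \<Rightarrow> real" where
  "chunkiness \<T> = Sup (aspect_ratios \<T>)"

definition element_patch :: "'a::euclidean_space set set \<Rightarrow> 'a set \<Rightarrow> 'a set" where
  "element_patch \<T> T = \<Union>{T' \<in> \<T>. T \<inter> T' \<noteq> {}}"

definition nodes :: "'a::euclidean_space set set \<Rightarrow> 'a set" where
  "nodes \<T> = {\<nu>. \<exists>T\<in>\<T>. \<nu> extreme_point_of T}"

definition sides :: "'a::euclidean_space set set \<Rightarrow> 'a set set" where
  "sides \<T> = {S. \<exists>T\<in>\<T>. S facet_of T}"

definition interior_sides :: "'a::euclidean_space set \<Rightarrow> 'a set set \<Rightarrow> 'a set set" where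
  "interior_sides \<Omega> \<T> = {S \<in> sides \<T>. rel_interior S \<subseteq> \<Omega>}"

definition boundary_sides :: "'a::euclidean_space set \<Rightarrow> 'a set set \<Rightarrow> 'a set set" where
  "boundary_sides \<Omega> \<T> = {S \<in> sides \<T>. S \<subseteq> frontier \<Omega>}"

definition sides_in ::
    "'a::euclidean_space set \<Rightarrow> 'a set set \<Rightarrow> 'a set \<Rightarrow> 'a set set" where
  "sides_in \<Omega> \<T> \<Gamma> = {S \<in> boundary_sides \<Omega> \<T>. rel_interior S \<subseteq> \<Gamma>}"

definition boundary_partition :: "'a::euclidean_space set \<Rightarrow> 'a set \<Rightarrow> 'a set \<Rightarrow> bool" where
  "boundary_partition \<Omega> \<Gamma>\<^sub>D \<Gamma>\<^sub>N \<longleftrightarrow>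
     frontier \<Omega> = \<Gamma>\<^sub>D \<union> \<Gamma>\<^sub>N \<and> \<Gamma>\<^sub>D \<inter> \<Gamma>\<^sub>N = {} \<and>
     \<Gamma>\<^sub>D \<in> sets borel \<and> \<Gamma>\<^sub>N \<in> sets borel \<and>
     (\<Gamma>\<^sub>D = {} \<or> emeasure surface_measure \<Gamma>\<^sub>D > 0) \<and>
     (\<Gamma>\<^sub>N = {} \<or> emeasure surface_measure \<Gamma>\<^sub>N > 0)"

text \<open>Sides are closed, so that a side in the Neumann part may have lower-dimensional faces in
  \<open>\<Gamma>\<^sub>D\<close>; hence the relative interiors.  The second condition excludes Dirichlet parts without surface
  measure, such as an isolated boundary vertex, which the zero trace does not see but the node
  averaging does.  It holds if \<open>\<Gamma>\<^sub>D\<close> is the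
  union of closed sides, and also if it is the relative interior of such a union.\<close>

definition mesh_resolves ::
    "'a::euclidean_space set \<Rightarrow> 'a set \<Rightarrow> 'a set \<Rightarrow> 'a set set \<Rightarrow> bool" where
  "mesh_resolves \<Omega> \<Gamma>\<^sub>D \<Gamma>\<^sub>N \<T> \<longleftrightarrow>
     boundary_sides \<Omega> \<T> = sides_in \<Omega> \<T> \<Gamma>\<^sub>D \<union> sides_in \<Omega> \<T> \<Gamma>\<^sub>N \<and>
     nodes \<T> \<inter> \<Gamma>\<^sub>D \<subseteq> \<Union>(sides_in \<Omega> \<T> \<Gamma>\<^sub>D)"


section \<open>Discrete spaces\<close>

text \<open>Element-wise affine functions are prescribed in the interiors of the elements only; their
  values on the sides, a null set, are irrelevant.  The value at \<open>x \<in> T\<close> of the affine function on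
  the closed element \<open>T\<close> is recovered as the limit from the interior of \<open>T\<close>.  The element-wise
  gradient is \<^const>\<open>grad\<close>, which is meaningful in the interiors of the elements.\<close>

definition L1_elem :: "'a::euclidean_space set set \<Rightarrow> ('a \<Rightarrow> real) set" where
  "L1_elem \<T> = {v. \<forall>T\<in>\<T>. \<exists>a b. \<forall>x\<in>interior T. v x = a \<bullet> x + b}"

definition restr :: "('a::euclidean_space \<Rightarrow> real) \<Rightarrow> 'a set \<Rightarrow> 'a \<Rightarrow> real" where
  "restr v T x = Lim (at x within interior T) v"

definition S1 :: "'a::euclidean_space set set \<Rightarrow> ('a \<Rightarrow> real) set" where
  "S1 \<T> = {v \<in> L1_elem \<T>. continuous_on (\<Union>\<T>) v}"

definition S1cr_D ::
    "'a::euclidean_space set \<Rightarrow> 'a set \<Rightarrow> 'a set set \<Rightarrow> ('a \<Rightarrow> real) set" where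
  "S1cr_D \<Omega> \<Gamma>\<^sub>D \<T> = {v \<in> L1_elem \<T>.
     (\<forall>S\<in>interior_sides \<Omega> \<T>. \<forall>T\<in>\<T>. \<forall>T'\<in>\<T>. S facet_of T \<and> S facet_of T' \<and> T \<noteq> T' \<longrightarrow>
        (LINT x:S|hyperplane_measure (affine hull S). restr v T x - restr v T' x) = 0) \<and>
     (\<forall>S\<in>sides_in \<Omega> \<T> \<Gamma>\<^sub>D. \<forall>T\<in>\<T>. S facet_of T \<longrightarrow>
        (LINT x:S|hyperplane_measure (affine hull S). restr v T x) = 0)}"

text \<open>Unique on \<open>\<Union>\<T>\<close>; values elsewhere are irrelevant.\<close>

definition nodal_basis :: "'a::euclidean_space set set \<Rightarrow> 'a \<Rightarrow> 'a \<Rightarrow> real" where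
  "nodal_basis \<T> \<nu> =
     (SOME f. f \<in> S1 \<T> \<and> (\<forall>\<mu>\<in>nodes \<T>. f \<mu> = (if \<mu> = \<nu> then 1 else 0)))"

definition node_average ::
    "'a::euclidean_space set \<Rightarrow> 'a set set \<Rightarrow> ('a \<Rightarrow> real) \<Rightarrow> 'a \<Rightarrow> real" where
  "node_average \<Gamma>\<^sub>D \<T> v \<nu> =
     (if \<nu> \<in> \<Gamma>\<^sub>D then 0
      else (\<Sum>T | T \<in> \<T> \<and> \<nu> \<in> T. restr v T \<nu>) / real (card {T \<in> \<T>. \<nu> \<in> T}))"

definition node_averaging ::
    "'a::euclidean_space set \<Rightarrow> 'a set set \<Rightarrow> ('a \<Rightarrow> real) \<Rightarrow> 'a \<Rightarrow> real" where
  "node_averaging \<Gamma>\<^sub>D \<T> v x = (\<Sum>\<nu>\<in>nodes \<T>. node_average \<Gamma>\<^sub>D \<T> v \<nu> * nodal_basis \<T> \<nu> x)"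

end

theory Submission
  imports Defs
begin

text \<open>The function \<open>\<psi>\<^sub>b(t) = \<phi>'(b + t) / (b + t) t\<^sup>2\<close> satisfies \<open>|F(a) - F(b)|\<^sup>2 \<sim> \<psi>\<^bsub>|b|\<^esub>(|a - b|)\<close>, its slope
  \<open>\<psi>\<^sub>b(t) / t\<close> is nondecreasing, and it is doubling.  Hence it suffices to bound, for every vector
  \<open>r\<close>, the distance of the gradient of the node average on \<open>T\<close> to \<open>r\<close> by averages over elements
  \<open>T'\<close> of the patch of \<open>|\<nabla>v\<^sub>h - r| + |\<nabla>v - r|\<close>.

  At a node, two elements of its star are joined by a chain of elements that share facets, because
  the domain is locally connected near its closure and a generic segment avoids all faces of
  codimension two.  The jump across such a facet is affine with mean zero and so has a zero, whence it
  is at most the diameter times the jump of the gradient.  The chain also shows that the elements of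
  a star have comparable sizes; its length is bounded since every element of a star occupies a fixed
  part of every small ball about the node.

  At a Dirichlet node the trace of \<open>v\<^sub>h\<close> on a side \<open>S\<close> has to be bounded.  Let \<open>\<lambda>\<^sub>i\<close> be the barycentric
  coordinates of an element with vertices \<open>z\<^sub>i\<close>, where \<open>S\<close> is opposite \<open>z\<^sub>0\<close>.  The field
  \<open>X = \<lambda>\<^sub>1 (z\<^sub>1 - z\<^sub>0) - \<lambda>\<^sub>2 (z\<^sub>2 - z\<^sub>0)\<close> is divergence free and tangential to all faces but \<open>S\<close>; so
  \<open>\<integral> X \<cdot> \<nabla>v = 0\<close> if \<open>v\<close> has zero trace on \<open>S\<close>, while \<open>\<integral> X \<cdot> \<nabla>v\<^sub>h\<close> is a fixed
  multiple of the volume times \<open>v\<^sub>h(z\<^sub>1) - v\<^sub>h(z\<^sub>2)\<close>.  In dimension one the elements of a star need not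
  be comparable, but there all node errors vanish.\<close>

section \<open>The map F and shifted functions\<close>

text \<open>One function comes with several weak gradients: the one in the statement, the one that
  witnesses membership in \<open>W11\<close>, and the one that accompanies the trace. Uniqueness
  almost everywhere, proved with smooth bumps on boxes, makes them interchangeable and carries
  integrability from one to the other. The zero trace is available only as a limit of smooth
  functions. The flux identity for \<open>X\<close> is therefore first an inequality for smooth
  \<open>w\<close>, whose only boundary term is the integral of \<open>\<bar>w\<bar>\<close> over
  the side, and then passes to the limit. Two numbers govern all constants besides the dimension: a
  shape constant \<open>\<kappa>\<close>, which comes from the chunkiness, and a natural number
  \<open>k\<close> above \<open>c\<^sub>0\<close>, for which \<open>deriv \<phi> t / t ^ k\<close>
  is nonincreasing. Chain lengths, size ratios and volume ratios in a star depend on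
  \<open>\<kappa>\<close>; the growth of \<open>\<psi>\<close> depends on \<open>k\<close>. An upper
  bound for an average of \<open>u\<close> has to become a bound by an average of
  \<open>\<psi>(u)\<close>. In place of convexity there is only a nondecreasing slope, so the
  comparison is made at half the mean, which costs a power of two.\<close>

lemma C_on_2_real_deriv:
  fixes \<phi> :: "real \<Rightarrow> real"
  assumes "C_on 2 {0<..} \<phi>" "t > 0"
  shows "(\<phi> has_real_derivative deriv \<phi> t) (at t)"
    and "(deriv \<phi> has_real_derivative deriv (deriv \<phi>) t) (at t)"
proof -
  obtain g where g: "\<forall>x\<in>{0<..}. GDERIV \<phi> x :> g x" "C_on 1 {0<..} g"
    using assms by (auto simp: numeral_2_eq_2)
  then obtain g' where g': "\<forall>x\<in>{0<..}. GDERIV g x :> g' x"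
    by auto
  have d: "(\<phi> has_real_derivative g x) (at x)" if "x > 0" for x
    using g(1) that by (auto simp: gderiv_def has_field_derivative_def inner_commute
        intro: has_derivative_eq_rhs)
  have d': "(g has_real_derivative g' x) (at x)" if "x > 0" for x
    using g' that by (auto simp: gderiv_def has_field_derivative_def inner_commute
        intro: has_derivative_eq_rhs)
  have eq: "deriv \<phi> x = g x" if "x > 0" for x
    using d[OF that] by (rule DERIV_imp_deriv)
  show "(\<phi> has_real_derivative deriv \<phi> t) (at t)" using d eq assms by simp
  have "(deriv \<phi> has_real_derivative g' t) (at t)"
    by (rule DERIV_cong_ev[THEN iffD2, OF refl _ refl d'])
       (use eq assms eventually_nhds_in_open[of "{0<..}" t] in \<open>auto elim!: eventually_mono\<close>)
  then show "(deriv \<phi> has_real_derivative deriv (deriv \<phi>) t) (at t)"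
    using DERIV_imp_deriv by metis
qed

text \<open>This is all that the estimates for \<open>F\<close> use about \<open>\<phi>\<close>. The
  growth exponent is a natural number so that ordinary powers and Bernoulli's inequality
  apply.\<close>

locale regular_N_function =
  fixes \<phi> :: "real \<Rightarrow> real" and k :: nat
  assumes dpos: "t > 0 \<Longrightarrow> deriv \<phi> t > 0"
    and dmono: "\<lbrakk>0 < s; s \<le> t\<rbrakk> \<Longrightarrow> deriv \<phi> s \<le> deriv \<phi> t"
    and dscale: "\<lbrakk>0 < s; 1 \<le> l\<rbrakk> \<Longrightarrow> deriv \<phi> (l * s) \<le> l ^ k * deriv \<phi> s"

text \<open>Positivity is the tangent inequality at \<open>t\<close>, evaluated at \<open>0\<close>,
  where \<open>\<phi>\<close> vanishes. Monotonicity is the sign of the second derivative. The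
  growth bound holds because \<open>deriv \<phi> x / x ^ k\<close> is nonincreasing: the numerator
  of its derivative has the sign of
  \<open>x * deriv (deriv \<phi>) x - k * deriv \<phi> x\<close>.\<close>

lemma regular_N_functionI:
  assumes N: "N_function \<phi>" and C: "C_on 2 {0<..} \<phi>" and E: "deriv_equivalence c \<phi>"
    and k: "c \<le> real k"
  shows "regular_N_function \<phi> k"
proof
  note D = C_on_2_real_deriv[OF C]
  have c: "c > 0" using E by (auto simp: deriv_equivalence_def)
  have conv: "convex_on {0..} \<phi>" and z: "\<phi> 0 = 0" and p: "\<And>t. t > 0 \<Longrightarrow> \<phi> t > 0"
    using N by (auto simp: N_function_def)
  show dpos: "deriv \<phi> t > 0" if t: "t > 0" for t
  proof -
    have "\<phi> 0 - \<phi> t \<ge> deriv \<phi> t * (0 - t)"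
    proof (rule convex_on_imp_above_tangent[OF conv])
      show "connected {0::real..}" by (rule convex_connected) (rule convex_real_interval)
      show "t \<in> interior {0..}" using t by (simp add: interior_real_atLeast)
      show "(\<phi> has_real_derivative deriv \<phi> t) (at t within {0..})"
        using D(1)[OF t] by (rule has_field_derivative_at_within)
    qed auto
    then have "deriv \<phi> t * t > 0" using p[OF t] z by (simp add: algebra_simps)
    then show ?thesis using t by (simp add: zero_less_mult_iff)
  qed
  have dd: "deriv (deriv \<phi>) t \<ge> 0" "t * deriv (deriv \<phi>) t \<le> real k * deriv \<phi> t" if t: "t > 0" for t
  proof -
    have "t * deriv (deriv \<phi>) t \<ge> inverse c * deriv \<phi> t" using E t by (auto simp: deriv_equivalence_def)
    moreover have "inverse c * deriv \<phi> t > 0" using c dpos[OF t] by simp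
    ultimately have "t * deriv (deriv \<phi>) t > 0" by linarith
    then show "deriv (deriv \<phi>) t \<ge> 0" using t by (simp add: zero_less_mult_iff)
    have "t * deriv (deriv \<phi>) t \<le> c * deriv \<phi> t" using E t by (auto simp: deriv_equivalence_def)
    also have "\<dots> \<le> real k * deriv \<phi> t" using k dpos[OF t] by (intro mult_right_mono) auto
    finally show "t * deriv (deriv \<phi>) t \<le> real k * deriv \<phi> t" .
  qed
  show dmono: "deriv \<phi> s \<le> deriv \<phi> t" if "0 < s" "s \<le> t" for s t
  proof (rule DERIV_nonneg_imp_nondecreasing[OF that(2)])
    fix x assume "s \<le> x"
    then have "x > 0" using that by simp
    then show "\<exists>y. (deriv \<phi> has_real_derivative y) (at x) \<and> 0 \<le> y" using D(2) dd(1) by blast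
  qed
  show "deriv \<phi> (l * s) \<le> l ^ k * deriv \<phi> s" if s: "0 < s" and l: "1 \<le> l" for s l
  proof -
    let ?q = "\<lambda>x. deriv \<phi> x / x ^ k"
    have "s \<le> l * s" using s l by simp
    then have "?q (l * s) \<le> ?q s"
    proof (rule DERIV_nonpos_imp_nonincreasing)
      fix x assume "s \<le> x" "x \<le> l * s"
      then have x: "x > 0" using s by simp
      \<comment> \<open>For \<open>k = 0\<close> the exponent \<open>k - Suc 0\<close> is truncated
        to \<open>0\<close>; it then stands next to the factor \<open>real k = 0\<close>.\<close>
      have "k = 0 \<or> x ^ k = x * x ^ (k - 1)" by (cases k) auto
      then have "deriv (deriv \<phi>) x * x ^ k - deriv \<phi> x * (real k * x ^ (k - Suc 0)) \<le> 0"
      proof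
        assume "k = 0"
        then have "x * deriv (deriv \<phi>) x \<le> 0" using dd(2)[OF x] by simp
        then show ?thesis using x \<open>k = 0\<close> by (simp add: mult_le_0_iff)
      next
        assume e: "x ^ k = x * x ^ (k - 1)"
        have "x ^ (k - 1) * (x * deriv (deriv \<phi>) x) \<le> x ^ (k - 1) * (real k * deriv \<phi> x)"
          using dd(2)[OF x] x by (intro mult_left_mono) auto
        then show ?thesis by (simp add: e algebra_simps)
      qed
      then have "(deriv (deriv \<phi>) x * x ^ k - deriv \<phi> x * (real k * x ^ (k - Suc 0))) / (x ^ k * x ^ k) \<le> 0"
        by (rule divide_nonpos_nonneg) simp
      moreover have "(?q has_real_derivative
          (deriv (deriv \<phi>) x * x ^ k - deriv \<phi> x * (real k * x ^ (k - Suc 0))) / (x ^ k * x ^ k)) (at x)"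
        using x by (auto intro!: derivative_eq_intros D(2))
      ultimately show "\<exists>y. (?q has_real_derivative y) (at x) \<and> y \<le> 0" by blast
    qed
    then show ?thesis using s l by (simp add: field_simps power_mult_distrib)
  qed
qed

section \<open>Shifted functions: monotone slope, scaling and a substitute for Jensen's
  inequality\<close>

context regular_N_function begin

text \<open>The weight for which \<open>F a\<close> is \<open>sqrt (\<omega> (norm a))\<close> times
  \<open>a\<close>.\<close>

definition "\<omega> t = deriv \<phi> t / t"
text \<open>The shifted N-function is usually the integral of \<open>\<omega> (b + s) * s\<close>
  over \<open>s\<close> from \<open>0\<close> to \<open>t\<close>; this closed form is comparable to
  it.\<close>

definition "shifted b t = \<omega> (b + t) * t\<^sup>2"

lemma omega_nonneg: "t \<ge> 0 \<Longrightarrow> \<omega> t \<ge> 0"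
  by (cases "t = 0") (auto simp: \<omega>_def less_imp_le[OF dpos])

lemma omega_le: "0 < s \<Longrightarrow> s \<le> t \<Longrightarrow> \<omega> s * s \<le> \<omega> t * t"
  using dmono[of s t] by (simp add: \<omega>_def)

text \<open>The weight may increase or decrease, as for powers above or below the quadratic one.
  This lemma and the next one bound its change in either direction when the argument grows by a
  factor at most \<open>l\<close>.\<close>

lemma omega_scale:
  assumes "0 < s" "s \<le> t" "t \<le> l * s"
  shows "\<omega> t \<le> l ^ k * \<omega> s"
proof -
  have l: "1 \<le> l"
  proof (rule ccontr)
    assume "\<not> 1 \<le> l"
    then have "l * s < 1 * s" using assms by (intro mult_strict_right_mono) auto
    then show False using assms(2,3) by linarith
  qed
  have "deriv \<phi> t \<le> deriv \<phi> (l * s)" using assms by (intro dmono) auto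
  also have "\<dots> \<le> l ^ k * deriv \<phi> s" by (rule dscale) (use assms l in auto)
  finally have "deriv \<phi> t / t \<le> l ^ k * deriv \<phi> s / t" using assms by (intro divide_right_mono) auto
  also have "\<dots> \<le> l ^ k * deriv \<phi> s / s"
    using assms l dpos[of s] by (intro divide_left_mono) auto
  finally show ?thesis by (simp add: \<omega>_def)
qed

lemma omega_scale':
  assumes "0 < s" "s \<le> t" "t \<le> l * s"
  shows "\<omega> s \<le> l * \<omega> t"
proof -
  have "\<omega> s * s \<le> \<omega> t * t" using omega_le assms by simp
  also have "\<dots> \<le> \<omega> t * (l * s)" using assms omega_nonneg[of t] by (intro mult_left_mono) auto
  finally show ?thesis using assms by (simp add: mult.assoc[symmetric] mult.commute[of "\<omega> t"])
qed

lemma shifted_nonneg: "b \<ge> 0 \<Longrightarrow> t \<ge> 0 \<Longrightarrow> shifted b t \<ge> 0"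
  by (auto simp: shifted_def omega_nonneg)

lemma shifted_0 [simp]: "shifted b 0 = 0" by (simp add: shifted_def)

text \<open>The slope \<open>shifted b t / t\<close> is the product of
  \<open>\<omega> (b + t) * (b + t)\<close>, which is \<open>deriv \<phi> (b + t)\<close>, and of
  \<open>t / (b + t)\<close>; both are nondecreasing. The form without division covers the argument
  \<open>0\<close>.\<close>

lemma shifted_slope_mono:
  assumes b: "b \<ge> 0" and st: "0 \<le> s" "s \<le> t"
  shows "shifted b s * t \<le> shifted b t * s"
proof (cases "s = 0")
  case False
  then have s: "s > 0" using st by simp
  have "\<omega> (b + s) * s * (b + s) \<le> \<omega> (b + t) * (b + t) * s"
    using omega_le[of "b+s" "b+t"] s st b by (simp add: mult_right_mono mult.commute mult.left_commute)
  then have "\<omega> (b + s) * s * (b + s) * (b + t) \<le> \<omega> (b + t) * (b + t) * s * (b + t)"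
    using b st s by (intro mult_right_mono) auto
  also have "\<dots> * s \<le> \<omega> (b + t) * (b + t) * t * (b + s) * s"
  proof -
    have "s * (b + t) \<le> t * (b + s)" using b st by (simp add: algebra_simps mult_left_mono)
    then show ?thesis using b st s omega_nonneg[of "b+t"]
      by (intro mult_right_mono) (auto simp: mult.assoc intro!: mult_left_mono)
  qed
  finally have "\<omega> (b + s) * s * (b + s) * (b + t) * s \<le> \<omega> (b + t) * (b + t) * t * (b + s) * s"
    using s by (simp add: mult_right_mono)
  then have "(\<omega> (b + s) * s * s) * ((b + s) * (b + t)) \<le> (\<omega> (b + t) * t * s) * ((b + s) * (b + t))"
    by (simp add: mult_ac)
  then have "\<omega> (b + s) * s * s \<le> \<omega> (b + t) * t * s" using b s st by simp
  then have "\<omega> (b + s) * s * s * t \<le> \<omega> (b + t) * t * s * t" using s st by (intro mult_right_mono) auto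
  then show ?thesis by (simp add: shifted_def power2_eq_square mult_ac)
qed simp

lemma shifted_mono:
  assumes b: "b \<ge> 0" and st: "0 \<le> s" "s \<le> t"
  shows "shifted b s \<le> shifted b t"
proof (cases "t = 0")
  case False
  have "shifted b s * t \<le> shifted b t * s" by (rule shifted_slope_mono[OF assms])
  also have "\<dots> \<le> shifted b t * t" using st shifted_nonneg[of b t] b by (intro mult_left_mono) auto
  finally show ?thesis using False st by simp
qed (use st in auto)

lemma shifted_scale:
  assumes b: "b \<ge> 0" and t: "t \<ge> 0" and l: "l \<ge> 1"
  shows "shifted b (l * t) \<le> l ^ (k + 2) * shifted b t"
proof (cases "t = 0")
  case False
  then have t: "t > 0" using t by simp
  have lt: "t \<le> l * t" and lb: "b \<le> l * b" using l t b by (auto simp: mult_left_le intro: mult_right_mono[of 1 l, simplified])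
  have "\<omega> (b + l * t) \<le> l ^ k * \<omega> (b + t)"
    using b t lt lb by (intro omega_scale) (auto simp: algebra_simps)
  then have "\<omega> (b + l * t) * (l * t)\<^sup>2 \<le> l ^ k * \<omega> (b + t) * (l * t)\<^sup>2"
    by (intro mult_right_mono) auto
  then show ?thesis by (simp add: shifted_def power_mult_distrib power_add power2_eq_square mult_ac)
qed simp

lemma shifted_add:
  assumes b: "b \<ge> 0" and "s \<ge> 0" "t \<ge> 0"
  shows "shifted b (s + t) \<le> 2 ^ (k + 2) * (shifted b s + shifted b t)"
proof -
  have "shifted b (s + t) \<le> shifted b (2 * max s t)" using assms by (intro shifted_mono) auto
  also have "\<dots> \<le> 2 ^ (k + 2) * shifted b (max s t)" using assms by (intro shifted_scale) auto
  also have "\<dots> \<le> 2 ^ (k + 2) * (shifted b s + shifted b t)"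
    using assms shifted_nonneg[of b s] shifted_nonneg[of b t] by (intro mult_left_mono) (auto simp: max_def)
  finally show ?thesis .
qed

text \<open>A tangent-type bound at \<open>m / 2\<close> that replaces Jensen's inequality, as \<open>shifted b\<close> need not be
  convex.\<close>

lemma shifted_tangent:
  assumes b: "b \<ge> 0" and u: "u \<ge> 0" and m: "m > 0"
  shows "shifted b u * (m / 2) \<ge> (u - m / 2) * shifted b (m / 2)"
proof (cases "u \<ge> m / 2")
  case True
  have "shifted b (m/2) * u \<le> shifted b u * (m/2)" using True b m by (intro shifted_slope_mono) auto
  moreover have "m/2 * shifted b (m/2) \<ge> 0" using b m shifted_nonneg[of b "m/2"] by simp
  ultimately show ?thesis by (simp add: algebra_simps)
next
  case False
  then have "(u - m / 2) * shifted b (m / 2) \<le> 0" using b m shifted_nonneg[of b "m/2"] by (intro mult_nonpos_nonneg) auto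
  also have "\<dots> \<le> shifted b u * (m / 2)" using b m u shifted_nonneg[of b u] by simp
  finally show ?thesis .
qed

section \<open>Two-sided comparison of F with the shifted function\<close>

lemma F_map_omega: "F_map \<phi> (a :: 'a::euclidean_space) = sqrt (\<omega> (norm a)) *\<^sub>R a"
  by (simp add: F_map_def \<omega>_def)

lemma sqrt_omega_mono: "0 < t \<Longrightarrow> t \<le> s \<Longrightarrow> sqrt (\<omega> t) * t \<le> sqrt (t / s) * (sqrt (\<omega> s) * s)"
proof -
  assume *: "0 < t" "t \<le> s"
  have "\<omega> t * t\<^sup>2 \<le> t / s * (\<omega> s * s\<^sup>2)"
    using omega_le[OF *] * by (simp add: power2_eq_square mult_left_mono mult_ac)
  then have "sqrt (\<omega> t * t\<^sup>2) \<le> sqrt (t / s * (\<omega> s * s\<^sup>2))" by (rule real_sqrt_le_mono)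
  then show ?thesis using * by (simp only: real_sqrt_mult) simp
qed

text \<open>\<open>sqrt (\<omega> t) * t\<close> is the length of \<open>F\<close> at a vector of
  length \<open>t\<close>. With \<open>x = t / s\<close>, the lower bound follows from
  \<open>sqrt x \<le> (1 + x) / 2\<close>, the upper one from the growth bound in the form
  \<open>x ^ (k + 2)\<close> and Bernoulli's inequality.\<close>

lemma sqrt_omega_gap:
  assumes "0 < t" "t \<le> s"
  shows "sqrt (\<omega> s) * s - sqrt (\<omega> t) * t \<ge> sqrt (\<omega> s) * (s - t) / 2"
    and "sqrt (\<omega> s) * s - sqrt (\<omega> t) * t \<le> real (k + 2) * (sqrt (\<omega> s) * (s - t))"
proof -
  let ?x = "t / s"
  have x: "0 < ?x" "?x \<le> 1" using assms by auto
  have f: "sqrt (\<omega> s) * s \<ge> 0" using assms omega_nonneg[of s] by simp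
  have "0 \<le> (sqrt ?x - 1)\<^sup>2" by simp
  then have "sqrt ?x \<le> (1 + ?x) / 2" using x by (simp add: power2_eq_square algebra_simps)
  then have "sqrt ?x * (sqrt (\<omega> s) * s) \<le> (1 + ?x) / 2 * (sqrt (\<omega> s) * s)"
    using f by (rule mult_right_mono)
  then have "sqrt (\<omega> t) * t \<le> (1 + ?x) / 2 * (sqrt (\<omega> s) * s)"
    using sqrt_omega_mono[OF assms] by linarith
  also have "\<dots> = sqrt (\<omega> s) * (s + t) / 2" using assms by (simp add: field_simps)
  finally show "sqrt (\<omega> s) * s - sqrt (\<omega> t) * t \<ge> sqrt (\<omega> s) * (s - t) / 2"
    by (simp add: field_simps)
  have "\<omega> s \<le> (s / t) ^ k * \<omega> t" using assms by (intro omega_scale) auto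
  then have "\<omega> s * ?x ^ k \<le> \<omega> t"
    using assms by (simp add: field_simps)
  then have "t\<^sup>2 * (\<omega> s * ?x ^ k) \<le> t\<^sup>2 * \<omega> t" by (intro mult_left_mono) auto
  moreover have "?x ^ (k + 2) * (\<omega> s * s\<^sup>2) = t\<^sup>2 * (\<omega> s * ?x ^ k)"
  proof -
    have "?x\<^sup>2 * s\<^sup>2 = t\<^sup>2" using assms by (simp add: power_divide)
    then have "?x ^ k * \<omega> s * (?x\<^sup>2 * s\<^sup>2) = ?x ^ k * \<omega> s * t\<^sup>2" by (rule arg_cong)
    moreover have "?x ^ (k + 2) = ?x ^ k * ?x\<^sup>2" by (rule power_add)
    ultimately show ?thesis by (metis mult.assoc mult.commute)
  qed
  ultimately have "?x ^ (k + 2) * (\<omega> s * s\<^sup>2) \<le> \<omega> t * t\<^sup>2"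
    by (simp add: mult.commute[of "t\<^sup>2" "\<omega> t"])
  \<comment> \<open>Taking the root directly would leave the exponent \<open>(k + 2) / 2\<close>;
    giving up a square first keeps a natural exponent.\<close>
  moreover have "(?x ^ (k + 2))\<^sup>2 \<le> ?x ^ (k + 2)"
  proof -
    have "?x ^ (k + 2) \<le> 1" using x by (intro power_le_one) auto
    moreover have "0 \<le> ?x ^ (k + 2)" using x by (intro zero_le_power) auto
    ultimately show ?thesis unfolding power2_eq_square[of "?x ^ (k + 2)"] by (rule mult_left_le)
  qed
  ultimately have "(?x ^ (k + 2))\<^sup>2 * (\<omega> s * s\<^sup>2) \<le> \<omega> t * t\<^sup>2"
    using mult_right_mono[of "(?x ^ (k + 2))\<^sup>2" "?x ^ (k + 2)" "\<omega> s * s\<^sup>2"] assms omega_nonneg[of s] by simp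
  then have "sqrt ((?x ^ (k + 2))\<^sup>2 * (\<omega> s * s\<^sup>2)) \<le> sqrt (\<omega> t * t\<^sup>2)" by simp
  then have "?x ^ (k + 2) * (sqrt (\<omega> s) * s) \<le> sqrt (\<omega> t) * t"
    using assms x by (simp add: real_sqrt_mult)
  moreover have "1 + real (k + 2) * (?x - 1) \<le> ?x ^ (k + 2)"
    using Bernoulli_inequality[of "?x - 1" "k + 2"] x by simp
  then have "(1 + real (k + 2) * (?x - 1)) * (sqrt (\<omega> s) * s) \<le> ?x ^ (k + 2) * (sqrt (\<omega> s) * s)"
    using f by (rule mult_right_mono)
  ultimately have "(1 + real (k + 2) * (?x - 1)) * (sqrt (\<omega> s) * s) \<le> sqrt (\<omega> t) * t" by linarith
  moreover have "(1 + real (k + 2) * (?x - 1)) * (sqrt (\<omega> s) * s)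
      = sqrt (\<omega> s) * s - real (k + 2) * (sqrt (\<omega> s) * (s - t))"
    using assms by (simp add: divide_simps) (simp add: algebra_simps)
  ultimately show "sqrt (\<omega> s) * s - sqrt (\<omega> t) * t \<le> real (k + 2) * (sqrt (\<omega> s) * (s - t))"
    by linarith
qed

text \<open>With the weight of the longer vector \<open>a\<close> put on \<open>a - b\<close>, the
  remainder is a multiple of \<open>b\<close>. Its length is the error of the radial difference
  against \<open>sqrt (\<omega> s) * (s - t)\<close>, which \<open>sqrt_omega_gap\<close>
  controls.\<close>

lemma F_map_diff_le_max:
  fixes a b :: "'a::euclidean_space"
  assumes "norm b \<le> norm a"
  shows "norm (F_map \<phi> a - F_map \<phi> b) \<le> real (k + 3) * sqrt (\<omega> (norm a)) * norm (a - b)"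
proof (cases "b = 0")
  case True
  have "1 * (sqrt (\<omega> (norm a)) * norm a) \<le> real (k + 3) * (sqrt (\<omega> (norm a)) * norm a)"
    using omega_nonneg[of "norm a"] by (intro mult_right_mono) auto
  then show ?thesis using True omega_nonneg[of "norm a"] by (simp add: F_map_omega abs_mult mult.assoc)
next
  case False
  define s t where "s = norm a" and "t = norm b"
  have st: "0 < t" "t \<le> s" "s - t \<le> norm (a - b)"
    using False assms norm_triangle_ineq2[of a b] by (auto simp: s_def t_def)
  have g0: "sqrt (\<omega> s) \<ge> 0" using omega_nonneg[of s] st by simp
  note gap = sqrt_omega_gap[OF st(1,2)]
  have "F_map \<phi> a - F_map \<phi> b = sqrt (\<omega> s) *\<^sub>R (a - b) + (sqrt (\<omega> s) - sqrt (\<omega> t)) *\<^sub>R b"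
    by (simp add: F_map_omega s_def t_def algebra_simps)
  then have "norm (F_map \<phi> a - F_map \<phi> b) \<le> sqrt (\<omega> s) * norm (a - b) + \<bar>sqrt (\<omega> s) - sqrt (\<omega> t)\<bar> * t"
    using norm_triangle_ineq[of "sqrt (\<omega> s) *\<^sub>R (a - b)" "(sqrt (\<omega> s) - sqrt (\<omega> t)) *\<^sub>R b"] g0
    by (simp add: t_def)
  moreover have "\<bar>sqrt (\<omega> s) - sqrt (\<omega> t)\<bar> * t = \<bar>(sqrt (\<omega> s) * s - sqrt (\<omega> t) * t) - sqrt (\<omega> s) * (s - t)\<bar>"
  proof -
    have "\<bar>sqrt (\<omega> s) - sqrt (\<omega> t)\<bar> * t = \<bar>(sqrt (\<omega> s) - sqrt (\<omega> t)) * t\<bar>"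
      using st by (simp add: abs_mult)
    then show ?thesis by (simp add: algebra_simps)
  qed
  moreover have "\<dots> \<le> real (k + 2) * (sqrt (\<omega> s) * (s - t))"
  proof -
    have p: "0 \<le> sqrt (\<omega> s) * (s - t)" using g0 st by simp
    then have "sqrt (\<omega> s) * (s - t) \<le> real (k + 2) * (sqrt (\<omega> s) * (s - t))"
      using mult_right_mono[of 1 "real (k+2)", OF _ p] by simp
    then show ?thesis using gap p by linarith
  qed
  moreover have "real (k + 2) * (sqrt (\<omega> s) * (s - t)) \<le> real (k + 2) * (sqrt (\<omega> s) * norm (a - b))"
    using st g0 by (intro mult_left_mono) auto
  ultimately have "norm (F_map \<phi> a - F_map \<phi> b) \<le> sqrt (\<omega> s) * norm (a - b) + real (k + 2) * (sqrt (\<omega> s) * norm (a - b))"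
    by linarith
  then show ?thesis by (simp add: s_def algebra_simps)
qed

lemma F_map_diff_ge_max:
  fixes a b :: "'a::euclidean_space"
  assumes "norm b \<le> norm a"
  shows "\<omega> (norm a) * (norm (a - b))\<^sup>2 \<le> 36 * 2 ^ k * (norm (F_map \<phi> a - F_map \<phi> b))\<^sup>2"
proof (cases "b = 0")
  case True
  have "1 * (\<omega> (norm a) * (norm a)\<^sup>2) \<le> 36 * 2 ^ k * (\<omega> (norm a) * (norm a)\<^sup>2)"
  proof (rule mult_right_mono)
    have "1 * 1 \<le> 36 * (2::real) ^ k" by (intro mult_mono) auto
    then show "1 \<le> 36 * (2::real) ^ k" by simp
  qed (use omega_nonneg[of "norm a"] in simp)
  then show ?thesis using True omega_nonneg[of "norm a"] by (simp add: F_map_omega power_mult_distrib)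
next
  case False
  define s t where "s = norm a" and "t = norm b"
  define g h where "g = sqrt (\<omega> s)" and "h = sqrt (\<omega> t)"
  have st: "0 < t" "t \<le> s" "s - t \<le> norm (a - b)" "norm (a - b) \<le> s + t"
    using False assms norm_triangle_ineq2[of a b] norm_triangle_ineq4[of a b] by (auto simp: s_def t_def)
  have g0: "g \<ge> 0" "h \<ge> 0" using omega_nonneg[of s] omega_nonneg[of t] st by (auto simp: g_def h_def)
  have g2: "g\<^sup>2 = \<omega> s" "h\<^sup>2 = \<omega> t" using omega_nonneg[of s] omega_nonneg[of t] st by (auto simp: g_def h_def)
  define P where "P = (norm (F_map \<phi> a - F_map \<phi> b))\<^sup>2"
  have gap: "g * (s - t) / 2 \<le> g * s - h * t"
    using sqrt_omega_gap(1)[OF st(1,2)] by (simp add: g_def h_def)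
  have gst: "0 \<le> g * (s - t)" using g0 st by simp
  have ab: "a \<bullet> b = (s\<^sup>2 + t\<^sup>2 - (norm (a - b))\<^sup>2) / 2"
    by (simp add: s_def t_def power2_norm_eq_inner inner_diff inner_commute)
  have "P = g\<^sup>2 * s\<^sup>2 + h\<^sup>2 * t\<^sup>2 - 2 * g * h * (a \<bullet> b)"
    unfolding P_def F_map_omega s_def[symmetric] t_def[symmetric] g_def[symmetric] h_def[symmetric]
    by (simp add: power2_norm_eq_inner inner_diff inner_commute[of b a] s_def t_def)
       (simp add: power2_eq_square algebra_simps)
  \<comment> \<open>A radial part and an angular part; both are nonnegative.\<close>
  also have "\<dots> = (g * s - h * t)\<^sup>2 + g * h * ((norm (a - b))\<^sup>2 - (s - t)\<^sup>2)"
    unfolding ab by (simp add: power2_eq_square field_simps)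
  finally have P: "P = (g * s - h * t)\<^sup>2 + g * h * ((norm (a - b))\<^sup>2 - (s - t)\<^sup>2)" .
  have D: "(norm (a - b))\<^sup>2 - (s - t)\<^sup>2 \<ge> 0" using st by (simp add: power_mono)
  have gap2: "(g * (s - t) / 2)\<^sup>2 \<le> (g * s - h * t)\<^sup>2" using gap gst by (intro power_mono) auto
  have "g\<^sup>2 * (norm (a - b))\<^sup>2 \<le> 36 * 2 ^ k * P"
  \<comment> \<open>For comparable lengths the two weights are comparable, and both parts of
    \<open>P\<close> contribute. Otherwise
    \<open>norm (a - b) \<le> s + t \<le> 3 * (s - t)\<close>, so that the radial part alone
    suffices; there \<open>36\<close> arises as \<open>9 * 4\<close>, the \<open>4\<close> from the
    halved gap.\<close>
  proof (cases "s \<le> 2 * t")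
    case True
    have "g\<^sup>2 \<le> 2 ^ k * h\<^sup>2" unfolding g2 using st True by (intro omega_scale) auto
    also have "\<dots> \<le> (2 ^ k * h)\<^sup>2"
    proof -
      have "(2::real) ^ k * 1 \<le> 2 ^ k * 2 ^ k" by (intro mult_left_mono) auto
      then have "(2::real) ^ k * h\<^sup>2 \<le> (2 ^ k * 2 ^ k) * h\<^sup>2" by (intro mult_right_mono) auto
      then show ?thesis by (simp add: power_mult_distrib power2_eq_square mult_ac)
    qed
    finally have gh: "g \<le> 2 ^ k * h" by (rule power2_le_imp_le) (use g0 in auto)
    let ?D = "(norm (a - b))\<^sup>2 - (s - t)\<^sup>2"
    have "g\<^sup>2 * ?D \<le> 2 ^ k * (g * h * ?D)"
    proof -
      have "g * g * ?D \<le> g * (2 ^ k * h) * ?D" using gh g0 D by (intro mult_right_mono mult_left_mono)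
      then show ?thesis unfolding power2_eq_square[of g] by (simp only: mult_ac)
    qed
    moreover have "g\<^sup>2 * (s - t)\<^sup>2 \<le> 4 * (g * s - h * t)\<^sup>2"
      using gap2 by (simp add: power_mult_distrib power_divide)
    moreover have "4 * (g * s - h * t)\<^sup>2 \<le> 36 * 2 ^ k * (g * s - h * t)\<^sup>2"
    proof (rule mult_right_mono)
      have "4 * 1 \<le> 36 * (2::real) ^ k" by (intro mult_mono) auto
      then show "4 \<le> 36 * (2::real) ^ k" by simp
    qed simp
    moreover have "2 ^ k * (g * h * ?D) \<le> 36 * 2 ^ k * (g * h * ?D)"
      using g0 D by (intro mult_right_mono) auto
    ultimately have "g\<^sup>2 * ?D + g\<^sup>2 * (s - t)\<^sup>2 \<le> 36 * 2 ^ k * (g * h * ?D) + 36 * 2 ^ k * (g * s - h * t)\<^sup>2"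
      by linarith
    then show ?thesis unfolding P by (simp add: algebra_simps)
  next
    case False
    then have "s + t \<le> 3 * (s - t)" by simp
    then have "norm (a - b) \<le> 3 * (s - t)" using st(4) by (rule order_trans[rotated])
    then have "(norm (a - b))\<^sup>2 \<le> (3 * (s - t))\<^sup>2" by (intro power_mono) auto
    then have "g\<^sup>2 * (norm (a - b))\<^sup>2 \<le> g\<^sup>2 * (3 * (s - t))\<^sup>2" by (intro mult_left_mono) auto
    also have "\<dots> = 36 * (g * (s - t) / 2)\<^sup>2" by (simp add: power2_eq_square field_simps)
    also have "\<dots> \<le> 36 * P" using gap2 g0 D unfolding P by (smt (verit) mult_nonneg_nonneg)
    also have "36 * P * 1 \<le> 36 * P * 2 ^ k" by (intro mult_left_mono) (auto simp: P_def)
    finally show ?thesis by (simp add: mult_ac)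
  qed
  then show ?thesis unfolding g2 by (simp add: s_def P_def)
qed

text \<open>The preceding estimates carry the weight at the larger norm, \<open>shifted\<close>
  carries it at \<open>norm b + norm (a - b)\<close>. These arguments differ by a factor of at most
  \<open>3\<close>.\<close>

lemma omega_max_shift:
  fixes a b :: "'a::euclidean_space"
  shows "\<omega> (norm b + norm (a - b)) \<le> 3 ^ k * \<omega> (max (norm a) (norm b))"
    and "\<omega> (max (norm a) (norm b)) \<le> 3 * \<omega> (norm b + norm (a - b))"
proof -
  let ?m = "max (norm a) (norm b)" and ?u = "norm b + norm (a - b)"
  have m: "?m \<le> ?u" "?u \<le> 3 * ?m"
    using norm_triangle_ineq[of "a - b" b] norm_triangle_ineq4[of a b] by auto
  show "\<omega> ?u \<le> 3 ^ k * \<omega> ?m" "\<omega> ?m \<le> 3 * \<omega> ?u"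
  proof -
    show "\<omega> ?u \<le> 3 ^ k * \<omega> ?m"
    proof (cases "?m = 0")
      case True then show ?thesis by (auto simp: max_def split: if_splits simp: \<omega>_def)
    next
      case False then have "?m > 0" using norm_ge_zero[of a] by linarith
      then show ?thesis using m by (intro omega_scale) auto
    qed
    show "\<omega> ?m \<le> 3 * \<omega> ?u"
    proof (cases "?m = 0")
      case True then show ?thesis by (auto simp: max_def split: if_splits simp: \<omega>_def)
    next
      case False then have "?m > 0" using norm_ge_zero[of a] by linarith
      then show ?thesis using m by (intro omega_scale') auto
    qed
  qed
qed

text \<open>The sum of the constants of the two directions: \<open>3\<close> from the change of
  weight times \<open>(k + 3)\<^sup>2\<close>, and \<open>3 ^ k\<close> from the change of weight
  times \<open>36 * 2 ^ k\<close>.\<close>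

definition "C\<^sub>F = 3 * (real (k + 3))\<^sup>2 + 36 * 6 ^ k"

lemma C_F_ge_1: "C\<^sub>F \<ge> 1"
proof -
  have "(6::real) ^ k \<ge> 1" by simp
  then have "36 * (6::real) ^ k \<ge> 36" by linarith
  then show ?thesis unfolding C\<^sub>F_def using zero_le_power2[of "real (k + 3)"] by linarith
qed

lemma F_map_diff_le_shifted:
  fixes a b :: "'a::euclidean_space"
  shows "(norm (F_map \<phi> a - F_map \<phi> b))\<^sup>2 \<le> C\<^sub>F * shifted (norm b) (norm (a - b))"
proof -
  let ?m = "max (norm a) (norm b)"
  have "norm (F_map \<phi> a - F_map \<phi> b) \<le> real (k + 3) * sqrt (\<omega> ?m) * norm (a - b)"
    using F_map_diff_le_max[of b a] F_map_diff_le_max[of a b]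
    by (cases "norm b \<le> norm a") (auto simp: max_def norm_minus_commute)
  then have "(norm (F_map \<phi> a - F_map \<phi> b))\<^sup>2 \<le> (real (k + 3) * sqrt (\<omega> ?m) * norm (a - b))\<^sup>2"
    by (rule power_mono) simp
  also have "\<dots> = (real (k + 3))\<^sup>2 * (\<omega> ?m * (norm (a - b))\<^sup>2)"
  proof -
    have "\<omega> ?m \<ge> 0" by (intro omega_nonneg) (simp add: le_max_iff_disj)
    then show ?thesis by (simp add: power_mult_distrib)
  qed
  also have "\<dots> \<le> (real (k + 3))\<^sup>2 * (3 * \<omega> (norm b + norm (a - b)) * (norm (a - b))\<^sup>2)"
    using omega_max_shift(2)[of a b] by (intro mult_left_mono mult_right_mono) auto
  also have "\<dots> = 3 * (real (k + 3))\<^sup>2 * shifted (norm b) (norm (a - b))" by (simp add: shifted_def)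
  also have "\<dots> \<le> C\<^sub>F * shifted (norm b) (norm (a - b))"
    unfolding C\<^sub>F_def using shifted_nonneg[of "norm b" "norm (a - b)"] by (intro mult_right_mono) auto
  finally show ?thesis .
qed

lemma shifted_le_F_map_diff:
  fixes a b :: "'a::euclidean_space"
  shows "shifted (norm b) (norm (a - b)) \<le> C\<^sub>F * (norm (F_map \<phi> a - F_map \<phi> b))\<^sup>2"
proof -
  let ?m = "max (norm a) (norm b)"
  have *: "\<omega> ?m * (norm (a - b))\<^sup>2 \<le> 36 * 2 ^ k * (norm (F_map \<phi> a - F_map \<phi> b))\<^sup>2"
    using F_map_diff_ge_max[of b a] F_map_diff_ge_max[of a b]
    by (cases "norm b \<le> norm a") (auto simp: max_def norm_minus_commute)
  have "shifted (norm b) (norm (a - b)) \<le> 3 ^ k * \<omega> ?m * (norm (a - b))\<^sup>2"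
    unfolding shifted_def using omega_max_shift(1)[of b a] by (intro mult_right_mono) auto
  also have "\<dots> \<le> 3 ^ k * (36 * 2 ^ k * (norm (F_map \<phi> a - F_map \<phi> b))\<^sup>2)"
    unfolding mult.assoc using * by (intro mult_left_mono) (auto simp: mult.assoc)
  also have "\<dots> = 36 * 6 ^ k * (norm (F_map \<phi> a - F_map \<phi> b))\<^sup>2"
    by (simp add: mult_ac flip: power_mult_distrib)
  also have "\<dots> \<le> C\<^sub>F * (norm (F_map \<phi> a - F_map \<phi> b))\<^sup>2"
    unfolding C\<^sub>F_def by (intro mult_right_mono) auto
  finally show ?thesis .
qed

end

section \<open>Simplices in barycentric coordinates\<close>

definition verts :: "'a::euclidean_space set \<Rightarrow> 'a set" where
  "verts T = {x. x extreme_point_of T}"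

text \<open>The gradient of the barycentric coordinate of \<open>v\<close>. On a full-dimensional
  simplex the edges that leave \<open>v\<close> form a basis, so the choice is unique.\<close>

definition bary_grad :: "'a::euclidean_space set \<Rightarrow> 'a \<Rightarrow> 'a" where
  "bary_grad T v = (SOME a. \<forall>w\<in>verts T. w \<noteq> v \<longrightarrow> a \<bullet> (w - v) = - 1)"

definition bary :: "'a::euclidean_space set \<Rightarrow> 'a \<Rightarrow> 'a \<Rightarrow> real" where
  "bary T v x = 1 + bary_grad T v \<bullet> (x - v)"

text \<open>The edges from \<open>v\<close> are linearly independent, hence a linear functional with
  prescribed values on them exists; the adjoint turns it into a vector.\<close>

lemma affine_independent_interpolation:
  fixes C :: "'a::euclidean_space set" and f :: "'a \<Rightarrow> real"
  assumes "\<not> affine_dependent C" "v \<in> C"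
  shows "\<exists>a. \<forall>w\<in>C. w \<noteq> v \<longrightarrow> a \<bullet> (w - v) = f w"
proof -
  let ?B = "(\<lambda>x. - v + x) ` (C - {v})"
  have "independent ?B" using assms(1) unfolding affine_dependent_iff_dependent2[OF assms(2)] .
  then obtain g :: "'a \<Rightarrow> real" where g: "linear g" "\<forall>x\<in>?B. g x = f (v + x)"
    using linear_independent_extend[of ?B "\<lambda>x. f (v + x)"] by auto
  have "adjoint g 1 \<bullet> (w - v) = f w" if "w \<in> C" "w \<noteq> v" for w
  proof -
    have "adjoint g 1 \<bullet> (w - v) = g (w - v)"
      using adjoint_works[OF g(1), of "w - v" 1] by (simp add: inner_commute)
    also have "\<dots> = f w"
    proof -
      have "- v + w \<in> ?B" using that by blast
      then have "g (- v + w) = f (v + (- v + w))" using g(2) by blast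
      then show ?thesis by simp
    qed
    finally show ?thesis .
  qed
  then show ?thesis by blast
qed

lemma affine_function_eq_on_hull:
  fixes a c :: "'a::euclidean_space"
  assumes "\<forall>w\<in>C. a \<bullet> w + b = c \<bullet> w + d" "x \<in> affine hull C"
  shows "a \<bullet> x + b = c \<bullet> x + d"
proof -
  have "affine {x. (a - c) \<bullet> x = d - b}" by (rule affine_hyperplane)
  moreover have "C \<subseteq> {x. (a - c) \<bullet> x = d - b}" using assms(1) by (fastforce simp: inner_diff_left)
  ultimately have "affine hull C \<subseteq> {x. (a - c) \<bullet> x = d - b}" by (rule hull_minimal[rotated])
  then show ?thesis using assms(2) by (fastforce simp: inner_diff_left)
qed

locale full_simplex =
  fixes T :: "'a::euclidean_space set"
  assumes simplex: "int DIM('a) simplex T"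
begin

lemma
  shows finite_verts: "finite (verts T)" and indep: "\<not> affine_dependent (verts T)"
    and card_verts: "card (verts T) = DIM('a) + 1" and T_eq: "T = convex hull verts T"
    and aff: "affine hull verts T = UNIV"
proof -
  obtain C where C: "\<not> affine_dependent C" "int (card C) = int DIM('a) + 1" "T = convex hull C"
    using simplex by (auto simp: simplex_def)
  have v: "verts T = C"
    using C extreme_point_of_convex_hull_affine_independent[OF C(1)] by (auto simp: verts_def)
  show "\<not> affine_dependent (verts T)" "T = convex hull verts T" using C v by auto
  show c: "card (verts T) = DIM('a) + 1" using C v by auto
  then show "finite (verts T)" using card.infinite by fastforce
  have "aff_dim C = int DIM('a)" using C aff_dim_affine_independent[OF C(1)] by simp
  then show "affine hull verts T = UNIV" unfolding v by (rule aff_dim_eq_full[THEN iffD1])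
qed

lemma compact_T: "compact T" and convex_T: "convex T" and closed_T: "closed T"
  and bounded_T: "bounded T"
  using T_eq finite_verts by (metis compact_convex_hull finite_imp_compact, metis convex_convex_hull,
      metis compact_convex_hull finite_imp_compact compact_imp_closed,
      metis compact_convex_hull finite_imp_compact compact_imp_bounded)

lemma verts_subset: "verts T \<subseteq> T"
  by (metis T_eq hull_subset)

lemma verts_ne: "verts T \<noteq> {}" using card_verts by auto

lemma bary_grad_eq: "v \<in> verts T \<Longrightarrow> w \<in> verts T \<Longrightarrow> w \<noteq> v \<Longrightarrow> bary_grad T v \<bullet> (w - v) = - 1"
  using someI_ex[OF affine_independent_interpolation[OF indep, of v "\<lambda>_. - 1"]]
  unfolding bary_grad_def by blast

lemma bary_vert: "v \<in> verts T \<Longrightarrow> w \<in> verts T \<Longrightarrow> bary T v w = (if w = v then 1 else 0)"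
  by (auto simp: bary_def bary_grad_eq)

lemma bary_alt: "bary T v x = bary_grad T v \<bullet> x + (1 - bary_grad T v \<bullet> v)"
  by (simp add: bary_def inner_diff_right)

lemma bary_diff: "bary T v x - bary T v y = bary_grad T v \<bullet> (x - y)"
  by (simp add: bary_def inner_diff_right)

text \<open>Both sides are affine in \<open>x\<close> and agree at the vertices, whose affine hull
  is the whole space. That the coordinates sum to one and that they represent \<open>x\<close> are
  instances of this identity.\<close>

lemma bary_affine:
  fixes a :: 'a
  shows "(\<Sum>v\<in>verts T. bary T v x * (a \<bullet> v + b)) = a \<bullet> x + b"
proof -
  have "(\<Sum>v\<in>verts T. (a \<bullet> v + b) *\<^sub>R bary_grad T v) \<bullet> w + (\<Sum>v\<in>verts T. (a \<bullet> v + b) * (1 - bary_grad T v \<bullet> v)) =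
        (\<Sum>v\<in>verts T. bary T v w * (a \<bullet> v + b))" for w
    by (simp add: bary_alt inner_sum_left sum.distrib[symmetric] algebra_simps)
  note eq = this
  have "(\<Sum>v\<in>verts T. bary T v w * (a \<bullet> v + b)) = a \<bullet> w + b" if "w \<in> verts T" for w
  proof -
    have "(\<Sum>v\<in>verts T. bary T v w * (a \<bullet> v + b)) = (\<Sum>v\<in>verts T. if v = w then a \<bullet> w + b else 0)"
      using that by (intro sum.cong) (auto simp: bary_vert)
    then show ?thesis using that finite_verts by simp
  qed
  then show ?thesis
    unfolding eq[symmetric] using affine_function_eq_on_hull[where C = "verts T" and x = x] aff by blast
qed

lemma bary_sum: "(\<Sum>v\<in>verts T. bary T v x) = 1"
  using bary_affine[of x 0 1] by simp

lemma bary_combination: "(\<Sum>v\<in>verts T. bary T v x *\<^sub>R v) = x"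
proof (rule euclidean_eqI)
  fix b :: 'a
  have "(\<Sum>v\<in>verts T. bary T v x *\<^sub>R v) \<bullet> b = (\<Sum>v\<in>verts T. bary T v x * (b \<bullet> v + 0))"
    by (simp add: inner_sum_left) (simp add: inner_commute)
  also have "\<dots> = x \<bullet> b" unfolding bary_affine by (simp add: inner_commute)
  finally show "(\<Sum>v\<in>verts T. bary T v x *\<^sub>R v) \<bullet> b = x \<bullet> b" .
qed

lemma affine_eq_bary_grad:
  assumes "\<And>x. x \<in> verts T \<Longrightarrow> f x = a \<bullet> x + b"
  shows "a = (\<Sum>v\<in>verts T. f v *\<^sub>R bary_grad T v)"
proof -
  have "a \<bullet> x = (\<Sum>v\<in>verts T. f v *\<^sub>R bary_grad T v) \<bullet> x" for x
  proof -
    have "a \<bullet> x = (a \<bullet> x + b) - (a \<bullet> 0 + b)" by simp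
    also have "\<dots> = (\<Sum>v\<in>verts T. (bary T v x - bary T v 0) * (a \<bullet> v + b))"
      using bary_affine[of x a b] bary_affine[of 0 a b] by (simp only: left_diff_distrib sum_subtractf)
    also have "\<dots> = (\<Sum>v\<in>verts T. (bary_grad T v \<bullet> x) * f v)"
      using assms by (intro sum.cong) (auto simp: bary_diff)
    finally show ?thesis by (simp add: inner_sum_left mult.commute)
  qed
  then show ?thesis by (metis vector_eq_rdot)
qed

lemma mem_iff_bary: "x \<in> T \<longleftrightarrow> (\<forall>v\<in>verts T. bary T v x \<ge> 0)"
proof
  have "convex {x. bary T v x \<ge> 0}" for v
    using convex_halfspace_ge[of "bary_grad T v \<bullet> v - 1" "bary_grad T v"] by (simp add: bary_alt algebra_simps)
  then have "convex (\<Inter>v\<in>verts T. {x. bary T v x \<ge> 0})" by (intro convex_INT) auto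
  moreover have "verts T \<subseteq> (\<Inter>v\<in>verts T. {x. bary T v x \<ge> 0})" by (auto simp: bary_vert)
  ultimately have "convex hull verts T \<subseteq> (\<Inter>v\<in>verts T. {x. bary T v x \<ge> 0})" by (rule hull_minimal[rotated])
  then show "x \<in> T \<Longrightarrow> \<forall>v\<in>verts T. bary T v x \<ge> 0" using T_eq by blast
next
  assume *: "\<forall>v\<in>verts T. bary T v x \<ge> 0"
  then have "x \<in> convex hull verts T"
    using * bary_sum[of x] bary_combination[of x]
    by (auto simp: convex_hull_finite[OF finite_verts] intro!: exI[of _ "\<lambda>v. bary T v x"])
  then show "x \<in> T" by (simp add: T_eq[symmetric])
qed

lemma exists_other_vertex: "\<exists>w\<in>verts T. w \<noteq> v"
proof (rule ccontr)
  assume "\<not> ?thesis"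
  then have "verts T \<subseteq> {v}" by auto
  then have "card (verts T) \<le> 1" using card_mono[of "{v}" "verts T"] by simp
  then show False using card_verts DIM_positive[where 'a='a] by linarith
qed

lemma bary_grad_ne:
  assumes "v \<in> verts T"
  shows "bary_grad T v \<noteq> 0"
proof -
  obtain w where "w \<in> verts T" "w \<noteq> v" using exists_other_vertex by blast
  then have "bary_grad T v \<bullet> (w - v) = - 1" using bary_grad_eq assms by simp
  then show ?thesis by auto
qed

lemma continuous_bary [continuous_intros]: "continuous_on A (bary T v)"
  unfolding bary_def by (intro continuous_intros)

lemma interior_iff_bary: "x \<in> interior T \<longleftrightarrow> (\<forall>v\<in>verts T. bary T v x > 0)"
proof
  assume x: "x \<in> interior T"
  show "\<forall>v\<in>verts T. bary T v x > 0"
  proof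
    fix v assume v: "v \<in> verts T"
    obtain e where e: "e > 0" "ball x e \<subseteq> T" using x by (meson mem_interior)
    let ?n = "bary_grad T v"
    \<comment> \<open>A step against the gradient lowers the coordinate strictly and stays in
      \<open>T\<close>, where the coordinate is still nonnegative.\<close>
    define y where "y = x - (e / 2 / norm ?n) *\<^sub>R ?n"
    have "dist x y < e" using e bary_grad_ne[OF v] by (simp add: y_def dist_norm)
    then have "bary T v y \<ge> 0" using e v mem_iff_bary by auto
    moreover have "bary T v x - bary T v y = e / 2 / norm ?n * (?n \<bullet> ?n)"
      by (simp add: bary_diff y_def)
    moreover have "e / 2 / norm ?n * (?n \<bullet> ?n) > 0" using e bary_grad_ne[OF v] by simp
    ultimately show "bary T v x > 0" by linarith
  qed
next
  assume *: "\<forall>v\<in>verts T. bary T v x > 0"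
  have "open (\<Inter>v\<in>verts T. {x. bary T v x > 0})"
    using finite_verts by (intro open_INT ballI open_Collect_less continuous_intros)
  moreover have "(\<Inter>v\<in>verts T. {x. bary T v x > 0}) \<subseteq> T"
    by (auto simp: mem_iff_bary less_imp_le)
  ultimately have "(\<Inter>v\<in>verts T. {x. bary T v x > 0}) \<subseteq> interior T" by (rule interior_maximal[rotated])
  then show "x \<in> interior T" using * by auto
qed

lemma affine_hull_T: "affine hull T = UNIV"
  using aff affine_hull_convex_hull[of "verts T"] by (simp add: T_eq[symmetric])

lemma interior_ne: "interior T \<noteq> {}"
proof -
  have "T \<noteq> {}" using verts_ne verts_subset by auto
  then show ?thesis using rel_interior_interior[OF affine_hull_T] rel_interior_eq_empty[OF convex_T] by simp
qed

lemma closure_interior_T: "closure (interior T) = T"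
  using convex_closure_interior[OF convex_T interior_ne] closed_T by simp

lemma bary_le_1: "x \<in> T \<Longrightarrow> v \<in> verts T \<Longrightarrow> bary T v x \<le> 1"
  using bary_sum[of x] finite_verts mem_iff_bary sum_nonneg[of "verts T - {v}" "\<lambda>v. bary T v x"]
  by (subst (asm) sum.remove[of _ v]) auto

text \<open>A coordinate varies by at most one on \<open>T\<close>, in particular along the diameter
  of the ball in the direction of its gradient. The ball is open, so radii \<open>r < R\<close> come
  first and the limit after them.\<close>

lemma norm_bary_grad_le:
  assumes "ball z R \<subseteq> T" "R > 0" "v \<in> verts T"
  shows "2 * R * norm (bary_grad T v) \<le> 1"
proof -
  let ?n = "bary_grad T v"
  have "2 * r * norm ?n \<le> 1" if r: "0 < r" "r < R" for r
  proof -
    define u where "u = (r / norm ?n) *\<^sub>R ?n"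
    have "norm u < R" using r bary_grad_ne[OF assms(3)] by (simp add: u_def)
    then have "z + u \<in> T" "z - u \<in> T" using assms by (auto simp: dist_norm subset_eq)
    then have "bary T v (z + u) - bary T v (z - u) \<le> 1"
      using bary_le_1[of "z + u" v] mem_iff_bary assms by force
    moreover have "bary T v (z + u) - bary T v (z - u) = 2 * r * norm ?n"
      by (simp add: bary_diff u_def norm_eq_sqrt_inner)
         (simp add: dot_square_norm power2_eq_square inner_add_right flip: norm_eq_sqrt_inner)
    ultimately show ?thesis by simp
  qed
  then have "eventually (\<lambda>r. 2 * r * norm ?n \<le> 1) (at_left R)"
    using assms(2) eventually_at_left_real[of 0 R] by (auto elim!: eventually_mono)
  moreover have "((\<lambda>r. 2 * r * norm ?n) \<longlongrightarrow> 2 * R * norm ?n) (at_left R)"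
    by (intro tendsto_intros)
  ultimately show ?thesis by (intro tendsto_upperbound) auto
qed

text \<open>Along an edge a coordinate falls from one to zero, while its gradient is at most
  \<open>1 / (2 * R)\<close>. This lower bound is what makes elements with a common edge comparable
  in size.\<close>

lemma edge_length_ge:
  assumes "ball z R \<subseteq> T" "R > 0" "v \<in> verts T" "w \<in> verts T" "v \<noteq> w"
  shows "2 * R \<le> dist v w"
proof -
  have "1 = \<bar>bary_grad T v \<bullet> (w - v)\<bar>" using bary_grad_eq[of v w] assms by simp
  also have "\<dots> \<le> norm (bary_grad T v) * norm (w - v)" by (rule Cauchy_Schwarz_ineq2)
  finally have "2 * R * 1 \<le> 2 * R * (norm (bary_grad T v) * norm (w - v))"
    using assms by (intro mult_left_mono) auto
  also have "\<dots> = (2 * R * norm (bary_grad T v)) * norm (w - v)" by simp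
  also have "\<dots> \<le> 1 * norm (w - v)" using norm_bary_grad_le[OF assms(1-3)] by (intro mult_right_mono) auto
  finally show ?thesis by (simp add: dist_norm norm_minus_commute)
qed

lemma facetD:
  assumes "S facet_of T"
  obtains v where "v \<in> verts T" "S = convex hull (verts T - {v})" "S = {x \<in> T. bary T v x = 0}"
    "verts T - {v} \<noteq> {}" "affine hull S = {x. bary T v x = 0}"
proof -
  have "S facet_of (convex hull verts T)" using assms by (simp add: T_eq[symmetric])
  then obtain v where v: "S \<noteq> {}" "v \<in> verts T" "S = convex hull (verts T - {v})"
    using facet_of_convex_hull_affine_independent[OF indep] by blast
  have "S \<subseteq> {x. bary T v x = 0}"
  proof -
    have "convex {x. bary T v x = 0}"
      using convex_hyperplane[of "bary_grad T v" "bary_grad T v \<bullet> v - 1"] by (simp add: bary_alt algebra_simps)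
    then show ?thesis unfolding v by (intro hull_minimal) (auto simp: bary_vert v)
  qed
  moreover have "S \<subseteq> T" using assms by (meson facet_of_imp_subset)
  moreover have "x \<in> S" if x: "x \<in> T" "bary T v x = 0" for x
  proof -
    have "(\<Sum>w\<in>verts T - {v}. bary T w x) = 1" "(\<Sum>w\<in>verts T - {v}. bary T w x *\<^sub>R w) = x"
      using bary_sum[of x] bary_combination[of x] finite_verts v x by (simp_all add: sum.remove)
    then show ?thesis unfolding v convex_hull_finite[OF finite_Diff[OF finite_verts]]
      using x(1) mem_iff_bary[of x] by (auto intro!: exI[of _ "\<lambda>v. bary T v x"])
  qed
  ultimately have S: "S = {x \<in> T. bary T v x = 0}" by auto
  have ne: "verts T - {v} \<noteq> {}" using v by auto
  have "affine hull S = {x. bary T v x = 0}"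
  proof
    have "affine {x. bary T v x = 0}"
      using affine_hyperplane[of "bary_grad T v" "bary_grad T v \<bullet> v - 1"] by (simp add: bary_alt algebra_simps)
    then show "affine hull S \<subseteq> {x. bary T v x = 0}" by (rule hull_minimal[rotated]) (use S in auto)
    show "{x. bary T v x = 0} \<subseteq> affine hull S"
    proof
      fix x assume x: "x \<in> {x. bary T v x = 0}"
      have "(\<Sum>w\<in>verts T - {v}. bary T w x) = 1" "(\<Sum>w\<in>verts T - {v}. bary T w x *\<^sub>R w) = x"
        using bary_sum[of x] bary_combination[of x] finite_verts v x by (simp_all add: sum.remove)
      then show "x \<in> affine hull S" unfolding v affine_hull_convex_hull affine_hull_finite[OF finite_Diff[OF finite_verts]]
        by (auto intro!: exI[of _ "\<lambda>v. bary T v x"])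
    qed
  qed
  then show ?thesis using that v S ne by blast
qed

text \<open>Dimensions are integers here: in dimension one the bound is \<open>- 1\<close>, the
  dimension of the empty face.\<close>

lemma face_facetI:
  assumes "F face_of T" "F \<noteq> T" "aff_dim F > int DIM('a) - 2"
  shows "F facet_of T"
proof -
  have d: "aff_dim T = int DIM('a)"
    using affine_hull_T aff_dim_eq_full by blast
  have "aff_dim F < aff_dim T" using face_of_aff_dim_lt[OF convex_T assms(1,2)] .
  then show ?thesis using assms d DIM_positive[where 'a='a] by (auto simp: facet_of_def)
qed

end

section \<open>Uniqueness of weak gradients\<close>

text \<open>\<open>expinv 0\<close> is the standard smooth function that is flat at the origin. The
  additional powers of the inverse make the derivative of each member a linear combination of
  members.\<close>

definition expinv :: "nat \<Rightarrow> real \<Rightarrow> real" where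
  "expinv n t = (if t > 0 then exp (- inverse t) * inverse t ^ n else 0)"

lemma expinv_tendsto_0: "(expinv n \<longlongrightarrow> 0) (at 0)"
proof -
  have "((\<lambda>t. inverse t ^ n / exp (inverse t)) \<longlongrightarrow> 0) (at_right (0::real))"
    by (rule filterlim_compose[OF tendsto_power_div_exp_0 filterlim_inverse_at_top_right])
  moreover have "eventually (\<lambda>t. inverse t ^ n / exp (inverse t) = expinv n t) (at_right 0)"
    using eventually_at_right_less[of "0::real"]
    by eventually_elim (auto simp: expinv_def exp_minus divide_inverse)
  ultimately have "(expinv n \<longlongrightarrow> 0) (at_right 0)" by (rule Lim_transform_eventually)
  moreover have "(expinv n \<longlongrightarrow> 0) (at_left 0)"
    by (rule Lim_transform_eventually[OF tendsto_const])
       (auto simp: expinv_def eventually_at_filter)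
  ultimately show ?thesis by (simp add: filterlim_split_at)
qed

lemma DERIV_expinv:
  "(expinv n has_real_derivative expinv (n + 2) t - real n * expinv (n + 1) t) (at t)"
proof (cases t "0::real" rule: linorder_cases)
  case less
  have "((\<lambda>_. 0) has_real_derivative 0) (at t)" by simp
  moreover have "eventually (\<lambda>x. expinv n x = 0) (nhds t)"
    using eventually_nhds_in_open[of "{..<0}" t] less by (auto elim!: eventually_mono simp: expinv_def)
  ultimately show ?thesis using less
    by (subst DERIV_cong_ev[OF refl _ refl, of _ "\<lambda>_. 0"]) (auto simp: expinv_def)
next
  case equal
  \<comment> \<open>The difference quotient of \<open>expinv n\<close> at the origin is
    \<open>expinv (n + 1)\<close>.\<close>
  have "((\<lambda>h. (expinv n (0 + h) - expinv n 0) / h) \<longlongrightarrow> 0) (at 0)"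
    by (rule Lim_transform_eventually[OF expinv_tendsto_0[of "n + 1"]])
       (auto simp: expinv_def eventually_at_filter field_simps)
  then show ?thesis using equal by (simp add: DERIV_def expinv_def)
next
  case greater
  let ?f = "\<lambda>t. exp (- inverse t) * inverse t ^ n"
  have "n = 0 \<or> inverse t ^ (n - Suc 0) * inverse t = inverse t ^ n" by (cases n) auto
  then have *: "real n * inverse t ^ (n - Suc 0) * (inverse t * inverse t) = real n * inverse t ^ (n + 1)"
    by auto
  have "(?f has_real_derivative exp (- inverse t) * (inverse t * inverse t) * inverse t ^ n
      - exp (- inverse t) * (real n * inverse t ^ (n - Suc 0) * (inverse t * inverse t))) (at t)"
    using greater by (auto intro!: derivative_eq_intros)
  then have "(?f has_real_derivative expinv (n + 2) t - real n * expinv (n + 1) t) (at t)"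
    unfolding * using greater by (simp add: expinv_def mult_ac)
  moreover have "eventually (\<lambda>x. expinv n x = ?f x) (nhds t)"
    using eventually_nhds_in_open[of "{0<..}" t] greater by (auto elim!: eventually_mono simp: expinv_def)
  ultimately show ?thesis by (subst DERIV_cong_ev[OF refl _ refl])
qed

text \<open>A class of differentiable functions that contains the partial derivatives of its
  members. Smoothness then follows by induction on the order, with no formula for higher
  derivatives.\<close>

inductive expinv_algebra :: "('a::euclidean_space \<Rightarrow> real) \<Rightarrow> bool" where
  const: "expinv_algebra (\<lambda>x. c)"
| inner: "expinv_algebra (\<lambda>x. x \<bullet> b)"
| expinv: "expinv_algebra q \<Longrightarrow> expinv_algebra (\<lambda>x. expinv n (q x))"
| add: "expinv_algebra f \<Longrightarrow> expinv_algebra g \<Longrightarrow> expinv_algebra (\<lambda>x. f x + g x)"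
| mult: "expinv_algebra f \<Longrightarrow> expinv_algebra g \<Longrightarrow> expinv_algebra (\<lambda>x. f x * g x)"

lemma expinv_algebra_GDERIV:
  "expinv_algebra f \<Longrightarrow> \<exists>g. (\<forall>x. GDERIV f x :> g x) \<and> (\<forall>b. expinv_algebra (\<lambda>x. g x \<bullet> b))"
proof (induction rule: expinv_algebra.induct)
  case (const c)
  then show ?case by (intro exI[of _ "\<lambda>_. 0"]) (auto intro: expinv_algebra.const GDERIV_const)
next
  case (inner b)
  have "GDERIV (\<lambda>x. x \<bullet> b) x :> b" for x
    unfolding gderiv_def by (auto intro!: derivative_eq_intros)
  then show ?case by (intro exI[of _ "\<lambda>_. b"]) (auto intro: expinv_algebra.const)
next
  case (expinv q n)
  then obtain g where g: "\<And>x. GDERIV q x :> g x" "\<And>b. expinv_algebra (\<lambda>x. g x \<bullet> b)" by blast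
  let ?g = "\<lambda>x. (expinv (n + 2) (q x) + (- real n) * expinv (n + 1) (q x)) *\<^sub>R g x"
  have "GDERIV (\<lambda>x. expinv n (q x)) x :> ?g x" for x
    using GDERIV_DERIV_compose[OF g(1)[of x] DERIV_expinv[of n "q x"]] by simp
  moreover have "expinv_algebra (\<lambda>x. ?g x \<bullet> b)" for b
    unfolding inner_scaleR_left by (intro expinv_algebra.intros expinv g)
  ultimately show ?case by (intro exI[of _ ?g]) blast
next
  case (add f f')
  then obtain g g' where g: "\<And>x. GDERIV f x :> g x" "\<And>b. expinv_algebra (\<lambda>x. g x \<bullet> b)"
    "\<And>x. GDERIV f' x :> g' x" "\<And>b. expinv_algebra (\<lambda>x. g' x \<bullet> b)" by blast
  have "GDERIV (\<lambda>x. f x + f' x) x :> g x + g' x" for x by (intro GDERIV_add g)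
  moreover have "expinv_algebra (\<lambda>x. (g x + g' x) \<bullet> b)" for b
    unfolding inner_add_left by (intro expinv_algebra.intros g)
  ultimately show ?case by (intro exI[of _ "\<lambda>x. g x + g' x"]) blast
next
  case (mult f f')
  then obtain g g' where g: "\<And>x. GDERIV f x :> g x" "\<And>b. expinv_algebra (\<lambda>x. g x \<bullet> b)"
    "\<And>x. GDERIV f' x :> g' x" "\<And>b. expinv_algebra (\<lambda>x. g' x \<bullet> b)" by blast
  have "GDERIV (\<lambda>x. f x * f' x) x :> f x *\<^sub>R g' x + f' x *\<^sub>R g x" for x by (intro GDERIV_mult g)
  moreover have "expinv_algebra (\<lambda>x. (f x *\<^sub>R g' x + f' x *\<^sub>R g x) \<bullet> b)" for b
    unfolding inner_add_left inner_scaleR_left by (intro expinv_algebra.intros g mult)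
  ultimately show ?case by (intro exI[of _ "\<lambda>x. f x *\<^sub>R g' x + f' x *\<^sub>R g x"]) blast
qed

lemma GDERIV_continuous:
  assumes "\<And>x. GDERIV f x :> g x"
  shows "continuous_on UNIV f"
  using assms unfolding gderiv_def continuous_on_eq_continuous_at[OF open_UNIV]
  by (auto intro: has_derivative_continuous)

lemma expinv_algebra_C_on: "expinv_algebra f \<Longrightarrow> C_on k UNIV f"
proof (induction k arbitrary: f)
  case 0
  then show ?case using expinv_algebra_GDERIV[of f] GDERIV_continuous by (metis C_on.simps(1))
next
  case (Suc k)
  then show ?case using expinv_algebra_GDERIV[of f] by auto
qed

lemma expinv_algebra_smooth: "expinv_algebra f \<Longrightarrow> smooth f"
  by (simp add: smooth_def expinv_algebra_C_on)

lemma expinv_algebra_prod: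
  "finite I \<Longrightarrow> (\<And>i. i \<in> I \<Longrightarrow> expinv_algebra (f i)) \<Longrightarrow> expinv_algebra (\<lambda>x. \<Prod>i\<in>I. f i x)"
  by (induction rule: finite_induct) (auto intro: expinv_algebra.const expinv_algebra.mult)

text \<open>The factor \<open>n\<close> stretches the profile, so that the bumps tend pointwise to
  the indicator of the open box while their support stays in the closed one.\<close>

definition box_bump :: "'a::euclidean_space \<Rightarrow> 'a \<Rightarrow> nat \<Rightarrow> 'a \<Rightarrow> real" where
  "box_bump a b n x = (\<Prod>i\<in>Basis. expinv 0 (real n * (x \<bullet> i + (- (a \<bullet> i)))) *
     expinv 0 (real n * (b \<bullet> i + (- 1) * (x \<bullet> i))))"

lemma box_bump_algebra: "expinv_algebra (box_bump a b n)"
  unfolding box_bump_def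
  by (intro expinv_algebra_prod expinv_algebra.intros finite_Basis)

lemma expinv_0_bounds: "0 \<le> expinv 0 t" "expinv 0 t \<le> 1"
  by (auto simp: expinv_def)

lemma expinv_0_limit: "(\<lambda>n. expinv 0 (real n * t)) \<longlonglongrightarrow> (if t > 0 then 1 else 0)"
proof (cases "t > 0")
  case True
  have "(\<lambda>n. exp (- (inverse t * inverse (real n)))) \<longlonglongrightarrow> exp (- (inverse t * 0))"
    by (intro tendsto_intros lim_inverse_n)
  moreover have "eventually (\<lambda>n. exp (- (inverse t * inverse (real n))) = expinv 0 (real n * t)) sequentially"
    using eventually_gt_at_top[of "0::nat"] by eventually_elim (use True in \<open>auto simp: expinv_def\<close>)
  ultimately show ?thesis using True by (auto intro: Lim_transform_eventually)
next
  case False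
  then have "expinv 0 (real n * t) = 0" for n by (auto simp: expinv_def mult_le_0_iff not_less zero_less_mult_iff)
  then show ?thesis using False by simp
qed

lemma box_bump_bounds: "0 \<le> box_bump a b n x" "box_bump a b n x \<le> 1"
  unfolding box_bump_def
  by (auto intro!: prod_nonneg prod_le_1 mult_nonneg_nonneg mult_le_one expinv_0_bounds)

lemma box_bump_mult_le: "\<bar>y * box_bump a b n x\<bar> \<le> \<bar>y\<bar>"
  using box_bump_bounds[of a b n x] by (simp add: abs_mult mult_left_le)

lemma box_bump_limit: "(\<lambda>n. box_bump a b n x) \<longlonglongrightarrow> indicator (box a b) x"
proof -
  let ?c = "\<lambda>t::real. if t > 0 then 1 else (0::real)"
  have "(\<lambda>n. box_bump a b n x) \<longlonglongrightarrow> (\<Prod>i\<in>Basis. ?c (x \<bullet> i + (- (a \<bullet> i))) * ?c (b \<bullet> i + (- 1) * (x \<bullet> i)))"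
    unfolding box_bump_def by (intro tendsto_prod tendsto_mult expinv_0_limit)
  also have "(\<Prod>i\<in>Basis. ?c (x \<bullet> i + (- (a \<bullet> i))) * ?c (b \<bullet> i + (- 1) * (x \<bullet> i))) = indicator (box a b) x"
  proof (cases "x \<in> box a b")
    case True
    then show ?thesis by (auto simp: mem_box intro!: prod.neutral)
  next
    case False
    then obtain i where "i \<in> Basis" "\<not> (a \<bullet> i < x \<bullet> i \<and> x \<bullet> i < b \<bullet> i)" by (auto simp: mem_box)
    then show ?thesis using False by (auto simp: prod_zero_iff intro!: bexI[of _ i])
  qed
  finally show ?thesis .
qed

lemma box_bump_support: "box_bump a b n x \<noteq> 0 \<Longrightarrow> x \<in> box a b"
  unfolding box_bump_def mem_box by (auto simp: expinv_def zero_less_mult_iff split: if_splits)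

lemma box_bump_test_function:
  assumes "cbox a b \<subseteq> \<Omega>"
  shows "test_function \<Omega> (box_bump a b n)"
proof -
  have "{x. box_bump a b n x \<noteq> 0} \<subseteq> cbox a b" using box_bump_support box_subset_cbox by blast
  then have "closure {x. box_bump a b n x \<noteq> 0} \<subseteq> cbox a b" by (rule closure_minimal) (rule closed_cbox)
  then show ?thesis unfolding test_function_def
    using assms expinv_algebra_smooth[OF box_bump_algebra]
    by (auto intro: bounded_subset[OF bounded_cbox] simp: compact_eq_bounded_closed)
qed

text \<open>Open boxes generate the Borel sets and are stable under intersection, so the integral of
  \<open>f\<close> vanishes over every Borel set; \<open>univ\<close> serves the step to
  complements. The sets where \<open>f\<close> is nonnegative and nonpositive then finish the
  argument.\<close>

lemma AE_zero_if_box_integrals_zero: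
  fixes f :: "'a::euclidean_space \<Rightarrow> real"
  assumes f: "integrable lborel f" and zero: "\<And>a b. (LINT x:box a b|lborel. f x) = 0"
    and univ: "(LINT x|lborel. f x) = 0"
  shows "AE x in lborel. f x = 0"
proof -
  have si: "set_integrable lborel A f" if "A \<in> sets borel" for A
    using f that unfolding set_integrable_def by (intro integrable_mult_indicator) auto
  have "(LINT x:A|lborel. f x) = 0" if "A \<in> sets borel" for A
  proof -
    have sig: "A \<in> sigma_sets UNIV (range (\<lambda>(a, b). box a b :: 'a set))"
      using that unfolding borel_eq_box by simp
    have stable: "Int_stable (range (\<lambda>(a, b). box a b :: 'a set))"
      by (auto simp: Int_stable_def box_Int_box)
    have pow: "range (\<lambda>(a, b). box a b :: 'a set) \<subseteq> Pow UNIV" by simp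
    from stable pow sig show ?thesis
    proof (induction rule: sigma_sets_induct_disjoint)
      case (basic A)
      then show ?case using zero by auto
    next
      case empty
      then show ?case by (simp add: set_lebesgue_integral_def)
    next
      case (compl A)
      then have A: "A \<in> sets borel" by (simp add: borel_eq_box)
      have "(LINT x:A \<union> (UNIV - A)|lborel. f x) = (LINT x:A|lborel. f x) + (LINT x:UNIV - A|lborel. f x)"
        using A by (intro set_integral_Un si) auto
      then show ?case using compl univ by (simp add: set_lebesgue_integral_def)
    next
      case (union A)
      then have A: "A i \<in> sets lborel" for i by (auto simp: borel_eq_box)
      have "(LINT x:(\<Union>i. A i)|lborel. f x) = (\<Sum>i. LINT x:A i|lborel. f x)"
        using A union(1) by (intro lebesgue_integral_countable_add si) (auto simp: disjoint_family_on_def)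
      then show ?case using union by simp
    qed
  qed
  note all = this
  have m: "f \<in> borel_measurable borel" using f by auto
  have 1: "{x. f x \<ge> 0} \<in> sets borel" "{x. f x \<le> 0} \<in> sets borel" using m by measurable
  have "AE x in lborel. indicator {x. f x \<ge> 0} x *\<^sub>R f x = 0"
    by (subst integral_nonneg_eq_0_iff_AE[symmetric])
       (use si[OF 1(1)] all[OF 1(1)] in \<open>auto simp: set_integrable_def set_lebesgue_integral_def indicator_def\<close>)
  moreover have "AE x in lborel. - (indicator {x. f x \<le> 0} x *\<^sub>R f x) = 0"
    by (subst integral_nonneg_eq_0_iff_AE[symmetric])
       (use si[OF 1(2)] all[OF 1(2)] in \<open>auto simp: set_integrable_def set_lebesgue_integral_def indicator_def\<close>)
  ultimately show ?thesis by eventually_elim (auto simp: indicator_def split: if_splits)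
qed

lemma continuous_borel_measurable_lebesgue:
  fixes f :: "'a::euclidean_space \<Rightarrow> 'b::euclidean_space"
  assumes "continuous_on UNIV f"
  shows "f \<in> borel_measurable lebesgue"
proof -
  have "f \<in> borel_measurable lborel" using borel_measurable_continuous_onI[OF assms] by simp
  then show ?thesis by (rule measurable_completion)
qed

text \<open>The fundamental lemma of the calculus of variations on one box. By dominated convergence
  the bumps may be replaced by indicators of boxes.\<close>

lemma set_integrable_AE_zero:
  fixes D :: "'a::euclidean_space \<Rightarrow> real"
  assumes D: "set_integrable lebesgue (cbox p q) D"
    and zero: "\<And>a b n. cbox a b \<subseteq> cbox p q \<Longrightarrow> (LINT x:cbox p q|lebesgue. D x * box_bump a b n x) = 0"
  shows "AE x in lebesgue. x \<in> box p q \<longrightarrow> D x = 0"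
proof -
  define h where "h x = indicator (cbox p q) x *\<^sub>R D x" for x
  have h: "integrable lebesgue h" using D unfolding h_def set_integrable_def .
  have bump_meas: "box_bump a b n \<in> borel_measurable lebesgue" for a b :: 'a and n
    using expinv_algebra_C_on[OF box_bump_algebra[of a b n], of 0]
    by (auto intro: continuous_borel_measurable_lebesgue)
  have box0: "(LINT x|lebesgue. h x * indicator (box a b) x) = 0" if ab: "cbox a b \<subseteq> cbox p q" for a b
  proof -
    have "(\<lambda>n. LINT x|lebesgue. h x * box_bump a b n x) \<longlonglongrightarrow> (LINT x|lebesgue. h x * indicator (box a b) x)"
    proof (rule integral_dominated_convergence)
      show "(\<lambda>x. h x * box_bump a b n x) \<in> borel_measurable lebesgue" for n
        using h bump_meas by measurable
      show "(\<lambda>x. h x * indicator (box a b) x) \<in> borel_measurable lebesgue"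
        using h by (intro borel_measurable_times borel_measurable_indicator) auto
      show "AE x in lebesgue. (\<lambda>n. h x * box_bump a b n x) \<longlonglongrightarrow> h x * indicator (box a b) x"
        by (intro AE_I2 tendsto_mult tendsto_const box_bump_limit)
      show "AE x in lebesgue. norm (h x * box_bump a b n x) \<le> norm (h x)" for n
        by (intro AE_I2) (simp only: real_norm_def box_bump_mult_le)
      show "integrable lebesgue (\<lambda>x. norm (h x))" using h by simp
    qed
    moreover have "(LINT x|lebesgue. h x * box_bump a b n x) = 0" for n
      using zero[OF ab, of n] by (simp add: set_lebesgue_integral_def h_def mult.assoc)
    ultimately show ?thesis by (simp add: LIMSEQ_const_iff)
  qed
  have hb: "integrable lebesgue (\<lambda>x. h x * indicator (box p q) x)"
    using h by (intro integrable_real_mult_indicator) auto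
  \<comment> \<open>A Borel representative, because the argument with generators of the Borel sets
    takes place over \<open>lborel\<close>.\<close>
  obtain f where f: "f \<in> borel_measurable lborel" "AE x in lborel. h x * indicator (box p q) x = f x"
    using completion_ex_borel_measurable_real[OF borel_measurable_integrable[OF hb]] by auto
  have f': "AE x in lebesgue. h x * indicator (box p q) x = f x"
    using f(2) by (rule AE_completion)
  have fm: "f \<in> borel_measurable lebesgue" using f(1) by (rule measurable_completion)
  have "integrable lebesgue f"
    using integrable_cong_AE_imp[OF hb fm] f' by (auto simp: eq_commute)
  then have fi: "integrable lborel f" using integrable_completion[OF f(1)] by simp
  have boxes: "(LINT x|lborel. f x * indicator (box a b) x) = 0" for a b
  proof -
    have "(LINT x|lborel. f x * indicator (box a b) x) = (LINT x|lebesgue. f x * indicator (box a b) x)"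
      by (intro integral_completion[symmetric] borel_measurable_times borel_measurable_indicator f(1)) simp
    also have "\<dots> = (LINT x|lebesgue. h x * indicator (box p q \<inter> box a b) x)"
    proof (rule integral_cong_AE)
      show "(\<lambda>x. f x * indicator (box a b) x) \<in> borel_measurable lebesgue"
        using fm by (intro borel_measurable_times borel_measurable_indicator) auto
      show "(\<lambda>x. h x * indicator (box p q \<inter> box a b) x) \<in> borel_measurable lebesgue"
        using h by (intro borel_measurable_times borel_measurable_indicator) auto
      show "AE x in lebesgue. f x * indicator (box a b) x = h x * indicator (box p q \<inter> box a b) x"
        using f' by eventually_elim (auto simp: indicator_def split: if_splits)
    qed
    also have "\<dots> = 0"
    proof (cases "box p q \<inter> box a b = {}")
      case False
      define c d where "c = (\<Sum>i\<in>Basis. max (p\<bullet>i) (a\<bullet>i) *\<^sub>R i)" and "d = (\<Sum>i\<in>Basis. min (q\<bullet>i) (b\<bullet>i) *\<^sub>R i)"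
      have e: "box p q \<inter> box a b = box c d" unfolding c_def d_def by (rule box_Int_box)
      have "cbox c d \<subseteq> cbox p q" by (auto simp: mem_box c_def d_def)
      then show ?thesis unfolding e by (rule box0)
    qed simp
    finally show ?thesis .
  qed
  have "AE x in lborel. f x = 0"
  proof (rule AE_zero_if_box_integrals_zero[OF fi])
    show "(LINT x:box a b|lborel. f x) = 0" for a b
      using boxes[of a b] by (simp add: set_lebesgue_integral_def mult.commute)
    have "(LINT x|lborel. f x) = (LINT x|lborel. f x * indicator (box p q) x)"
    proof (rule integral_cong_AE)
      show "(\<lambda>x. f x * indicator (box p q) x) \<in> borel_measurable lborel"
        using f(1) by (intro borel_measurable_times borel_measurable_indicator) auto
      show "AE x in lborel. f x = f x * indicator (box p q) x"
        using f(2) by eventually_elim (auto simp: indicator_def split: if_splits)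
    qed (use f in simp)
    then show "(LINT x|lborel. f x) = 0" using boxes by simp
  qed
  then have "AE x in lebesgue. f x = 0" by (rule AE_completion)
  with f' show ?thesis
    by eventually_elim (use box_subset_cbox[of p q] in \<open>auto simp: h_def indicator_def\<close>)
qed

text \<open>An open set is a countable union of closed boxes. On each of them the components of
  \<open>G - H\<close> integrate to zero against all bumps, and the boundary of a box is a null
  set.\<close>

theorem has_weak_gradient_unique:
  fixes \<Omega> :: "'a::euclidean_space set"
  assumes \<Omega>: "open \<Omega>" and G: "has_weak_gradient \<Omega> v G" and H: "has_weak_gradient \<Omega> v H"
  shows "AE x in lebesgue. x \<in> \<Omega> \<longrightarrow> G x = H x"
proof -
  obtain \<D> where D: "countable \<D>" "\<D> \<subseteq> Pow \<Omega>" "\<And>X. X \<in> \<D> \<Longrightarrow> \<exists>a b. X = cbox a b" "\<Union>\<D> = \<Omega>"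
    using open_countable_Union_open_cbox[OF \<Omega>] by blast
  have "AE x in lebesgue. x \<in> X \<longrightarrow> G x = H x" if X: "X \<in> \<D>" for X
  proof -
    obtain p q where X: "X = cbox p q" "cbox p q \<subseteq> \<Omega>" using D(3)[OF X] D(2) X by blast
    have int: "set_integrable lebesgue (cbox p q) G" "set_integrable lebesgue (cbox p q) H"
      using G H X unfolding has_weak_gradient_def by auto
    have comp: "AE x in lebesgue. x \<in> box p q \<longrightarrow> (G x - H x) \<bullet> i = 0" if i: "i \<in> Basis" for i
    proof (rule set_integrable_AE_zero)
      have int_i: "set_integrable lebesgue (cbox p q) (\<lambda>x. K x \<bullet> i)" if "set_integrable lebesgue (cbox p q) K"
        for K :: "'a \<Rightarrow> 'a"
        using integrable_inner_left[of i lebesgue "\<lambda>x. indicator (cbox p q) x *\<^sub>R K x"] that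
        unfolding set_integrable_def by simp
      show "set_integrable lebesgue (cbox p q) (\<lambda>x. (G x - H x) \<bullet> i)"
        unfolding inner_diff_left by (intro set_integral_diff int_i int)
      fix a b :: 'a and n assume ab: "cbox a b \<subseteq> cbox p q"
      let ?\<psi> = "box_bump a b n"
      have t: "test_function \<Omega> ?\<psi>" using ab X by (intro box_bump_test_function) auto
      have restrict: "(LINT x:\<Omega>|lebesgue. (K x \<bullet> i) * ?\<psi> x) = (LINT x:cbox p q|lebesgue. (K x \<bullet> i) * ?\<psi> x)"
        for K :: "'a \<Rightarrow> 'a"
        unfolding set_lebesgue_integral_def
        using box_bump_support[of a b n] box_subset_cbox[of a b] ab X
        by (intro Bochner_Integration.integral_cong) (auto simp: indicator_def)
      have "(LINT x:\<Omega>|lebesgue. (G x \<bullet> i) * ?\<psi> x) = (LINT x:\<Omega>|lebesgue. (H x \<bullet> i) * ?\<psi> x)"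
      proof -
        have "(LINT x:\<Omega>|lebesgue. v x * (grad ?\<psi> x \<bullet> i)) = - (LINT x:\<Omega>|lebesgue. (G x \<bullet> i) * ?\<psi> x)"
          using G t i unfolding has_weak_gradient_def by blast
        moreover have "(LINT x:\<Omega>|lebesgue. v x * (grad ?\<psi> x \<bullet> i)) = - (LINT x:\<Omega>|lebesgue. (H x \<bullet> i) * ?\<psi> x)"
          using H t i unfolding has_weak_gradient_def by blast
        ultimately show ?thesis by linarith
      qed
      then have eq: "(LINT x:cbox p q|lebesgue. (G x \<bullet> i) * ?\<psi> x) = (LINT x:cbox p q|lebesgue. (H x \<bullet> i) * ?\<psi> x)"
        unfolding restrict .
      have prod: "set_integrable lebesgue (cbox p q) (\<lambda>x. (K x \<bullet> i) * ?\<psi> x)" if "set_integrable lebesgue (cbox p q) K"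
        for K :: "'a \<Rightarrow> 'a"
      proof (rule set_integrable_bound[OF int_i[OF that]])
        have "?\<psi> \<in> borel_measurable lebesgue"
          using expinv_algebra_C_on[OF box_bump_algebra[of a b n], of 0]
          by (auto intro: continuous_borel_measurable_lebesgue)
        then show "set_borel_measurable lebesgue (cbox p q) (\<lambda>x. (K x \<bullet> i) * ?\<psi> x)"
          using int_i[OF that] unfolding set_borel_measurable_def set_integrable_def
          by (auto simp: mult.assoc[symmetric] dest!: borel_measurable_integrable intro!: borel_measurable_times)
        show "AE x in lebesgue. x \<in> cbox p q \<longrightarrow> norm ((K x \<bullet> i) * ?\<psi> x) \<le> norm (K x \<bullet> i)"
          by (intro AE_I2 impI) (simp only: real_norm_def box_bump_mult_le)
      qed
      show "(LINT x:cbox p q|lebesgue. ((G x - H x) \<bullet> i) * ?\<psi> x) = 0"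
        unfolding inner_diff_left left_diff_distrib
        using eq by (subst set_integral_diff) (auto intro: prod int)
    qed
    have "AE x in lebesgue. \<forall>i\<in>Basis. x \<in> box p q \<longrightarrow> (G x - H x) \<bullet> i = 0"
      using comp by (intro AE_finite_allI) auto
    moreover have "AE x in lebesgue. x \<notin> cbox p q - box p q"
      using negligible_frontier_interval[of p q] unfolding negligible_iff_null_sets by (rule AE_not_in)
    ultimately show ?thesis
    proof eventually_elim
      case (elim x)
      show ?case
      proof
        assume "x \<in> X"
        then have "x \<in> box p q" using elim(2) X(1) by blast
        then have z: "(G x - H x) \<bullet> i = 0" if "i \<in> Basis" for i using elim(1) that by blast
        have "G x - H x = 0" by (rule euclidean_eqI) (simp only: z inner_zero_left)
        then show "G x = H x" by simp
      qed
    qed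
  qed
  then have "AE x in lebesgue. \<forall>X\<in>\<D>. x \<in> X \<longrightarrow> G x = H x"
    unfolding AE_ball_countable[OF D(1)] by blast
  then show ?thesis by eventually_elim (use D(4) in auto)
qed

section \<open>Stars of nodes\<close>

lemma negligible_aff_dim_less:
  fixes S :: "'a::euclidean_space set"
  assumes "aff_dim S < int DIM('a)"
  shows "negligible S"
proof -
  obtain a b where "a \<noteq> 0" "S \<subseteq> {x. a \<bullet> x = b}" using aff_lowdim_subset_hyperplane[OF assms] .
  then show ?thesis using negligible_hyperplane[of a b] negligible_subset by blast
qed

lemma norm_diff_projection_le:
  fixes e :: "'a::real_inner"
  assumes "norm e = 1"
  shows "norm (x - (x \<bullet> e) *\<^sub>R e) \<le> norm x"
proof -
  have "e \<bullet> e = 1" using assms by (simp add: norm_eq_1)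
  define c where "c = x \<bullet> e"
  have "(x - c *\<^sub>R e) \<bullet> (x - c *\<^sub>R e) = x \<bullet> x - c * c"
    using \<open>e \<bullet> e = 1\<close> c_def[symmetric]
    by (simp add: inner_diff_left inner_diff_right inner_commute[of e x])
  then have "(norm (x - (x \<bullet> e) *\<^sub>R e))\<^sup>2 = (norm x)\<^sup>2 - c * c"
    by (simp add: power2_norm_eq_inner c_def)
  then have "(norm (x - (x \<bullet> e) *\<^sub>R e))\<^sup>2 \<le> (norm x)\<^sup>2" using zero_le_square[of c] by linarith
  then show ?thesis by (rule power2_le_imp_le) simp
qed

section \<open>Local geometry of a Lipschitz domain and of its mesh\<close>

locale mesh =
  fixes \<Omega> :: "'a::euclidean_space set" and \<T> :: "'a set set"
  assumes domain: "simplicial_lipschitz_domain \<Omega>"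
    and conforming: "conforming_triangulation \<Omega> \<T>"
begin

lemma open_domain: "open \<Omega>" and bounded_domain: "bounded \<Omega>"
  using domain by (auto simp: simplicial_lipschitz_domain_def)

lemma finite_mesh: "finite \<T>" and Union_mesh: "\<Union>\<T> = closure \<Omega>"
  and face_Int: "T \<in> \<T> \<Longrightarrow> T' \<in> \<T> \<Longrightarrow> T \<inter> T' face_of T"
  and full: "T \<in> \<T> \<Longrightarrow> full_simplex T"
  using conforming by (auto simp: conforming_triangulation_def triangulation_def full_simplex_def)

lemma lipschitz_epigraph:
  assumes "p \<in> frontier \<Omega>"
  obtains e r L g where "norm e = 1" "r > 0" "L \<ge> 0" "L-lipschitz_on {y. y \<bullet> e = 0} g"
    "\<And>x. x \<in> ball p r \<Longrightarrow> x \<in> \<Omega> \<longleftrightarrow> g (x - (x \<bullet> e) *\<^sub>R e) < x \<bullet> e"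
proof -
  obtain e r L g where "norm e = 1" "r > 0" "L-lipschitz_on {y. y \<bullet> e = 0} g"
    "\<forall>x\<in>ball p r. x \<in> \<Omega> \<longleftrightarrow> g (x - (x \<bullet> e) *\<^sub>R e) < x \<bullet> e"
    using domain assms unfolding simplicial_lipschitz_domain_def by blast
  then show ?thesis using that lipschitz_on_nonneg by blast
qed

text \<open>A Lipschitz domain lies on one side of its boundary, so that slits are excluded. Thereby
  a set that elements fill up to an open neighbourhood lies in \<open>\<Omega>\<close>
  itself.\<close>

lemma interior_closure_domain: "interior (closure \<Omega>) = \<Omega>"
proof
  show "\<Omega> \<subseteq> interior (closure \<Omega>)" using open_domain closure_subset interior_maximal by metis
  show "interior (closure \<Omega>) \<subseteq> \<Omega>"
  proof (rule subsetI, rule ccontr)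
    fix x assume x: "x \<in> interior (closure \<Omega>)" "x \<notin> \<Omega>"
    then have "x \<in> frontier \<Omega>"
      using interior_subset[of "closure \<Omega>"] open_domain by (auto simp: frontier_def interior_open)
    then obtain e r L g where e: "norm e = 1" "r > 0" "L-lipschitz_on {y. y \<bullet> e = 0} g"
      "\<And>y. y \<in> ball x r \<Longrightarrow> y \<in> \<Omega> \<longleftrightarrow> g (y - (y \<bullet> e) *\<^sub>R e) < y \<bullet> e"
      by (rule lipschitz_epigraph) blast
    have ee: "e \<bullet> e = 1" using e(1) by (simp add: norm_eq_1)
    obtain s where s: "s > 0" "ball x s \<subseteq> closure \<Omega>" using x(1) by (auto simp: mem_interior)
    define t where "t = min r s / 2"
    have t: "t > 0" "t < r" "t < s" using s(1) e(2) by (auto simp: t_def min_def)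
    \<comment> \<open>A point not above the graph, moved down, is strictly below it and hence has a
      neighbourhood that misses \<open>\<Omega>\<close>; yet it is still within the ball contained
      in the closure.\<close>
    define y where "y = x - t *\<^sub>R e"
    let ?Q = "{z. z \<bullet> e < g (z - (z \<bullet> e) *\<^sub>R e)}"
    have "continuous_on UNIV (\<lambda>z. g (z - (z \<bullet> e) *\<^sub>R e))"
      by (rule continuous_on_compose2[OF lipschitz_on_continuous_on[OF e(3)]])
         (auto intro!: continuous_intros simp: inner_diff_left ee)
    then have "open ?Q" by (intro open_Collect_less continuous_intros) auto
    have "\<not> g (x - (x \<bullet> e) *\<^sub>R e) < x \<bullet> e" using e(4)[of x] x(2) e(2) by auto
    moreover have "y - (y \<bullet> e) *\<^sub>R e = x - (x \<bullet> e) *\<^sub>R e" "y \<bullet> e = x \<bullet> e - t"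
      by (simp_all add: y_def inner_diff_left ee algebra_simps)
    ultimately have "y \<in> ?Q" using t by simp
    moreover have dy: "dist x y = t" using e(1) t by (simp add: y_def dist_norm)
    ultimately have yb: "y \<in> ?Q \<inter> ball x r" using t by simp
    have "(?Q \<inter> ball x r) \<inter> \<Omega> = {}" using e(4) by force
    then have "(?Q \<inter> ball x r) \<inter> closure \<Omega> = {}"
      using open_Int_closure_eq_empty[of "?Q \<inter> ball x r" \<Omega>] \<open>open ?Q\<close> by auto
    moreover have "y \<in> closure \<Omega>" using s(2) dy t by (auto simp: subset_eq)
    ultimately show False using yb by blast
  qed
qed

lemma interior_element_subset: "T \<in> \<T> \<Longrightarrow> interior T \<subseteq> \<Omega>"
  using interior_mono[of T "closure \<Omega>"] Union_mesh interior_closure_domain by blast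

lemma interior_disjoint:
  assumes "T \<in> \<T>" "T' \<in> \<T>" "T \<noteq> T'"
  shows "interior T \<inter> T' = {}"
proof (rule ccontr)
  assume "interior T \<inter> T' \<noteq> {}"
  then have "(T \<inter> T') \<inter> interior T \<noteq> {}" using interior_subset by blast
  then have "T \<inter> T' = T" using face_of_disjoint_interior[OF face_Int[OF assms(1,2)]] by blast
  then have sub: "T \<subseteq> T'" by blast
  have "(T' \<inter> T) \<inter> interior T' = {}"
    using face_of_disjoint_interior[OF face_Int[OF assms(2,1)]] sub assms(3) by blast
  moreover have "interior T \<subseteq> interior T'" using sub by (rule interior_mono)
  ultimately show False
    using full_simplex.interior_ne[OF full[OF assms(1)]] interior_subset[of T] sub by blast
qed

text \<open>\<open>\<Omega>\<close> intersected with a ball need not be connected, hence the two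
  radii. At a boundary point the path goes up in the direction \<open>e\<close>, across, and down
  again.\<close>

lemma connected_near:
  assumes \<nu>: "\<nu> \<in> closure \<Omega>" and \<epsilon>: "\<epsilon> > 0"
  obtains \<delta> where "\<delta> > 0" "\<And>x y. x \<in> \<Omega> \<inter> ball \<nu> \<delta> \<Longrightarrow> y \<in> \<Omega> \<inter> ball \<nu> \<delta> \<Longrightarrow>
    \<exists>C. connected C \<and> C \<subseteq> \<Omega> \<inter> ball \<nu> \<epsilon> \<and> x \<in> C \<and> y \<in> C"
proof (cases "\<nu> \<in> \<Omega>")
  case True
  then obtain \<delta> where \<delta>: "\<delta> > 0" "ball \<nu> \<delta> \<subseteq> \<Omega>" using open_domain by (meson openE)
  have "ball \<nu> (min \<delta> \<epsilon>) \<subseteq> \<Omega> \<inter> ball \<nu> \<epsilon>" using \<delta>(2) by auto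
  moreover have "connected (ball \<nu> (min \<delta> \<epsilon>))" by simp
  ultimately show ?thesis using that[of "min \<delta> \<epsilon>"] \<delta>(1) \<epsilon> by (metis IntD2 min_less_iff_conj)
next
  case False
  then have "\<nu> \<in> frontier \<Omega>" using \<nu> open_domain by (auto simp: frontier_def interior_open)
  then obtain e r L g where e: "norm e = 1" "r > 0" "L \<ge> 0" "L-lipschitz_on {y. y \<bullet> e = 0} g"
    "\<And>y. y \<in> ball \<nu> r \<Longrightarrow> y \<in> \<Omega> \<longleftrightarrow> g (y - (y \<bullet> e) *\<^sub>R e) < y \<bullet> e"
    by (rule lipschitz_epigraph) blast
  have ee: "e \<bullet> e = 1" using e(1) by (simp add: norm_eq_1)
  define \<delta> where "\<delta> = min \<epsilon> r / (1 + 2 * L)"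
  have \<delta>: "\<delta> > 0" using e \<epsilon> by (simp add: \<delta>_def)
  have \<delta>': "\<delta> + 2 * L * \<delta> = min \<epsilon> r"
  proof -
    have "\<delta> * (1 + 2 * L) = min \<epsilon> r" using e(3) by (simp add: \<delta>_def)
    then show ?thesis by (simp add: algebra_simps)
  qed
  \<comment> \<open>The most by which the Lipschitz graph can change over the distance
    \<open>2 * \<delta>\<close>: at height \<open>t\<close> above its ends the segment is clear of
    the graph. The choice of \<open>\<delta>\<close> makes \<open>\<delta> + t\<close> equal to
    \<open>min \<epsilon> r\<close>, so that the path remains in the chart and in the larger
    ball.\<close>
  define t where "t = 2 * L * \<delta>"
  have t: "t \<ge> 0" using \<delta> e by (simp add: t_def)
  let ?P = "\<lambda>z. z - (z \<bullet> e) *\<^sub>R e"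
  have P_add: "?P (z + s *\<^sub>R e) = ?P z" for z s by (simp add: inner_add_left ee algebra_simps)
  have P_mem: "?P z \<in> {y. y \<bullet> e = 0}" for z by (simp add: inner_diff_left ee)
  have up: "z + s *\<^sub>R e \<in> \<Omega> \<inter> ball \<nu> \<epsilon>" if z: "dist \<nu> z < \<delta>" "0 \<le> s" "s \<le> t" "g (?P z) < z \<bullet> e + s" for z s
  proof -
    have "dist \<nu> (z + s *\<^sub>R e) \<le> dist \<nu> z + s"
      using norm_triangle_ineq4[of "\<nu> - z" "s *\<^sub>R e"] e(1) z(2) by (simp add: dist_norm algebra_simps)
    also have "\<dots> < \<delta> + t" using z by simp
    finally have "dist \<nu> (z + s *\<^sub>R e) < min \<epsilon> r" unfolding t_def \<delta>' .
    then have m: "z + s *\<^sub>R e \<in> ball \<nu> r" "z + s *\<^sub>R e \<in> ball \<nu> \<epsilon>" by simp_all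
    have eq: "(z + s *\<^sub>R e) \<bullet> e = z \<bullet> e + s" by (simp add: inner_add_left ee)
    have "g (?P (z + s *\<^sub>R e)) < (z + s *\<^sub>R e) \<bullet> e" unfolding P_add unfolding eq by (rule z(4))
    then show ?thesis using e(5)[OF m(1)] m(2) by blast
  qed
  have "\<exists>C. connected C \<and> C \<subseteq> \<Omega> \<inter> ball \<nu> \<epsilon> \<and> x \<in> C \<and> y \<in> C"
    if x: "x \<in> \<Omega> \<inter> ball \<nu> \<delta>" and y: "y \<in> \<Omega> \<inter> ball \<nu> \<delta>" for x y
  proof -
    have dr: "\<delta> \<le> r" using \<delta>' t by (simp add: t_def)
    have gx: "g (?P x) < x \<bullet> e" "g (?P y) < y \<bullet> e" using e(5) x y dr by auto
    have seg1: "closed_segment z (z + t *\<^sub>R e) \<subseteq> \<Omega> \<inter> ball \<nu> \<epsilon>" if "z = x \<or> z = y" for z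
    proof
      fix w assume "w \<in> closed_segment z (z + t *\<^sub>R e)"
      then obtain u where u: "0 \<le> u" "u \<le> 1" "w = (1 - u) *\<^sub>R z + u *\<^sub>R (z + t *\<^sub>R e)"
        by (auto simp: closed_segment_def)
      have w: "w = z + (u * t) *\<^sub>R e" unfolding u(3) by (simp add: algebra_simps)
      have "u * t \<le> 1 * t" using u t by (intro mult_right_mono) auto
      then show "w \<in> \<Omega> \<inter> ball \<nu> \<epsilon>" unfolding w using that x y gx u t
        by (intro up) (auto intro: add_strict_increasing2 simp: add.commute)
    qed
    have seg2: "closed_segment (x + t *\<^sub>R e) (y + t *\<^sub>R e) \<subseteq> \<Omega> \<inter> ball \<nu> \<epsilon>"
    proof
      fix w assume "w \<in> closed_segment (x + t *\<^sub>R e) (y + t *\<^sub>R e)"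
      then obtain u where u: "0 \<le> u" "u \<le> 1" "w = (1 - u) *\<^sub>R (x + t *\<^sub>R e) + u *\<^sub>R (y + t *\<^sub>R e)"
        by (auto simp: closed_segment_def)
      define m where "m = (1 - u) *\<^sub>R x + u *\<^sub>R y"
      have w: "w = m + t *\<^sub>R e" unfolding u(3) m_def by (simp add: algebra_simps)
      have m: "m \<in> ball \<nu> \<delta>" unfolding m_def
        using convexD_alt[OF convex_ball[of \<nu> \<delta>]] x y u by blast
      have near: "g (?P m) < z \<bullet> e + t" if z: "z = x \<or> z = y" for z
      proof -
        have "dist m z \<le> 2 * \<delta>"
          using dist_triangle[of m z \<nu>] m z x y by (auto simp: dist_commute)
        have "\<bar>g (?P m) - g (?P z)\<bar> \<le> L * dist (?P m) (?P z)"
          using lipschitz_onD[OF e(4) P_mem P_mem, of m z] by (simp add: dist_norm)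
        moreover have "dist (?P m) (?P z) \<le> dist m z"
          using norm_diff_projection_le[OF e(1), of "m - z"] by (simp add: dist_norm inner_diff_left algebra_simps)
        moreover from this \<open>dist m z \<le> 2 * \<delta>\<close> have "L * dist (?P m) (?P z) \<le> L * (2 * \<delta>)"
          by (intro mult_left_mono[OF _ e(3)]) linarith
        ultimately have "\<bar>g (?P m) - g (?P z)\<bar> \<le> t" by (simp add: t_def mult_ac)
        then show ?thesis using gx z by auto
      qed
      have "g (?P m) < m \<bullet> e + t"
      proof -
        have "(1 - u) * (- (x \<bullet> e)) + u * (- (y \<bullet> e)) < - (g (?P m) - t)"
          using near[of x] near[of y] u by (intro convex_bound_lt) auto
        then show ?thesis by (simp add: m_def inner_add_left algebra_simps)
      qed
      then show "w \<in> \<Omega> \<inter> ball \<nu> \<epsilon>" unfolding w using m t by (intro up) auto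
    qed
    let ?C = "closed_segment x (x + t *\<^sub>R e) \<union> (closed_segment (x + t *\<^sub>R e) (y + t *\<^sub>R e) \<union> closed_segment y (y + t *\<^sub>R e))"
    have "connected ?C"
      by (intro connected_Un connected_segment) (force simp: ends_in_segment)+
    moreover have "?C \<subseteq> \<Omega> \<inter> ball \<nu> \<epsilon>" using seg1 seg2 by blast
    ultimately show ?thesis by (intro exI[of _ ?C]) auto
  qed
  then show ?thesis using that \<delta> by blast
qed

text \<open>Near a relative interior point of the common facet, only the two coordinates opposite to
  the facet can be negative. Two simplices on the same side of it would overlap, so together they
  fill a ball around the point.\<close>

lemma rel_interior_facet_subset:
  assumes T: "T1 \<in> \<T>" "T2 \<in> \<T>" "T1 \<noteq> T2" and S: "S facet_of T1" "S facet_of T2"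
  shows "rel_interior S \<subseteq> \<Omega>"
proof
  fix x assume x: "x \<in> rel_interior S"
  interpret s1: full_simplex T1 using full T by blast
  interpret s2: full_simplex T2 using full T by blast
  obtain v1 where v1: "v1 \<in> verts T1" "S = convex hull (verts T1 - {v1})" "affine hull S = {x. bary T1 v1 x = 0}"
    using S(1) s1.facetD by metis
  obtain v2 where v2: "v2 \<in> verts T2" "S = convex hull (verts T2 - {v2})" "affine hull S = {x. bary T2 v2 x = 0}"
    using S(2) s2.facetD by metis
  obtain \<epsilon> where \<epsilon>: "\<epsilon> > 0" "ball x \<epsilon> \<inter> affine hull S \<subseteq> S" and xS: "x \<in> S"
    using x by (auto simp: mem_rel_interior_ball)
  have pos: "bary T w x > 0"
    if T: "full_simplex T" and v: "S = convex hull (verts T - {v})" "S \<subseteq> T" and w: "w \<in> verts T - {v}" for T v w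
  proof (rule ccontr)
    interpret full_simplex T by fact
    assume "\<not> bary T w x > 0"
    then have b0: "bary T w x = 0" using mem_iff_bary[of x] xS v(2) w by force
    have wS: "w \<in> S" unfolding v(1) using w by (intro hull_inc)
    have "w \<noteq> x" using bary_vert[of w w] w b0 by auto
    define s where "s = \<epsilon> / 2 / norm (x - w)"
    have s: "s > 0" using \<epsilon> \<open>w \<noteq> x\<close> by (simp add: s_def)
    \<comment> \<open>The segment from \<open>w\<close> prolonged beyond \<open>x\<close> remains in
      \<open>S\<close> for a short while, but the coordinate of \<open>w\<close> would become
      negative there.\<close>
    define y where "y = x + s *\<^sub>R (x - w)"
    have "y = (1 + s) *\<^sub>R x + (- s) *\<^sub>R w" by (simp add: y_def algebra_simps)
    moreover have "x \<in> affine hull S" "w \<in> affine hull S" using xS wS by (auto intro: hull_inc)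
    ultimately have "y \<in> affine hull S" using mem_affine[OF affine_affine_hull, of x S w "1 + s" "- s"] by simp
    moreover have "dist x y < \<epsilon>" using \<epsilon> \<open>w \<noteq> x\<close> by (simp add: y_def dist_norm s_def)
    ultimately have "y \<in> T" using \<epsilon> v(2) by auto
    then have "bary T w y \<ge> 0" using mem_iff_bary w by blast
    moreover have "bary T w y - bary T w x = s * (bary T w x - bary T w w)"
      by (simp add: bary_diff y_def)
    ultimately show False using b0 bary_vert[of w w] w s by simp
  qed
  have ST: "S \<subseteq> T1" "S \<subseteq> T2" using S facet_of_imp_subset by blast+
  define U where "U = (\<Inter>w\<in>verts T1 - {v1}. {y. bary T1 w y > 0}) \<inter> (\<Inter>w\<in>verts T2 - {v2}. {y. bary T2 w y > 0})"
  have "open U" unfolding U_def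
    using s1.finite_verts s2.finite_verts
    by (intro open_Int open_INT ballI open_Collect_less continuous_intros s1.continuous_bary s2.continuous_bary) auto
  have xU: "x \<in> U" unfolding U_def
    using pos[OF s1.full_simplex_axioms v1(2) ST(1)] pos[OF s2.full_simplex_axioms v2(2) ST(2)] by auto
  obtain \<rho> where \<rho>: "\<rho> > 0" "ball x \<rho> \<subseteq> U" using \<open>open U\<close> xU by (meson openE)
  have x0: "bary T1 v1 x = 0" "bary T2 v2 x = 0" using xS v1(3) v2(3) hull_subset[of S affine] by auto
  have "ball x \<rho> \<subseteq> T1 \<union> T2"
  proof (rule subsetI, rule ccontr)
    fix y assume y: "y \<in> ball x \<rho>" and "y \<notin> T1 \<union> T2"
    have yU: "y \<in> U" using y \<rho>(2) by blast
    have "\<exists>w\<in>verts T1. bary T1 w y < 0" "\<exists>w\<in>verts T2. bary T2 w y < 0"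
      using \<open>y \<notin> T1 \<union> T2\<close> s1.mem_iff_bary[of y] s2.mem_iff_bary[of y] by (auto simp: not_le)
    then obtain w1 w2 where w: "w1 \<in> verts T1" "bary T1 w1 y < 0" "w2 \<in> verts T2" "bary T2 w2 y < 0"
      by blast
    have "w1 = v1"
    proof (rule ccontr)
      assume "w1 \<noteq> v1"
      then have "bary T1 w1 y > 0" using yU w(1) unfolding U_def by simp
      then show False using w(2) by simp
    qed
    moreover have "w2 = v2"
    proof (rule ccontr)
      assume "w2 \<noteq> v2"
      then have "bary T2 w2 y > 0" using yU w(3) unfolding U_def by simp
      then show False using w(4) by simp
    qed
    ultimately have "bary T1 v1 y < 0" "bary T2 v2 y < 0" using w by auto
    \<comment> \<open>The reflection of a point outside both elements lies in the interiors of both,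
      because the two opposite coordinates vanish at \<open>x\<close> and change sign.\<close>
    define z where "z = x - (y - x)"
    have z: "z \<in> ball x \<rho>" using y by (simp add: z_def dist_norm norm_minus_commute)
    have "bary T1 v1 z - bary T1 v1 x = - (bary T1 v1 y - bary T1 v1 x)"
      "bary T2 v2 z - bary T2 v2 x = - (bary T2 v2 y - bary T2 v2 x)"
      unfolding s1.bary_diff s2.bary_diff by (simp_all add: z_def inner_diff_right)
    then have "bary T1 v1 z > 0" "bary T2 v2 z > 0" using x0 \<open>bary T1 v1 y < 0\<close> \<open>bary T2 v2 y < 0\<close> by auto
    then have "z \<in> interior T1" "z \<in> interior T2"
      using subsetD[OF \<rho>(2) z] unfolding U_def s1.interior_iff_bary s2.interior_iff_bary by auto
    then show False using interior_disjoint[OF T] interior_subset by blast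
  qed
  also have "\<dots> \<subseteq> closure \<Omega>" using Union_mesh T by blast
  finally have "x \<in> interior (closure \<Omega>)" using \<rho>(1) by (auto simp: mem_interior)
  then show "x \<in> \<Omega>" using interior_closure_domain by simp
qed

definition "star \<nu> = {T \<in> \<T>. \<nu> \<in> T}"

definition "adjacent \<nu> = {(T, T'). T \<in> star \<nu> \<and> T' \<in> star \<nu> \<and> T \<noteq> T' \<and>
  (T \<inter> T') facet_of T \<and> (T \<inter> T') facet_of T'}"

lemma finite_star: "finite (star \<nu>)" using finite_mesh by (simp add: star_def)

lemma closed_Union_mesh: "A \<subseteq> \<T> \<Longrightarrow> closed (\<Union>A)"
  using finite_mesh full full_simplex.closed_T by (intro closed_Union) (auto intro: finite_subset)

lemma star_subset: "star \<nu> \<subseteq> \<T>" by (auto simp: star_def)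

lemma separated_from_star: "\<exists>\<epsilon>>0. \<forall>T\<in>\<T>. T \<inter> ball \<nu> \<epsilon> \<noteq> {} \<longrightarrow> \<nu> \<in> T"
proof -
  have "closed (\<Union>(\<T> - star \<nu>))" by (rule closed_Union_mesh) blast
  then have "open (- \<Union>(\<T> - star \<nu>))" by (simp add: open_Compl)
  moreover have "\<nu> \<in> - \<Union>(\<T> - star \<nu>)" by (auto simp: star_def)
  ultimately obtain \<epsilon> where "\<epsilon> > 0" "ball \<nu> \<epsilon> \<subseteq> - \<Union>(\<T> - star \<nu>)" by (meson openE)
  then show ?thesis by (intro exI[of _ \<epsilon>]) (auto simp: star_def)
qed

text \<open>A generic segment between two elements meets the intersection of two distinct elements only
  in facets.\<close>

lemma no_touching_components:
  assumes A: "A \<subseteq> star \<nu>" and B: "B \<subseteq> star \<nu>" and AB: "A \<inter> B = {}"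
    and closed: "\<And>T T'. T \<in> A \<Longrightarrow> T' \<in> B \<Longrightarrow> (T, T') \<notin> adjacent \<nu>"
    and W: "open W" "W \<subseteq> \<Union>(A \<union> B)"
    and p: "p \<in> W" "p \<in> \<Union>A" "p \<in> \<Union>B"
  shows False
proof -
  have sub: "A \<subseteq> \<T>" "B \<subseteq> \<T>" using A B by (auto simp: star_def)
  have ne: "T \<noteq> T'" if "T \<in> A" "T' \<in> B" for T T' using that AB by blast
  obtain \<eta> where \<eta>: "\<eta> > 0" "ball p \<eta> \<subseteq> W" using W p by (meson openE)
  obtain T1 T2 where T: "T1 \<in> A" "p \<in> T1" "T2 \<in> B" "p \<in> T2" using p by blast
  have meets: "interior T \<inter> ball p \<eta> \<noteq> {}" if "T \<in> \<T>" "p \<in> T" for T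
  proof -
    have "p \<in> closure (interior T)" using that full_simplex.closure_interior_T[OF full] by simp
    moreover have "p \<in> ball p \<eta>" using \<eta>(1) by simp
    ultimately show ?thesis using open_Int_closure_eq_empty[OF open_ball, of p \<eta> "interior T"] by blast
  qed
  obtain x where x: "x \<in> interior T1" "x \<in> ball p \<eta>" using meets[of T1] T sub by blast
  \<comment> \<open>The intersections that the segment has to avoid. Joining one of them with the
    start \<open>x\<close> raises its dimension by at most one, so the forbidden end points form a
    null set.\<close>
  define \<M> where "\<M> = {M \<in> (\<lambda>(T, T'). T \<inter> T') ` (\<T> \<times> \<T>). aff_dim M \<le> int DIM('a) - 2}"
  define N where "N = (\<Union>M\<in>\<M>. affine hull (insert x M))"
  have "negligible N" unfolding N_def
  proof (intro negligible_Union)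
    show "finite ((\<lambda>M. affine hull insert x M) ` \<M>)" using finite_mesh by (simp add: \<M>_def)
    fix X assume "X \<in> (\<lambda>M. affine hull insert x M) ` \<M>"
    then obtain M where M: "aff_dim M \<le> int DIM('a) - 2" "X = affine hull insert x M" by (auto simp: \<M>_def)
    then have "aff_dim X < int DIM('a)" by (simp add: aff_dim_insert)
    then show "negligible X" by (rule negligible_aff_dim_less)
  qed
  moreover have "open (interior T2 \<inter> ball p \<eta>)" by auto
  ultimately have "\<not> interior T2 \<inter> ball p \<eta> \<subseteq> N"
    using meets[of T2] T sub open_not_negligible negligible_subset by blast
  then obtain y where y: "y \<in> interior T2" "y \<in> ball p \<eta>" "y \<notin> N" by blast
  have "closed_segment x y \<subseteq> ball p \<eta>" using x y by (simp add: closed_segment_subset)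
  then have seg: "closed_segment x y \<subseteq> \<Union>A \<union> \<Union>B" using \<eta> W by blast
  have cl: "closed (\<Union>A)" "closed (\<Union>B)"
    using sub by (blast intro!: closed_Union_mesh)+
  have xy: "x \<in> \<Union>A" "y \<in> \<Union>B" using x y T interior_subset by blast+
  have "\<Union>A \<inter> \<Union>B \<inter> closed_segment x y \<noteq> {}"
  proof
    assume "\<Union>A \<inter> \<Union>B \<inter> closed_segment x y = {}"
    from connected_closedD[OF connected_segment(1) this seg cl] show False using xy by auto
  qed
  then obtain z T1' T2' where z: "z \<in> closed_segment x y" "T1' \<in> A" "z \<in> T1'" "T2' \<in> B" "z \<in> T2'" by blast
  have T': "T1' \<in> \<T>" "T2' \<in> \<T>" "T1' \<noteq> T2'" using z sub ne by auto
  have "z \<noteq> x" using x z T interior_disjoint[of T1 T2'] sub ne by blast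
  let ?M = "T1' \<inter> T2'"
  have "\<not> aff_dim ?M \<le> int DIM('a) - 2"
  proof
    assume "aff_dim ?M \<le> int DIM('a) - 2"
    then have "?M \<in> \<M>" unfolding \<M>_def using T' by auto
    then have "affine hull (insert x ?M) \<subseteq> N" by (auto simp: N_def)
    moreover have "y \<in> affine hull (insert x ?M)"
    proof -
      \<comment> \<open>Since \<open>z\<close> differs from \<open>x\<close>, the end
        \<open>y\<close> is on the line through \<open>x\<close> and \<open>z\<close>, contrary to
        its choice.\<close>
      obtain u where u: "0 \<le> u" "u \<le> 1" "z = (1 - u) *\<^sub>R x + u *\<^sub>R y" using z(1) by (auto simp: closed_segment_def)
      have "u \<noteq> 0" using u \<open>z \<noteq> x\<close> by auto
      then have "y = (1 - 1 / u) *\<^sub>R x + (1 / u) *\<^sub>R z"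
      proof -
        have "(1 / u) *\<^sub>R z = ((1 - u) / u) *\<^sub>R x + y" using \<open>u \<noteq> 0\<close> by (simp add: u(3) scaleR_right_distrib)
        moreover have "(1 - u) / u = 1 / u - 1" using \<open>u \<noteq> 0\<close> by (simp add: diff_divide_distrib)
        ultimately show ?thesis by (simp add: algebra_simps)
      qed
      moreover have "x \<in> affine hull (insert x ?M)" "z \<in> affine hull (insert x ?M)" using z by (auto intro: hull_inc)
      ultimately show ?thesis using mem_affine[OF affine_affine_hull, of x _ z "1 - 1 / u" "1 / u"] by simp
    qed
    ultimately show False using y by blast
  qed
  then have dim: "aff_dim ?M > int DIM('a) - 2" "aff_dim (T2' \<inter> T1') > int DIM('a) - 2" by (simp_all add: Int_commute)
  have "?M \<noteq> T1'"
    using interior_disjoint[OF T'] full_simplex.interior_ne[OF full[OF T'(1)]] interior_subset[of T1'] by blast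
  moreover have "T2' \<inter> T1' \<noteq> T2'"
    using interior_disjoint[OF T'(2,1)] T'(3) full_simplex.interior_ne[OF full[OF T'(2)]] interior_subset[of T2'] by blast
  ultimately have "?M facet_of T1'" "(T2' \<inter> T1') facet_of T2'"
    using full_simplex.face_facetI[OF full[OF T'(1)] face_Int[OF T'(1,2)]]
      full_simplex.face_facetI[OF full[OF T'(2)] face_Int[OF T'(2,1)]] dim by blast+
  then have "(T1', T2') \<in> adjacent \<nu>"
    using z A B T' unfolding adjacent_def by (auto simp: Int_commute)
  then show False using closed z by blast
qed

text \<open>Let \<open>A\<close> be the elements reachable from \<open>T\<close> and
  \<open>B\<close> the other ones of the star. Near \<open>\<nu>\<close> their closed unions cover
  \<open>\<Omega>\<close>, so a connected set from \<open>T\<close> to \<open>T'\<close> contains a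
  point of both, which \<open>no_touching_components\<close> forbids.\<close>

lemma star_connected:
  assumes T: "T \<in> star \<nu>" "T' \<in> star \<nu>"
  shows "(T, T') \<in> (adjacent \<nu>)\<^sup>*"
proof (rule ccontr)
  assume not: "(T, T') \<notin> (adjacent \<nu>)\<^sup>*"
  define A where "A = {T1 \<in> star \<nu>. (T, T1) \<in> (adjacent \<nu>)\<^sup>*}"
  define B where "B = star \<nu> - A"
  have AB: "T \<in> A" "T' \<in> B" using T not by (auto simp: A_def B_def)
  obtain \<epsilon> where \<epsilon>: "\<epsilon> > 0" "\<And>T1. T1 \<in> \<T> \<Longrightarrow> T1 \<inter> ball \<nu> \<epsilon> \<noteq> {} \<Longrightarrow> \<nu> \<in> T1"
    using separated_from_star[of \<nu>] by blast
  let ?W = "\<Omega> \<inter> ball \<nu> \<epsilon>"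
  have W: "?W \<subseteq> \<Union>(A \<union> B)"
  proof
    fix x assume x: "x \<in> ?W"
    then have "x \<in> \<Union>\<T>" using Union_mesh closure_subset by blast
    then obtain T1 where "T1 \<in> \<T>" "x \<in> T1" by blast
    moreover have "x \<in> ball \<nu> \<epsilon>" using x by blast
    ultimately have "T1 \<inter> ball \<nu> \<epsilon> \<noteq> {}" by blast
    then have "T1 \<in> star \<nu>" using \<epsilon>(2)[OF \<open>T1 \<in> \<T>\<close>] \<open>T1 \<in> \<T>\<close> by (simp add: star_def)
    then show "x \<in> \<Union>(A \<union> B)" using \<open>x \<in> T1\<close> by (auto simp: B_def)
  qed
  have noadj: "(T1, T2) \<notin> adjacent \<nu>" if "T1 \<in> A" "T2 \<in> B" for T1 T2
    using that by (auto simp: A_def B_def adjacent_def intro: rtrancl.rtrancl_into_rtrancl)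
  have "\<nu> \<in> closure \<Omega>" using T Union_mesh by (auto simp: star_def)
  then obtain \<delta> where \<delta>: "\<delta> > 0" "\<And>x y. x \<in> \<Omega> \<inter> ball \<nu> \<delta> \<Longrightarrow> y \<in> \<Omega> \<inter> ball \<nu> \<delta> \<Longrightarrow>
    \<exists>C. connected C \<and> C \<subseteq> ?W \<and> x \<in> C \<and> y \<in> C" using connected_near[OF _ \<epsilon>(1)] by metis
  have near: "\<exists>x\<in>T1. x \<in> \<Omega> \<inter> ball \<nu> \<delta>" if "T1 \<in> star \<nu>" for T1
  proof -
    have T1: "T1 \<in> \<T>" "\<nu> \<in> T1" using that by (auto simp: star_def)
    then have "\<nu> \<in> closure (interior T1)" using full_simplex.closure_interior_T[OF full] by simp
    moreover have "\<nu> \<in> ball \<nu> \<delta>" using \<delta>(1) by simp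
    ultimately have "interior T1 \<inter> ball \<nu> \<delta> \<noteq> {}"
      using open_Int_closure_eq_empty[OF open_ball, of \<nu> \<delta> "interior T1"] by blast
    then obtain x where "x \<in> interior T1" "x \<in> ball \<nu> \<delta>" by blast
    then show ?thesis using interior_element_subset[OF T1(1)] interior_subset[of T1] by blast
  qed
  obtain x y where xy: "x \<in> T" "x \<in> \<Omega> \<inter> ball \<nu> \<delta>" "y \<in> T'" "y \<in> \<Omega> \<inter> ball \<nu> \<delta>"
    using near T by meson
  obtain C where C: "connected C" "C \<subseteq> ?W" "x \<in> C" "y \<in> C" using \<delta>(2)[OF xy(2,4)] by blast
  have sub: "A \<subseteq> star \<nu>" "B \<subseteq> star \<nu>" "A \<inter> B = {}" by (auto simp: A_def B_def)
  have cl: "closed (\<Union>A)" "closed (\<Union>B)"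
    using sub star_subset by (blast intro!: closed_Union_mesh)+
  have cover: "C \<subseteq> \<Union>A \<union> \<Union>B" using C W by blast
  have "\<Union>A \<inter> \<Union>B \<inter> C \<noteq> {}"
  proof
    assume "\<Union>A \<inter> \<Union>B \<inter> C = {}"
    from connected_closedD[OF C(1) this cover cl] show False using xy C AB by blast
  qed
  then obtain p where "p \<in> C" "p \<in> \<Union>A" "p \<in> \<Union>B" by blast
  moreover have "open ?W" using open_domain by auto
  ultimately show False using no_touching_components[OF sub noadj _ W] C(2) by blast
qed

end

text \<open>The ratio of the volumes of balls of radii \<open>2 * s\<close> and
  \<open>s / \<kappa>\<close>, rounded up; in \<open>card_star_le\<close> disjoint small balls are
  packed into the large one.\<close>

definition star_bound :: "real \<Rightarrow> nat \<Rightarrow> nat" where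
  "star_bound \<kappa> d = nat \<lceil>(2 * \<kappa>) ^ d\<rceil>"

section \<open>Cardinality and size ratios of stars and patches\<close>

locale shape_regular_mesh = mesh +
  fixes \<kappa> :: real
  assumes kappa: "\<kappa> \<ge> 1"
    and shape: "T \<in> \<T> \<Longrightarrow> \<exists>z R. R > 0 \<and> ball z R \<subseteq> T \<and> diameter T \<le> \<kappa> * R"
begin

lemma bounded_element: "T \<in> \<T> \<Longrightarrow> bounded T" using full full_simplex.bounded_T by blast

lemma diameter_ge_ball:
  assumes "T \<in> \<T>" "ball z R \<subseteq> T" "R > 0"
  shows "2 * R \<le> diameter T"
  using diameter_subset[OF assms(2) bounded_element[OF assms(1)]] assms(3) by (simp add: diameter_ball)

lemma diameter_pos:
  assumes "T \<in> \<T>"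
  shows "diameter T > 0"
proof -
  obtain z R where "R > 0" "ball z R \<subseteq> T" using shape[OF assms] by blast
  then show ?thesis using diameter_ge_ball[OF assms, of z R] by simp
qed

lemma dist_le_diameter: "T \<in> \<T> \<Longrightarrow> x \<in> T \<Longrightarrow> y \<in> T \<Longrightarrow> dist x y \<le> diameter T"
  using diameter_bounded_bound bounded_element by blast

lemma content_element_le:
  assumes "T \<in> \<T>"
  shows "measure lebesgue T \<le> unit_ball_vol (DIM('a)) * diameter T ^ DIM('a)"
proof -
  interpret full_simplex T using full assms by blast
  obtain x where x: "x \<in> T" using verts_ne verts_subset by blast
  have "T \<subseteq> cball x (diameter T)" using dist_le_diameter[OF assms x] by auto
  then have "measure lebesgue T \<le> measure lebesgue (cball x (diameter T))"
    using compact_T by (intro measure_mono_fmeasurable) (auto intro: fmeasurableD lmeasurable_compact)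
  then show ?thesis using content_cball[of "diameter T" x] diameter_pos[OF assms] by simp
qed

lemma content_ge_ball:
  assumes "T \<in> \<T>" "ball z R \<subseteq> T" "R \<ge> 0"
  shows "unit_ball_vol (DIM('a)) * R ^ DIM('a) \<le> measure lebesgue T"
proof -
  interpret full_simplex T using full assms by blast
  have "measure lebesgue (ball z R) \<le> measure lebesgue T"
    using compact_T assms by (intro measure_mono_fmeasurable) (auto intro: lmeasurable_compact)
  then show ?thesis using content_ball[of R z] assms(3) by simp
qed

lemma content_element_ge:
  assumes "T \<in> \<T>"
  shows "unit_ball_vol (DIM('a)) * (diameter T / \<kappa>) ^ DIM('a) \<le> measure lebesgue T"
proof -
  obtain z R where R: "R > 0" "ball z R \<subseteq> T" "diameter T \<le> \<kappa> * R" using shape[OF assms] by blast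
  have "diameter T / \<kappa> \<le> R" using R(3) kappa by (simp add: divide_le_eq mult.commute)
  then have "(diameter T / \<kappa>) ^ DIM('a) \<le> R ^ DIM('a)"
    using kappa diameter_pos[OF assms] by (intro power_mono) auto
  then have "unit_ball_vol (DIM('a)) * (diameter T / \<kappa>) ^ DIM('a) \<le> unit_ball_vol (DIM('a)) * R ^ DIM('a)"
    by (intro mult_left_mono) auto
  then show ?thesis using content_ge_ball[OF assms R(2)] R(1) by linarith
qed

lemma content_pos: "T \<in> \<T> \<Longrightarrow> measure lebesgue T > 0"
  using content_element_ge[of T] diameter_pos[of T] kappa
  by (smt (verit) divide_pos_pos mult_pos_pos unit_ball_vol_pos of_nat_0_le_iff zero_less_power)

text \<open>Every element of a star contains, near \<open>\<nu>\<close>, a ball of comparable size; the size of the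
  elements plays no role.\<close>

lemma card_star_le: "card (star \<nu>) \<le> star_bound \<kappa> DIM('a)"
proof (cases "star \<nu> = {}")
  case False
  define s where "s = Min (diameter ` star \<nu>)"
  have s: "s > 0" unfolding s_def using False finite_star star_subset diameter_pos
    by (subst Min_gr_iff) auto
  have s_le: "s \<le> diameter T" if "T \<in> star \<nu>" for T
    unfolding s_def using that finite_star by (intro Min_le) auto
  have ball: "\<exists>c. ball c (s / \<kappa>) \<subseteq> interior T \<inter> ball \<nu> (2 * s)" if T: "T \<in> star \<nu>" for T
  proof -
    have T': "T \<in> \<T>" "\<nu> \<in> T" using T by (auto simp: star_def)
    obtain z R where R: "R > 0" "ball z R \<subseteq> T" "diameter T \<le> \<kappa> * R" using shape T' by blast
    \<comment> \<open>The contraction with centre \<open>\<nu>\<close> by this factor brings every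
      element of the star to the smallest diameter \<open>s\<close>; by convexity the image remains
      in the element, and so does the image of the inscribed ball.\<close>
    define \<theta> where "\<theta> = s / diameter T"
    have \<theta>: "\<theta> > 0" "\<theta> \<le> 1" using s s_le[OF T] diameter_pos[OF T'(1)] by (auto simp: \<theta>_def)
    define c where "c = \<nu> + \<theta> *\<^sub>R (z - \<nu>)"
    have "s / \<kappa> \<le> \<theta> * R"
      using R(3) s kappa diameter_pos[OF T'(1)] by (simp add: \<theta>_def field_simps)
    have inT: "ball c (s / \<kappa>) \<subseteq> T"
    proof
      fix y assume y: "y \<in> ball c (s / \<kappa>)"
      define w where "w = \<nu> + (1 / \<theta>) *\<^sub>R (y - \<nu>)"
      have "z - w = (1 / \<theta>) *\<^sub>R (c - y)" using \<theta> by (simp add: w_def c_def algebra_simps)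
      then have "dist z w = dist c y / \<theta>" using \<theta> by (simp add: dist_norm)
      also have "\<dots> < R" using y \<open>s / \<kappa> \<le> \<theta> * R\<close> \<theta> by (simp add: divide_less_eq mult.commute)
      finally have "w \<in> T" using R(2) by auto
      moreover have "y = (1 - \<theta>) *\<^sub>R \<nu> + \<theta> *\<^sub>R w" using \<theta> by (simp add: w_def algebra_simps)
      ultimately show "y \<in> T"
        using convexD_alt[OF full_simplex.convex_T[OF full[OF T'(1)]] T'(2), of w \<theta>] \<theta> by simp
    qed
    have "z \<in> T" using R by auto
    then have "dist z \<nu> \<le> diameter T" using dist_le_diameter T' by blast
    then have "\<theta> * dist z \<nu> \<le> \<theta> * diameter T" using \<theta> by (intro mult_left_mono) auto
    moreover have "dist \<nu> c = norm (\<theta> *\<^sub>R (z - \<nu>))" by (simp only: c_def dist_norm norm_minus_commute[of \<nu>] add_diff_cancel_left')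
    moreover have "\<theta> * diameter T = s" using diameter_pos[OF T'(1)] by (simp add: \<theta>_def)
    ultimately have "dist \<nu> c \<le> s" using \<theta> by (simp add: dist_norm)
    moreover have "s / \<kappa> \<le> s" using kappa s by (simp add: divide_le_eq)
    ultimately have "ball c (s / \<kappa>) \<subseteq> ball \<nu> (2 * s)"
    proof (intro subsetI)
      fix x assume "x \<in> ball c (s / \<kappa>)"
      then have "dist c x < s / \<kappa>" by simp
      then have "dist \<nu> x < 2 * s"
        using dist_triangle[of \<nu> x c] \<open>dist \<nu> c \<le> s\<close> \<open>s / \<kappa> \<le> s\<close> by linarith
      then show "x \<in> ball \<nu> (2 * s)" by simp
    qed
    then show ?thesis using inT interior_maximal[OF inT] by blast
  qed
  then obtain c where c: "\<And>T. T \<in> star \<nu> \<Longrightarrow> ball (c T) (s / \<kappa>) \<subseteq> interior T \<inter> ball \<nu> (2 * s)"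
    by metis
  have sk: "s / \<kappa> > 0" using s kappa by simp
  let ?d = "DIM('a)" and ?V = "unit_ball_vol (DIM('a))"
  have "measure lebesgue (\<Union>T\<in>star \<nu>. ball (c T) (s / \<kappa>)) = (\<Sum>T\<in>star \<nu>. measure lebesgue (ball (c T) (s / \<kappa>)))"
  proof (intro measure_finite_Union finite_star)
    show "disjoint_family_on (\<lambda>T. ball (c T) (s / \<kappa>)) (star \<nu>)"
      unfolding disjoint_family_on_def
    proof (intro ballI impI)
      fix T T' assume *: "T \<in> star \<nu>" "T' \<in> star \<nu>" "T \<noteq> T'"
      then have "interior T \<inter> T' = {}" using star_subset by (intro interior_disjoint) auto
      then show "ball (c T) (s / \<kappa>) \<inter> ball (c T') (s / \<kappa>) = {}"
        using c[OF *(1)] c[OF *(2)] interior_subset[of T'] by blast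
    qed
    show "emeasure lebesgue (ball (c T) (s / \<kappa>)) \<noteq> \<infinity>" for T
      using emeasure_lborel_ball_finite[of "c T" "s / \<kappa>"] by simp
  qed auto
  also have "\<dots> = real (card (star \<nu>)) * (?V * (s / \<kappa>) ^ ?d)"
    using sk by (simp add: content_ball)
  finally have eq: "measure lebesgue (\<Union>T\<in>star \<nu>. ball (c T) (s / \<kappa>)) = real (card (star \<nu>)) * (?V * (s / \<kappa>) ^ ?d)" .
  have "real (card (star \<nu>)) * (?V * (s / \<kappa>) ^ ?d) \<le> measure lebesgue (ball \<nu> (2 * s))"
    unfolding eq[symmetric]
  proof (rule measure_mono_fmeasurable)
    show "(\<Union>T\<in>star \<nu>. ball (c T) (s / \<kappa>)) \<subseteq> ball \<nu> (2 * s)" using c by blast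
    show "(\<Union>T\<in>star \<nu>. ball (c T) (s / \<kappa>)) \<in> sets lebesgue" using finite_star by (intro sets.finite_UN) auto
  qed auto
  also have "\<dots> = ?V * (2 * s) ^ ?d" using content_ball[of "2 * s" \<nu>] s by simp
  also have "\<dots> = (2 * \<kappa>) ^ ?d * (?V * (s / \<kappa>) ^ ?d)" using kappa by (simp add: power_mult_distrib power_divide)
  finally have "real (card (star \<nu>)) \<le> (2 * \<kappa>) ^ ?d"
    using sk by (simp add: mult_le_cancel_right)
  then show ?thesis unfolding star_bound_def by linarith
qed simp

text \<open>A reachability chain can be taken no longer than the number of pairs in the relation,
  and a star has at most this many pairs of elements.\<close>

definition "chain_bound = (star_bound \<kappa> DIM('a))\<^sup>2"

lemma chain_ex:
  assumes "T \<in> star \<nu>" "T' \<in> star \<nu>"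
  shows "\<exists>n\<le>chain_bound. (T, T') \<in> adjacent \<nu> ^^ n"
proof -
  have sub: "adjacent \<nu> \<subseteq> star \<nu> \<times> star \<nu>" by (auto simp: adjacent_def)
  then have fin: "finite (adjacent \<nu>)" using finite_star finite_subset by blast
  have "card (adjacent \<nu>) \<le> card (star \<nu> \<times> star \<nu>)" using sub finite_star by (intro card_mono) auto
  also have "\<dots> \<le> chain_bound" unfolding chain_bound_def power2_eq_square card_cartesian_product
    by (intro mult_le_mono card_star_le)
  finally have "card (adjacent \<nu>) \<le> chain_bound" .
  moreover have "(T, T') \<in> (\<Union>n\<in>{n. n \<le> card (adjacent \<nu>)}. adjacent \<nu> ^^ n)"
    using star_connected[OF assms] rtrancl_finite_eq_relpow[OF fin] by simp
  ultimately show ?thesis by (auto intro: le_trans)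
qed

text \<open>In dimension at least two the common facet contains an edge. Its length is at most the
  diameter of \<open>T2\<close>, and at least twice the radius of a ball inscribed in
  \<open>T1\<close>.\<close>

lemma diameter_adjacent_le:
  assumes "(T1, T2) \<in> adjacent \<nu>" "DIM('a) \<ge> 2"
  shows "diameter T1 \<le> \<kappa> * diameter T2"
proof -
  have T: "T1 \<in> \<T>" "T2 \<in> \<T>" "(T1 \<inter> T2) facet_of T1" using assms by (auto simp: adjacent_def star_def)
  interpret full_simplex T1 using full T by blast
  obtain v where v: "v \<in> verts T1" "T1 \<inter> T2 = convex hull (verts T1 - {v})" using facetD[OF T(3)] by metis
  have "card (verts T1 - {v}) \<ge> 2" using v(1) card_verts finite_verts assms(2) by simp
  then obtain w1 w2 where w: "w1 \<in> verts T1 - {v}" "w2 \<in> verts T1 - {v}" "w1 \<noteq> w2"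
    by (metis card_le_Suc0_iff_eq finite_Diff finite_verts not_less_eq_eq numeral_2_eq_2)
  have "w1 \<in> T1 \<inter> T2" "w2 \<in> T1 \<inter> T2" using w unfolding v(2) by (auto intro: hull_inc)
  then have d: "dist w1 w2 \<le> diameter T2" using dist_le_diameter T by blast
  obtain z R where R: "R > 0" "ball z R \<subseteq> T1" "diameter T1 \<le> \<kappa> * R" using shape T by blast
  have "2 * R \<le> dist w1 w2" using edge_length_ge[OF R(2,1)] w by auto
  then have "R \<le> diameter T2" using d R by linarith
  then have "\<kappa> * R \<le> \<kappa> * diameter T2" using kappa by (intro mult_left_mono) auto
  then show ?thesis using R by linarith
qed

lemma diameter_chain_le:
  assumes "DIM('a) \<ge> 2"
  shows "(T, T') \<in> adjacent \<nu> ^^ n \<Longrightarrow> diameter T \<le> \<kappa> ^ n * diameter T'"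
proof (induction n arbitrary: T')
  case (Suc n)
  then obtain T1 where T1: "(T, T1) \<in> adjacent \<nu> ^^ n" "(T1, T') \<in> adjacent \<nu>" by auto
  have "diameter T \<le> \<kappa> ^ n * diameter T1" using Suc.IH T1 by blast
  also have "\<dots> \<le> \<kappa> ^ n * (\<kappa> * diameter T')"
    using diameter_adjacent_le[OF T1(2) assms] kappa by (intro mult_left_mono) auto
  finally show ?case by (simp add: mult_ac)
qed simp

lemma diameter_star_le:
  assumes "DIM('a) \<ge> 2" "T \<in> star \<nu>" "T' \<in> star \<nu>"
  shows "diameter T \<le> \<kappa> ^ chain_bound * diameter T'"
proof -
  obtain n where n: "n \<le> chain_bound" "(T, T') \<in> adjacent \<nu> ^^ n" using chain_ex assms by blast
  have "diameter T \<le> \<kappa> ^ n * diameter T'" using diameter_chain_le[OF assms(1) n(2)] .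
  also have "\<dots> \<le> \<kappa> ^ chain_bound * diameter T'"
    using kappa n(1) diameter_pos[of T'] assms(3) star_subset
    by (intro mult_right_mono power_increasing) (auto intro: less_imp_le)
  finally show ?thesis .
qed

lemma verts_transfer:
  assumes "T \<in> \<T>" "T' \<in> \<T>" "\<nu> \<in> verts T" "\<nu> \<in> T'"
  shows "\<nu> \<in> verts T'"
proof -
  have "\<nu> \<in> T" using assms(1,3) full full_simplex.verts_subset by blast
  then have "\<nu> extreme_point_of (T \<inter> T')"
    using assms extreme_point_of_face[OF face_Int[OF assms(1,2)]] by (simp add: verts_def)
  then show ?thesis
    using extreme_point_of_face[OF face_Int[OF assms(2,1)]] by (simp add: verts_def Int_commute)
qed

text \<open>A nonempty compact convex set has an extreme point, and extreme points of a face are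
  vertices of the element. A patch is thereby covered by the stars of the vertices.\<close>

lemma common_vertex:
  assumes "T \<in> \<T>" "T' \<in> \<T>" "T \<inter> T' \<noteq> {}"
  shows "\<exists>\<nu>\<in>verts T. \<nu> \<in> T'"
proof -
  have c: "compact (T \<inter> T')" "convex (T \<inter> T')"
    using full_simplex.compact_T[OF full[OF assms(1)]] full_simplex.compact_T[OF full[OF assms(2)]]
      full_simplex.convex_T[OF full[OF assms(1)]] full_simplex.convex_T[OF full[OF assms(2)]]
    by (simp_all add: compact_Int convex_Int)
  have "{x. x extreme_point_of (T \<inter> T')} \<noteq> {}"
  proof
    assume "{x. x extreme_point_of (T \<inter> T')} = {}"
    then have "T \<inter> T' = {}" using Krein_Milman_Minkowski[OF c] by simp
    then show False using assms by simp
  qed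
  then obtain \<nu> where "\<nu> extreme_point_of (T \<inter> T')" by auto
  then show ?thesis
    using extreme_point_of_face[OF face_Int[OF assms(1,2)]] by (auto simp: verts_def)
qed

definition "patch T = {T' \<in> \<T>. T \<inter> T' \<noteq> {}}"

lemma element_patch_eq: "element_patch \<T> T = \<Union>(patch T)"
  by (simp add: element_patch_def patch_def)

lemma patch_subset_stars:
  assumes "T \<in> \<T>"
  shows "patch T \<subseteq> (\<Union>\<nu>\<in>verts T. star \<nu>)"
  using common_vertex[OF assms] by (auto simp: patch_def star_def)

lemma star_subset_patch: "T \<in> \<T> \<Longrightarrow> \<nu> \<in> T \<Longrightarrow> star \<nu> \<subseteq> patch T"
  by (auto simp: patch_def star_def)

lemma finite_patch: "finite (patch T)" using finite_mesh by (simp add: patch_def)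

lemma diameter_patch_le:
  assumes "DIM('a) \<ge> 2" "T \<in> \<T>" "T' \<in> patch T"
  shows "diameter T \<le> \<kappa> ^ chain_bound * diameter T'" "diameter T' \<le> \<kappa> ^ chain_bound * diameter T"
proof -
  obtain \<nu> where "T' \<in> star \<nu>" "\<nu> \<in> verts T" using patch_subset_stars[OF assms(2)] assms(3) by blast
  moreover from this have "T \<in> star \<nu>" using assms(2) full full_simplex.verts_subset by (auto simp: star_def)
  ultimately show "diameter T \<le> \<kappa> ^ chain_bound * diameter T'" "diameter T' \<le> \<kappa> ^ chain_bound * diameter T"
    using diameter_star_le[OF assms(1)] by auto
qed

text \<open>The power of \<open>\<kappa>\<close> compares diameters within a star; the further
  factor passes from a ball around one element to a ball inside the other.\<close>

definition "volume_ratio = (\<kappa> * \<kappa> ^ chain_bound) ^ DIM('a)"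

lemma content_patch_le:
  assumes "DIM('a) \<ge> 2" "T \<in> \<T>" "T' \<in> patch T"
  shows "measure lebesgue T \<le> volume_ratio * measure lebesgue T'"
proof -
  let ?V = "unit_ball_vol (DIM('a))" and ?d = "DIM('a)"
  have T': "T' \<in> \<T>" using assms(3) by (simp add: patch_def)
  have "measure lebesgue T \<le> ?V * diameter T ^ ?d" by (rule content_element_le[OF assms(2)])
  also have "\<dots> \<le> ?V * (\<kappa> ^ chain_bound * diameter T') ^ ?d"
    using diameter_patch_le(1)[OF assms] diameter_pos[OF assms(2)]
    by (intro mult_left_mono power_mono) auto
  also have "\<dots> = volume_ratio * (?V * (diameter T' / \<kappa>) ^ ?d)"
    using kappa by (simp add: volume_ratio_def power_mult_distrib power_divide)
  also have "\<dots> \<le> volume_ratio * measure lebesgue T'"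
    using content_element_ge[OF T'] kappa by (intro mult_left_mono) (auto simp: volume_ratio_def)
  finally show ?thesis .
qed

end

section \<open>Surface measure\<close>

definition hyproj :: "'a::euclidean_space \<Rightarrow> real \<Rightarrow> 'a \<Rightarrow> 'a" where
  "hyproj n c x = x - (n \<bullet> x - c) *\<^sub>R n"

lemma hyproj_inner: "norm n = 1 \<Longrightarrow> n \<bullet> hyproj n c x = c"
  by (simp add: hyproj_def inner_diff_right norm_eq_1)

lemma dist_hyproj: "norm n = 1 \<Longrightarrow> dist x (hyproj n c x) = \<bar>n \<bullet> x - c\<bar>"
  by (simp add: hyproj_def dist_norm)

lemma continuous_hyproj [continuous_intros]: "continuous_on A (hyproj n c)"
  unfolding hyproj_def by (intro continuous_intros)

lemma measurable_hyproj [measurable]: "hyproj n c \<in> borel_measurable borel"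
  by (intro borel_measurable_continuous_onI continuous_hyproj)

lemma hyproj_translate: "norm n = 1 \<Longrightarrow> hyproj n c (x + s *\<^sub>R n) = hyproj n c x"
  by (simp add: hyproj_def inner_add_right norm_eq_1 algebra_simps)

lemma
  assumes n: "norm n = 1"
  shows closest_point_hyperplane: "closest_point {x. n \<bullet> x = c} x = hyproj n c x"
    and infdist_hyperplane: "infdist x {x. n \<bullet> x = c} = \<bar>n \<bullet> x - c\<bar>"
proof -
  have mem: "hyproj n c x \<in> {x. n \<bullet> x = c}" using hyproj_inner[OF n] by simp
  have "dist x (hyproj n c x) \<le> dist x z" if "n \<bullet> z = c" for z
  proof -
    have "\<bar>n \<bullet> x - c\<bar> = \<bar>n \<bullet> (x - z)\<bar>" using that by (simp add: inner_diff_right)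
    also have "\<dots> \<le> norm n * norm (x - z)" by (rule Cauchy_Schwarz_ineq2)
    finally show ?thesis using dist_hyproj[OF n] n by (simp add: dist_norm)
  qed
  then show cp: "closest_point {x. n \<bullet> x = c} x = hyproj n c x"
    using closest_point_unique[OF convex_hyperplane closed_hyperplane mem, of x] by simp
  have "infdist x {x. n \<bullet> x = c} = dist x (closest_point {x. n \<bullet> x = c} x)"
    unfolding infdist_eq_setdist using mem by (intro setdist_closest_point closed_hyperplane) blast
  then show "infdist x {x. n \<bullet> x = c} = \<bar>n \<bullet> x - c\<bar>" unfolding cp using dist_hyproj[OF n] by simp
qed

lemma hyperplanesE:
  assumes "H \<in> (hyperplanes :: 'a::euclidean_space set set)"
  obtains n c where "norm n = 1" "H = {x. n \<bullet> x = c}"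
proof -
  have "affine H" "aff_dim H = int DIM('a) - 1" using assms by (auto simp: hyperplanes_def)
  then obtain a b where ab: "a \<noteq> 0" "H = {x. a \<bullet> x = b}"
    using aff_dim_eq_hyperplane[of H] by (auto simp: hull_same)
  define n where "n = (1 / norm a) *\<^sub>R a"
  have "norm n = 1" using ab by (simp add: n_def)
  moreover have "H = {x. n \<bullet> x = b / norm a}" using ab by (auto simp: n_def field_simps)
  ultimately show ?thesis using that by blast
qed

lemma hyperplane_mem: "norm n = 1 \<Longrightarrow> {x. n \<bullet> x = c} \<in> hyperplanes"
  unfolding hyperplanes_def using aff_dim_hyperplane[of n c] affine_hyperplane[of n c]
  by (cases "n = 0") auto

lemma sets_hyperplane_measure [simp]: "sets (hyperplane_measure H) = sets borel"
  and space_hyperplane_measure [simp]: "space (hyperplane_measure H) = UNIV"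
  by (simp_all add: hyperplane_measure_def)

section \<open>Surface integrals as volume integrals over slabs\<close>

abbreviation slab :: "'a::euclidean_space \<Rightarrow> real \<Rightarrow> 'a set" where
  "slab n c \<equiv> {x. \<bar>n \<bullet> x - c\<bar> \<le> 1 / 2}"

lemma nn_integral_hyperplane_measure:
  assumes n: "norm n = 1" and f: "f \<in> borel_measurable borel"
  shows "(\<integral>\<^sup>+x. f x \<partial>hyperplane_measure {x. n \<bullet> x = c}) =
    (\<integral>\<^sup>+x. f (hyproj n c x) * indicator (slab n c) x \<partial>lborel)"
proof -
  have sl: "slab n c \<in> sets borel" by (intro borel_closed closed_Collect_le continuous_intros)
  have "hyperplane_measure {x. n \<bullet> x = c} = distr (restrict_space lborel (slab n c)) borel (hyproj n c)"
    unfolding hyperplane_measure_def using closest_point_hyperplane[OF n] infdist_hyperplane[OF n]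
    by (simp add: fun_eq_iff[symmetric] cong: distr_cong)
  also have "(\<integral>\<^sup>+x. f x \<partial>distr (restrict_space lborel (slab n c)) borel (hyproj n c)) =
      (\<integral>\<^sup>+x. f (hyproj n c x) \<partial>restrict_space lborel (slab n c))"
    using f by (intro nn_integral_distr measurable_restrict_space1) auto
  also have "\<dots> = (\<integral>\<^sup>+x. f (hyproj n c x) * indicator (slab n c) x \<partial>lborel)"
    using sl by (intro nn_integral_restrict_space) auto
  finally show ?thesis .
qed

lemma emeasure_hyperplane_measure':
  assumes n: "norm n = 1" and A: "A \<in> sets borel"
  shows "emeasure (hyperplane_measure {x. n \<bullet> x = c}) A =
    emeasure lborel {x \<in> slab n c. hyproj n c x \<in> A}"
  using emeasure_hyperplane_measure[OF hyperplane_mem[OF n] A, of c]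
    closest_point_hyperplane[OF n] infdist_hyperplane[OF n] by simp

lemma emeasure_hyperplane_measure_bounded:
  assumes n: "norm n = 1" and A: "A \<in> sets borel" "bounded A"
  shows "emeasure (hyperplane_measure {x. n \<bullet> x = c}) A < \<infinity>"
proof -
  obtain B where B: "\<And>x. x \<in> A \<Longrightarrow> norm x \<le> B" using A(2) by (auto simp: bounded_iff)
  have "{x \<in> slab n c. hyproj n c x \<in> A} \<subseteq> cball 0 (B + 1 / 2)"
  proof
    fix x assume x: "x \<in> {x \<in> slab n c. hyproj n c x \<in> A}"
    have "norm x \<le> norm (hyproj n c x) + dist x (hyproj n c x)"
      using norm_triangle_ineq[of "hyproj n c x" "x - hyproj n c x"] by (simp add: dist_norm)
    then show "x \<in> cball 0 (B + 1 / 2)" using x B[of "hyproj n c x"] dist_hyproj[OF n, of x c] by auto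
  qed
  then have "bounded {x \<in> slab n c. hyproj n c x \<in> A}" by (rule bounded_subset[OF bounded_cball])
  then show ?thesis unfolding emeasure_hyperplane_measure'[OF n A(1)] by (rule emeasure_bounded_finite)
qed

lemma negligible_hyproj_hyperplane:
  assumes n: "norm n = 1" and a: "a \<notin> range (\<lambda>t. t *\<^sub>R n)"
  shows "negligible {x. a \<bullet> hyproj n c x = b}"
proof -
  have "a - (a \<bullet> n) *\<^sub>R n \<noteq> 0" using a by auto
  moreover have "{x. a \<bullet> hyproj n c x = b} = {x. (a - (a \<bullet> n) *\<^sub>R n) \<bullet> x = b - c * (a \<bullet> n)}"
    by (auto simp: hyproj_def inner_diff_left inner_diff_right algebra_simps)
  ultimately show ?thesis using negligible_hyperplane by metis
qed

text \<open>If the normals are not parallel, the points that project into \<open>H'\<close> form a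
  hyperplane, a null set. If they are parallel, the projection onto \<open>H\<close> never meets
  \<open>H'\<close>.\<close>

lemma hyperplane_measure_other_hyperplane:
  assumes H: "H \<in> hyperplanes" "H' \<in> hyperplanes" "H \<noteq> H'"
  shows "emeasure (hyperplane_measure H) H' = 0"
proof -
  obtain n c where n: "norm n = 1" "H = {x. n \<bullet> x = c}" using hyperplanesE[OF H(1)] .
  obtain n' c' where n': "norm n' = 1" "H' = {x. n' \<bullet> x = c'}" using hyperplanesE[OF H(2)] .
  have b: "H' \<in> sets borel" unfolding n' by (intro borel_closed closed_hyperplane)
  have e: "emeasure (hyperplane_measure H) H' = emeasure lborel {x \<in> slab n c. hyproj n c x \<in> H'}"
    unfolding n(2) by (rule emeasure_hyperplane_measure'[OF n(1) b])
  have m: "{x \<in> slab n c. hyproj n c x \<in> H'} \<in> sets lborel"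
    using b by measurable
  have "negligible {x \<in> slab n c. hyproj n c x \<in> H'}"
  proof (cases "n' \<in> range (\<lambda>t. t *\<^sub>R n)")
    case False
    then have "negligible {x. n' \<bullet> hyproj n c x = c'}" by (rule negligible_hyproj_hyperplane[OF n(1)])
    then show ?thesis by (rule negligible_subset) (auto simp: n')
  next
    case True
    then obtain k where k: "n' = k *\<^sub>R n" by auto
    then have k0: "k \<noteq> 0" using n' by auto
    have "hyproj n c x \<notin> H'" for x
    proof
      assume "hyproj n c x \<in> H'"
      then have "k * c = c'" using hyproj_inner[OF n(1), of c x] by (simp add: n' k)
      then have "H' = H" unfolding n n' k using k0 by auto
      then show False using H(3) by simp
    qed
    then show ?thesis by simp
  qed
  then have "emeasure lebesgue {x \<in> slab n c. hyproj n c x \<in> H'} = 0"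
    using m by (simp add: negligible_iff_emeasure0 sets_completionI_sets)
  then show ?thesis using e m by simp
qed

lemma hyperplane_measure_le_surface:
  assumes "H \<in> hyperplanes" "A \<in> sets borel"
  shows "emeasure (hyperplane_measure H) A \<le> emeasure surface_measure A"
proof -
  have "emeasure (hyperplane_measure H) A = (\<integral>\<^sup>+H'. emeasure (hyperplane_measure H') A * indicator {H} H' \<partial>count_space hyperplanes)"
    using assms(1) by (subst nn_integral_indicator_singleton) auto
  also have "\<dots> \<le> (\<integral>\<^sup>+H'. emeasure (hyperplane_measure H') A \<partial>count_space hyperplanes)"
    by (intro nn_integral_mono) (auto simp: indicator_def)
  finally show ?thesis unfolding emeasure_surface_measure[OF assms(2)] .
qed

lemma space_surface_measure [simp]: "space surface_measure = UNIV"
  by (simp add: surface_measure_def)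

text \<open>Any hyperplane outside \<open>\<H>\<close> sees \<open>A\<close> as a null set, so the
  sum over all hyperplanes reduces to a finite one.\<close>

lemma surface_measure_finite:
  assumes fin: "finite \<H>" "\<H> \<subseteq> hyperplanes" and A: "A \<in> sets borel" "bounded A" "A \<subseteq> \<Union>\<H>"
  shows "emeasure surface_measure A < \<infinity>"
proof -
  have "emeasure (hyperplane_measure H) A = 0" if H: "H \<in> hyperplanes" "H \<notin> \<H>" for H
  proof -
    have b: "H' \<in> sets borel" if "H' \<in> \<H>" for H'
      using that fin(2) by (auto elim!: hyperplanesE intro!: borel_closed closed_hyperplane)
    have "emeasure (hyperplane_measure H) A \<le> emeasure (hyperplane_measure H) (\<Union>H'\<in>\<H>. H')"
      using A fin(1) b by (intro emeasure_mono) auto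
    also have "\<dots> \<le> (\<Sum>H'\<in>\<H>. emeasure (hyperplane_measure H) H')"
      using fin(1) b by (intro emeasure_subadditive_finite) auto
    also have "\<dots> = 0" using H fin(2) hyperplane_measure_other_hyperplane
      by (intro sum.neutral) auto
    finally show ?thesis by simp
  qed
  then have "emeasure surface_measure A = (\<Sum>H\<in>\<H>. emeasure (hyperplane_measure H) A)"
    unfolding emeasure_surface_measure[OF A(1)] by (intro nn_integral_count_space' fin) auto
  also have "\<dots> < \<infinity>"
  proof -
    have "emeasure (hyperplane_measure H) A < \<infinity>" if "H \<in> \<H>" for H
    proof -
      have "H \<in> hyperplanes" using that fin(2) by blast
      then obtain n c where n: "norm n = 1" "H = {x. n \<bullet> x = c}" by (rule hyperplanesE)
      show ?thesis unfolding n(2) by (rule emeasure_hyperplane_measure_bounded[OF n(1) A(1,2)])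
    qed
    then show ?thesis using fin(1) by (auto simp: less_top[symmetric])
  qed
  finally show ?thesis .
qed

text \<open>Scaling of a slab by translation only: \<open>m\<close> translates of a slab of width \<open>1 / m\<close> make up
  one of width \<open>1\<close>.\<close>

lemma nn_integral_slab_translate:
  fixes h :: "'a::euclidean_space \<Rightarrow> ennreal"
  assumes n: "norm n = 1" and h: "h \<in> borel_measurable borel"
  shows "(\<integral>\<^sup>+x. h (hyproj n c x) * indicator {x. a + s < n \<bullet> x - c \<and> n \<bullet> x - c \<le> b + s} x \<partial>lborel) =
    (\<integral>\<^sup>+x. h (hyproj n c x) * indicator {x. a < n \<bullet> x - c \<and> n \<bullet> x - c \<le> b} x \<partial>lborel)"
proof -
  let ?f = "\<lambda>x. h (hyproj n c x) * indicator {x. a + s < n \<bullet> x - c \<and> n \<bullet> x - c \<le> b + s} x"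
  have m: "?f \<in> borel_measurable borel" using h by measurable
  have "(\<integral>\<^sup>+x. ?f x \<partial>lborel) = (\<integral>\<^sup>+x. ?f x \<partial>distr lborel borel ((+) (s *\<^sub>R n)))"
    by (simp add: lborel_distr_plus)
  also have "\<dots> = (\<integral>\<^sup>+x. ?f (s *\<^sub>R n + x) \<partial>lborel)"
    using m by (intro nn_integral_distr) auto
  also have "\<dots> = (\<integral>\<^sup>+x. h (hyproj n c x) * indicator {x. a < n \<bullet> x - c \<and> n \<bullet> x - c \<le> b} x \<partial>lborel)"
    using n by (intro nn_integral_cong arg_cong2[where f = "(*)"])
      (auto simp: hyproj_translate add.commute[of "s *\<^sub>R n"] inner_add_right norm_eq_1 indicator_def)
  finally show ?thesis .
qed

lemma nn_integral_thin_slab: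
  fixes h :: "'a::euclidean_space \<Rightarrow> ennreal"
  assumes n: "norm n = 1" and h: "h \<in> borel_measurable borel" and m: "m > 0"
  shows "of_nat m * (\<integral>\<^sup>+x. h (hyproj n c x) * indicator {x. 0 < n \<bullet> x - c \<and> n \<bullet> x - c \<le> 1 / real m} x \<partial>lborel)
    \<le> (\<integral>\<^sup>+x. h (hyproj n c x) * indicator (slab n c) x \<partial>lborel)"
proof -
  define J where "J a b = (\<integral>\<^sup>+x. h (hyproj n c x) * indicator {x. a < n \<bullet> x - c \<and> n \<bullet> x - c \<le> b} x \<partial>lborel)" for a b
  have add: "J a b + J b d = J a d" if "a \<le> b" "b \<le> d" for a b d
    unfolding J_def using that h
    by (subst nn_integral_add[symmetric]) (auto intro!: nn_integral_cong simp: indicator_def)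
  have tr: "J (a + s) (b + s) = J a b" for a b s
    unfolding J_def by (rule nn_integral_slab_translate[OF n h])
  have mult: "J 0 (real k / real m) = of_nat k * J 0 (1 / real m)" for k
  proof (induction k)
    case 0
    have "{x. 0 < n \<bullet> x - c \<and> n \<bullet> x - c \<le> 0} = {}" by auto
    then show ?case by (simp add: J_def)
  next
    case (Suc k)
    have "J 0 (real (Suc k) / real m) = J 0 (real k / real m) + J (real k / real m) (real (Suc k) / real m)"
      by (rule add[symmetric]) (auto intro: divide_right_mono)
    also have "J (real k / real m) (real (Suc k) / real m) = J (0 + real k / real m) (1 / real m + real k / real m)"
      by (simp add: add_divide_distrib)
    also have "\<dots> = J 0 (1 / real m)" by (rule tr)
    finally show ?case using Suc by (simp add: distrib_right add.commute)
  qed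
  have "of_nat m * J 0 (1 / real m) = J 0 1" using mult[of m] m by simp
  \<comment> \<open>A further shift by one half carries the layer above the hyperplane into the
    symmetric slab of the definition.\<close>
  also have "\<dots> = J (- 1 / 2 + 1 / 2) (1 / 2 + 1 / 2)" by simp
  also have "\<dots> = J (- 1 / 2) (1 / 2)" by (rule tr)
  also have "\<dots> \<le> (\<integral>\<^sup>+x. h (hyproj n c x) * indicator (slab n c) x \<partial>lborel)"
    unfolding J_def by (intro nn_integral_mono mult_left_mono) (auto simp: indicator_def abs_if)
  finally show ?thesis unfolding J_def .
qed

section \<open>Zero traces on simplices\<close>

lemma integrable_bounded_support:
  fixes f :: "'a::euclidean_space \<Rightarrow> real"
  assumes "f \<in> borel_measurable borel" "\<And>x. \<bar>f x\<bar> \<le> C * indicator (cball 0 \<rho>) x"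
  shows "integrable lborel f"
proof (rule Bochner_Integration.integrable_bound)
  have "cball 0 \<rho> \<in> sets (lborel :: 'a measure)" by simp
  moreover have "emeasure lborel (cball (0::'a) \<rho>) < \<infinity>" by (rule emeasure_lborel_cball_finite)
  ultimately show "integrable lborel (\<lambda>x::'a. C * indicator (cball 0 \<rho>) x)"
    by (intro integrable_mult_right) auto
  show "AE x in lborel. norm (f x) \<le> norm (C * indicator (cball 0 \<rho>) x)"
    using assms(2) by (intro AE_I2) (metis abs_ge_self order_trans real_norm_def)
qed (use assms(1) in simp)

lemma GDERIV_line_derivative:
  assumes "GDERIV w (x + t *\<^sub>R e) :> D"
  shows "((\<lambda>t. w (x + t *\<^sub>R e)) has_real_derivative D \<bullet> e) (at t)"
proof -
  have "(w has_derivative (\<lambda>h. h \<bullet> D)) (at (x + t *\<^sub>R e))" using assms by (simp add: gderiv_def)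
  moreover have "((\<lambda>t. x + t *\<^sub>R e) has_derivative (\<lambda>s. s *\<^sub>R e)) (at t)"
    by (auto intro!: derivative_eq_intros)
  ultimately have "((\<lambda>t. w (x + t *\<^sub>R e)) has_derivative (\<lambda>s. (s *\<^sub>R e) \<bullet> D)) (at t)"
    using has_derivative_compose[of "\<lambda>t. x + t *\<^sub>R e" "\<lambda>s. s *\<^sub>R e" t UNIV w "\<lambda>h. h \<bullet> D"] by (simp add: has_derivative_at_withinI)
  then show ?thesis unfolding has_field_derivative_def
    by (rule has_derivative_eq_rhs) (auto simp: inner_commute)
qed

section \<open>Faces of a simplex and a one-sided divergence theorem\<close>

context full_simplex begin

text \<open>The outward unit normal of the face opposite to \<open>v\<close>; the sign makes the
  signed distance positive on the far side of that face.\<close>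

definition "face_normal v = - (1 / norm (bary_grad T v)) *\<^sub>R bary_grad T v"
definition "face_offset v = (1 - bary_grad T v \<bullet> v) / norm (bary_grad T v)"
definition "face v = {x \<in> T. bary T v x = 0}"
definition "face_measure v = hyperplane_measure {x. bary T v x = 0}"

lemma norm_face_normal: "v \<in> verts T \<Longrightarrow> norm (face_normal v) = 1"
  using bary_grad_ne by (simp add: face_normal_def)

lemma face_signed_distance:
  "v \<in> verts T \<Longrightarrow> face_normal v \<bullet> x - face_offset v = - bary T v x / norm (bary_grad T v)"
  using bary_grad_ne[of v] by (simp add: face_normal_def face_offset_def bary_alt field_simps)

lemma face_hyperplane: "v \<in> verts T \<Longrightarrow> {x. bary T v x = 0} = {x. face_normal v \<bullet> x = face_offset v}"
  using face_signed_distance[of v] bary_grad_ne[of v] by (force simp: eq_iff_diff_eq_0[of _ "face_offset v"])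

lemma compact_face: "compact (face v)"
proof -
  have "face v = T \<inter> {x. bary T v x = 0}" by (auto simp: face_def)
  moreover have "closed {x. bary T v x = 0}" by (intro closed_Collect_eq continuous_intros)
  ultimately show ?thesis using compact_T by (simp add: compact_Int_closed)
qed

lemma face_ne:
  assumes "v \<in> verts T"
  shows "face v \<noteq> {}"
proof -
  obtain w where "w \<in> verts T" "w \<noteq> v" using exists_other_vertex by blast
  then show ?thesis using bary_vert[OF assms, of w] verts_subset by (auto simp: face_def)
qed

lemma sets_face [measurable]: "face v \<in> sets borel"
  using compact_face borel_compact by blast

lemma T_borel [measurable]: "T \<in> sets borel" using compact_T borel_compact by blast

lemma bary_measurable [measurable]: "bary T v \<in> borel_measurable borel"
  by (intro borel_measurable_continuous_onI continuous_bary)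

lemma sets_face_measure [simp]: "sets (face_measure v) = sets borel"
  and space_face_measure [simp]: "space (face_measure v) = UNIV"
  by (simp_all add: face_measure_def)

lemma face_integral:
  fixes h :: "'a \<Rightarrow> real"
  assumes v: "v \<in> verts T" and h: "h \<in> borel_measurable borel" "\<And>x. h x \<ge> 0"
    and C: "\<And>x. x \<in> face v \<Longrightarrow> h x \<le> C"
  defines "n \<equiv> face_normal v" and "c \<equiv> face_offset v"
  shows "integrable (face_measure v) (\<lambda>x. indicator (face v) x * h x)"
    and "(LINT x|lborel. indicator (slab n c) x * (indicator (face v) (hyproj n c x) * h (hyproj n c x))) =
      (LINT x|face_measure v. indicator (face v) x * h x)"
proof -
  note n = norm_face_normal[OF v, folded n_def]
  have m: "(\<lambda>x. indicator (face v) x * h x) \<in> borel_measurable borel"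
    by (intro borel_measurable_times borel_measurable_indicator sets_face h(1))
  have m': "(\<lambda>x. indicator (face v) x * h x) \<in> borel_measurable (face_measure v)"
    using m by (simp cong: measurable_cong_sets)
  have eq: "(\<integral>\<^sup>+x. ennreal (indicator (face v) x * h x) \<partial>face_measure v) =
     (\<integral>\<^sup>+x. ennreal (indicator (slab n c) x * (indicator (face v) (hyproj n c x) * h (hyproj n c x))) \<partial>lborel)"
    unfolding face_measure_def face_hyperplane[OF v] n_def[symmetric] c_def[symmetric]
    using m by (subst nn_integral_hyperplane_measure[OF n]) (auto intro!: nn_integral_cong simp: indicator_def)
  have "(\<integral>\<^sup>+x. ennreal (indicator (face v) x * h x) \<partial>face_measure v) \<le>
    (\<integral>\<^sup>+x. ennreal C * indicator (face v) x \<partial>face_measure v)"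
    using C by (intro nn_integral_mono) (auto simp: indicator_def ennreal_leI)
  also have "\<dots> = ennreal C * emeasure (face_measure v) (face v)" by (intro nn_integral_cmult_indicator) simp
  also have "\<dots> < \<infinity>"
    using emeasure_hyperplane_measure_bounded[OF n sets_face compact_imp_bounded[OF compact_face], of c v]
    unfolding face_measure_def face_hyperplane[OF v] n_def[symmetric] c_def[symmetric]
    by (simp add: ennreal_mult_less_top)
  finally show int: "integrable (face_measure v) (\<lambda>x. indicator (face v) x * h x)"
    using m' h by (intro integrableI_nonneg) auto
  show "(LINT x|lborel. indicator (slab n c) x * (indicator (face v) (hyproj n c x) * h (hyproj n c x))) =
      (LINT x|face_measure v. indicator (face v) x * h x)"
  proof -
    have sl: "slab n c \<in> sets borel" by (intro borel_closed closed_Collect_le continuous_intros)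
    have "(LINT x|lborel. indicator (slab n c) x * (indicator (face v) (hyproj n c x) * h (hyproj n c x))) =
      enn2real (\<integral>\<^sup>+x. ennreal (indicator (slab n c) x * (indicator (face v) (hyproj n c x) * h (hyproj n c x))) \<partial>lborel)"
      using m h sl by (intro integral_eq_nn_integral) (auto intro!: borel_measurable_times borel_measurable_indicator measurable_compose[OF measurable_hyproj])
    also have "\<dots> = (LINT x|face_measure v. indicator (face v) x * h x)"
      unfolding eq[symmetric] using m' h by (intro integral_eq_nn_integral[symmetric]) auto
    finally show ?thesis .
  qed
qed

text \<open>The difference quotient of the integral of \<open>f = bary T v1 * w\<close> in the direction \<open>v1 - v0\<close>
  is the integral of \<open>f\<close> over two thin layers: one over the face opposite \<open>v0\<close>, the other one at the
  face opposite \<open>v1\<close>, where \<open>f\<close> vanishes.\<close>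

lemma divergence_bound:
  fixes w :: "'a \<Rightarrow> real" and Dw :: "'a \<Rightarrow> 'a"
  assumes v: "v0 \<in> verts T" "v1 \<in> verts T" "v0 \<noteq> v1"
    and D: "\<And>x. GDERIV w x :> Dw x"
    and cont: "continuous_on UNIV (\<lambda>x. Dw x \<bullet> (v1 - v0))"
  shows "\<bar>LINT x|lborel. indicator T x * (w x + bary T v1 x * (Dw x \<bullet> (v1 - v0)))\<bar>
    \<le> (LINT x|face_measure v0. indicator (face v0) x * \<bar>w x\<bar>) / norm (bary_grad T v0)"
proof -
  define e where "e = v1 - v0"
  define n where "n = face_normal v0"
  define c where "c = face_offset v0"
  define g where "g = norm (bary_grad T v0)"
  define P where "P = hyproj n c"
  define f where "f x = bary T v1 x * w x" for x
  define Df where "Df x = w x + bary T v1 x * (Dw x \<bullet> e)" for x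
  \<comment> \<open>With these step sizes the layer beyond the face opposite to \<open>v0\<close>
    has normal thickness at most \<open>1 / Suc k\<close>, the form in which
    \<open>nn_integral_thin_slab\<close> applies.\<close>
  define t where "t k = g / real (Suc k)" for k
  have n: "norm n = 1" unfolding n_def by (rule norm_face_normal[OF v(1)])
  have sig: "n \<bullet> x - c = - bary T v0 x / g" for x
    unfolding n_def c_def g_def by (rule face_signed_distance[OF v(1)])
  have g: "g > 0" using bary_grad_ne[OF v(1)] by (simp add: g_def)
  have t: "0 < t k" "t k \<le> g" for k using g by (auto simp: t_def divide_le_eq mult_left_le)
  have t_lim: "t \<longlonglongrightarrow> 0" unfolding t_def
    using tendsto_mult_right_zero[OF LIMSEQ_inverse_real_of_nat, of g] by (simp add: divide_inverse)
  have g0e: "bary_grad T v0 \<bullet> e = - 1" unfolding e_def using bary_grad_eq[of v0 v1] v by simp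
  have g1e: "bary_grad T v1 \<bullet> e = 1" unfolding e_def
    using bary_grad_eq[of v1 v0] v by (simp add: inner_diff_right)
  have gie: "bary_grad T u \<bullet> e = 0" if "u \<in> verts T" "u \<noteq> v0" "u \<noteq> v1" for u
    using bary_diff[of u v1 v0] bary_vert[of u v1] bary_vert[of u v0] that v by (simp add: e_def)
  have shift: "bary T u (x - s *\<^sub>R e) = bary T u x - s * (bary_grad T u \<bullet> e)" for u x s
    using bary_diff[of u "x - s *\<^sub>R e" x] by (simp add: inner_diff_right)
  have ge: "1 \<le> g * norm e"
    using Cauchy_Schwarz_ineq2[of "bary_grad T v0" e] g0e by (simp add: g_def)
  have wcont: "continuous_on UNIV w"
    using D unfolding gderiv_def continuous_on_eq_continuous_at[OF open_UNIV]
    by (auto intro: has_derivative_continuous)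
  have fcont: "continuous_on UNIV f" unfolding f_def by (intro continuous_intros wcont)
  have Dfcont: "continuous_on UNIV Df" unfolding Df_def e_def
    by (intro continuous_on_add continuous_on_mult continuous_bary wcont cont)
  have [measurable]: "w \<in> borel_measurable borel" "f \<in> borel_measurable borel" "Df \<in> borel_measurable borel"
    using wcont fcont Dfcont by (auto intro: borel_measurable_continuous_onI)
  have line: "((\<lambda>s. f (x + s *\<^sub>R e)) has_real_derivative Df (x + s *\<^sub>R e)) (at s)" for x s
  proof -
    have b: "GDERIV (bary T v1) y :> bary_grad T v1" for y
      unfolding gderiv_def bary_alt by (auto intro!: derivative_eq_intros simp: inner_commute)
    have "GDERIV f y :> bary T v1 y *\<^sub>R Dw y + w y *\<^sub>R bary_grad T v1" for y
      unfolding f_def by (intro GDERIV_mult b D)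
    from GDERIV_line_derivative[OF this, where x = x and t = s and e = e] show ?thesis
      by (simp add: Df_def inner_add_left g1e add.commute)
  qed
  obtain R0 where R0: "\<And>x. x \<in> T \<Longrightarrow> norm x \<le> R0" using bounded_T by (auto simp: bounded_iff)
  define \<rho> where "\<rho> = R0 + g * norm e + 1"
  have te: "t k * norm e \<le> g * norm e" for k using t by (intro mult_right_mono) auto
  have in_ball: "x + s *\<^sub>R e \<in> cball 0 \<rho>" if "x \<in> T" "\<bar>s\<bar> \<le> g" for x s
  proof -
    have "norm (x + s *\<^sub>R e) \<le> norm x + \<bar>s\<bar> * norm e" using norm_triangle_ineq[of x "s *\<^sub>R e"] by simp
    moreover have "\<bar>s\<bar> * norm e \<le> g * norm e" using that by (intro mult_right_mono) auto
    ultimately show ?thesis using R0[OF that(1)] by (simp add: \<rho>_def)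
  qed
  obtain K where K: "\<And>x. x \<in> cball 0 \<rho> \<Longrightarrow> \<bar>Df x\<bar> \<le> K"
    using compact_imp_bounded[OF compact_continuous_image[OF continuous_on_subset[OF Dfcont] compact_cball]]
    by (auto simp: bounded_iff) (metis mem_cball_0 subset_UNIV)
  obtain K1 where K1: "\<And>x. x \<in> cball 0 (\<rho> + 1) \<Longrightarrow> \<bar>f x\<bar> \<le> K1"
    using compact_imp_bounded[OF compact_continuous_image[OF continuous_on_subset[OF fcont] compact_cball]]
    by (auto simp: bounded_iff) (metis mem_cball_0 subset_UNIV)
  obtain M where M: "\<And>x. x \<in> T \<Longrightarrow> \<bar>w x\<bar> \<le> M"
    using compact_imp_bounded[OF compact_continuous_image[OF continuous_on_subset[OF wcont] compact_T]]
    by (auto simp: bounded_iff)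
  obtain x0 where x0: "x0 \<in> T" using verts_ne verts_subset by blast
  have \<rho>0: "x0 \<in> cball 0 \<rho>" using in_ball[OF x0, of 0] g by simp
  have K0: "K \<ge> 0" using K[OF \<rho>0] by linarith
  have K10: "K1 \<ge> 0" using K1[of x0] \<rho>0 by simp
  have M0: "M \<ge> 0" using M[OF x0] by linarith
  have quot: "\<bar>f (x + t k *\<^sub>R e) - f x\<bar> \<le> K * t k" if x: "x \<in> T" for x k
  proof -
    have "\<exists>z. 0 < z \<and> z < t k \<and> f (x + t k *\<^sub>R e) - f (x + 0 *\<^sub>R e) = (t k - 0) * Df (x + z *\<^sub>R e)"
      using t[of k] line by (intro MVT2) auto
    then obtain z where z: "0 < z" "z < t k" "f (x + t k *\<^sub>R e) - f x = t k * Df (x + z *\<^sub>R e)" by auto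
    have "x + z *\<^sub>R e \<in> cball 0 \<rho>" using in_ball[OF x, of z] z t[of k] by auto
    then have "\<bar>Df (x + z *\<^sub>R e)\<bar> \<le> K" by (rule K)
    then show ?thesis using z(3) t[of k] by (simp add: abs_mult mult.commute mult_right_mono)
  qed
  define a where "a k = (LINT x|lborel. indicator T x * ((f (x + t k *\<^sub>R e) - f x) / t k))" for k
  have a_lim: "a \<longlonglongrightarrow> (LINT x|lborel. indicator T x * Df x)"
    unfolding a_def
  proof (rule integral_dominated_convergence)
    show "integrable lborel (\<lambda>x. K * indicator (cball 0 \<rho>) x)"
      by (rule integrable_bounded_support[where C = K and \<rho> = \<rho>]) (use K0 in \<open>auto simp: indicator_def\<close>)
    show "AE x in lborel. (\<lambda>k. indicator T x * ((f (x + t k *\<^sub>R e) - f x) / t k)) \<longlonglongrightarrow> indicator T x * Df x"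
    proof (intro AE_I2 tendsto_mult tendsto_const)
      fix x
      have "((\<lambda>s. (f (x + (0 + s) *\<^sub>R e) - f (x + 0 *\<^sub>R e)) / s) \<longlongrightarrow> Df (x + 0 *\<^sub>R e)) (at 0)"
        using line[of x 0] by (simp add: DERIV_def)
      then have "((\<lambda>s. (f (x + s *\<^sub>R e) - f x) / s) \<longlongrightarrow> Df x) (at 0)" by simp
      moreover have "filterlim t (at 0) sequentially"
        using t_lim t by (auto simp: filterlim_at intro!: always_eventually dest: less_imp_neq) (metis less_irrefl)
      ultimately show "(\<lambda>k. (f (x + t k *\<^sub>R e) - f x) / t k) \<longlonglongrightarrow> Df x" by (rule filterlim_compose)
    qed
    show "AE x in lborel. norm (indicator T x * ((f (x + t k *\<^sub>R e) - f x) / t k)) \<le> K * indicator (cball 0 \<rho>) x" for k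
    proof (intro AE_I2)
      fix x
      show "norm (indicator T x * ((f (x + t k *\<^sub>R e) - f x) / t k)) \<le> K * indicator (cball 0 \<rho>) x"
      proof (cases "x \<in> T")
        case True
        then have "x \<in> cball 0 \<rho>" using in_ball[of x 0] g by simp
        then show ?thesis using quot[OF True, of k] t[of k] True by (simp add: abs_divide divide_le_eq)
      qed (use K0 in simp)
    qed
  qed measurable
  \<comment> \<open>The translate of \<open>T\<close> gains \<open>A k\<close> and loses
    \<open>B k\<close>. Along \<open>e\<close> only the coordinates of \<open>v0\<close> and
    \<open>v1\<close> change, the first of them decreasing; so the gain lies beyond the face
    opposite to \<open>v0\<close> and the loss close to the face opposite to
    \<open>v1\<close>.\<close>
  define A where "A k = {x. x - t k *\<^sub>R e \<in> T \<and> x \<notin> T}" for k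
  define B where "B k = {x \<in> T. x - t k *\<^sub>R e \<notin> T}" for k
  have [measurable]: "A k \<in> sets borel" "B k \<in> sets borel" for k
    unfolding A_def B_def by measurable
  have A: "- t k \<le> bary T v0 x" "bary T v0 x < 0" if "x \<in> A k" for x k
  proof -
    have x: "x - t k *\<^sub>R e \<in> T" "x \<notin> T" using that by (auto simp: A_def)
    show "- t k \<le> bary T v0 x" using x(1) v(1) mem_iff_bary shift[of v0 x "t k"] g0e by force
    obtain u where u: "u \<in> verts T" "bary T u x < 0" using x(2) mem_iff_bary by force
    have "bary T u (x - t k *\<^sub>R e) \<ge> 0" using x(1) u(1) mem_iff_bary by blast
    then have "u = v0"
      using shift[of u x "t k"] u g1e gie[OF u(1)] t[of k] by (cases "u = v1"; cases "u = v0") auto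
    then show "bary T v0 x < 0" using u by simp
  qed
  have B: "0 \<le> bary T v1 x" "bary T v1 x < t k" if "x \<in> B k" for x k
  proof -
    have x: "x - t k *\<^sub>R e \<notin> T" "x \<in> T" using that by (auto simp: B_def)
    show "0 \<le> bary T v1 x" using x(2) v(2) mem_iff_bary by blast
    obtain u where u: "u \<in> verts T" "bary T u (x - t k *\<^sub>R e) < 0" using x(1) mem_iff_bary by force
    have "bary T u x \<ge> 0" using x(2) u(1) mem_iff_bary by blast
    then have "u = v1"
      using shift[of u x "t k"] u g0e gie[OF u(1)] t[of k] by (cases "u = v0"; cases "u = v1") auto
    then show "bary T v1 x < t k" using u shift[of v1 x "t k"] g1e by simp
  qed
  have A_ball: "x \<in> cball 0 \<rho>" if "x \<in> A k" for x k
    using in_ball[of "x - t k *\<^sub>R e" "t k"] that t[of k] by (auto simp: A_def)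
  have T_ball: "x \<in> cball 0 \<rho>" if "x \<in> T" for x using in_ball[OF that, of 0] g by simp
  have ball_sub: "x \<in> cball 0 (\<rho> + 1)" if "x \<in> cball 0 \<rho>" for x :: 'a using that by simp
  have iA: "integrable lborel (\<lambda>x. indicator (A k) x * \<bar>f x\<bar>)" for k
  proof (rule integrable_bounded_support[where C = K1 and \<rho> = \<rho>])
    show "\<bar>indicator (A k) x * \<bar>f x\<bar>\<bar> \<le> K1 * indicator (cball 0 \<rho>) x" for x
      using A_ball[of x k] K1[of x] K10 by (auto simp: indicator_def)
  qed measurable
  have iB: "integrable lborel (\<lambda>x. indicator (B k) x * \<bar>f x\<bar>)" for k
  proof (rule integrable_bounded_support[where C = K1 and \<rho> = \<rho>])
    show "\<bar>indicator (B k) x * \<bar>f x\<bar>\<bar> \<le> K1 * indicator (cball 0 \<rho>) x" for x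
      using T_ball[of x] K1[of x] K10 by (auto simp: indicator_def B_def)
  qed measurable
  define bA where "bA k = (LINT x|lborel. indicator (A k) x * \<bar>f x\<bar>)" for k
  define bB where "bB k = (LINT x|lborel. indicator (B k) x * \<bar>f x\<bar>)" for k
  have a_le: "\<bar>a k\<bar> \<le> (bA k + bB k) / t k" for k
  proof -
    have i1: "integrable lborel (\<lambda>x. indicator T x * f x)"
    proof (rule integrable_bounded_support[where C = K1 and \<rho> = \<rho>])
      show "\<bar>indicator T x * f x\<bar> \<le> K1 * indicator (cball 0 \<rho>) x" for x
        using T_ball[of x] K1[of x] K10 by (auto simp: indicator_def)
    qed measurable
    have i2: "integrable lborel (\<lambda>x. indicator T (x - t k *\<^sub>R e) * f x)"
    proof (rule integrable_bounded_support[where C = K1 and \<rho> = \<rho>])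
      show "\<bar>indicator T (x - t k *\<^sub>R e) * f x\<bar> \<le> K1 * indicator (cball 0 \<rho>) x" for x
        using in_ball[of "x - t k *\<^sub>R e" "t k"] t[of k] K1[of x] K10 by (auto simp: indicator_def)
    qed measurable
    have i3: "integrable lborel (\<lambda>x. indicator T x * f (x + t k *\<^sub>R e))"
    proof (rule integrable_bounded_support[where C = K1 and \<rho> = \<rho>])
      show "\<bar>indicator T x * f (x + t k *\<^sub>R e)\<bar> \<le> K1 * indicator (cball 0 \<rho>) x" for x
        using in_ball[of "x" "t k"] t[of k] K1[of "x + t k *\<^sub>R e"] K10 T_ball[of x] by (auto simp: indicator_def)
    qed measurable
    have "(LINT x|lborel. indicator T (x - t k *\<^sub>R e) * f x) =
        (LINT x|distr lborel borel ((+) (t k *\<^sub>R e)). indicator T (x - t k *\<^sub>R e) * f x)"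
      by (simp add: lborel_distr_plus)
    also have "\<dots> = (LINT x|lborel. indicator T (t k *\<^sub>R e + x - t k *\<^sub>R e) * f (t k *\<^sub>R e + x))"
      by (rule integral_distr) measurable
    finally have tr: "(LINT x|lborel. indicator T x * f (x + t k *\<^sub>R e)) = (LINT x|lborel. indicator T (x - t k *\<^sub>R e) * f x)"
      by (simp add: add.commute)
    have "a k * t k = (LINT x|lborel. indicator T x * ((f (x + t k *\<^sub>R e) - f x) / t k) * t k)"
      unfolding a_def by (rule integral_mult_left_zero[symmetric])
    also have "\<dots> = (LINT x|lborel. indicator T x * f (x + t k *\<^sub>R e) - indicator T x * f x)"
      using t(1)[of k] by (intro Bochner_Integration.integral_cong) (auto simp: right_diff_distrib)
    also have "\<dots> = (LINT x|lborel. indicator T (x - t k *\<^sub>R e) * f x - indicator T x * f x)"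
      using i1 i2 i3 tr by simp
    finally have ak: "a k * t k = (LINT x|lborel. indicator T (x - t k *\<^sub>R e) * f x - indicator T x * f x)" .
    have "\<bar>a k * t k\<bar> \<le> (LINT x|lborel. \<bar>indicator T (x - t k *\<^sub>R e) * f x - indicator T x * f x\<bar>)"
      unfolding ak by (rule integral_abs_bound)
    also have "\<dots> \<le> (LINT x|lborel. indicator (A k) x * \<bar>f x\<bar> + indicator (B k) x * \<bar>f x\<bar>)"
      using i1 i2 iA iB
      by (intro integral_mono Bochner_Integration.integrable_add Bochner_Integration.integrable_abs
          Bochner_Integration.integrable_diff) (auto simp: indicator_def A_def B_def)
    also have "\<dots> = bA k + bB k" unfolding bA_def bB_def using iA iB by simp
    finally show ?thesis using t[of k] by (simp add: abs_mult le_divide_eq)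
  qed
  \<comment> \<open>On \<open>B k\<close> the factor \<open>bary T v1\<close> is below
    \<open>t k\<close>, which cancels the denominator; the remaining integral runs over layers that
    shrink to a null set.\<close>
  have bB_lim: "(\<lambda>k. bB k / t k) \<longlonglongrightarrow> 0"
  proof -
    define q where "q k = (LINT x|lborel. indicator T x * indicator {..<t k} (bary T v1 x) :: real)" for k
    have "q \<longlonglongrightarrow> (LINT x|lborel. indicator T x * indicator {..0} (bary T v1 x))"
      unfolding q_def
    proof (rule integral_dominated_convergence)
      show "integrable lborel (\<lambda>x. indicator (cball 0 \<rho>) x :: real)"
        by (rule integrable_bounded_support[where C = 1 and \<rho> = \<rho>]) (auto intro!: borel_measurable_indicator)
      show "AE x in lborel. (\<lambda>k. indicator T x * indicator {..<t k} (bary T v1 x) :: real) \<longlonglongrightarrow>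
          indicator T x * indicator {..0} (bary T v1 x)"
      proof (intro AE_I2 tendsto_mult tendsto_const)
        fix x
        show "(\<lambda>k. indicator {..<t k} (bary T v1 x) :: real) \<longlonglongrightarrow> indicator {..0} (bary T v1 x)"
        proof (cases "bary T v1 x \<le> 0")
          case True
          have "indicator {..<t k} (bary T v1 x) = (1::real)" for k using t(1)[of k] True by auto
          then show ?thesis using True by simp
        next
          case False
          then have "eventually (\<lambda>k. t k < bary T v1 x) sequentially" using t_lim by (intro order_tendstoD) auto
          then show ?thesis using False by (intro tendsto_eventually) (auto elim!: eventually_mono)
        qed
      qed
      show "AE x in lborel. norm (indicator T x * indicator {..<t k} (bary T v1 x) :: real) \<le> indicator (cball 0 \<rho>) x" for k
        using T_ball by (intro AE_I2) (auto simp: indicator_def)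
    qed measurable
    also have "(LINT x|lborel. indicator T x * indicator {..0} (bary T v1 x) :: real) = 0"
    proof -
      have "negligible {x. bary_grad T v1 \<bullet> x = bary_grad T v1 \<bullet> v1 - 1}"
        using negligible_hyperplane bary_grad_ne[OF v(2)] by blast
      then have "AE x in lebesgue. x \<notin> {x. bary_grad T v1 \<bullet> x = bary_grad T v1 \<bullet> v1 - 1}"
        unfolding negligible_iff_null_sets by (rule AE_not_in)
      then have "AE x in lborel. x \<notin> {x. bary_grad T v1 \<bullet> x = bary_grad T v1 \<bullet> v1 - 1}"
        by (simp add: AE_completion_iff)
      then have "AE x in lborel. indicator T x * indicator {..0} (bary T v1 x) = (0::real)"
      proof eventually_elim
        case (elim x)
        then have "bary T v1 x \<noteq> 0" by (auto simp: bary_alt)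
        moreover have "x \<in> T \<Longrightarrow> bary T v1 x \<ge> 0" using mem_iff_bary v(2) by blast
        ultimately show ?case by (auto simp: indicator_def)
      qed
      then show ?thesis by (rule integral_eq_zero_AE)
    qed
    finally have "(\<lambda>k. M * q k) \<longlonglongrightarrow> M * 0" by (intro tendsto_intros)
    then have lim: "(\<lambda>k. M * q k) \<longlonglongrightarrow> 0" by simp
    have "bB k / t k \<le> M * q k" for k
    proof -
      have "bB k \<le> (LINT x|lborel. M * t k * (indicator T x * indicator {..<t k} (bary T v1 x)))"
        unfolding bB_def
      proof (rule integral_mono[OF iB])
        show "integrable lborel (\<lambda>x. M * t k * (indicator T x * indicator {..<t k} (bary T v1 x)))"
          by (intro integrable_mult_right integrable_bounded_support[where C = 1 and \<rho> = \<rho>])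
            (use T_ball in \<open>auto simp: indicator_def\<close>)
        fix x
        show "indicator (B k) x * \<bar>f x\<bar> \<le> M * t k * (indicator T x * indicator {..<t k} (bary T v1 x))"
        proof (cases "x \<in> B k")
          case True
          then have "x \<in> T" by (simp add: B_def)
          have "\<bar>f x\<bar> \<le> t k * M" unfolding f_def abs_mult
            using B[OF True] M[OF \<open>x \<in> T\<close>] by (intro mult_mono) auto
          then show ?thesis using True B[OF True] \<open>x \<in> T\<close> by (simp add: mult.commute)
        next
          case False
          then show ?thesis using M0 t[of k] by simp
        qed
      qed
      also have "\<dots> = M * t k * q k" unfolding q_def by simp
      finally show ?thesis using t[of k] by (simp add: divide_le_eq mult_ac)
    qed
    moreover have "0 \<le> bB k / t k" for k unfolding bB_def using t[of k] by (simp add: integral_nonneg)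
    ultimately show ?thesis using tendsto_sandwich[OF _ _ tendsto_const lim] by (auto intro: always_eventually)
  qed
  define I where "I \<eta> = (LINT x|face_measure v0. indicator (face v0) x * (\<bar>f x\<bar> + \<eta>))" for \<eta>
  have main: "\<bar>LINT x|lborel. indicator T x * Df x\<bar> \<le> I \<eta> / g" if \<eta>: "\<eta> > 0" for \<eta>
  proof -
    have "uniformly_continuous_on (cball 0 (\<rho> + 1)) f"
      by (intro compact_uniformly_continuous continuous_on_subset[OF fcont]) auto
    then obtain \<delta> where \<delta>: "\<delta> > 0" "\<And>x y. x \<in> cball 0 (\<rho> + 1) \<Longrightarrow> y \<in> cball 0 (\<rho> + 1) \<Longrightarrow> dist y x < \<delta> \<Longrightarrow> dist (f y) (f x) < \<eta>"
      using \<eta> unfolding uniformly_continuous_on_def by metis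
    \<comment> \<open>Projections of points of \<open>A k\<close> may miss the face, but only by
      this distance: one \<open>t k * norm e\<close> for the projection, one for sliding back along
      \<open>e\<close>. The sets shrink to the face, so the slab integrals of \<open>h k\<close>
      tend to the face integral, with \<open>\<eta>\<close> absorbing the change of \<open>f\<close>
      under projection.\<close>
    define S where "S k = {y. infdist y (face v0) \<le> 2 * t k * norm e}" for k
    define h where "h k y = indicator (S k) y * (\<bar>f y\<bar> + \<eta>)" for k y
    have Scl: "closed (S k)" for k unfolding S_def by (intro closed_Collect_le continuous_intros)
    then have [measurable]: "S k \<in> sets borel" for k by (rule borel_closed)
    have [measurable]: "h k \<in> borel_measurable borel" for k unfolding h_def by measurable
    have h0: "h k y \<ge> 0" for k y using \<eta> by (simp add: h_def)
    have slab_m: "slab n c \<in> sets borel" by (intro borel_closed closed_Collect_le continuous_intros)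
    have Pm [measurable]: "P \<in> borel_measurable borel" unfolding P_def by measurable
    have Sdec: "S k \<subseteq> S 0" for k
      unfolding S_def using t(2)[of k] te[of k] by (auto simp: t_def[of 0])
    have faceT: "face v0 \<subseteq> T" by (auto simp: face_def)
    have S0_ball: "norm y \<le> R0 + 2 * (g * norm e)" if "y \<in> S 0" for y
    proof -
      obtain z where z: "z \<in> face v0" "infdist y (face v0) = dist y z"
        using infdist_attains_inf[OF compact_imp_closed[OF compact_face] face_ne[OF v(1)]] by metis
      have "dist y z \<le> 2 * (g * norm e)" using that z by (simp add: S_def t_def)
      then have "norm y \<le> norm z + 2 * (g * norm e)"
        using norm_triangle_ineq[of z "y - z"] by (simp add: dist_norm)
      then show ?thesis using R0[of z] z faceT by force
    qed
    define \<rho>' where "\<rho>' = R0 + 2 * (g * norm e) + 1"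
    obtain K2 where K2: "\<And>x. x \<in> cball 0 \<rho>' \<Longrightarrow> \<bar>f x\<bar> \<le> K2"
      using compact_imp_bounded[OF compact_continuous_image[OF continuous_on_subset[OF fcont] compact_cball]]
      by (auto simp: bounded_iff) (metis mem_cball_0 subset_UNIV)
    have hb: "\<bar>indicator (slab n c) x * h k (P x)\<bar> \<le> (\<bar>K2\<bar> + \<eta>) * indicator (cball 0 \<rho>') x" for k x
    proof (cases "x \<in> slab n c \<and> P x \<in> S k")
      case True
      then have s: "norm (P x) \<le> R0 + 2 * (g * norm e)" using S0_ball Sdec by blast
      moreover have "norm x \<le> norm (P x) + dist x (P x)"
        using norm_triangle_ineq[of "P x" "x - P x"] by (simp add: dist_norm)
      moreover have "dist x (P x) \<le> 1 / 2" unfolding P_def dist_hyproj[OF n] using True by simp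
      ultimately have "x \<in> cball 0 \<rho>'" "P x \<in> cball 0 \<rho>'" by (auto simp: \<rho>'_def)
      then show ?thesis using K2[of "P x"] True \<eta> by (auto simp: h_def)
    next
      case False
      have "0 \<le> (\<bar>K2\<bar> + \<eta>) * indicator (cball 0 \<rho>') x" using \<eta> by simp
      then show ?thesis using False by (auto simp: h_def)
    qed
    have ih: "integrable lborel (\<lambda>x. indicator (slab n c) x * h k (P x))" for k
      using slab_m by (intro integrable_bounded_support[where C = "\<bar>K2\<bar> + \<eta>" and \<rho> = \<rho>'] hb) measurable
    define L where "L k = (LINT x|lborel. indicator (slab n c) x * h k (P x))" for k
    have L_lim: "L \<longlonglongrightarrow> I \<eta>"
    proof -
      have "L \<longlonglongrightarrow> (LINT x|lborel. indicator (slab n c) x * (indicator (face v0) (P x) * (\<bar>f (P x)\<bar> + \<eta>)))"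
        unfolding L_def
      proof (rule integral_dominated_convergence)
        show "integrable lborel (\<lambda>x. (\<bar>K2\<bar> + \<eta>) * indicator (cball 0 \<rho>') x)"
          by (rule integrable_bounded_support[where C = "\<bar>K2\<bar> + \<eta>" and \<rho> = \<rho>']) (use \<eta> in \<open>auto simp: indicator_def\<close>)
        show "AE x in lborel. norm (indicator (slab n c) x * h k (P x)) \<le> (\<bar>K2\<bar> + \<eta>) * indicator (cball 0 \<rho>') x" for k
          using hb by (intro AE_I2) simp
        show "AE x in lborel. (\<lambda>k. indicator (slab n c) x * h k (P x)) \<longlonglongrightarrow>
            indicator (slab n c) x * (indicator (face v0) (P x) * (\<bar>f (P x)\<bar> + \<eta>))"
          unfolding h_def
        proof (intro AE_I2 tendsto_mult tendsto_const)
          fix x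
          show "(\<lambda>k. indicator (S k) (P x) :: real) \<longlonglongrightarrow> indicator (face v0) (P x)"
          proof (cases "P x \<in> face v0")
            case True
            then have "P x \<in> S k" for k using t[of k] by (simp add: S_def)
            then show ?thesis using True by simp
          next
            case False
            then have "infdist (P x) (face v0) > 0"
              using infdist_pos_not_in_closed[OF compact_imp_closed[OF compact_face] face_ne[OF v(1)]] by blast
            moreover have "(\<lambda>k. 2 * t k * norm e) \<longlonglongrightarrow> 2 * 0 * norm e" by (intro tendsto_intros t_lim)
            ultimately have "eventually (\<lambda>k. 2 * t k * norm e < infdist (P x) (face v0)) sequentially"
              by (intro order_tendstoD) auto
            then show ?thesis using False by (intro tendsto_eventually) (auto elim!: eventually_mono simp: S_def)
          qed
        qed
      qed (use slab_m in measurable)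
      also have "(LINT x|lborel. indicator (slab n c) x * (indicator (face v0) (P x) * (\<bar>f (P x)\<bar> + \<eta>))) = I \<eta>"
        unfolding I_def P_def n_def c_def
      proof (rule face_integral(2)[OF v(1)])
        show "\<bar>f x\<bar> + \<eta> \<le> K1 + \<eta>" if "x \<in> face v0" for x
          using that faceT K1[of x] T_ball[of x] by force
      qed (use \<eta> in auto)
      finally show ?thesis .
    qed
    have key: "bA k / t k \<le> L k / g" if k: "1 / real (Suc k) < \<delta>" for k
    proof -
      have pw: "indicator (A k) x * \<bar>f x\<bar> \<le> h k (P x) * indicator {x. 0 < n \<bullet> x - c \<and> n \<bullet> x - c \<le> 1 / real (Suc k)} x" for x
      proof (cases "x \<in> A k")
        case True
        note A' = A[OF True]
        have s: "0 < n \<bullet> x - c" "n \<bullet> x - c \<le> 1 / real (Suc k)"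
          using A' g unfolding sig by (auto simp: t_def field_simps)
        have d: "dist x (P x) = n \<bullet> x - c" using dist_hyproj[OF n, of x c] s by (simp add: P_def)
        have xb: "x \<in> cball 0 \<rho>" by (rule A_ball[OF True])
        have "norm (P x) \<le> norm x + dist x (P x)" using norm_triangle_ineq[of x "P x - x"] by (simp add: dist_norm norm_minus_commute)
        moreover have "1 / real (Suc k) \<le> 1" by simp
        moreover have "norm x \<le> \<rho>" using xb by simp
        ultimately have "norm (P x) \<le> \<rho> + 1" using s(2) d by linarith
        then have "P x \<in> cball 0 (\<rho> + 1)" by simp
        then have "dist (f x) (f (P x)) < \<eta>" using \<delta>(2)[of "P x" x] ball_sub[OF xb] d s k by simp
        then have fx: "\<bar>f x\<bar> \<le> \<bar>f (P x)\<bar> + \<eta>" by (simp add: dist_real_def)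
        \<comment> \<open>The point at which sliding back along \<open>e\<close> reaches the face;
          there the coordinate of \<open>v0\<close> is zero and the other ones are still
          nonnegative.\<close>
        define y0 where "y0 = x - (- bary T v0 x) *\<^sub>R e"
        have y0_face: "y0 \<in> face v0"
        proof -
          have xT: "x - t k *\<^sub>R e \<in> T" using True by (simp add: A_def)
          have "bary T u y0 \<ge> 0" if u: "u \<in> verts T" for u
          proof -
            have b: "bary T u (x - t k *\<^sub>R e) \<ge> 0" using xT u mem_iff_bary by blast
            consider "u = v0" | "u = v1" | "u \<noteq> v0" "u \<noteq> v1" by blast
            then show ?thesis
            proof cases
              case 1
              then show ?thesis unfolding y0_def shift by (simp add: g0e)
            next
              case 2
              then show ?thesis using b A' unfolding y0_def shift by (simp add: g1e)
            next
              case 3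
              then show ?thesis using b unfolding y0_def shift by (simp add: gie[OF u])
            qed
          qed
          moreover have "bary T v0 y0 = 0" unfolding y0_def shift by (simp add: g0e)
          ultimately show ?thesis using mem_iff_bary by (simp add: face_def)
        qed
        have "dist x y0 = \<bar>bary T v0 x\<bar> * norm e" by (simp add: y0_def dist_norm)
        also have "\<dots> \<le> t k * norm e" using A' by (intro mult_right_mono) auto
        finally have "dist x y0 \<le> t k * norm e" .
        moreover have "n \<bullet> x - c \<le> t k * norm e"
        proof -
          have "1 / real (Suc k) * 1 \<le> 1 / real (Suc k) * (g * norm e)" using ge by (intro mult_left_mono) auto
          then show ?thesis using s by (simp add: t_def)
        qed
        ultimately have "dist (P x) y0 \<le> 2 * t k * norm e"
          using dist_triangle[of "P x" y0 x] d by (simp add: dist_commute)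
        then have "P x \<in> S k" using infdist_le[OF y0_face, of "P x"] by (simp add: S_def)
        then show ?thesis using fx s True by (simp add: h_def)
      next
        case False
        then show ?thesis using h0 by simp
      qed
      let ?J = "\<integral>\<^sup>+x. ennreal (h k (P x)) * indicator {x. 0 < n \<bullet> x - c \<and> n \<bullet> x - c \<le> 1 / real (Suc k)} x \<partial>lborel"
      have "ennreal (bA k) = (\<integral>\<^sup>+x. ennreal (indicator (A k) x * \<bar>f x\<bar>) \<partial>lborel)"
        unfolding bA_def by (intro nn_integral_eq_integral[symmetric] iA) auto
      also have "\<dots> \<le> ?J"
      proof (intro nn_integral_mono)
        fix x
        let ?s = "{x. 0 < n \<bullet> x - c \<and> n \<bullet> x - c \<le> 1 / real (Suc k)}"
        have "ennreal (indicator (A k) x * \<bar>f x\<bar>) \<le> ennreal (h k (P x) * indicator ?s x)"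
          by (intro ennreal_leI pw)
        also have "\<dots> = ennreal (h k (P x)) * indicator ?s x" by (simp add: indicator_def)
        finally show "ennreal (indicator (A k) x * \<bar>f x\<bar>) \<le> ennreal (h k (P x)) * indicator ?s x" .
      qed
      finally have 1: "ennreal (bA k) \<le> ?J" .
      have "ennreal (real (Suc k) * bA k) = of_nat (Suc k) * ennreal (bA k)"
        by (simp add: ennreal_mult' ennreal_of_nat_eq_real_of_nat)
      also have "\<dots> \<le> of_nat (Suc k) * ?J" using 1 by (intro mult_left_mono) auto
      also have "\<dots> \<le> (\<integral>\<^sup>+x. ennreal (h k (P x)) * indicator (slab n c) x \<partial>lborel)"
        unfolding P_def by (rule nn_integral_thin_slab[OF n]) auto
      also have "\<dots> = (\<integral>\<^sup>+x. ennreal (indicator (slab n c) x * h k (P x)) \<partial>lborel)"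
        by (intro nn_integral_cong) (auto simp: indicator_def)
      also have "\<dots> = ennreal (L k)"
        unfolding L_def using h0 by (intro nn_integral_eq_integral ih) auto
      finally have "real (Suc k) * bA k \<le> L k"
        using h0 by (subst (asm) ennreal_le_iff) (auto simp: L_def intro!: integral_nonneg)
      then have "real (Suc k) * bA k / g \<le> L k / g" using g by (intro divide_right_mono) auto
      then show ?thesis by (simp add: t_def mult.commute)
    qed
    have ev: "eventually (\<lambda>k. \<bar>a k\<bar> \<le> L k / g + bB k / t k) sequentially"
    proof -
      have "eventually (\<lambda>k. inverse (real (Suc k)) < \<delta>) sequentially"
        using LIMSEQ_inverse_real_of_nat \<delta>(1) by (intro order_tendstoD)
      then show ?thesis
      proof eventually_elim
        case (elim k)
        then have "bA k / t k \<le> L k / g" by (intro key) (simp add: inverse_eq_divide)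
        then show ?case using a_le[of k] by (simp add: add_divide_distrib)
      qed
    qed
    have l1: "(\<lambda>k. \<bar>a k\<bar>) \<longlonglongrightarrow> \<bar>LINT x|lborel. indicator T x * Df x\<bar>" by (intro tendsto_rabs a_lim)
    have l2: "(\<lambda>k. L k / g + bB k / t k) \<longlonglongrightarrow> I \<eta> / g + 0"
      by (intro tendsto_add tendsto_divide L_lim tendsto_const bB_lim) (use g in auto)
    show ?thesis using tendsto_le[OF _ l2 l1 ev] by simp
  qed
  have If: "integrable (face_measure v0) (\<lambda>x. indicator (face v0) x * \<bar>f x\<bar>)"
    and Iw: "integrable (face_measure v0) (\<lambda>x. indicator (face v0) x * \<bar>w x\<bar>)"
    and I1: "integrable (face_measure v0) (\<lambda>x. indicator (face v0) x * (1::real))"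
  proof -
    show "integrable (face_measure v0) (\<lambda>x. indicator (face v0) x * \<bar>f x\<bar>)"
    proof (rule face_integral(1)[OF v(1)])
      show "\<bar>f x\<bar> \<le> K1" if "x \<in> face v0" for x using that K1[of x] T_ball[of x] by (force simp: face_def)
    qed auto
    show "integrable (face_measure v0) (\<lambda>x. indicator (face v0) x * \<bar>w x\<bar>)"
    proof (rule face_integral(1)[OF v(1)])
      show "\<bar>w x\<bar> \<le> M" if "x \<in> face v0" for x using that M[of x] by (force simp: face_def)
    qed auto
    show "integrable (face_measure v0) (\<lambda>x. indicator (face v0) x * (1::real))"
      by (rule face_integral(1)[OF v(1), where C = 1]) auto
  qed
  define m0 where "m0 = (LINT x|face_measure v0. indicator (face v0) x * (1::real))"
  have I_eq: "I \<eta> = I 0 + \<eta> * m0" for \<eta>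
  proof -
    have "I \<eta> = (LINT x|face_measure v0. indicator (face v0) x * \<bar>f x\<bar> + \<eta> * (indicator (face v0) x * (1::real)))"
      unfolding I_def by (intro Bochner_Integration.integral_cong) (auto simp: algebra_simps)
    then show ?thesis unfolding I_def m0_def using If I1 by simp
  qed
  \<comment> \<open>The auxiliary \<open>\<eta>\<close> enters linearly, with the finite measure of
    the face as its factor, and may tend to zero.\<close>
  have "\<bar>LINT x|lborel. indicator T x * Df x\<bar> \<le> I 0 / g"
  proof (rule tendsto_lowerbound)
    show "((\<lambda>\<eta>. (I 0 + \<eta> * m0) / g) \<longlongrightarrow> I 0 / g) (at_right 0)"
      by (rule tendsto_eq_intros refl | use g in simp)+
    show "eventually (\<lambda>\<eta>. \<bar>LINT x|lborel. indicator T x * Df x\<bar> \<le> (I 0 + \<eta> * m0) / g) (at_right 0)"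
      using eventually_at_right_less[of "0::real"] by eventually_elim (use main I_eq in metis)
  qed simp
  also have "I 0 \<le> (LINT x|face_measure v0. indicator (face v0) x * \<bar>w x\<bar>)"
    unfolding I_def
  proof (rule integral_mono)
    show "indicator (face v0) x * (\<bar>f x\<bar> + 0) \<le> indicator (face v0) x * \<bar>w x\<bar>" for x
    proof (cases "x \<in> face v0")
      case True
      then have "x \<in> T" by (simp add: face_def)
      then have "\<bar>bary T v1 x\<bar> \<le> 1" using bary_le_1 mem_iff_bary v(2) by fastforce
      then show ?thesis using True by (simp add: f_def abs_mult mult_left_le_one_le)
    qed simp
  qed (use If Iw in auto)
  finally show ?thesis using g by (simp add: Df_def e_def g_def divide_right_mono)
qed

end

lemma GDERIV_unique:
  assumes "GDERIV f x :> D" "GDERIV f x :> D'"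
  shows "D = D'"
proof -
  have "(\<lambda>h. h \<bullet> D) = (\<lambda>h. h \<bullet> D')"
    using assms unfolding gderiv_def by (rule has_derivative_unique)
  then have "h \<bullet> D = h \<bullet> D'" for h by (rule fun_cong)
  then show ?thesis by (metis vector_eq_ldot)
qed

lemma grad_eq: "GDERIV f x :> D \<Longrightarrow> grad f x = D"
  unfolding grad_def by (rule the_equality) (auto intro: GDERIV_unique)

lemma smooth_gradE:
  fixes w :: "'a::euclidean_space \<Rightarrow> real"
  assumes "smooth w"
  shows "GDERIV w x :> grad w x" "continuous_on UNIV (grad w)" "continuous_on UNIV w"
proof -
  have "C_on (Suc 0) UNIV w" using assms by (simp only: smooth_def)
  then obtain g where g: "\<And>x. GDERIV w x :> g x" "\<And>b. b \<in> Basis \<Longrightarrow> continuous_on UNIV (\<lambda>x. g x \<bullet> b)"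
    by auto
  have e: "grad w = g" using grad_eq[OF g(1)] by (rule ext)
  show "GDERIV w x :> grad w x" unfolding e by (rule g(1))
  show "continuous_on UNIV (grad w)" unfolding e
    using g(2) by (subst continuous_on_componentwise) auto
  show "continuous_on UNIV w"
    using g(1) unfolding gderiv_def continuous_on_eq_continuous_at[OF open_UNIV]
    by (auto intro: has_derivative_continuous)
qed

section \<open>The edge field and its flux\<close>

context full_simplex begin

definition "edge_field v0 v1 v2 x = bary T v1 x *\<^sub>R (v1 - v0) - bary T v2 x *\<^sub>R (v2 - v0)"

lemma continuous_edge_field: "continuous_on A (edge_field v0 v1 v2)"
  unfolding edge_field_def by (intro continuous_intros)

lemma integrable_continuous_T:
  fixes f :: "'a \<Rightarrow> real"
  assumes "continuous_on UNIV f"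
  shows "integrable lborel (\<lambda>x. indicator T x * f x)"
proof -
  show ?thesis
    using borel_integrable_compact[OF compact_T continuous_on_subset[OF assms subset_UNIV]] by simp
qed

text \<open>Each of the fields \<open>bary T v1 x *\<^sub>R (v1 - v0)\<close> and
  \<open>bary T v2 x *\<^sub>R (v2 - v0)\<close> has divergence one. In the difference of the two
  instances of \<open>divergence_bound\<close> the terms with \<open>w\<close> itself
  cancel.\<close>

lemma edge_field_flux_bound:
  fixes w :: "'a \<Rightarrow> real"
  assumes v: "v0 \<in> verts T" "v1 \<in> verts T" "v2 \<in> verts T" "v0 \<noteq> v1" "v0 \<noteq> v2"
    and D: "\<And>x. GDERIV w x :> Dw x" and cont: "continuous_on UNIV Dw"
  shows "\<bar>LINT x|lborel. indicator T x * (edge_field v0 v1 v2 x \<bullet> Dw x)\<bar>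
    \<le> 2 * (LINT x|face_measure v0. indicator (face v0) x * \<bar>w x\<bar>) / norm (bary_grad T v0)"
proof -
  have wcont: "continuous_on UNIV w"
    using D unfolding gderiv_def continuous_on_eq_continuous_at[OF open_UNIV]
    by (auto intro: has_derivative_continuous)
  let ?f = "\<lambda>v x. w x + bary T v x * (Dw x \<bullet> (v - v0))"
  have c: "continuous_on UNIV (\<lambda>x. Dw x \<bullet> (v - v0))" for v by (intro continuous_intros cont)
  have i: "integrable lborel (\<lambda>x. indicator T x * ?f v x)" for v
    by (intro integrable_continuous_T continuous_intros wcont cont)
  have "(LINT x|lborel. indicator T x * (edge_field v0 v1 v2 x \<bullet> Dw x)) =
    (LINT x|lborel. indicator T x * ?f v1 x - indicator T x * ?f v2 x)"
    by (intro Bochner_Integration.integral_cong)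
      (auto simp: edge_field_def inner_diff_left inner_commute[of "Dw _"] right_diff_distrib distrib_left)
  also have "\<dots> = (LINT x|lborel. indicator T x * ?f v1 x) - (LINT x|lborel. indicator T x * ?f v2 x)"
    by (intro Bochner_Integration.integral_diff i)
  finally show ?thesis
    using divergence_bound[OF v(1,2,4) D c] divergence_bound[OF v(1,3,5) D c] by linarith
qed

text \<open>The flux bound is applied to \<open>w = bary T v0\<close>, which vanishes on the face
  opposite to \<open>v0\<close>; the flux is the difference of the two integrals. The third vertex
  is where the dimension has to be at least two.\<close>

lemma bary_integral_eq:
  assumes "v1 \<in> verts T" "v2 \<in> verts T" "DIM('a) \<ge> 2"
  shows "(LINT x|lborel. indicator T x * bary T v1 x) = (LINT x|lborel. indicator T x * bary T v2 x)"
proof (cases "v1 = v2")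
  case False
  have "\<exists>v0\<in>verts T. v0 \<notin> {v1, v2}"
  proof (rule ccontr)
    assume "\<not> ?thesis"
    then have "verts T \<subseteq> {v1, v2}" by auto
    then have "card (verts T) \<le> card {v1, v2}" by (intro card_mono) auto
    also have "\<dots> \<le> 2" by (simp add: card_insert_if)
    finally show False using card_verts assms(3) by simp
  qed
  then obtain v0 where v0: "v0 \<in> verts T" "v0 \<noteq> v1" "v0 \<noteq> v2" by auto
  have b: "GDERIV (bary T v0) y :> bary_grad T v0" for y
    unfolding gderiv_def bary_alt by (auto intro!: derivative_eq_intros simp: inner_commute)
  have z: "indicator (face v0) x * \<bar>bary T v0 x\<bar> = 0" for x by (simp add: face_def indicator_def)
  have e: "edge_field v0 v1 v2 x \<bullet> bary_grad T v0 = bary T v2 x - bary T v1 x" for x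
  proof -
    have "edge_field v0 v1 v2 x \<bullet> bary_grad T v0 =
      bary T v1 x * (bary_grad T v0 \<bullet> (v1 - v0)) - bary T v2 x * (bary_grad T v0 \<bullet> (v2 - v0))"
      by (simp add: edge_field_def inner_diff_left inner_diff_right inner_commute)
    moreover have "bary_grad T v0 \<bullet> (v1 - v0) = - 1" "bary_grad T v0 \<bullet> (v2 - v0) = - 1"
      using bary_grad_eq v0 assms by auto
    ultimately show ?thesis by simp
  qed
  have "\<bar>LINT x|lborel. indicator T x * (edge_field v0 v1 v2 x \<bullet> bary_grad T v0)\<bar> \<le> 0"
    using edge_field_flux_bound[OF v0(1) assms(1,2) v0(2,3) b continuous_on_const] by (simp add: z)
  then have "(LINT x|lborel. indicator T x * bary T v2 x - indicator T x * bary T v1 x) = 0"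
    unfolding e right_diff_distrib by simp
  then show ?thesis
    by (subst (asm) Bochner_Integration.integral_diff) (auto intro!: integrable_continuous_T continuous_bary)
qed simp

lemma bary_integral:
  assumes "v \<in> verts T" "DIM('a) \<ge> 2"
  shows "(LINT x|lborel. indicator T x * bary T v x) = measure lebesgue T / (DIM('a) + 1)"
proof -
  have "real (DIM('a) + 1) * (LINT x|lborel. indicator T x * bary T v x) =
    (\<Sum>u\<in>verts T. LINT x|lborel. indicator T x * bary T v x)" by (simp add: card_verts)
  also have "\<dots> = (\<Sum>u\<in>verts T. LINT x|lborel. indicator T x * bary T u x)"
    using bary_integral_eq[OF assms(1) _ assms(2)] by (intro sum.cong) auto
  also have "\<dots> = (LINT x|lborel. (\<Sum>u\<in>verts T. indicator T x * bary T u x))"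
    by (intro Bochner_Integration.integral_sum[symmetric] integrable_continuous_T continuous_bary)
  also have "\<dots> = (LINT x|lborel. indicator T x)"
    by (simp add: sum_distrib_left[symmetric] bary_sum)
  also have "\<dots> = measure lebesgue T" by simp
  finally show ?thesis by (simp add: field_simps)
qed

lemma norm_edge_field_le:
  assumes "x \<in> T" "v0 \<in> verts T" "v1 \<in> verts T" "v2 \<in> verts T"
  shows "norm (edge_field v0 v1 v2 x) \<le> 2 * diameter T"
proof -
  have d: "norm (v - v0) \<le> diameter T" if "v \<in> verts T" for v
    using diameter_bounded_bound[OF bounded_T, of v v0] verts_subset that assms(2) by (auto simp: dist_norm)
  have t: "norm (bary T v x *\<^sub>R (v - v0)) \<le> diameter T" if "v \<in> verts T" for v
  proof -
    have "0 \<le> bary T v x" "bary T v x \<le> 1" using mem_iff_bary bary_le_1 assms(1) that by auto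
    then have "bary T v x * norm (v - v0) \<le> 1 * norm (v - v0)" by (intro mult_right_mono) auto
    then show ?thesis using d[OF that] \<open>0 \<le> bary T v x\<close> by simp
  qed
  show ?thesis unfolding edge_field_def
    using norm_triangle_ineq4[of "bary T v1 x *\<^sub>R (v1 - v0)" "bary T v2 x *\<^sub>R (v2 - v0)"] t[OF assms(3)] t[OF assms(4)]
    by linarith
qed

lemma edge_field_affine_flux:
  assumes v: "v0 \<in> verts T" "v1 \<in> verts T" "v2 \<in> verts T" and d: "DIM('a) \<ge> 2"
  shows "(LINT x|lborel. indicator T x * (edge_field v0 v1 v2 x \<bullet> a)) = measure lebesgue T / (DIM('a) + 1) * (a \<bullet> (v1 - v2))"
proof -
  have "(LINT x|lborel. indicator T x * (edge_field v0 v1 v2 x \<bullet> a)) =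
    (LINT x|lborel. (a \<bullet> (v1 - v0)) * (indicator T x * bary T v1 x) - (a \<bullet> (v2 - v0)) * (indicator T x * bary T v2 x))"
  proof (intro Bochner_Integration.integral_cong refl)
    fix x
    have "edge_field v0 v1 v2 x \<bullet> a = bary T v1 x * (a \<bullet> (v1 - v0)) - bary T v2 x * (a \<bullet> (v2 - v0))"
      by (simp add: edge_field_def inner_diff_left inner_diff_right inner_commute)
    then show "indicator T x * (edge_field v0 v1 v2 x \<bullet> a) =
      (a \<bullet> (v1 - v0)) * (indicator T x * bary T v1 x) - (a \<bullet> (v2 - v0)) * (indicator T x * bary T v2 x)"
      by (simp only: right_diff_distrib mult_ac)
  qed
  also have "\<dots> = (a \<bullet> (v1 - v0)) * (measure lebesgue T / (DIM('a) + 1)) - (a \<bullet> (v2 - v0)) * (measure lebesgue T / (DIM('a) + 1))"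
    by (subst Bochner_Integration.integral_diff)
      (simp_all only: integrable_mult_right integrable_continuous_T continuous_bary integral_mult_right_zero bary_integral[OF v(2) d] bary_integral[OF v(3) d])
  also have "\<dots> = measure lebesgue T / (DIM('a) + 1) * (a \<bullet> (v1 - v2))"
  proof -
    define q where "q = measure lebesgue T / (DIM('a) + 1)"
    show ?thesis unfolding q_def[symmetric] by (simp add: inner_diff_right algebra_simps)
  qed
  finally show ?thesis .
qed

lemma negligible_frontier_T: "negligible (T - interior T)"
proof -
  have "frontier T = T - interior T" using closed_T by (simp add: frontier_def)
  then show ?thesis using negligible_convex_frontier[OF convex_T] by simp
qed

text \<open>The relative boundary of a face is contained in the hyperplanes of the other faces,
  which are null for the measure of this one. A side of the Dirichlet part has only its relative
  interior in \<open>\<Gamma>\<close>, so the zero trace is available almost everywhere on the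
  side.\<close>

lemma face_interior_AE: "AE x in face_measure v0. x \<in> face v0 \<longrightarrow> x \<in> rel_interior (face v0)"
  if v0: "v0 \<in> verts T" and aff: "affine hull (face v0) = {x. bary T v0 x = 0}"
proof -
  have hyp: "{x. bary T v x = 0} \<in> hyperplanes" if "v \<in> verts T" for v
    unfolding face_hyperplane[OF that] by (rule hyperplane_mem[OF norm_face_normal[OF that]])
  have "AE x in face_measure v0. \<forall>v\<in>verts T - {v0}. bary T v x \<noteq> 0"
  proof (rule AE_finite_allI)
    fix v assume v: "v \<in> verts T - {v0}"
    have ne: "{x. bary T v0 x = 0} \<noteq> {x. bary T v x = 0}"
    proof
      assume "{x. bary T v0 x = 0} = {x. bary T v x = 0}"
      moreover have "v0 \<in> {x. bary T v x = 0}" using bary_vert[of v v0] v v0 by auto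
      ultimately have "bary T v0 v0 = 0" by blast
      then show False using bary_vert[OF v0 v0] by simp
    qed
    have cl: "{x. bary T v x = 0} \<in> sets borel" by (intro borel_closed closed_Collect_eq continuous_intros)
    have "emeasure (face_measure v0) {x. bary T v x = 0} = 0"
      unfolding face_measure_def using hyperplane_measure_other_hyperplane[OF hyp hyp ne] v0 v by simp
    then have "{x. bary T v x = 0} \<in> null_sets (face_measure v0)" using cl by (simp add: null_sets_def)
    then show "AE x in face_measure v0. bary T v x \<noteq> 0" by (rule AE_not_in[THEN AE_mp]) simp
  qed (use finite_verts in simp)
  then show ?thesis
  proof eventually_elim
    case (elim x)
    show ?case
    proof
      assume x: "x \<in> face v0"
      let ?U = "\<Inter>v\<in>verts T - {v0}. {y. bary T v y > 0}"
      have "open ?U" using finite_verts by (intro open_INT ballI open_Collect_less continuous_intros) auto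
      moreover have "x \<in> ?U"
      proof (rule INT_I)
        fix v assume v: "v \<in> verts T - {v0}"
        then have "bary T v x \<ge> 0" using x mem_iff_bary by (simp add: face_def)
        moreover have "bary T v x \<noteq> 0" using elim v by blast
        ultimately show "x \<in> {y. bary T v y > 0}" by simp
      qed
      moreover have "?U \<inter> affine hull (face v0) \<subseteq> face v0"
      proof
        fix y assume y: "y \<in> ?U \<inter> affine hull (face v0)"
        then have "bary T v0 y = 0" using aff by auto
        moreover have "bary T v y \<ge> 0" if "v \<in> verts T" for v
          using y that calculation by (cases "v = v0") (auto intro: less_imp_le)
        ultimately show "y \<in> face v0" using mem_iff_bary by (simp add: face_def)
      qed
      ultimately show "x \<in> rel_interior (face v0)" unfolding mem_rel_interior using x by blast
    qed
  qed
qed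

lemma facet_eq_face:
  assumes "S facet_of T"
  obtains v0 where "v0 \<in> verts T" "S = face v0" "affine hull (face v0) = {x. bary T v0 x = 0}"
    "verts T - {v0} \<subseteq> S" "S = convex hull (verts T - {v0})"
proof -
  show ?thesis
  proof (rule facetD[OF assms])
    fix v assume v: "v \<in> verts T" "S = convex hull (verts T - {v})" "S = {x \<in> T. bary T v x = 0}"
      "affine hull S = {x. bary T v x = 0}"
    have S: "S = face v" using v(3) by (simp add: face_def)
    have "verts T - {v} \<subseteq> S" unfolding v(2) by (rule hull_subset)
    then show thesis using v S by (intro that[of v]) auto
  qed
qed

end

lemma hyperplane_measure_AE:
  assumes "H \<in> hyperplanes" "AE x in surface_measure. Q x"
  shows "AE x in hyperplane_measure H. Q x"
proof -
  obtain N where N': "{x \<in> space surface_measure. \<not> Q x} \<subseteq> N" "emeasure surface_measure N = 0"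
    "N \<in> sets surface_measure" using AE_E[OF assms(2)] .
  then have N: "N \<in> null_sets surface_measure" "{x. \<not> Q x} \<subseteq> N" by (auto simp: null_sets_def)
  have b: "N \<in> sets borel" using N'(3) by (simp add: sets_surface_measure)
  have "emeasure (hyperplane_measure H) N \<le> 0"
    using hyperplane_measure_le_surface[OF assms(1) b] N(1) by auto
  then have "N \<in> null_sets (hyperplane_measure H)" using b by (simp add: null_sets_def)
  then have "AE x in hyperplane_measure H. x \<notin> N" by (rule AE_not_in)
  then show ?thesis by eventually_elim (use N(2) in auto)
qed

section \<open>Surface measure on the boundary of the domain\<close>

context mesh begin

text \<open>A boundary point belongs to an element but not to its interior, so one coordinate
  vanishes there. Hence finitely many face hyperplanes cover the boundary.\<close>

lemma surface_measure_frontier_finite: "emeasure surface_measure (frontier \<Omega>) < \<infinity>"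
proof (rule surface_measure_finite)
  let ?\<H> = "\<Union>T\<in>\<T>. (\<lambda>v. {x. bary T v x = 0}) ` verts T"
  show "finite ?\<H>" using finite_mesh full full_simplex.finite_verts by blast
  show "?\<H> \<subseteq> hyperplanes"
  proof
    fix H assume "H \<in> ?\<H>"
    then obtain T v where T: "T \<in> \<T>" "v \<in> verts T" "H = {x. bary T v x = 0}" by blast
    interpret full_simplex T using full T by blast
    show "H \<in> hyperplanes" unfolding T(3) face_hyperplane[OF T(2)]
      by (rule hyperplane_mem[OF norm_face_normal[OF T(2)]])
  qed
  show "frontier \<Omega> \<in> sets borel" by (intro borel_closed frontier_closed)
  show "bounded (frontier \<Omega>)"
    by (rule bounded_subset[OF bounded_closure[OF bounded_domain]]) (auto simp: frontier_def)
  show "frontier \<Omega> \<subseteq> \<Union>?\<H>"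
  proof
    fix x assume x: "x \<in> frontier \<Omega>"
    then have "x \<in> \<Union>\<T>" "x \<notin> \<Omega>" using Union_mesh open_domain by (auto simp: frontier_def interior_open)
    then obtain T where T: "T \<in> \<T>" "x \<in> T" by blast
    interpret full_simplex T using full T by blast
    have "x \<notin> interior T" using interior_element_subset[OF T(1)] \<open>x \<notin> \<Omega>\<close> by blast
    then obtain v where v: "v \<in> verts T" "\<not> bary T v x > 0" using interior_iff_bary by blast
    then have "bary T v x = 0" using mem_iff_bary[of x] T(2) by force
    then show "x \<in> \<Union>?\<H>" using T v by blast
  qed
qed

text \<open>On the side, \<open>g\<close> vanishes almost everywhere, so
  \<open>\<bar>w\<bar>\<close> equals \<open>\<bar>w - g\<bar>\<close> there; and the measure of one
  hyperplane is below the surface measure.\<close>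

lemma face_integral_le_trace_error:
  fixes w g :: "'a \<Rightarrow> real"
  assumes T: "T \<in> \<T>" "S facet_of T" and S: "S \<subseteq> frontier \<Omega>" "rel_interior S \<subseteq> \<Gamma>"
    and g: "set_integrable surface_measure (frontier \<Omega>) g" "AE x in surface_measure. x \<in> \<Gamma> \<longrightarrow> g x = 0"
    and w: "continuous_on UNIV w"
    and v0: "v0 \<in> verts T" "S = full_simplex.face T v0" "affine hull S = {x. bary T v0 x = 0}"
  shows "(LINT x|full_simplex.face_measure T v0. indicator S x * \<bar>w x\<bar>)
    \<le> (LINT x:frontier \<Omega>|surface_measure. \<bar>w x - g x\<bar>)"
proof -
  interpret full_simplex T using full T by blast
  let ?u = "\<lambda>x. \<bar>indicator (frontier \<Omega>) x * w x - indicator (frontier \<Omega>) x * g x\<bar>"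
  have fr: "frontier \<Omega> \<in> sets borel" by (intro borel_closed frontier_closed)
  have gi: "integrable surface_measure (\<lambda>x. indicator (frontier \<Omega>) x * g x)"
    using g(1) by (simp add: set_integrable_def)
  have wm: "w \<in> borel_measurable borel" by (rule borel_measurable_continuous_onI[OF w])
  have gm: "(\<lambda>x. indicator (frontier \<Omega>) x * g x) \<in> borel_measurable borel"
    using borel_measurable_integrable[OF gi] by (simp cong: measurable_cong_sets add: sets_surface_measure)
  have um: "?u \<in> borel_measurable borel"
    by (intro borel_measurable_abs borel_measurable_diff borel_measurable_times borel_measurable_indicator fr wm gm)
  obtain B where B: "\<And>x. x \<in> frontier \<Omega> \<Longrightarrow> \<bar>w x\<bar> \<le> B"
    using compact_imp_bounded[OF compact_continuous_image[OF continuous_on_subset[OF w] compact_frontier_bounded[OF bounded_domain]]]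
    by (auto simp: bounded_iff)
  have wi: "integrable surface_measure (\<lambda>x. indicator (frontier \<Omega>) x * w x)"
  proof (rule Bochner_Integration.integrable_bound)
    show "integrable surface_measure (\<lambda>x. \<bar>B\<bar> * indicator (frontier \<Omega>) x)"
      using surface_measure_frontier_finite fr by (intro integrable_mult_right integrable_real_indicator) (auto simp: sets_surface_measure)
    show "AE x in surface_measure. norm (indicator (frontier \<Omega>) x * w x) \<le> norm (\<bar>B\<bar> * indicator (frontier \<Omega>) x)"
      using B by (intro AE_I2) (force simp: indicator_def)
    show "(\<lambda>x. indicator (frontier \<Omega>) x * w x) \<in> borel_measurable surface_measure"
      using wm fr by (simp cong: measurable_cong_sets add: sets_surface_measure)
  qed
  have ui: "integrable surface_measure ?u" using wi gi by simp
  have hyp: "{x. bary T v0 x = 0} \<in> hyperplanes"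
    unfolding face_hyperplane[OF v0(1)] by (rule hyperplane_mem[OF norm_face_normal[OF v0(1)]])
  have "AE x in face_measure v0. x \<in> \<Gamma> \<longrightarrow> g x = 0"
    unfolding face_measure_def by (rule hyperplane_measure_AE[OF hyp g(2)])
  moreover have "AE x in face_measure v0. x \<in> S \<longrightarrow> x \<in> rel_interior S"
    using face_interior_AE[OF v0(1)] v0(2,3) by simp
  ultimately have ae: "AE x in face_measure v0. ennreal (indicator S x * \<bar>w x\<bar>) \<le> ennreal (?u x)"
  proof eventually_elim
    case (elim x)
    show ?case using elim S by (intro ennreal_leI) (auto simp: indicator_def)
  qed
  obtain B' where B': "\<And>x. x \<in> T \<Longrightarrow> \<bar>w x\<bar> \<le> B'"
    using compact_imp_bounded[OF compact_continuous_image[OF continuous_on_subset[OF w] compact_T]]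
    by (auto simp: bounded_iff)
  have iS: "integrable (face_measure v0) (\<lambda>x. indicator S x * \<bar>w x\<bar>)"
    unfolding v0(2) by (rule face_integral(1)[OF v0(1), where C = B']) (use wm B' in \<open>auto simp: face_def\<close>)
  have le: "face_measure v0 \<le> surface_measure"
    unfolding face_measure_def
    by (subst le_measure) (auto simp: sets_surface_measure hyperplane_measure_le_surface[OF hyp])
  have "ennreal (LINT x|face_measure v0. indicator S x * \<bar>w x\<bar>) = (\<integral>\<^sup>+x. ennreal (indicator S x * \<bar>w x\<bar>) \<partial>face_measure v0)"
    by (intro nn_integral_eq_integral[symmetric] iS) auto
  also have "\<dots> \<le> (\<integral>\<^sup>+x. ennreal (?u x) \<partial>face_measure v0)" by (rule nn_integral_mono_AE[OF ae])
  also have "\<dots> \<le> (\<integral>\<^sup>+x. ennreal (?u x) \<partial>surface_measure)"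
    by (intro nn_integral_mono_measure le) (simp add: sets_surface_measure)
  also have "\<dots> = ennreal (LINT x|surface_measure. ?u x)" by (intro nn_integral_eq_integral ui) auto
  also have "(LINT x|surface_measure. ?u x) = (LINT x:frontier \<Omega>|surface_measure. \<bar>w x - g x\<bar>)"
    unfolding set_lebesgue_integral_def by (intro Bochner_Integration.integral_cong) (auto simp: indicator_def)
  finally show ?thesis
    by (subst (asm) ennreal_le_iff) (auto simp: set_lebesgue_integral_def intro!: integral_nonneg)
qed

end

lemma set_integral_subset_le:
  fixes f :: "'a \<Rightarrow> real"
  assumes "set_integrable M B f" "A \<in> sets M" "A \<subseteq> B" "\<And>x. 0 \<le> f x"
  shows "(LINT x:A|M. f x) \<le> (LINT x:B|M. f x)"
  unfolding set_lebesgue_integral_def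
proof (rule integral_mono)
  show "integrable M (\<lambda>x. indicator A x *\<^sub>R f x)"
    using set_integrable_subset[OF assms(1-3)] by (simp add: set_integrable_def)
  show "integrable M (\<lambda>x. indicator B x *\<^sub>R f x)" using assms(1) by (simp add: set_integrable_def)
qed (use assms(3,4) in \<open>auto simp: indicator_def\<close>)

lemma AE_lebesgue_negligible:
  assumes "AE x in lebesgue. P x"
  shows "negligible {x. \<not> P x}"
proof -
  obtain N where "{x \<in> space lebesgue. \<not> P x} \<subseteq> N" "emeasure lebesgue N = 0" "N \<in> sets lebesgue"
    using AE_E[OF assms] .
  then have "negligible N" "{x. \<not> P x} \<subseteq> N" by (auto simp: negligible_iff_null_sets null_sets_def)
  then show ?thesis by (rule negligible_subset)
qed

section \<open>Zeros of affine functions with mean zero, and integrals over one element\<close>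

context full_simplex begin

lemma bary_sum_points:
  assumes "finite W" "(\<Sum>w\<in>W. c w) = 1"
  shows "bary T u (\<Sum>w\<in>W. c w *\<^sub>R w) = (\<Sum>w\<in>W. c w * bary T u w)"
  using assms by (simp add: bary_alt inner_sum_right sum.distrib distrib_left sum_distrib_right[symmetric])

lemma hyproj_face: "v \<in> verts T \<Longrightarrow> bary T v x = 0 \<Longrightarrow> hyproj (face_normal v) (face_offset v) x = x"
  using face_signed_distance[of v x] by (simp add: hyproj_def)

lemma bary_hyproj_face: "v \<in> verts T \<Longrightarrow> bary T v (hyproj (face_normal v) (face_offset v) x) = 0"
  using hyproj_inner[OF norm_face_normal, of v "face_offset v" x] face_hyperplane[of v] by blast

text \<open>Every point near the centroid of the face projects into the face, so the cylinder over
  the face contains a nonempty open set.\<close>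

lemma face_measure_face_pos:
  assumes v: "v \<in> verts T"
  shows "emeasure (face_measure v) (face v) \<noteq> 0"
proof
  assume 0: "emeasure (face_measure v) (face v) = 0"
  let ?n = "face_normal v" and ?c = "face_offset v"
  let ?P = "hyproj ?n ?c" and ?W = "verts T - {v}"
  have "card ?W = DIM('a)" using v card_verts finite_verts by simp
  then have W: "(\<Sum>w\<in>?W. 1 / real DIM('a)) = 1" by simp
  define p where "p = (\<Sum>w\<in>?W. (1 / real DIM('a)) *\<^sub>R w)"
  have b: "bary T u p = (\<Sum>w\<in>?W. 1 / real DIM('a) * bary T u w)" for u
    unfolding p_def using finite_verts by (intro bary_sum_points W) auto
  have pv: "bary T v p = 0" unfolding b using v by (intro sum.neutral) (auto simp: bary_vert)
  have pw: "bary T u p > 0" if "u \<in> ?W" for u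
  proof -
    have "bary T u p = (\<Sum>w\<in>?W. if w = u then 1 / real DIM('a) else 0)"
      unfolding b using that by (intro sum.cong) (auto simp: bary_vert)
    then show ?thesis using that finite_verts by simp
  qed
  define U where "U = {x. \<bar>?n \<bullet> x - ?c\<bar> < 1 / 2} \<inter> (\<Inter>u\<in>?W. {x. bary T u (?P x) > 0})"
  have c: "continuous_on UNIV (\<lambda>x. bary T u (?P x))" for u
    unfolding bary_def by (intro continuous_intros)
  have "open U" unfolding U_def
    using finite_verts by (intro open_Int open_INT ballI open_Collect_less continuous_intros c) auto
  moreover have "p \<in> U" unfolding U_def
    using pw face_signed_distance[OF v, of p] pv hyproj_face[OF v pv] by auto
  ultimately have "\<not> negligible U" using open_not_negligible by blast
  moreover have "U \<subseteq> {x \<in> slab ?n ?c. ?P x \<in> face v}"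
  proof
    fix x assume x: "x \<in> U"
    have "bary T u (?P x) \<ge> 0" if "u \<in> verts T" for u
      using x that bary_hyproj_face[OF v, of x] by (cases "u = v") (auto simp: U_def less_imp_le)
    then have "?P x \<in> face v" using mem_iff_bary bary_hyproj_face[OF v] by (simp add: face_def)
    then show "x \<in> {x \<in> slab ?n ?c. ?P x \<in> face v}" using x by (simp add: U_def)
  qed
  moreover have "negligible {x \<in> slab ?n ?c. ?P x \<in> face v}"
  proof -
    have "slab ?n ?c \<in> sets borel" by (intro borel_closed closed_Collect_le continuous_intros)
    then have m: "{x \<in> slab ?n ?c. ?P x \<in> face v} \<in> sets borel"
      using sets_face[of v] by measurable
    have "emeasure lborel {x \<in> slab ?n ?c. ?P x \<in> face v} = 0"
      using 0 unfolding face_measure_def face_hyperplane[OF v]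
      by (subst (asm) emeasure_hyperplane_measure'[OF norm_face_normal[OF v] sets_face])
    then have "emeasure lebesgue {x \<in> slab ?n ?c. ?P x \<in> face v} = 0" using m by simp
    then show ?thesis using m by (simp add: negligible_iff_emeasure0 sets_completionI_sets)
  qed
  ultimately show False using negligible_subset by blast
qed

text \<open>On a convex face an affine function without zeros has one sign. A vanishing mean would
  then make it zero almost everywhere on a set of positive measure.\<close>

lemma affine_zero_mean_zero:
  assumes v: "v \<in> verts T" and aff: "affine hull (face v) = {x. bary T v x = 0}"
    and zero: "(LINT x:face v|hyperplane_measure (affine hull (face v)). f x) = 0"
    and f: "\<And>x. x \<in> face v \<Longrightarrow> f x = a \<bullet> x + b"
  shows "\<exists>x\<in>face v. f x = 0"
proof (rule ccontr)
  assume "\<not> ?thesis"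
  then have nz: "a \<bullet> x + b \<noteq> 0" if "x \<in> face v" for x using f that by force
  have fm: "face_measure v = hyperplane_measure (affine hull (face v))" by (simp add: face_measure_def aff)
  have conv: "convex (face v)"
  proof -
    have "face v = T \<inter> {x. bary_grad T v \<bullet> x = bary_grad T v \<bullet> v - 1}" by (auto simp: face_def bary_alt)
    then show ?thesis
      using convex_Int[OF convex_T convex_hyperplane[of "bary_grad T v" "bary_grad T v \<bullet> v - 1"]] by simp
  qed
  have contr: False if pos: "\<And>x. x \<in> face v \<Longrightarrow> s * (a \<bullet> x + b) > 0" and s: "\<bar>s\<bar> = 1" for s :: real
  proof -
    \<comment> \<open>The truncation is invisible on the face and provides the global nonnegativity
      that \<open>face_integral\<close> asks for.\<close>
    define h where "h x = max 0 (s * (a \<bullet> x + b))" for x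
    have hc: "continuous_on UNIV h" unfolding h_def by (intro continuous_intros)
    obtain C where C: "\<And>x. x \<in> T \<Longrightarrow> \<bar>h x\<bar> \<le> C"
      using compact_imp_bounded[OF compact_continuous_image[OF continuous_on_subset[OF hc] compact_T]]
      by (auto simp: bounded_iff)
    have hi: "integrable (face_measure v) (\<lambda>x. indicator (face v) x * h x)"
      by (rule face_integral(1)[OF v, where C = C])
        (use C in \<open>force simp: face_def h_def intro: borel_measurable_continuous_onI[OF hc, unfolded h_def]\<close>)+
    have "(LINT x|face_measure v. indicator (face v) x * h x) = (LINT x|face_measure v. s * (indicator (face v) x *\<^sub>R f x))"
      using f by (intro Bochner_Integration.integral_cong) (auto simp: h_def indicator_def max_def dest!: pos)
    also have "\<dots> = 0" using zero by (simp add: set_lebesgue_integral_def fm)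
    finally have "AE x in face_measure v. indicator (face v) x * h x = 0"
      using hi by (subst (asm) integral_nonneg_eq_0_iff_AE) (auto simp: h_def)
    then have "AE x in face_measure v. x \<notin> face v"
    proof eventually_elim
      case (elim x)
      then show ?case using pos[of x] by (auto simp: h_def max_def)
    qed
    then have "face v \<in> null_sets (face_measure v)" by (simp add: AE_iff_null_sets)
    then show False using face_measure_face_pos[OF v] by auto
  qed
  have "connected ((\<lambda>x. a \<bullet> x + b) ` face v)"
    by (intro connected_continuous_image continuous_intros convex_connected conv)
  moreover have "0 \<notin> (\<lambda>x. a \<bullet> x + b) ` face v" using nz by force
  ultimately have "(\<forall>x\<in>face v. a \<bullet> x + b > 0) \<or> (\<forall>x\<in>face v. a \<bullet> x + b < 0)"
  proof -
    assume c: "connected ((\<lambda>x. a \<bullet> x + b) ` face v)" "0 \<notin> (\<lambda>x. a \<bullet> x + b) ` face v"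
    show ?thesis
    proof (rule ccontr)
      assume "\<not> ?thesis"
      then obtain x y where "x \<in> face v" "a \<bullet> x + b \<le> 0" "y \<in> face v" "a \<bullet> y + b \<ge> 0" by (auto simp: not_less)
      then have "0 \<in> (\<lambda>x. a \<bullet> x + b) ` face v"
        using connectedD_interval[OF c(1), of "a \<bullet> x + b" "a \<bullet> y + b" 0] by blast
      then show False using c(2) by simp
    qed
  qed
  then show False
  proof
    assume "\<forall>x\<in>face v. a \<bullet> x + b > 0"
    then show False using contr[of 1] by simp
  next
    assume "\<forall>x\<in>face v. a \<bullet> x + b < 0"
    then show False using contr[of "- 1"] by force
  qed
qed

lemma restr_eq:
  assumes v: "\<And>x. x \<in> interior T \<Longrightarrow> v x = a \<bullet> x + b" and x: "x \<in> T"
  shows "restr v T x = a \<bullet> x + b"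
  unfolding restr_def
proof (rule tendsto_Lim)
  have "x islimpt interior T"
  proof (cases "x \<in> interior T")
    case True
    then show ?thesis using interior_limit_point[of x "interior T"] by simp
  next
    case False
    then show ?thesis using x closure_interior_T by (auto simp: closure_def)
  qed
  then show "\<not> trivial_limit (at x within interior T)" by (simp add: trivial_limit_within)
  have "((\<lambda>x. a \<bullet> x + b) \<longlongrightarrow> a \<bullet> x + b) (at x within interior T)" by (intro tendsto_intros)
  then show "(v \<longlongrightarrow> a \<bullet> x + b) (at x within interior T)"
    by (rule Lim_transform_within[OF _ zero_less_one]) (auto simp: v)
qed

lemma edge_field_integrable:
  assumes v: "v0 \<in> verts T" "v1 \<in> verts T" "v2 \<in> verts T" and H: "set_integrable lebesgue (interior T) H"
  shows "set_integrable lebesgue (interior T) (\<lambda>x. edge_field v0 v1 v2 x \<bullet> H x)"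
    and "\<bar>LINT x:interior T|lebesgue. edge_field v0 v1 v2 x \<bullet> H x\<bar>
      \<le> 2 * diameter T * (LINT x:interior T|lebesgue. norm (H x))"
proof -
  let ?X = "edge_field v0 v1 v2"
  have Xm: "?X \<in> borel_measurable lebesgue"
    by (intro continuous_borel_measurable_lebesgue continuous_edge_field)
  have pw: "norm (?X x \<bullet> H x) \<le> 2 * diameter T * norm (H x)" if "x \<in> interior T" for x
  proof -
    have "norm (?X x \<bullet> H x) \<le> norm (?X x) * norm (H x)" using Cauchy_Schwarz_ineq2 by simp
    also have "\<dots> \<le> 2 * diameter T * norm (H x)"
      using norm_edge_field_le[of x v0 v1 v2] that interior_subset[of T] v by (intro mult_right_mono) auto
    finally show ?thesis .
  qed
  have Hn: "set_integrable lebesgue (interior T) (\<lambda>x. 2 * diameter T * norm (H x))"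
    by (intro set_integrable_mult_right set_integrable_norm H)
  show int: "set_integrable lebesgue (interior T) (\<lambda>x. ?X x \<bullet> H x)"
  proof (rule set_integrable_bound[OF Hn])
    have "(\<lambda>x. ?X x \<bullet> (indicator (interior T) x *\<^sub>R H x)) \<in> borel_measurable lebesgue"
      using H Xm unfolding set_integrable_def by (intro borel_measurable_inner) auto
    then show "set_borel_measurable lebesgue (interior T) (\<lambda>x. ?X x \<bullet> H x)"
      by (simp add: set_borel_measurable_def)
    show "AE x in lebesgue. x \<in> interior T \<longrightarrow> norm (?X x \<bullet> H x) \<le> norm (2 * diameter T * norm (H x))"
    proof (intro AE_I2 impI)
      fix x assume "x \<in> interior T"
      then show "norm (?X x \<bullet> H x) \<le> norm (2 * diameter T * norm (H x))"
        by (rule order_trans[OF pw]) simp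
    qed
  qed
  have "\<bar>LINT x:interior T|lebesgue. ?X x \<bullet> H x\<bar> \<le> (LINT x:interior T|lebesgue. norm (?X x \<bullet> H x))"
    using set_integral_norm_bound[OF int] by simp
  also have "\<dots> \<le> (LINT x:interior T|lebesgue. 2 * diameter T * norm (H x))"
    by (intro set_integral_mono set_integrable_norm[OF int] Hn pw)
  finally show "\<bar>LINT x:interior T|lebesgue. ?X x \<bullet> H x\<bar> \<le> 2 * diameter T * (LINT x:interior T|lebesgue. norm (H x))"
    by simp
qed

lemma integral_interior_continuous:
  fixes f :: "'a \<Rightarrow> real"
  assumes c: "continuous_on UNIV f"
  shows "(LINT x:interior T|lebesgue. f x) = (LINT x|lborel. indicator T x * f x)"
proof -
  have "(LINT x:interior T|lebesgue. f x) = (LINT x|lebesgue. indicator T x * f x)"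
    unfolding set_lebesgue_integral_def
  proof (rule integral_cong_AE)
    show "(\<lambda>x. indicator (interior T) x *\<^sub>R f x) \<in> borel_measurable lebesgue"
      by (intro borel_measurable_scaleR borel_measurable_indicator continuous_borel_measurable_lebesgue[OF c]) simp
    show "(\<lambda>x. indicator T x * f x) \<in> borel_measurable lebesgue"
      by (intro borel_measurable_times borel_measurable_indicator continuous_borel_measurable_lebesgue[OF c])
        (simp add: sets_completionI_sets)
    have "AE x in lebesgue. x \<notin> T - interior T"
      using negligible_frontier_T unfolding negligible_iff_null_sets by (rule AE_not_in)
    then show "AE x in lebesgue. indicator (interior T) x *\<^sub>R f x = indicator T x * f x"
      by eventually_elim (use interior_subset[of T] in \<open>auto simp: indicator_def\<close>)
  qed
  also have "\<dots> = (LINT x|lborel. indicator T x * f x)"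
  proof (rule integral_completion)
    have "f \<in> borel_measurable borel" by (rule borel_measurable_continuous_onI[OF c])
    then show "(\<lambda>x. indicator T x * f x) \<in> borel_measurable lborel" by simp
  qed
  finally show ?thesis .
qed

end

section \<open>Vanishing flux for functions with zero trace\<close>

context mesh begin

lemma W11_gradient_integrable:
  assumes v: "v \<in> W11_D \<Omega> \<Gamma>" and G: "has_weak_gradient \<Omega> v G"
  shows "set_integrable lebesgue \<Omega> G"
proof -
  obtain G' where G': "has_weak_gradient \<Omega> v G'" "G' \<in> Lp_space 1 \<Omega>"
    using v by (auto simp: W11_D_def W11_def)
  have "set_integrable lebesgue \<Omega> G'"
    using G'(2) unfolding Lp_space_def set_integrable_def set_borel_measurable_def
    by (auto intro: integrable_norm_cancel simp: norm_scaleR)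
  moreover have "negligible {x. \<not> (x \<in> \<Omega> \<longrightarrow> G x = G' x)}"
    using has_weak_gradient_unique[OF open_domain G G'(1)] by (rule AE_lebesgue_negligible)
  ultimately show ?thesis by (rule absolutely_integrable_spike) auto
qed

lemma set_integrable_element:
  fixes H :: "'a \<Rightarrow> 'b::euclidean_space"
  assumes "T \<in> \<T>" "set_integrable lebesgue \<Omega> H"
  shows "set_integrable lebesgue (interior T) H"
  by (rule set_integrable_subset[OF assms(2) _ interior_element_subset[OF assms(1)]]) simp

text \<open>For the smooth approximations the flux is bounded by the trace error \<open>s k\<close>;
  exchanging their gradients for \<open>G'\<close> costs a multiple of \<open>d k\<close>. Both tend
  to zero, and uniqueness of weak gradients replaces \<open>G'\<close> by \<open>G\<close>.\<close>

lemma edge_field_null_trace: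
  assumes T: "T \<in> \<T>" "S facet_of T" and S: "S \<in> sides_in \<Omega> \<T> \<Gamma>"
    and v: "v \<in> W11_D \<Omega> \<Gamma>" and G: "has_weak_gradient \<Omega> v G"
    and v0: "v0 \<in> verts T" "S = full_simplex.face T v0" "affine hull S = {x. bary T v0 x = 0}"
    and v12: "v1 \<in> verts T - {v0}" "v2 \<in> verts T - {v0}"
  shows "(LINT x:interior T|lebesgue. full_simplex.edge_field T v0 v1 v2 x \<bullet> G x) = 0"
proof -
  interpret full_simplex T using full T by blast
  let ?X = "edge_field v0 v1 v2"
  have v12': "v1 \<in> verts T" "v2 \<in> verts T" "v0 \<noteq> v1" "v0 \<noteq> v2" using v12 by auto
  note Xint = edge_field_integrable[OF v0(1) v12'(1,2)]
  obtain g where g: "has_trace \<Omega> v g" "AE x in surface_measure. x \<in> \<Gamma> \<longrightarrow> g x = 0"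
    using v by (auto simp: W11_D_def)
  obtain w G' where gi: "set_integrable surface_measure (frontier \<Omega>) g" and w: "\<And>k::nat. smooth (w k)"
    and G': "has_weak_gradient \<Omega> v G'" "G' \<in> Lp_space 1 \<Omega>"
    and lim1: "(\<lambda>k. Lp_norm 1 \<Omega> (\<lambda>x. grad (w k) x - G' x)) \<longlonglongrightarrow> 0"
    and lim2: "(\<lambda>k. LINT x:frontier \<Omega>|surface_measure. \<bar>w k x - g x\<bar>) \<longlonglongrightarrow> 0"
    using g(1) unfolding has_trace_def by blast
  have G'i: "set_integrable lebesgue \<Omega> G'" by (rule W11_gradient_integrable[OF v G'(1)])
  have wi: "set_integrable lebesgue \<Omega> (grad (w k))" for k
  proof -
    have c: "compact (closure \<Omega>)" using bounded_domain by (simp add: compact_closure)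
    have i: "integrable lborel (\<lambda>x. indicator (closure \<Omega>) x *\<^sub>R grad (w k) x)"
      by (rule borel_integrable_compact[OF c continuous_on_subset[OF smooth_gradE(2)[OF w] subset_UNIV]])
    then have "set_integrable lebesgue (closure \<Omega>) (grad (w k))"
      unfolding set_integrable_def using integrable_completion[OF borel_measurable_integrable[OF i]] by simp
    then show ?thesis by (rule set_integrable_subset) (use open_domain closure_subset in auto)
  qed
  define d where "d k = (LINT x:\<Omega>|lebesgue. norm (grad (w k) x - G' x))" for k
  have d_lim: "d \<longlonglongrightarrow> 0"
  proof -
    have "d k \<ge> 0" for k unfolding d_def set_lebesgue_integral_def by (intro Bochner_Integration.integral_nonneg) auto
    then have "Lp_norm 1 \<Omega> (\<lambda>x. grad (w k) x - G' x) = d k" for k by (simp add: Lp_norm_def d_def)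
    then show ?thesis using lim1 by simp
  qed
  define s where "s k = (LINT x:frontier \<Omega>|surface_measure. \<bar>w k x - g x\<bar>)" for k
  have est: "\<bar>LINT x:interior T|lebesgue. ?X x \<bullet> G' x\<bar> \<le> 2 * s k / norm (bary_grad T v0) + 2 * diameter T * d k" for k
  proof -
    let ?D = "grad (w k)"
    have c: "continuous_on UNIV (\<lambda>x. ?X x \<bullet> ?D x)"
      by (intro continuous_on_inner continuous_edge_field smooth_gradE(2)[OF w])
    have "\<bar>LINT x:interior T|lebesgue. ?X x \<bullet> ?D x\<bar>
        \<le> 2 * (LINT x|face_measure v0. indicator (face v0) x * \<bar>w k x\<bar>) / norm (bary_grad T v0)"
      unfolding integral_interior_continuous[OF c]
      by (rule edge_field_flux_bound[OF v0(1) v12' smooth_gradE(1,2)[OF w]])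
    also have "\<dots> \<le> 2 * s k / norm (bary_grad T v0)"
    proof -
      have "(LINT x|face_measure v0. indicator S x * \<bar>w k x\<bar>) \<le> s k"
        unfolding s_def
        using S by (intro face_integral_le_trace_error[OF T _ _ gi g(2) smooth_gradE(3)[OF w] v0])
          (auto simp: sides_in_def boundary_sides_def)
      then show ?thesis unfolding v0(2)[symmetric] by (intro divide_right_mono mult_left_mono) auto
    qed
    finally have 1: "\<bar>LINT x:interior T|lebesgue. ?X x \<bullet> ?D x\<bar> \<le> 2 * s k / norm (bary_grad T v0)" .
    have di: "set_integrable lebesgue \<Omega> (\<lambda>x. ?D x - G' x)" by (intro set_integral_diff wi G'i)
    have "\<bar>LINT x:interior T|lebesgue. ?X x \<bullet> (?D x - G' x)\<bar> \<le> 2 * diameter T * (LINT x:interior T|lebesgue. norm (?D x - G' x))"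
      by (rule Xint(2)[OF set_integrable_element[OF T(1) di]])
    also have "\<dots> \<le> 2 * diameter T * d k"
    proof (intro mult_left_mono)
      show "(LINT x:interior T|lebesgue. norm (?D x - G' x)) \<le> d k"
        unfolding d_def using interior_element_subset[OF T(1)]
        by (intro set_integral_subset_le set_integrable_norm di) auto
    qed (simp add: diameter_ge_0[OF bounded_T])
    finally have 2: "\<bar>LINT x:interior T|lebesgue. ?X x \<bullet> (?D x - G' x)\<bar> \<le> 2 * diameter T * d k" .
    have "(LINT x:interior T|lebesgue. ?X x \<bullet> (?D x - G' x)) =
        (LINT x:interior T|lebesgue. ?X x \<bullet> ?D x) - (LINT x:interior T|lebesgue. ?X x \<bullet> G' x)"
      unfolding inner_diff_right
      by (rule set_integral_diff(2)[OF Xint(1)[OF set_integrable_element[OF T(1) wi]] Xint(1)[OF set_integrable_element[OF T(1) G'i]]])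
    then show ?thesis using 1 2 by linarith
  qed
  have "(\<lambda>k. 2 * s k / norm (bary_grad T v0) + 2 * diameter T * d k) \<longlonglongrightarrow> 2 * 0 / norm (bary_grad T v0) + 2 * diameter T * 0"
    using lim2 d_lim bary_grad_ne[OF v0(1)] unfolding s_def by (intro tendsto_intros) auto
  then have lim: "(\<lambda>k. 2 * s k / norm (bary_grad T v0) + 2 * diameter T * d k) \<longlonglongrightarrow> 0" by simp
  have "\<bar>LINT x:interior T|lebesgue. ?X x \<bullet> G' x\<bar> \<le> 0"
    using est by (intro LIMSEQ_le_const[OF lim]) auto
  then have z: "(LINT x:interior T|lebesgue. ?X x \<bullet> G' x) = 0" by simp
  have "(LINT x:interior T|lebesgue. ?X x \<bullet> G x) = (LINT x:interior T|lebesgue. ?X x \<bullet> G' x)"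
    unfolding set_lebesgue_integral_def
  proof (rule integral_cong_AE)
    show "(\<lambda>x. indicator (interior T) x *\<^sub>R (?X x \<bullet> G x)) \<in> borel_measurable lebesgue"
      using Xint(1)[OF set_integrable_element[OF T(1) W11_gradient_integrable[OF v G]]]
      unfolding set_integrable_def by (rule borel_measurable_integrable)
    show "(\<lambda>x. indicator (interior T) x *\<^sub>R (?X x \<bullet> G' x)) \<in> borel_measurable lebesgue"
      using Xint(1)[OF set_integrable_element[OF T(1) G'i]]
      unfolding set_integrable_def by (rule borel_measurable_integrable)
    show "AE x in lebesgue. indicator (interior T) x *\<^sub>R (?X x \<bullet> G x) = indicator (interior T) x *\<^sub>R (?X x \<bullet> G' x)"
      using has_weak_gradient_unique[OF open_domain G G'(1)]
      by eventually_elim (use interior_element_subset[OF T(1)] in \<open>auto simp: indicator_def\<close>)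
  qed
  then show ?thesis using z by simp
qed

lemma set_integrable_const_element:
  fixes a :: "'b::euclidean_space"
  assumes "T \<in> \<T>"
  shows "set_integrable lebesgue (interior T) (\<lambda>x. a)"
proof -
  have "emeasure lebesgue (interior T) < \<infinity>"
    using emeasure_bounded_finite[OF bounded_subset[OF full_simplex.bounded_T[OF full[OF assms]] interior_subset]] by simp
  then show ?thesis
    unfolding set_integrable_def by (intro integrable_scaleR_left integrable_real_indicator) auto
qed

text \<open>The flux of \<open>G\<close> is zero, so the flux of \<open>a - G\<close> is that of the
  constant \<open>a\<close>, which is known exactly. Thus the tangential part of \<open>a\<close>
  along the side is controlled by the distance of \<open>a\<close> to \<open>G\<close>.\<close>

lemma dirichlet_vertex_difference:
  assumes T: "T \<in> \<T>" "S facet_of T" and S: "S \<in> sides_in \<Omega> \<T> \<Gamma>"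
    and v: "v \<in> W11_D \<Omega> \<Gamma>" and G: "has_weak_gradient \<Omega> v G"
    and v0: "v0 \<in> verts T" "S = full_simplex.face T v0" "affine hull S = {x. bary T v0 x = 0}"
    and v12: "v1 \<in> verts T - {v0}" "v2 \<in> verts T - {v0}" and d: "DIM('a) \<ge> 2"
  shows "\<bar>a \<bullet> (v1 - v2)\<bar> * measure lebesgue T / (DIM('a) + 1)
    \<le> 2 * diameter T * (LINT x:interior T|lebesgue. norm (a - G x))"
proof -
  interpret full_simplex T using full T by blast
  let ?X = "edge_field v0 v1 v2"
  have v12': "v1 \<in> verts T" "v2 \<in> verts T" using v12 by auto
  note Xint = edge_field_integrable[OF v0(1) v12']
  have Gi: "set_integrable lebesgue (interior T) G"
    by (rule set_integrable_element[OF T(1) W11_gradient_integrable[OF v G]])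
  have ai: "set_integrable lebesgue (interior T) (\<lambda>x. a)" by (rule set_integrable_const_element[OF T(1)])
  have c: "continuous_on UNIV (\<lambda>x. ?X x \<bullet> a)"
    by (intro continuous_on_inner continuous_edge_field continuous_on_const)
  have eq: "(LINT x:interior T|lebesgue. ?X x \<bullet> a) = measure lebesgue T / (DIM('a) + 1) * (a \<bullet> (v1 - v2))"
    unfolding integral_interior_continuous[OF c] by (rule edge_field_affine_flux[OF v0(1) v12' d])
  have "(LINT x:interior T|lebesgue. ?X x \<bullet> (a - G x)) =
      (LINT x:interior T|lebesgue. ?X x \<bullet> a) - (LINT x:interior T|lebesgue. ?X x \<bullet> G x)"
    unfolding inner_diff_right by (rule set_integral_diff(2)[OF Xint(1)[OF ai] Xint(1)[OF Gi]])
  also have "\<dots> = measure lebesgue T / (DIM('a) + 1) * (a \<bullet> (v1 - v2))"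
    unfolding eq using edge_field_null_trace[OF T S v G v0 v12] by simp
  finally have eq2: "(LINT x:interior T|lebesgue. ?X x \<bullet> (a - G x)) = measure lebesgue T / (DIM('a) + 1) * (a \<bullet> (v1 - v2))" .
  show ?thesis
    using Xint(2)[OF set_integral_diff(1)[OF ai Gi]] unfolding eq2 by (simp add: abs_mult mult_ac)
qed

end

section \<open>Node averaging\<close>

definition elem_grad :: "('a::euclidean_space \<Rightarrow> real) \<Rightarrow> 'a set \<Rightarrow> 'a" where
  "elem_grad v T = (SOME a. \<exists>b. \<forall>x\<in>interior T. v x = a \<bullet> x + b)"

lemma grad_affine:
  assumes "open U" "x \<in> U" "\<And>y. y \<in> U \<Longrightarrow> v y = a \<bullet> y + b"
  shows "grad v x = a"
proof (rule grad_eq)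
  have "((\<lambda>y. a \<bullet> y + b) has_derivative (\<lambda>h. h \<bullet> a)) (at x)"
    by (auto intro!: derivative_eq_intros simp: inner_commute)
  then have "(v has_derivative (\<lambda>h. h \<bullet> a)) (at x)"
    by (rule has_derivative_transform_within_open[OF _ assms(1,2)]) (simp add: assms(3))
  then show "GDERIV v x :> a" by (simp add: gderiv_def)
qed

context full_simplex begin

lemma affine_from_vertices:
  assumes "\<And>u. u \<in> verts T \<Longrightarrow> a \<bullet> u + b = f u"
  shows "a \<bullet> x + b = (\<Sum>u\<in>verts T. f u * bary T u x)"
  unfolding bary_affine[of x a b, symmetric] using assms by (intro sum.cong) auto

text \<open>In dimension one a facet is a single point. This is the source of the zero that makes
  all node errors vanish there.\<close>

lemma facet_dist_le:
  assumes "S facet_of T" "x \<in> S" "y \<in> S"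
  shows "dist x y \<le> (if DIM('a) = 1 then 0 else diameter T)"
proof (cases "DIM('a) = 1")
  case True
  show ?thesis
  proof (rule facet_eq_face[OF assms(1)])
    fix v assume v: "v \<in> verts T" "S = convex hull (verts T - {v})"
    have "card (verts T - {v}) = 1" using v(1) card_verts True finite_verts by simp
    then obtain u where "verts T - {v} = {u}" by (auto simp: card_1_singleton_iff)
    then have "S = {u}" using v(2) by simp
    then show ?thesis using assms(2,3) True by simp
  qed
next
  case False
  then show ?thesis
    using diameter_bounded_bound[OF bounded_T, of x y] facet_of_imp_subset[OF assms(1)] assms(2,3) by auto
qed

end

section \<open>Nodal basis, jumps and node errors\<close>

context shape_regular_mesh begin

lemma nodes_eq: "nodes \<T> = (\<Union>T\<in>\<T>. verts T)"
  by (auto simp: nodes_def verts_def)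

lemma finite_nodes: "finite (nodes \<T>)"
  unfolding nodes_eq using finite_mesh full full_simplex.finite_verts by blast

definition "hat \<nu> T x = (if \<nu> \<in> verts T then bary T \<nu> x else 0)"

text \<open>A common point is a convex combination of the vertices of the common face, and in either
  element the coordinate of \<open>\<nu>\<close> reads off the same weight.\<close>

lemma hat_consistent:
  assumes T: "T \<in> \<T>" "T' \<in> \<T>" and x: "x \<in> T" "x \<in> T'"
  shows "hat \<nu> T x = hat \<nu> T' x"
proof -
  interpret s: full_simplex T using full T by blast
  interpret s': full_simplex T' using full T by blast
  let ?F = "T \<inter> T'"
  have sub: "verts ?F \<subseteq> verts T" "verts ?F \<subseteq> verts T'"
    using extreme_point_of_face[OF face_Int[OF T]] extreme_point_of_face[OF face_Int[OF T(2,1)]]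
    by (auto simp: verts_def Int_commute)
  have fin: "finite (verts ?F)" using sub(1) s.finite_verts finite_subset by blast
  have "?F = convex hull (verts ?F)"
    unfolding verts_def
    by (intro Krein_Milman_Minkowski compact_Int convex_Int s.compact_T s'.compact_T s.convex_T s'.convex_T)
  then have "x \<in> convex hull (verts ?F)" using x by blast
  then obtain u where u: "(\<Sum>w\<in>verts ?F. u w) = 1" "(\<Sum>w\<in>verts ?F. u w *\<^sub>R w) = x"
    by (auto simp: convex_hull_finite[OF fin])
  have "hat \<nu> T x = (if \<nu> \<in> verts ?F then u \<nu> else 0)"
  proof -
    have "bary T \<nu> x = (\<Sum>w\<in>verts ?F. u w * bary T \<nu> w)"
      using s.bary_sum_points[OF fin u(1)] u(2) by simp
    also have "\<nu> \<in> verts T \<Longrightarrow> \<dots> = (\<Sum>w\<in>verts ?F. if w = \<nu> then u \<nu> else 0)"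
      using sub by (intro sum.cong) (auto simp: s.bary_vert)
    finally show ?thesis using fin sub by (auto simp: hat_def)
  qed
  moreover have "hat \<nu> T' x = (if \<nu> \<in> verts ?F then u \<nu> else 0)"
  proof -
    have "bary T' \<nu> x = (\<Sum>w\<in>verts ?F. u w * bary T' \<nu> w)"
      using s'.bary_sum_points[OF fin u(1)] u(2) by simp
    also have "\<nu> \<in> verts T' \<Longrightarrow> \<dots> = (\<Sum>w\<in>verts ?F. if w = \<nu> then u \<nu> else 0)"
      using sub by (intro sum.cong) (auto simp: s'.bary_vert)
    finally show ?thesis using fin sub by (auto simp: hat_def)
  qed
  ultimately show ?thesis by simp
qed

lemma hat_affine:
  assumes "T \<in> \<T>"
  shows "\<exists>a b. \<forall>x. hat \<nu> T x = a \<bullet> x + b"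
proof -
  interpret full_simplex T using full assms by blast
  show ?thesis
  proof (cases "\<nu> \<in> verts T")
    case True
    then show ?thesis unfolding hat_def using bary_alt[of \<nu>] by auto
  next
    case False
    then show ?thesis unfolding hat_def by (intro exI[of _ 0]) simp
  qed
qed

lemma nodal_basis_exists: "\<exists>f. f \<in> S1 \<T> \<and> (\<forall>\<mu>\<in>nodes \<T>. f \<mu> = (if \<mu> = \<nu> then 1 else 0))"
proof -
  define f where "f x = hat \<nu> (SOME T. T \<in> \<T> \<and> x \<in> T) x" for x
  have f: "f x = hat \<nu> T x" if "T \<in> \<T>" "x \<in> T" for T x
  proof -
    have "(SOME T. T \<in> \<T> \<and> x \<in> T) \<in> \<T> \<and> x \<in> (SOME T. T \<in> \<T> \<and> x \<in> T)"
      by (rule someI[of "\<lambda>T. T \<in> \<T> \<and> x \<in> T"]) (use that in simp)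
    then show ?thesis unfolding f_def using hat_consistent that by blast
  qed
  have "f \<in> L1_elem \<T>" unfolding L1_elem_def
  proof (clarsimp)
    fix T assume T: "T \<in> \<T>"
    obtain a b where "\<And>x. hat \<nu> T x = a \<bullet> x + b" using hat_affine[OF T] by blast
    then show "\<exists>a b. \<forall>x\<in>interior T. f x = a \<bullet> x + b"
      using f[OF T] interior_subset[of T] by (metis subsetD)
  qed
  moreover have "continuous_on (\<Union>\<T>) f"
  proof -
    have "continuous_on T f" if T: "T \<in> \<T>" for T
    proof -
      obtain a b where ab: "\<And>x. hat \<nu> T x = a \<bullet> x + b" using hat_affine[OF T] by blast
      have "continuous_on T (\<lambda>x. a \<bullet> x + b)" by (intro continuous_intros)
      then show ?thesis by (rule continuous_on_eq) (simp add: f[OF T] ab)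
    qed
    then have "continuous_on (\<Union>T\<in>\<T>. T) f"
      using finite_mesh full full_simplex.closed_T by (intro continuous_on_closed_Union) auto
    then show ?thesis by simp
  qed
  moreover have "f \<mu> = (if \<mu> = \<nu> then 1 else 0)" if \<mu>: "\<mu> \<in> nodes \<T>" for \<mu>
  proof -
    obtain T where T: "T \<in> \<T>" "\<mu> \<in> verts T" using \<mu> by (auto simp: nodes_eq)
    interpret full_simplex T using full T by blast
    have "f \<mu> = hat \<nu> T \<mu>" using f T verts_subset by blast
    then show ?thesis using T(2) by (auto simp: hat_def bary_vert)
  qed
  ultimately show ?thesis by (auto simp: S1_def)
qed

text \<open>The basis function is an arbitrary choice, but the affine formula in the interior
  extends by continuity to the vertices, where the values are prescribed.\<close>

lemma nodal_basis_interior: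
  assumes T: "T \<in> \<T>" and x: "x \<in> interior T"
  shows "nodal_basis \<T> \<nu> x = hat \<nu> T x"
proof -
  interpret full_simplex T using full T by blast
  let ?f = "nodal_basis \<T> \<nu>"
  have f: "?f \<in> S1 \<T>" "\<And>\<mu>. \<mu> \<in> nodes \<T> \<Longrightarrow> ?f \<mu> = (if \<mu> = \<nu> then 1 else 0)"
    using someI_ex[OF nodal_basis_exists[of \<nu>]] unfolding nodal_basis_def[symmetric] by blast+
  obtain a b where ab: "\<And>y. y \<in> interior T \<Longrightarrow> ?f y = a \<bullet> y + b"
    using f(1) T by (auto simp: S1_def L1_elem_def)
  have cont: "continuous_on T ?f" using f(1) T by (auto simp: S1_def intro: continuous_on_subset)
  have cd: "continuous_on (closure (interior T)) (\<lambda>y. ?f y - (a \<bullet> y + b))"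
    unfolding closure_interior_T by (intro continuous_intros cont)
  have "?f y - (a \<bullet> y + b) = 0" if "y \<in> T" for y
    by (rule continuous_constant_on_closure[OF cd]) (use ab that closure_interior_T in auto)
  then have fT: "a \<bullet> y + b = ?f y" if "y \<in> T" for y using that by force
  have "a \<bullet> u + b = (if u = \<nu> then 1 else 0)" if "u \<in> verts T" for u
  proof -
    have "u \<in> T" "u \<in> nodes \<T>" using that verts_subset T by (auto simp: nodes_eq)
    then show ?thesis using fT[of u] f(2)[of u] by simp
  qed
  then have "a \<bullet> x + b = (\<Sum>u\<in>verts T. (if u = \<nu> then 1 else 0) * bary T u x)"
    by (rule affine_from_vertices)
  also have "\<dots> = hat \<nu> T x"
    using finite_verts by (simp add: hat_def if_distrib[of "\<lambda>c. c * _"] cong: if_cong)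
  finally show ?thesis using ab[OF x] by simp
qed

lemma node_averaging_grad:
  assumes T: "T \<in> \<T>" and x: "x \<in> interior T"
  shows "grad (node_averaging \<Gamma> \<T> v) x = (\<Sum>\<nu>\<in>verts T. node_average \<Gamma> \<T> v \<nu> *\<^sub>R bary_grad T \<nu>)"
proof -
  interpret full_simplex T using full T by blast
  let ?c = "node_average \<Gamma> \<T> v"
  have "node_averaging \<Gamma> \<T> v y = (\<Sum>\<nu>\<in>verts T. ?c \<nu> *\<^sub>R bary_grad T \<nu>) \<bullet> y + (\<Sum>\<nu>\<in>verts T. ?c \<nu> * (1 - bary_grad T \<nu> \<bullet> \<nu>))"
    if y: "y \<in> interior T" for y
  proof -
    have "node_averaging \<Gamma> \<T> v y = (\<Sum>\<nu>\<in>nodes \<T>. ?c \<nu> * hat \<nu> T y)"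
      unfolding node_averaging_def using nodal_basis_interior[OF T y] by simp
    also have "\<dots> = (\<Sum>\<nu>\<in>verts T. ?c \<nu> * hat \<nu> T y)"
      using T finite_nodes by (intro sum.mono_neutral_right) (auto simp: nodes_eq hat_def)
    also have "\<dots> = (\<Sum>\<nu>\<in>verts T. ?c \<nu> * bary T \<nu> y)" by (intro sum.cong) (auto simp: hat_def)
    finally show ?thesis by (simp add: bary_alt inner_sum_left sum.distrib[symmetric] distrib_left)
  qed
  then show ?thesis by (rule grad_affine[OF open_interior x])
qed

lemma elem_grad:
  assumes v: "v \<in> L1_elem \<T>" and T: "T \<in> \<T>"
  obtains b where "\<And>x. x \<in> interior T \<Longrightarrow> v x = elem_grad v T \<bullet> x + b"
    "\<And>x. x \<in> T \<Longrightarrow> restr v T x = elem_grad v T \<bullet> x + b"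
proof -
  interpret full_simplex T using full T by blast
  have "\<exists>a b. \<forall>x\<in>interior T. v x = a \<bullet> x + b" using v T by (auto simp: L1_elem_def)
  then have "\<exists>b. \<forall>x\<in>interior T. v x = elem_grad v T \<bullet> x + b" unfolding elem_grad_def by (rule someI_ex)
  then obtain b where b: "\<And>x. x \<in> interior T \<Longrightarrow> v x = elem_grad v T \<bullet> x + b" by blast
  show ?thesis using that[OF b restr_eq[OF b]] by blast
qed

lemma grad_elem_grad:
  assumes "v \<in> L1_elem \<T>" "T \<in> \<T>" "x \<in> interior T"
  shows "grad v x = elem_grad v T"
  using elem_grad[OF assms(1,2)] grad_affine[OF open_interior assms(3)] by metis

lemma elem_grad_vertices:
  assumes "v \<in> L1_elem \<T>" "T \<in> \<T>"
  shows "elem_grad v T = (\<Sum>\<nu>\<in>verts T. restr v T \<nu> *\<^sub>R bary_grad T \<nu>)"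
proof -
  interpret full_simplex T using full assms by blast
  show ?thesis
  proof (rule elem_grad[OF assms])
    fix b assume "\<And>x. x \<in> T \<Longrightarrow> restr v T x = elem_grad v T \<bullet> x + b"
    then show ?thesis using verts_subset by (intro affine_eq_bary_grad[of _ _ b]) blast
  qed
qed

text \<open>A bound for the distance of two points of one facet, which is the only length that the
  jump estimates need.\<close>

definition "side_size T = (if DIM('a) = 1 then 0 else diameter (T :: 'a set))"

lemma side_size_nonneg: "T \<in> \<T> \<Longrightarrow> side_size T \<ge> 0"
  using diameter_pos by (simp add: side_size_def less_imp_le)

lemma jump_le:
  assumes v: "v \<in> S1cr_D \<Omega> \<Gamma> \<T>" and adj: "(T1, T2) \<in> adjacent \<nu>"
  shows "\<bar>restr v T1 \<nu> - restr v T2 \<nu>\<bar> \<le> norm (elem_grad v T1 - elem_grad v T2) * side_size T1"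
proof -
  let ?S = "T1 \<inter> T2"
  have T: "T1 \<in> \<T>" "T2 \<in> \<T>" "T1 \<noteq> T2" "\<nu> \<in> ?S" "?S facet_of T1" "?S facet_of T2"
    using adj by (auto simp: adjacent_def star_def)
  interpret s1: full_simplex T1 using full T by blast
  have vL: "v \<in> L1_elem \<T>" using v by (simp add: S1cr_D_def)
  obtain b1 where b1: "\<And>x. x \<in> T1 \<Longrightarrow> restr v T1 x = elem_grad v T1 \<bullet> x + b1"
    using elem_grad[OF vL T(1)] by metis
  obtain b2 where b2: "\<And>x. x \<in> T2 \<Longrightarrow> restr v T2 x = elem_grad v T2 \<bullet> x + b2"
    using elem_grad[OF vL T(2)] by metis
  let ?a = "elem_grad v T1 - elem_grad v T2" and ?j = "\<lambda>x. restr v T1 x - restr v T2 x"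
  have j: "?j x = ?a \<bullet> x + (b1 - b2)" if "x \<in> ?S" for x
    using that b1 b2 by (simp add: inner_diff_left)
  have "?S \<in> interior_sides \<Omega> \<T>"
    using rel_interior_facet_subset[OF T(1-3,5,6)] T by (auto simp: interior_sides_def sides_def)
  then have mean: "(LINT x:?S|hyperplane_measure (affine hull ?S). ?j x) = 0"
    using v T by (simp add: S1cr_D_def)
  obtain x where x: "x \<in> ?S" "?j x = 0"
  proof (rule s1.facet_eq_face[OF T(5)])
    fix v0 assume v0: "v0 \<in> verts T1" "?S = s1.face v0" "affine hull s1.face v0 = {x. bary T1 v0 x = 0}"
    have "\<exists>x\<in>s1.face v0. ?j x = 0"
      by (rule s1.affine_zero_mean_zero[OF v0(1,3)]) (use mean j in \<open>simp_all only: v0(2)\<close>)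
    then show thesis using that v0(2) by blast
  qed
  have "?j \<nu> = ?a \<bullet> (\<nu> - x)" using j[OF T(4)] j[OF x(1)] x(2) by (simp add: inner_diff_right)
  then have "\<bar>?j \<nu>\<bar> \<le> norm ?a * dist \<nu> x" using Cauchy_Schwarz_ineq2[of ?a "\<nu> - x"] by (simp add: dist_norm)
  also have "\<dots> \<le> norm ?a * side_size T1"
    using s1.facet_dist_le[OF T(5,4) x(1)] by (intro mult_left_mono) (auto simp: side_size_def)
  finally show ?thesis .
qed

lemma chain_jump_le:
  assumes v: "v \<in> S1cr_D \<Omega> \<Gamma> \<T>"
    and D: "\<And>T. T \<in> star \<nu> \<Longrightarrow> side_size T \<le> D" and M: "\<And>T. T \<in> star \<nu> \<Longrightarrow> norm (elem_grad v T - r) \<le> M"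
    and T: "T \<in> star \<nu>"
  shows "(T, T') \<in> adjacent \<nu> ^^ n \<Longrightarrow> \<bar>restr v T \<nu> - restr v T' \<nu>\<bar> \<le> real n * (2 * M * D)"
proof (induction n arbitrary: T')
  case (Suc n)
  then obtain T1 where T1: "(T, T1) \<in> adjacent \<nu> ^^ n" "(T1, T') \<in> adjacent \<nu>" by auto
  have st: "T1 \<in> star \<nu>" "T' \<in> star \<nu>" using T1(2) by (auto simp: adjacent_def)
  have M0: "M \<ge> 0" using M[OF T] norm_ge_zero order_trans by blast
  have "norm (elem_grad v T1 - elem_grad v T') \<le> norm (elem_grad v T1 - r) + norm (elem_grad v T' - r)"
    using norm_triangle_ineq4[of "elem_grad v T1 - r" "elem_grad v T' - r"] by simp
  then have g: "norm (elem_grad v T1 - elem_grad v T') \<le> 2 * M" using M[OF st(1)] M[OF st(2)] by linarith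
  have "\<bar>restr v T1 \<nu> - restr v T' \<nu>\<bar> \<le> norm (elem_grad v T1 - elem_grad v T') * side_size T1"
    by (rule jump_le[OF v T1(2)])
  also have "\<dots> \<le> 2 * M * D"
    using g D[OF st(1)] side_size_nonneg[of T1] st(1) star_subset M0 by (intro mult_mono) auto
  finally have "\<bar>restr v T1 \<nu> - restr v T' \<nu>\<bar> \<le> 2 * M * D" .
  then show ?case using Suc.IH[OF T1(1)] by (simp add: distrib_right)
qed simp

lemma star_jump_le:
  assumes v: "v \<in> S1cr_D \<Omega> \<Gamma> \<T>"
    and D: "\<And>T. T \<in> star \<nu> \<Longrightarrow> side_size T \<le> D" and M: "\<And>T. T \<in> star \<nu> \<Longrightarrow> norm (elem_grad v T - r) \<le> M"
    and T: "T \<in> star \<nu>" "T' \<in> star \<nu>"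
  shows "\<bar>restr v T \<nu> - restr v T' \<nu>\<bar> \<le> real chain_bound * (2 * M * D)"
proof -
  obtain n where n: "n \<le> chain_bound" "(T, T') \<in> adjacent \<nu> ^^ n" using chain_ex[OF T] by blast
  have "M \<ge> 0" using M[OF T(1)] norm_ge_zero order_trans by blast
  moreover have "D \<ge> 0" using D[OF T(1)] side_size_nonneg[of T] T(1) star_subset by force
  ultimately have "real n * (2 * M * D) \<le> real chain_bound * (2 * M * D)"
    using n(1) by (intro mult_right_mono) auto
  then show ?thesis using chain_jump_le[OF v D M T(1) n(2)] by linarith
qed

definition "mean_error v G T = (LINT x:interior T|lebesgue. norm (elem_grad v T - G x)) / measure lebesgue T"

text \<open>The trace vanishes at some \<open>x\<close> of the side, so the value at
  \<open>\<nu>\<close> is \<open>elem_grad v T \<bullet> (\<nu> - x)\<close>. As \<open>x\<close> is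
  a convex combination of the vertices of the side, this is an average of the vertex differences
  already estimated.\<close>

lemma dirichlet_value_le:
  assumes v: "v \<in> S1cr_D \<Omega> \<Gamma> \<T>" and u: "u \<in> W11_D \<Omega> \<Gamma>" "has_weak_gradient \<Omega> u G"
    and T: "T \<in> \<T>" and S: "S \<in> sides_in \<Omega> \<T> \<Gamma>" "S facet_of T" and \<nu>: "\<nu> \<in> verts T" "\<nu> \<in> S"
  shows "\<bar>restr v T \<nu>\<bar> \<le> 2 * (DIM('a) + 1) * side_size T * mean_error v G T"
proof -
  interpret full_simplex T using full T by blast
  have vL: "v \<in> L1_elem \<T>" using v by (simp add: S1cr_D_def)
  obtain b where b: "\<And>x. x \<in> T \<Longrightarrow> restr v T x = elem_grad v T \<bullet> x + b"
    using elem_grad[OF vL T] by metis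
  let ?a = "elem_grad v T"
  show ?thesis
  proof (rule facet_eq_face[OF S(2)])
    fix v0 assume v0: "v0 \<in> verts T" "S = face v0" "affine hull face v0 = {x. bary T v0 x = 0}"
    have "(LINT x:S|hyperplane_measure (affine hull S). restr v T x) = 0"
      using v S T by (simp add: S1cr_D_def)
    then have "\<exists>x\<in>face v0. restr v T x = 0"
      using b by (intro affine_zero_mean_zero[OF v0(1,3), where a = ?a and b = b]) (auto simp: v0(2) face_def)
    then obtain x where x: "x \<in> face v0" "restr v T x = 0" by blast
    then have xT: "x \<in> T" by (simp add: face_def)
    have \<nu>T: "\<nu> \<in> T" using \<nu>(1) verts_subset by blast
    have val: "restr v T \<nu> = ?a \<bullet> (\<nu> - x)" using b[OF xT] b[OF \<nu>T] x(2) by (simp add: inner_diff_right)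
    show ?thesis
    proof (cases "DIM('a) = 1")
      case True
      then have "dist \<nu> x = 0" using facet_dist_le[OF S(2) \<nu>(2), of x] x v0(2) by simp
      then show ?thesis using val True by (simp add: side_size_def)
    next
      case False
      then have d: "DIM('a) \<ge> 2" using DIM_positive[where 'a='a] by linarith
      let ?E = "2 * (DIM('a) + 1) * diameter T * mean_error v G T"
      have aff: "affine hull S = {x. bary T v0 x = 0}" using v0 by simp
      have pos: "measure lebesgue T > 0" by (rule content_pos[OF T])
      have \<nu>0: "\<nu> \<noteq> v0" using \<nu>(2) v0(2) bary_vert[OF v0(1) v0(1)] by (auto simp: face_def)
      have diff: "\<bar>?a \<bullet> (\<nu> - w)\<bar> \<le> ?E" if "w \<in> verts T - {v0}" for w
      proof -
        have "\<bar>?a \<bullet> (\<nu> - w)\<bar> * measure lebesgue T / (DIM('a) + 1)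
            \<le> 2 * diameter T * (LINT x:interior T|lebesgue. norm (?a - G x))"
          using dirichlet_vertex_difference[OF T S(2,1) u v0(1,2) aff _ that d, of \<nu> ?a] \<nu>(1) \<nu>0 by simp
        then show ?thesis using pos by (simp add: mean_error_def field_simps)
      qed
      have E0: "?E \<ge> 0" using diff[of \<nu>] \<nu>(1) \<nu>0 by force
      have x0: "bary T v0 x = 0" using x(1) by (simp add: face_def)
      have "restr v T \<nu> = (\<Sum>w\<in>verts T. bary T w x * (- ?a \<bullet> w + ?a \<bullet> \<nu>))"
        unfolding bary_affine val by (simp add: inner_diff_right)
      also have "\<dots> = (\<Sum>w\<in>verts T. bary T w x * (?a \<bullet> (\<nu> - w)))"
        by (simp add: inner_diff_right)
      finally have "\<bar>restr v T \<nu>\<bar> \<le> (\<Sum>w\<in>verts T. \<bar>bary T w x * (?a \<bullet> (\<nu> - w))\<bar>)"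
        using sum_abs by simp
      also have "\<dots> \<le> (\<Sum>w\<in>verts T. bary T w x * ?E)"
      proof (rule sum_mono)
        fix w assume w: "w \<in> verts T"
        have b0: "bary T w x \<ge> 0" using xT w mem_iff_bary by blast
        show "\<bar>bary T w x * (?a \<bullet> (\<nu> - w))\<bar> \<le> bary T w x * ?E"
        proof (cases "w = v0")
          case True
          then show ?thesis using x0 by simp
        next
          case False
          then have "bary T w x * \<bar>?a \<bullet> (\<nu> - w)\<bar> \<le> bary T w x * ?E"
            using diff[of w] w b0 by (intro mult_left_mono) auto
          then show ?thesis using b0 by (simp add: abs_mult)
        qed
      qed
      also have "\<dots> = ?E" by (simp only: sum_distrib_right[symmetric] bary_sum mult_1)
      finally show ?thesis using False by (simp add: side_size_def)
    qed
  qed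
qed

text \<open>At a Dirichlet node the side may belong to another element than \<open>T\<close>; the
  value is bounded there and carried over to \<open>T\<close> through the star. At other nodes the
  error is an average of jumps.\<close>

lemma node_error_le:
  assumes v: "v \<in> S1cr_D \<Omega> \<Gamma> \<T>" and u: "u \<in> W11_D \<Omega> \<Gamma>" "has_weak_gradient \<Omega> u G"
    and res: "mesh_resolves \<Omega> \<Gamma> \<Gamma>' \<T>"
    and T: "T \<in> \<T>" "\<nu> \<in> verts T"
    and D: "\<And>T. T \<in> star \<nu> \<Longrightarrow> side_size T \<le> D" and M: "\<And>T. T \<in> star \<nu> \<Longrightarrow> norm (elem_grad v T - r) \<le> M"
    and M': "\<And>T. T \<in> star \<nu> \<Longrightarrow> mean_error v G T \<le> M"
  shows "\<bar>node_average \<Gamma> \<T> v \<nu> - restr v T \<nu>\<bar> \<le> 2 * (real chain_bound + real DIM('a) + 1) * M * D"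
proof -
  have Ts: "T \<in> star \<nu>" using T full full_simplex.verts_subset by (auto simp: star_def)
  have M0: "M \<ge> 0" using M[OF Ts] norm_ge_zero order_trans by blast
  have D0: "D \<ge> 0" using D[OF Ts] side_size_nonneg[OF T(1)] by linarith
  let ?c = "real chain_bound * (2 * M * D)"
  have jump: "\<bar>restr v T' \<nu> - restr v T \<nu>\<bar> \<le> ?c" if "T' \<in> star \<nu>" for T'
    by (rule star_jump_le[OF v D M that Ts])
  show ?thesis
  proof (cases "\<nu> \<in> \<Gamma>")
    case True
    have "\<nu> \<in> nodes \<T>" using T by (auto simp: nodes_eq)
    then obtain S where S: "S \<in> sides_in \<Omega> \<T> \<Gamma>" "\<nu> \<in> S" using res True by (auto simp: mesh_resolves_def)
    then obtain T' where T': "T' \<in> \<T>" "S facet_of T'" by (auto simp: sides_in_def boundary_sides_def sides_def)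
    have \<nu>T': "\<nu> \<in> T'" using facet_of_imp_subset[OF T'(2)] S(2) by blast
    then have st: "T' \<in> star \<nu>" using T' by (simp add: star_def)
    have \<nu>v: "\<nu> \<in> verts T'" by (rule verts_transfer[OF T(1) T'(1) T(2) \<nu>T'])
    have "\<bar>restr v T' \<nu>\<bar> \<le> 2 * (DIM('a) + 1) * side_size T' * mean_error v G T'"
      by (rule dirichlet_value_le[OF v u T'(1) S(1) T'(2) \<nu>v S(2)])
    also have "\<dots> \<le> 2 * (DIM('a) + 1) * side_size T' * M"
      using M'[OF st] side_size_nonneg[OF T'(1)] by (intro mult_left_mono) auto
    also have "\<dots> \<le> 2 * (DIM('a) + 1) * D * M"
      using D[OF st] M0 by (intro mult_right_mono mult_left_mono) auto
    finally have "\<bar>restr v T \<nu>\<bar> \<le> 2 * (DIM('a) + 1) * D * M + ?c" using jump[OF st] by linarith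
    then show ?thesis using True by (simp add: node_average_def algebra_simps)
  next
    case False
    have cpos: "real (card (star \<nu>)) > 0" using Ts finite_star card_gt_0_iff by fastforce
    have "node_average \<Gamma> \<T> v \<nu> = (\<Sum>T'\<in>star \<nu>. restr v T' \<nu>) / real (card (star \<nu>))"
      using False by (simp add: node_average_def star_def)
    then have "node_average \<Gamma> \<T> v \<nu> - restr v T \<nu> = (\<Sum>T'\<in>star \<nu>. restr v T' \<nu> - restr v T \<nu>) / real (card (star \<nu>))"
      using cpos by (simp add: sum_subtractf diff_divide_distrib)
    then have "\<bar>node_average \<Gamma> \<T> v \<nu> - restr v T \<nu>\<bar> = \<bar>\<Sum>T'\<in>star \<nu>. restr v T' \<nu> - restr v T \<nu>\<bar> / real (card (star \<nu>))"
      by (simp add: abs_divide)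
    also have "\<dots> \<le> (\<Sum>T'\<in>star \<nu>. ?c) / real (card (star \<nu>))"
      by (intro divide_right_mono order_trans[OF sum_abs] sum_mono jump) auto
    also have "\<dots> = ?c" using cpos by simp
    also have "\<dots> \<le> 2 * (real chain_bound + real DIM('a) + 1) * M * D"
    proof -
      have "real chain_bound * (2 * (M * D)) \<le> (real chain_bound + real DIM('a) + 1) * (2 * (M * D))"
        using M0 D0 by (intro mult_right_mono) auto
      then show ?thesis by (simp add: mult_ac)
    qed
    finally show ?thesis .
  qed
qed

text \<open>An inverse estimate: the gradient difference is the sum of the node errors times
  barycentric gradients, and each of the latter has length at most
  \<open>\<kappa> / (2 * diameter T)\<close>.\<close>

lemma averaging_grad_diff_le:
  assumes v: "v \<in> S1cr_D \<Omega> \<Gamma> \<T>" and u: "u \<in> W11_D \<Omega> \<Gamma>" "has_weak_gradient \<Omega> u G"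
    and res: "mesh_resolves \<Omega> \<Gamma> \<Gamma>' \<T>" and T: "T \<in> \<T>" and x: "x \<in> interior T"
    and D: "\<And>T'. T' \<in> patch T \<Longrightarrow> side_size T' \<le> D" and M: "\<And>T'. T' \<in> patch T \<Longrightarrow> norm (elem_grad v T' - r) \<le> M"
    and M': "\<And>T'. T' \<in> patch T \<Longrightarrow> mean_error v G T' \<le> M"
  shows "norm (grad (node_averaging \<Gamma> \<T> v) x - elem_grad v T)
    \<le> real (DIM('a) + 1) * (real chain_bound + real DIM('a) + 1) * M * D * \<kappa> / diameter T"
proof -
  interpret full_simplex T using full T by blast
  have vL: "v \<in> L1_elem \<T>" using v by (simp add: S1cr_D_def)
  let ?e = "\<lambda>\<nu>. node_average \<Gamma> \<T> v \<nu> - restr v T \<nu>"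
  let ?B = "2 * (real chain_bound + real DIM('a) + 1) * M * D"
  have h: "diameter T > 0" by (rule diameter_pos[OF T])
  obtain z R where R: "R > 0" "ball z R \<subseteq> T" "diameter T \<le> \<kappa> * R" using shape T by blast
  have gr: "norm (bary_grad T \<nu>) \<le> \<kappa> / (2 * diameter T)" if "\<nu> \<in> verts T" for \<nu>
  proof -
    have "2 * R * norm (bary_grad T \<nu>) \<le> 1" by (rule norm_bary_grad_le[OF R(2,1) that])
    then have "\<kappa> * (2 * R * norm (bary_grad T \<nu>)) \<le> \<kappa> * 1" using kappa by (intro mult_left_mono) auto
    moreover have "2 * diameter T * norm (bary_grad T \<nu>) \<le> 2 * (\<kappa> * R) * norm (bary_grad T \<nu>)"
      using R(3) by (intro mult_right_mono) auto
    ultimately have "2 * diameter T * norm (bary_grad T \<nu>) \<le> \<kappa>" by (simp add: mult_ac)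
    then show ?thesis using h by (simp add: le_divide_eq mult_ac)
  qed
  have err: "\<bar>?e \<nu>\<bar> \<le> ?B" if \<nu>: "\<nu> \<in> verts T" for \<nu>
  proof -
    have sub: "star \<nu> \<subseteq> patch T" using star_subset_patch[OF T] \<nu> verts_subset by blast
    show ?thesis
      by (rule node_error_le[OF v u res T \<nu>, of D r M]) (use sub D M M' in blast)+
  qed
  have "grad (node_averaging \<Gamma> \<T> v) x - elem_grad v T = (\<Sum>\<nu>\<in>verts T. ?e \<nu> *\<^sub>R bary_grad T \<nu>)"
    unfolding node_averaging_grad[OF T x] elem_grad_vertices[OF vL T]
    by (simp add: sum_subtractf[symmetric] scaleR_diff_left)
  then have "norm (grad (node_averaging \<Gamma> \<T> v) x - elem_grad v T) \<le> (\<Sum>\<nu>\<in>verts T. \<bar>?e \<nu>\<bar> * norm (bary_grad T \<nu>))"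
    using norm_sum[of "\<lambda>\<nu>. ?e \<nu> *\<^sub>R bary_grad T \<nu>" "verts T"] by simp
  also have "\<dots> \<le> (\<Sum>\<nu>\<in>verts T. ?B * (\<kappa> / (2 * diameter T)))"
  proof (intro sum_mono mult_mono err gr)
    fix \<nu> assume "\<nu> \<in> verts T"
    then show "0 \<le> ?B" using err[of \<nu>] abs_ge_zero order_trans by blast
  qed auto
  also have "\<dots> = real (DIM('a) + 1) * (?B * (\<kappa> / (2 * diameter T)))" by (simp add: card_verts)
  also have "\<dots> = real (DIM('a) + 1) * (real chain_bound + real DIM('a) + 1) * M * D * \<kappa> / diameter T"
    using h by (simp add: field_simps)
  finally show ?thesis .
qed

end

section \<open>Nikolskii seminorms\<close>

text \<open>Joint measurability in a point and a translation, as required for Fubini's theorem, is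
  available for a Borel function.\<close>

lemma lebesgue_measurable_borel_representative:
  fixes f :: "'a::euclidean_space \<Rightarrow> 'b::euclidean_space"
  assumes "f \<in> borel_measurable lebesgue"
  obtains g where "g \<in> borel_measurable borel" "AE x in lborel. f x = g x"
proof -
  have "\<exists>g\<in>borel_measurable lborel. AE x in lborel. f x \<bullet> b = g x" if "b \<in> Basis" for b
    using assms by (intro completion_ex_borel_measurable_real borel_measurable_inner) auto
  then obtain g where g: "\<And>b. b \<in> Basis \<Longrightarrow> g b \<in> borel_measurable lborel"
    "\<And>b. b \<in> Basis \<Longrightarrow> AE x in lborel. f x \<bullet> b = g b x" by metis
  have "AE x in lborel. \<forall>b\<in>Basis. f x \<bullet> b = g b x" using g(2) by (intro AE_finite_allI) auto
  then have "AE x in lborel. f x = (\<Sum>b\<in>Basis. g b x *\<^sub>R b)"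
  proof eventually_elim
    case (elim x)
    then have "(\<Sum>b\<in>Basis. g b x *\<^sub>R b) = (\<Sum>b\<in>Basis. (f x \<bullet> b) *\<^sub>R b)" by (intro sum.cong) auto
    then show ?case by (simp add: euclidean_representation)
  qed
  moreover have "(\<lambda>x. \<Sum>b\<in>Basis. g b x *\<^sub>R b) \<in> borel_measurable borel"
    using g(1) by (intro borel_measurable_sum borel_measurable_scaleR) auto
  ultimately show ?thesis using that by blast
qed

lemma Lp_norm_2_squared: "(Lp_norm 2 A f)\<^sup>2 = (LINT x:A|lebesgue. (norm (f x))\<^sup>2)"
proof -
  have "(LINT x:A|lebesgue. norm (f x) powr 2) \<ge> 0"
    unfolding set_lebesgue_integral_def by (intro Bochner_Integration.integral_nonneg) auto
  then show ?thesis by (simp add: Lp_norm_def powr_half_sqrt)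
qed

lemma AE_lborel_translate:
  fixes c :: "'a::euclidean_space"
  assumes "AE x in lborel. P x"
  shows "AE x in lborel. P (x + c)"
proof -
  have "AE x in distr lborel borel ((+) c). P x" unfolding lborel_distr_plus by (rule assms)
  then have "AE x in lborel. P (c + x)" by (rule AE_distrD[rotated]) simp
  then show ?thesis by (simp add: add.commute)
qed

lemma nikolskii_translation_le:
  fixes f :: "'a::euclidean_space \<Rightarrow> 'b::euclidean_space"
  assumes f: "f \<in> nikolskii_space \<beta> 2 U" and h: "h \<noteq> 0"
  shows "(LINT x:{x \<in> U. x + h \<in> U}|lebesgue. (norm (f (x + h) - f x))\<^sup>2)
    \<le> norm h powr (2 * \<beta>) * (nikolskii_seminorm \<beta> 2 U f)\<^sup>2"
proof -
  let ?L = "Lp_norm 2 {x \<in> U. x + h \<in> U} (\<lambda>x. f (x + h) - f x)"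
  have "norm h powr (- \<beta>) * ?L \<in> nikolskii_quotients \<beta> 2 U f"
    using h unfolding nikolskii_quotients_def by blast
  then have q: "norm h powr (- \<beta>) * ?L \<le> nikolskii_seminorm \<beta> 2 U f"
    unfolding nikolskii_seminorm_def using f by (intro cSup_upper) (auto simp: nikolskii_space_def)
  have L0: "?L \<ge> 0" by (simp add: Lp_norm_def)
  have hp: "norm h powr \<beta> > 0" using h by simp
  have "?L = norm h powr \<beta> * (norm h powr (- \<beta>) * ?L)" using hp by (simp add: powr_minus)
  also have "\<dots> \<le> norm h powr \<beta> * nikolskii_seminorm \<beta> 2 U f" using q hp by (intro mult_left_mono) auto
  finally have "?L\<^sup>2 \<le> (norm h powr \<beta> * nikolskii_seminorm \<beta> 2 U f)\<^sup>2" using L0 by (intro power_mono)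
  also have "\<dots> = norm h powr (2 * \<beta>) * (nikolskii_seminorm \<beta> 2 U f)\<^sup>2"
    using h by (simp add: power_mult_distrib power2_eq_square powr_add[symmetric])
  finally show ?thesis unfolding Lp_norm_2_squared .
qed

text \<open>Averaging the Nikolskii bound over all translations of length at most \<open>d\<close>; no chain of
  convex subsets of \<open>U\<close> is needed.\<close>

lemma nikolskii_oscillation:
  fixes f :: "'a::euclidean_space \<Rightarrow> 'b::euclidean_space"
  assumes f: "f \<in> nikolskii_space \<beta> 2 U" and U: "U \<in> sets borel" "bounded U"
    and d: "\<And>x y. x \<in> U \<Longrightarrow> y \<in> U \<Longrightarrow> dist x y \<le> d" and \<beta>: "\<beta> > 0"
    and c: "d powr (2 * \<beta>) * (nikolskii_seminorm \<beta> 2 U f)\<^sup>2 * measure lebesgue (cball (0::'a) d) < c * measure lebesgue U"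
  shows "\<exists>y\<in>U. (LINT x:U|lebesgue. (norm (f x - f y))\<^sup>2) \<le> c"
proof -
  let ?S = "nikolskii_seminorm \<beta> 2 U f"
  have fm: "(\<lambda>x. indicator U x *\<^sub>R f x) \<in> borel_measurable lebesgue"
    and f2: "set_integrable lebesgue U (\<lambda>x. (norm (f x))\<^sup>2)"
    using f by (auto simp: nikolskii_space_def Lp_space_def set_borel_measurable_def)
  obtain g where gm [measurable]: "g \<in> borel_measurable borel"
    and gae: "AE x in lborel. indicator U x *\<^sub>R f x = g x"
    using lebesgue_measurable_borel_representative[OF fm] .
  have [measurable]: "U \<in> sets borel" by (rule U(1))
  have U_fin: "emeasure lborel U < \<infinity>" by (rule emeasure_bounded_finite[OF U(2)])
  have mU: "emeasure lborel U = ennreal (measure lebesgue U)"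
    using U_fin U(1) emeasure_eq_ennreal_measure[of lborel U] by simp
  have g2: "(\<integral>\<^sup>+x. ennreal (indicator U x * (norm (g x))\<^sup>2) \<partial>lborel) < \<infinity>"
  proof -
    have "integrable lebesgue (\<lambda>x. indicator U x * (norm (f x))\<^sup>2)" using f2 by (simp add: set_integrable_def)
    then have "(\<integral>\<^sup>+x. ennreal (norm (indicator U x * (norm (f x))\<^sup>2)) \<partial>lebesgue) < \<infinity>" by (simp add: integrable_iff_bounded)
    also have "(\<integral>\<^sup>+x. ennreal (norm (indicator U x * (norm (f x))\<^sup>2)) \<partial>lebesgue) =
        (\<integral>\<^sup>+x. ennreal (indicator U x * (norm (g x))\<^sup>2) \<partial>lebesgue)"
      using AE_completion[OF gae] by (intro nn_integral_cong_AE) (auto simp: indicator_def elim!: eventually_mono)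
    also have "\<dots> = (\<integral>\<^sup>+x. ennreal (indicator U x * (norm (g x))\<^sup>2) \<partial>lborel)"
      by (rule nn_integral_completion)
    finally show ?thesis .
  qed
  define k where "k h x = indicator U x * indicator U (x + h) * (norm (g (x + h) - g x))\<^sup>2" for h x
  have km [measurable]: "(\<lambda>(h, x). ennreal (k h x)) \<in> borel_measurable (borel \<Otimes>\<^sub>M borel)"
    unfolding k_def by measurable
  define J where "J h = (\<integral>\<^sup>+x. ennreal (k h x) \<partial>lborel)" for h
  let ?K = "d powr (2 * \<beta>) * ?S\<^sup>2"
  \<comment> \<open>A translation longer than \<open>d\<close> moves no point of \<open>U\<close>
    into \<open>U\<close>. For the other ones the Nikolskii bound is taken at the largest length
    \<open>d\<close>.\<close>
  have J_le: "J h \<le> ennreal ?K * indicator (cball 0 d) h" for h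
  proof (cases "h = 0 \<or> norm h > d")
    case True
    have "k h x = 0" for x
    proof (cases "x \<in> U \<and> x + h \<in> U \<and> norm h > d")
      case True
      then have "norm h \<le> d" using d[of "x + h" x] by (simp add: dist_norm)
      then show ?thesis using True by simp
    qed (use True in \<open>auto simp: k_def\<close>)
    then show ?thesis by (simp add: J_def)
  next
    case False
    let ?V = "{x \<in> U. x + h \<in> U}"
    have hm [measurable]: "(\<lambda>x. k h x) \<in> borel_measurable borel" unfolding k_def by measurable
    have k0: "k h x \<ge> 0" for x by (simp add: k_def)
    have kf: "AE x in lebesgue. indicator ?V x *\<^sub>R (norm (f (x + h) - f x))\<^sup>2 = k h x"
    proof (rule AE_completion)
      show "AE x in lborel. indicator ?V x *\<^sub>R (norm (f (x + h) - f x))\<^sup>2 = k h x"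
        using gae AE_lborel_translate[OF gae, of h]
        by eventually_elim (auto simp: k_def indicator_def)
    qed
    have J_fin: "J h < \<infinity>"
    proof -
      have "J h \<le> (\<integral>\<^sup>+x. 2 * ennreal (indicator U (x + h) * (norm (g (x + h)))\<^sup>2) + 2 * ennreal (indicator U x * (norm (g x))\<^sup>2) \<partial>lborel)"
        unfolding J_def
      proof (intro nn_integral_mono)
        fix x
        have "(norm (g (x + h) - g x))\<^sup>2 \<le> (norm (g (x + h)) + norm (g x))\<^sup>2"
          by (intro power_mono norm_triangle_ineq4) auto
        also have "\<dots> \<le> 2 * (norm (g (x + h)))\<^sup>2 + 2 * (norm (g x))\<^sup>2"
          using zero_le_power2[of "norm (g (x + h)) - norm (g x)"] by (simp add: power2_eq_square algebra_simps)
        finally have "k h x \<le> 2 * (indicator U (x + h) * (norm (g (x + h)))\<^sup>2) + 2 * (indicator U x * (norm (g x))\<^sup>2)"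
          by (auto simp: k_def indicator_def)
        then have "ennreal (k h x) \<le> ennreal (2 * (indicator U (x + h) * (norm (g (x + h)))\<^sup>2) + 2 * (indicator U x * (norm (g x))\<^sup>2))"
          by (rule ennreal_leI)
        also have "\<dots> = 2 * ennreal (indicator U (x + h) * (norm (g (x + h)))\<^sup>2) + 2 * ennreal (indicator U x * (norm (g x))\<^sup>2)"
          by (simp add: ennreal_plus ennreal_mult)
        finally show "ennreal (k h x) \<le> 2 * ennreal (indicator U (x + h) * (norm (g (x + h)))\<^sup>2) + 2 * ennreal (indicator U x * (norm (g x))\<^sup>2)" .
      qed
      also have "\<dots> = 2 * (\<integral>\<^sup>+x. ennreal (indicator U (x + h) * (norm (g (x + h)))\<^sup>2) \<partial>lborel) + 2 * (\<integral>\<^sup>+x. ennreal (indicator U x * (norm (g x))\<^sup>2) \<partial>lborel)"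
        by (subst nn_integral_add) (auto simp: nn_integral_cmult)
      also have "(\<integral>\<^sup>+x. ennreal (indicator U (x + h) * (norm (g (x + h)))\<^sup>2) \<partial>lborel) =
          (\<integral>\<^sup>+x. ennreal (indicator U x * (norm (g x))\<^sup>2) \<partial>distr lborel borel ((+) h))"
        by (subst nn_integral_distr) (auto simp: add.commute)
      also have "\<dots> = (\<integral>\<^sup>+x. ennreal (indicator U x * (norm (g x))\<^sup>2) \<partial>lborel)" by (simp add: lborel_distr_plus)
      finally show ?thesis using g2 by (auto intro: le_less_trans simp: ennreal_mult_less_top)
    qed
    have "(LINT x:?V|lebesgue. (norm (f (x + h) - f x))\<^sup>2) = enn2real (J h)"
    proof -
      have "(LINT x:?V|lebesgue. (norm (f (x + h) - f x))\<^sup>2) = (LINT x|lebesgue. k h x)"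
        unfolding set_lebesgue_integral_def
      proof (rule integral_cong_AE)
        show km': "(\<lambda>x. k h x) \<in> borel_measurable lebesgue" by (rule measurable_completion) simp
        show "(\<lambda>x. indicator ?V x *\<^sub>R (norm (f (x + h) - f x))\<^sup>2) \<in> borel_measurable lebesgue"
          by (rule borel_measurable_AE[OF km' AE_symmetric[OF kf]])
      qed (rule kf)
      also have "\<dots> = (LINT x|lborel. k h x)" by (intro integral_completion) simp
      also have "\<dots> = enn2real (J h)" unfolding J_def by (intro integral_eq_nn_integral) (auto simp: k0)
      finally show ?thesis .
    qed
    moreover have "(LINT x:?V|lebesgue. (norm (f (x + h) - f x))\<^sup>2) \<le> norm h powr (2 * \<beta>) * ?S\<^sup>2"
      by (rule nikolskii_translation_le[OF f]) (use False in simp)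
    moreover have "norm h powr (2 * \<beta>) * ?S\<^sup>2 \<le> ?K"
      using False \<beta> by (intro mult_right_mono powr_mono2) auto
    ultimately have "enn2real (J h) \<le> ?K" by linarith
    then have "J h \<le> ennreal ?K" using J_fin ennreal_leI[of "enn2real (J h)" ?K] by simp
    then show ?thesis using False by simp
  qed
  define I where "I y = (\<integral>\<^sup>+x. ennreal (indicator U x * (norm (g x - g y))\<^sup>2) \<partial>lborel)" for y
  have Im: "I \<in> borel_measurable borel" unfolding I_def by measurable
  \<comment> \<open>The substitution \<open>x = y + h\<close> turns the double integral over
    \<open>U\<close> into an integral over translations.\<close>
  have "(\<integral>\<^sup>+y. indicator U y * I y \<partial>lborel) = (\<integral>\<^sup>+y. (\<integral>\<^sup>+h. ennreal (k h y) \<partial>lborel) \<partial>lborel)"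
  proof (intro nn_integral_cong)
    fix y
    have "indicator U y * I y = (\<integral>\<^sup>+x. ennreal (indicator U y * indicator U x * (norm (g x - g y))\<^sup>2) \<partial>lborel)"
      unfolding I_def by (auto simp: indicator_def)
    also have "\<dots> = (\<integral>\<^sup>+x. ennreal (indicator U y * indicator U x * (norm (g x - g y))\<^sup>2) \<partial>distr lborel borel ((+) y))"
      by (simp add: lborel_distr_plus)
    also have "\<dots> = (\<integral>\<^sup>+h. ennreal (k h y) \<partial>lborel)"
      by (subst nn_integral_distr) (auto simp: k_def)
    finally show "indicator U y * I y = (\<integral>\<^sup>+h. ennreal (k h y) \<partial>lborel)" .
  qed
  also have "\<dots> = (\<integral>\<^sup>+h. J h \<partial>lborel)" unfolding J_def
    by (rule lborel_pair.Fubini') (use km in simp)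
  also have "\<dots> \<le> (\<integral>\<^sup>+h. ennreal ?K * indicator (cball 0 d) h \<partial>(lborel :: 'a measure))" by (intro nn_integral_mono J_le)
  also have "\<dots> = ennreal ?K * emeasure lborel (cball (0::'a) d)" by (rule nn_integral_cmult_indicator) simp
  also have "emeasure lborel (cball (0::'a) d) = ennreal (measure lebesgue (cball (0::'a) d))"
    using emeasure_eq_ennreal_measure[of lborel "cball (0::'a) d"] emeasure_lborel_cball_finite[of "0::'a" d] by simp
  also have "ennreal ?K * ennreal (measure lebesgue (cball (0::'a) d)) = ennreal (?K * measure lebesgue (cball (0::'a) d))"
    by (simp add: ennreal_mult)
  also have "\<dots> < ennreal (c * measure lebesgue U)" using c by (intro ennreal_lessI) (auto intro: le_less_trans[rotated])
  finally have small: "(\<integral>\<^sup>+y. indicator U y * I y \<partial>lborel) < ennreal (c * measure lebesgue U)" .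
  have "?K * measure lebesgue (cball (0::'a) d) \<ge> 0" by simp
  then have cU: "0 < c * measure lebesgue U" using c by linarith
  then have c0: "c > 0" using measure_nonneg[of lebesgue U] by (simp add: zero_less_mult_iff)
  \<comment> \<open>A function with small mean is small at some point. The point must avoid the null
    set where \<open>f\<close> and its representative differ, because the value of \<open>f\<close>
    there is the comparison vector.\<close>
  have "\<exists>y\<in>U. g y = f y \<and> I y \<le> ennreal c"
  proof (rule ccontr)
    assume no: "\<not> ?thesis"
    have "ennreal (c * measure lebesgue U) = (\<integral>\<^sup>+y. ennreal c * indicator U y \<partial>lborel)"
      using c0 mU U(1) by (subst nn_integral_cmult_indicator) (auto simp: ennreal_mult)
    also have "\<dots> \<le> (\<integral>\<^sup>+y. indicator U y * I y \<partial>lborel)"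
    proof (rule nn_integral_mono_AE)
      show "AE y in lborel. ennreal c * indicator U y \<le> indicator U y * I y"
        using gae
      proof eventually_elim
        case (elim y)
        show ?case
        proof (cases "y \<in> U")
          case True
          then have "\<not> I y \<le> ennreal c" using no elim by auto
          then show ?thesis using True by simp
        qed simp
      qed
    qed
    finally show False using small by simp
  qed
  then obtain y where y: "y \<in> U" "g y = f y" "I y \<le> ennreal c" by blast
  have "(LINT x:U|lebesgue. (norm (f x - f y))\<^sup>2) = (LINT x|lebesgue. indicator U x * (norm (g x - g y))\<^sup>2)"
    unfolding set_lebesgue_integral_def
  proof (rule integral_cong_AE)
    show m: "(\<lambda>x. indicator U x * (norm (g x - g y))\<^sup>2) \<in> borel_measurable lebesgue"
      by (rule measurable_completion) measurable
    show ae: "AE x in lebesgue. indicator U x *\<^sub>R (norm (f x - f y))\<^sup>2 = indicator U x * (norm (g x - g y))\<^sup>2"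
      using AE_completion[OF gae] by eventually_elim (auto simp: indicator_def y(2))
    show "(\<lambda>x. indicator U x *\<^sub>R (norm (f x - f y))\<^sup>2) \<in> borel_measurable lebesgue"
      by (rule borel_measurable_AE[OF m AE_symmetric[OF ae]])
  qed
  also have "\<dots> = (LINT x|lborel. indicator U x * (norm (g x - g y))\<^sup>2)"
    by (intro integral_completion) measurable
  also have "\<dots> = enn2real (I y)" unfolding I_def by (intro integral_eq_nn_integral) auto
  also have "\<dots> \<le> c" using enn2real_mono[OF y(3)] c0 by simp
  finally show ?thesis using y(1) by blast
qed

section \<open>The local estimate\<close>

lemma
  fixes f :: "'a::euclidean_space \<Rightarrow> real"
  assumes sub: "B \<subseteq> A" and neg: "negligible (A - B)" and int: "set_integrable lebesgue B f"
  shows set_integrable_negligible_diff: "set_integrable lebesgue A f"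
    and set_integral_negligible_diff: "(LINT x:A|lebesgue. f x) = (LINT x:B|lebesgue. f x)"
proof -
  have ae: "AE x in lebesgue. indicator B x *\<^sub>R f x = indicator A x *\<^sub>R f x"
    using AE_not_in[OF neg[unfolded negligible_iff_null_sets]]
    by eventually_elim (use sub in \<open>auto simp: indicator_def\<close>)
  have i: "integrable lebesgue (\<lambda>x. indicator B x *\<^sub>R f x)" using int by (simp add: set_integrable_def)
  have m: "(\<lambda>x. indicator A x *\<^sub>R f x) \<in> borel_measurable lebesgue"
    by (rule borel_measurable_AE[OF borel_measurable_integrable[OF i] ae])
  show "set_integrable lebesgue A f"
    unfolding set_integrable_def by (rule integrable_cong_AE_imp[OF i m ae])
  show "(LINT x:A|lebesgue. f x) = (LINT x:B|lebesgue. f x)"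
    unfolding set_lebesgue_integral_def
    by (rule integral_cong_AE[OF m borel_measurable_integrable[OF i] AE_symmetric[OF ae]])
qed

lemma sq_norm_diff_le:
  fixes a b c :: "'a::real_normed_vector"
  shows "(norm (a - c))\<^sup>2 \<le> 2 * (norm (a - b))\<^sup>2 + 2 * (norm (b - c))\<^sup>2"
proof -
  have "norm (a - c) \<le> norm (a - b) + norm (b - c)" using norm_triangle_ineq[of "a - b" "b - c"] by simp
  then have "(norm (a - c))\<^sup>2 \<le> (norm (a - b) + norm (b - c))\<^sup>2" by (rule power_mono) simp
  also have "\<dots> \<le> 2 * (norm (a - b))\<^sup>2 + 2 * (norm (b - c))\<^sup>2"
    using zero_le_power2[of "norm (a - b) - norm (b - c)"] by (simp add: power2_eq_square algebra_simps)
  finally show ?thesis .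
qed

text \<open>The factor from \<open>averaging_grad_diff_le\<close>, with diameters in the patch
  compared to that of \<open>T\<close>; the \<open>1\<close> accounts for the distance from the
  element gradient to \<open>r\<close>.\<close>

definition gradient_const :: "real \<Rightarrow> nat \<Rightarrow> real" where
  "gradient_const \<kappa> d = 1 + real (d + 1) * (real ((star_bound \<kappa> d)\<^sup>2) + real d + 1) * \<kappa> ^ (star_bound \<kappa> d)\<^sup>2 * \<kappa>"

text \<open>The product of \<open>C\<^sub>F\<close> squared, \<open>volume_ratio\<close>, the
  scaling factor and the addition factor of the shifted function. The locale constants are written
  out so that the final constant can be named before a mesh is given.\<close>

definition local_const :: "real \<Rightarrow> nat \<Rightarrow> nat \<Rightarrow> real" where
  "local_const \<kappa> k d = (3 * (real (k + 3))\<^sup>2 + 36 * 6 ^ k)\<^sup>2 * (\<kappa> * \<kappa> ^ (star_bound \<kappa> d)\<^sup>2) ^ d *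
     (2 * gradient_const \<kappa> d) ^ (k + 2) * 2 ^ (k + 2)"

definition stability_const :: "real \<Rightarrow> nat \<Rightarrow> nat \<Rightarrow> real" where
  "stability_const \<kappa> k d = 6 * local_const \<kappa> k d + 2"

lemma gradient_const_ge_1: "\<kappa> \<ge> 1 \<Longrightarrow> gradient_const \<kappa> d \<ge> 1"
  unfolding gradient_const_def by simp

lemma local_const_nonneg: "\<kappa> \<ge> 1 \<Longrightarrow> local_const \<kappa> k d \<ge> 0"
  unfolding local_const_def using gradient_const_ge_1[of \<kappa> d] by simp

section \<open>The estimate for a fixed comparison vector\<close>

locale averaging_problem = shape_regular_mesh \<Omega> \<T> \<kappa> + regular_N_function \<phi> k
  for \<Omega> :: "'a::euclidean_space set" and \<T> \<kappa> \<phi> k +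
  fixes \<Gamma> \<Gamma>' :: "'a set" and v u :: "'a \<Rightarrow> real" and G :: "'a \<Rightarrow> 'a"
  assumes v: "v \<in> S1cr_D \<Omega> \<Gamma> \<T>" and u: "u \<in> W11_D \<Omega> \<Gamma>" and G: "has_weak_gradient \<Omega> u G"
    and resolves: "mesh_resolves \<Omega> \<Gamma> \<Gamma>' \<T>"
    and FG: "(\<lambda>x. F_map \<phi> (G x)) \<in> Lp_space 2 \<Omega>"
begin

abbreviation F :: "'a \<Rightarrow> 'a" where "F \<equiv> F_map \<phi>"

definition "error T = (LINT x:element_patch \<T> T|lebesgue. (norm (F (grad v x) - F (G x)))\<^sup>2)"
definition "oscillation T r = (LINT x:element_patch \<T> T|lebesgue. (norm (F (G x) - F r))\<^sup>2)"
definition "averaging_error T = (LINT x:T|lebesgue. (norm (F (grad (node_averaging \<Gamma> \<T> v) x) - F (G x)))\<^sup>2)"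

lemma cr_elementwise_affine: "v \<in> L1_elem \<T>" using v by (simp add: S1cr_D_def)

lemma square_integrable_diff:
  assumes T: "T \<in> \<T>"
  shows "set_integrable lebesgue (interior T) (\<lambda>x. (norm (c - F (G x)))\<^sup>2)"
    and "set_integrable lebesgue (interior T) (\<lambda>x. (norm (F (G x) - c))\<^sup>2)"
proof -
  have m: "(\<lambda>x. indicator \<Omega> x *\<^sub>R F (G x)) \<in> borel_measurable lebesgue"
    and i: "set_integrable lebesgue \<Omega> (\<lambda>x. norm (F (G x)) powr 2)"
    using FG by (auto simp: Lp_space_def set_borel_measurable_def)
  have om: "interior T \<in> sets lebesgue" by simp
  have b: "set_integrable lebesgue (interior T) (\<lambda>x. 2 * (norm c)\<^sup>2 + 2 * norm (F (G x)) powr 2)"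
    by (intro set_integral_add set_integrable_const_element T set_integrable_mult_right set_integrable_element[OF T i])
  show 1: "set_integrable lebesgue (interior T) (\<lambda>x. (norm (c - F (G x)))\<^sup>2)"
  proof (rule set_integrable_bound[OF b])
    have "(\<lambda>x. indicator (interior T) x * (norm (c - indicator \<Omega> x *\<^sub>R F (G x)))\<^sup>2) \<in> borel_measurable lebesgue"
      using m om by measurable
    moreover have "(\<lambda>x. indicator (interior T) x * (norm (c - indicator \<Omega> x *\<^sub>R F (G x)))\<^sup>2) =
        (\<lambda>x. indicator (interior T) x *\<^sub>R (norm (c - F (G x)))\<^sup>2)"
      using interior_element_subset[OF T] by (auto simp: indicator_def fun_eq_iff)
    ultimately show "set_borel_measurable lebesgue (interior T) (\<lambda>x. (norm (c - F (G x)))\<^sup>2)"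
      by (simp add: set_borel_measurable_def)
    show "AE x in lebesgue. x \<in> interior T \<longrightarrow>
        norm ((norm (c - F (G x)))\<^sup>2) \<le> norm (2 * (norm c)\<^sup>2 + 2 * norm (F (G x)) powr 2)"
      using sq_norm_diff_le[of c "F (G _)" 0] by (intro AE_I2 impI) simp
  qed
  then show "set_integrable lebesgue (interior T) (\<lambda>x. (norm (F (G x) - c))\<^sup>2)"
    by (simp add: norm_minus_commute)
qed

lemma integral_const_interior:
  assumes T: "T \<in> \<T>"
  shows "(LINT x:interior T|lebesgue. c) = measure lebesgue T * (c :: real)"
proof -
  interpret full_simplex T using full T by blast
  have "(LINT x:interior T|lebesgue. c) = (LINT x|lborel. indicator T x * c)"
    by (rule integral_interior_continuous) simp
  then show ?thesis using compact_T by simp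
qed

lemma patch_self: "T \<in> \<T> \<Longrightarrow> T \<in> patch T"
  using full full_simplex.interior_ne interior_subset by (fastforce simp: patch_def)

lemma negligible_patch_diff: "negligible (element_patch \<T> T - (\<Union>T'\<in>patch T. interior T'))"
proof (rule negligible_subset)
  show "negligible (\<Union>T'\<in>patch T. T' - interior T')"
    using finite_patch full full_simplex.negligible_frontier_T by (intro negligible_Union) (auto simp: patch_def)
  show "element_patch \<T> T - (\<Union>T'\<in>patch T. interior T') \<subseteq> (\<Union>T'\<in>patch T. T' - interior T')"
    unfolding element_patch_eq by blast
qed

lemma interiors_subset_patch: "(\<Union>T'\<in>patch T. interior T') \<subseteq> element_patch \<T> T"
  unfolding element_patch_eq using interior_subset by blast

lemma set_integrable_patch:
  fixes f :: "'a \<Rightarrow> real"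
  assumes "\<And>T'. T' \<in> patch T \<Longrightarrow> set_integrable lebesgue (interior T') f"
  shows "set_integrable lebesgue (element_patch \<T> T) f"
proof (rule set_integrable_negligible_diff[OF interiors_subset_patch negligible_patch_diff])
  show "set_integrable lebesgue (\<Union>T'\<in>patch T. interior T') f"
    using assms finite_patch by (intro set_integrable_UN) auto
qed

lemma integral_patch_ge:
  fixes f :: "'a \<Rightarrow> real"
  assumes "\<And>T'. T' \<in> patch T \<Longrightarrow> set_integrable lebesgue (interior T') f" "\<And>x. f x \<ge> 0" "T' \<in> patch T"
  shows "(LINT x:interior T'|lebesgue. f x) \<le> (LINT x:element_patch \<T> T|lebesgue. f x)"
  using assms interior_subset[of T']
  by (intro set_integral_subset_le set_integrable_patch) (auto simp: element_patch_eq)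

lemma error_integrable:
  assumes "T' \<in> \<T>"
  shows "set_integrable lebesgue (interior T') (\<lambda>x. (norm (F (grad v x) - F (G x)))\<^sup>2)"
    and "(LINT x:interior T'|lebesgue. (norm (F (grad v x) - F (G x)))\<^sup>2) =
      (LINT x:interior T'|lebesgue. (norm (F (elem_grad v T') - F (G x)))\<^sup>2)"
proof -
  have eq: "indicator (interior T') x *\<^sub>R (norm (F (elem_grad v T') - F (G x)))\<^sup>2 =
      indicator (interior T') x *\<^sub>R (norm (F (grad v x) - F (G x)))\<^sup>2" for x
    using grad_elem_grad[OF cr_elementwise_affine assms] by (auto simp: indicator_def)
  show "set_integrable lebesgue (interior T') (\<lambda>x. (norm (F (grad v x) - F (G x)))\<^sup>2)"
    using square_integrable_diff(1)[OF assms, of "F (elem_grad v T')"] unfolding set_integrable_def eq .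
  show "(LINT x:interior T'|lebesgue. (norm (F (grad v x) - F (G x)))\<^sup>2) =
      (LINT x:interior T'|lebesgue. (norm (F (elem_grad v T') - F (G x)))\<^sup>2)"
    unfolding set_lebesgue_integral_def eq ..
qed

lemma element_error_le:
  assumes "T' \<in> patch T"
  shows "(LINT x:interior T'|lebesgue. (norm (F (elem_grad v T') - F (G x)))\<^sup>2) \<le> error T"
proof -
  have "T' \<in> \<T>" using assms by (simp add: patch_def)
  then show ?thesis unfolding error_integrable(2)[OF \<open>T' \<in> \<T>\<close>, symmetric] error_def
    using assms by (intro integral_patch_ge error_integrable(1)) (auto simp: patch_def)
qed

lemma element_oscillation_le:
  assumes "T' \<in> patch T"
  shows "(LINT x:interior T'|lebesgue. (norm (F (G x) - F r))\<^sup>2) \<le> oscillation T r"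
  unfolding oscillation_def
  using assms by (intro integral_patch_ge square_integrable_diff(2)) (auto simp: patch_def)

lemma error_nonneg: "error T \<ge> 0" and oscillation_nonneg: "oscillation T r \<ge> 0"
  unfolding error_def oscillation_def set_lebesgue_integral_def
  by (auto intro!: Bochner_Integration.integral_nonneg)

definition "averaged_grad T = (\<Sum>\<nu>\<in>verts T. node_average \<Gamma> \<T> v \<nu> *\<^sub>R bary_grad T \<nu>)"

lemma averaging_error_eq:
  assumes T: "T \<in> \<T>"
  shows "averaging_error T = (LINT x:interior T|lebesgue. (norm (F (averaged_grad T) - F (G x)))\<^sup>2)"
proof -
  interpret full_simplex T using full T by blast
  let ?f = "\<lambda>x. (norm (F (grad (node_averaging \<Gamma> \<T> v) x) - F (G x)))\<^sup>2"
  have eq: "indicator (interior T) x *\<^sub>R (norm (F (averaged_grad T) - F (G x)))\<^sup>2 = indicator (interior T) x *\<^sub>R ?f x" for x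
    using node_averaging_grad[OF T] by (auto simp: indicator_def averaged_grad_def)
  have "set_integrable lebesgue (interior T) ?f"
    using square_integrable_diff(1)[OF T, of "F (averaged_grad T)"] unfolding set_integrable_def eq .
  then have "averaging_error T = (LINT x:interior T|lebesgue. ?f x)"
    unfolding averaging_error_def by (rule set_integral_negligible_diff[OF interior_subset negligible_frontier_T])
  then show ?thesis unfolding set_lebesgue_integral_def eq .
qed

text \<open>A single quantity above both inputs of \<open>node_error_le\<close>: the distance of the
  element gradient to \<open>r\<close>, which governs the jumps, and \<open>mean_error\<close>,
  which governs the Dirichlet nodes.\<close>

definition "mean_dist r T = (LINT x:interior T|lebesgue. norm (elem_grad v T - r) + norm (G x - r)) / measure lebesgue T"

lemma mean_dist:
  assumes T: "T \<in> \<T>"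
  shows "set_integrable lebesgue (interior T) (\<lambda>x. norm (elem_grad v T - r) + norm (G x - r))"
    and "norm (elem_grad v T - r) \<le> mean_dist r T" and "mean_error v G T \<le> mean_dist r T"
    and "measure lebesgue T * mean_dist r T = (LINT x:interior T|lebesgue. norm (elem_grad v T - r) + norm (G x - r))"
proof -
  have Gi: "set_integrable lebesgue (interior T) G"
    by (rule set_integrable_element[OF T W11_gradient_integrable[OF u G]])
  have i1: "set_integrable lebesgue (interior T) (\<lambda>x. norm (G x - r))"
    by (intro set_integrable_norm set_integral_diff Gi set_integrable_const_element T)
  have i2: "set_integrable lebesgue (interior T) (\<lambda>x. norm (elem_grad v T - r))"
    by (rule set_integrable_const_element[OF T])
  have i3: "set_integrable lebesgue (interior T) (\<lambda>x. norm (elem_grad v T - G x))"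
    by (intro set_integrable_norm set_integral_diff Gi set_integrable_const_element T)
  show int: "set_integrable lebesgue (interior T) (\<lambda>x. norm (elem_grad v T - r) + norm (G x - r))"
    by (rule set_integral_add(1)[OF i2 i1])
  have pos: "measure lebesgue T > 0" by (rule content_pos[OF T])
  then show eq: "measure lebesgue T * mean_dist r T = (LINT x:interior T|lebesgue. norm (elem_grad v T - r) + norm (G x - r))"
    by (simp add: mean_dist_def)
  have "(LINT x:interior T|lebesgue. norm (G x - r)) \<ge> 0"
    unfolding set_lebesgue_integral_def by (intro Bochner_Integration.integral_nonneg) auto
  then have "measure lebesgue T * norm (elem_grad v T - r) \<le> measure lebesgue T * mean_dist r T"
    unfolding eq set_integral_add(2)[OF i2 i1] integral_const_interior[OF T] by simp
  then show "norm (elem_grad v T - r) \<le> mean_dist r T" using pos by simp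
  have "(LINT x:interior T|lebesgue. norm (elem_grad v T - G x)) \<le> measure lebesgue T * mean_dist r T"
    unfolding eq
  proof (rule set_integral_mono[OF i3 int])
    fix x
    show "norm (elem_grad v T - G x) \<le> norm (elem_grad v T - r) + norm (G x - r)"
      using norm_triangle_ineq4[of "elem_grad v T - r" "G x - r"] by simp
  qed
  then show "mean_error v G T \<le> mean_dist r T"
    unfolding mean_error_def using pos by (simp add: divide_le_eq mult.commute)
qed

text \<open>The bound \<open>shifted_tangent\<close> is integrated over the element. As
  \<open>M\<close> is the mean of the integrand, subtracting \<open>M / 2\<close> leaves half the
  mean, and the common factor \<open>M / 2\<close> cancels.\<close>

lemma element_tangent_estimate:
  assumes T: "T' \<in> patch T" and M: "M = mean_dist r T'" "M > 0"
  shows "measure lebesgue T' * shifted (norm r) (M / 2) \<le> 2 ^ (k + 2) * C\<^sub>F * (2 * error T + 3 * oscillation T r)"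
proof -
  have T': "T' \<in> \<T>" using T by (simp add: patch_def)
  let ?a = "elem_grad v T'"
  let ?\<psi> = "shifted (norm r)"
  let ?u = "\<lambda>x. norm (?a - r) + norm (G x - r)"
  let ?W = "\<lambda>x. 2 ^ (k + 2) * C\<^sub>F * (2 * (norm (F ?a - F (G x)))\<^sup>2 + 3 * (norm (F (G x) - F r))\<^sup>2)"
  have C0: "C\<^sub>F \<ge> 0" using C_F_ge_1 by simp
  have pw: "?\<psi> (M / 2) * (?u x - M / 2) \<le> M / 2 * ?W x" for x
  proof -
    have "?\<psi> (?u x) \<le> 2 ^ (k + 2) * (?\<psi> (norm (?a - r)) + ?\<psi> (norm (G x - r)))"
      by (rule shifted_add) auto
    also have "\<dots> \<le> 2 ^ (k + 2) * (C\<^sub>F * (norm (F ?a - F r))\<^sup>2 + C\<^sub>F * (norm (F (G x) - F r))\<^sup>2)"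
      by (intro mult_left_mono add_mono shifted_le_F_map_diff) auto
    also have "\<dots> = 2 ^ (k + 2) * C\<^sub>F * ((norm (F ?a - F r))\<^sup>2 + (norm (F (G x) - F r))\<^sup>2)"
      by (simp add: algebra_simps)
    \<comment> \<open>The distance of \<open>F ?a\<close> to \<open>F r\<close> is split at
      \<open>F (G x)\<close>; this yields the weights \<open>2\<close> and
      \<open>2 + 1\<close>.\<close>
    also have "\<dots> \<le> ?W x"
      using sq_norm_diff_le[of "F ?a" "F r" "F (G x)"] C0 by (intro mult_left_mono) auto
    finally have 1: "?\<psi> (?u x) * (M / 2) \<le> ?W x * (M / 2)" using M(2) by (intro mult_right_mono) auto
    have "(?u x - M / 2) * ?\<psi> (M / 2) \<le> ?\<psi> (?u x) * (M / 2)" using M(2) by (intro shifted_tangent) auto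
    then show ?thesis using 1 by (simp add: mult.commute)
  qed
  note mi = mean_dist[OF T', of r]
  have i1: "set_integrable lebesgue (interior T') (\<lambda>x. ?\<psi> (M / 2) * (?u x - M / 2))"
    by (intro set_integrable_mult_right set_integral_diff mi(1) set_integrable_const_element T')
  have e1: "set_integrable lebesgue (interior T') (\<lambda>x. 2 * (norm (F ?a - F (G x)))\<^sup>2)"
    and e2: "set_integrable lebesgue (interior T') (\<lambda>x. 3 * (norm (F (G x) - F r))\<^sup>2)"
    by (intro set_integrable_mult_right square_integrable_diff T')+
  have i2: "set_integrable lebesgue (interior T') (\<lambda>x. M / 2 * ?W x)"
    by (intro set_integrable_mult_right set_integral_add e1 e2)
  have "(LINT x:interior T'|lebesgue. ?\<psi> (M / 2) * (?u x - M / 2)) \<le> (LINT x:interior T'|lebesgue. M / 2 * ?W x)"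
    by (rule set_integral_mono[OF i1 i2 pw])
  moreover have "(LINT x:interior T'|lebesgue. ?\<psi> (M / 2) * (?u x - M / 2)) = ?\<psi> (M / 2) * (measure lebesgue T' * M - measure lebesgue T' * (M / 2))"
    using set_integral_diff(2)[OF mi(1) set_integrable_const_element[OF T', of "M / 2"]]
    by (simp add: integral_const_interior[OF T'] mi(4)[symmetric] M(1))
  moreover have "(LINT x:interior T'|lebesgue. M / 2 * ?W x) = M / 2 * (2 ^ (k + 2) * C\<^sub>F * (2 * (LINT x:interior T'|lebesgue. (norm (F ?a - F (G x)))\<^sup>2)
      + 3 * (LINT x:interior T'|lebesgue. (norm (F (G x) - F r))\<^sup>2)))"
    using set_integral_add(2)[OF e1 e2] by simp
  ultimately have "M / 2 * (measure lebesgue T' * ?\<psi> (M / 2)) \<le> M / 2 * (2 ^ (k + 2) * C\<^sub>F *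
      (2 * (LINT x:interior T'|lebesgue. (norm (F ?a - F (G x)))\<^sup>2) + 3 * (LINT x:interior T'|lebesgue. (norm (F (G x) - F r))\<^sup>2)))"
    by (simp add: algebra_simps)
  then have "measure lebesgue T' * ?\<psi> (M / 2) \<le> 2 ^ (k + 2) * C\<^sub>F *
      (2 * (LINT x:interior T'|lebesgue. (norm (F ?a - F (G x)))\<^sup>2) + 3 * (LINT x:interior T'|lebesgue. (norm (F (G x) - F r))\<^sup>2))"
    using M(2) by (simp only: mult_le_cancel_left_pos half_gt_zero)
  also have "\<dots> \<le> 2 ^ (k + 2) * C\<^sub>F * (2 * error T + 3 * oscillation T r)"
    using element_error_le[OF T] element_oscillation_le[OF T, of r] C0 by (intro mult_left_mono) auto
  finally show ?thesis .
qed

lemma averaged_grad_dist_le: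
  assumes T: "T \<in> \<T>" and D: "\<And>T'. T' \<in> patch T \<Longrightarrow> side_size T' \<le> D"
    and M: "\<And>T'. T' \<in> patch T \<Longrightarrow> mean_dist r T' \<le> M"
  shows "norm (averaged_grad T - elem_grad v T)
    \<le> real (DIM('a) + 1) * (real chain_bound + real DIM('a) + 1) * M * D * \<kappa> / diameter T"
proof -
  obtain x where x: "x \<in> interior T" using full_simplex.interior_ne[OF full[OF T]] by blast
  have M': "norm (elem_grad v T' - r) \<le> M" "mean_error v G T' \<le> M" if "T' \<in> patch T" for T'
    using mean_dist(2,3)[of T' r] M[OF that] that by (auto simp: patch_def)
  show ?thesis
    using averaging_grad_diff_le[OF v u G resolves T x D M'] by (simp add: node_averaging_grad[OF T x] averaged_grad_def)
qed

lemma averaging_error_le_dim1: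
  assumes T: "T \<in> \<T>" and d: "DIM('a) = 1"
  shows "averaging_error T \<le> error T"
proof -
  have "norm (averaged_grad T - elem_grad v T) \<le> real (DIM('a) + 1) * (real chain_bound + real DIM('a) + 1) *
      Max (mean_dist 0 ` patch T) * 0 * \<kappa> / diameter T"
    using finite_patch d by (intro averaged_grad_dist_le[OF T, where r = 0]) (auto simp: side_size_def)
  then have "averaged_grad T = elem_grad v T" by simp
  then show ?thesis using element_error_le[OF patch_self[OF T]] averaging_error_eq[OF T] by simp
qed

text \<open>On \<open>T\<close> the averaged gradient is one vector, within \<open>?K * M\<close> of
  \<open>r\<close>. The maximum \<open>M\<close> is attained on one element \<open>Ts\<close> of the
  patch, whose volume is comparable to that of \<open>T\<close>; so a single tangent estimate on
  \<open>Ts\<close> suffices.\<close>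

lemma averaging_error_le:
  assumes T: "T \<in> \<T>" and d: "DIM('a) \<ge> 2"
  shows "averaging_error T \<le> stability_const \<kappa> k DIM('a) * (error T + oscillation T r)"
proof -
  let ?p = "averaged_grad T"
  let ?\<psi> = "shifted (norm r)"
  let ?K = "gradient_const \<kappa> DIM('a)" and ?C1 = "local_const \<kappa> k DIM('a)"
  define M where "M = Max (mean_dist r ` patch T)"
  have ne: "patch T \<noteq> {}" using patch_self[OF T] by blast
  have M: "mean_dist r T' \<le> M" if "T' \<in> patch T" for T'
    unfolding M_def using that finite_patch by (intro Max_ge) auto
  have "M \<in> mean_dist r ` patch T" unfolding M_def using ne finite_patch by (intro Max_in) auto
  then obtain Ts where Ts: "Ts \<in> patch T" "M = mean_dist r Ts" by blast
  have Ts': "Ts \<in> \<T>" using Ts(1) by (simp add: patch_def)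
  have M0: "M \<ge> 0" using mean_dist(2)[OF Ts', of r] Ts(2) norm_ge_zero order_trans by metis
  have K1: "?K \<ge> 1" using gradient_const_ge_1[OF kappa] .
  have "norm (?p - elem_grad v T) \<le> real (DIM('a) + 1) * (real chain_bound + real DIM('a) + 1) * M *
      (\<kappa> ^ chain_bound * diameter T) * \<kappa> / diameter T"
    using diameter_patch_le(2)[OF d T] d by (intro averaged_grad_dist_le[OF T _ M]) (auto simp: side_size_def)
  also have "\<dots> = (?K - 1) * M"
    using diameter_pos[OF T] by (simp add: gradient_const_def chain_bound_def)
  finally have "norm (?p - elem_grad v T) \<le> (?K - 1) * M" .
  moreover have "norm (elem_grad v T - r) \<le> M"
    using mean_dist(2)[OF T, of r] M[OF patch_self[OF T]] by linarith
  moreover have "norm (?p - r) \<le> norm (?p - elem_grad v T) + norm (elem_grad v T - r)"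
    using norm_triangle_ineq[of "?p - elem_grad v T" "elem_grad v T - r"] by simp
  ultimately have pr: "norm (?p - r) \<le> ?K * M" by (simp add: algebra_simps)
  have eo: "2 * error T + 3 * oscillation T r \<ge> 0" using error_nonneg[of T] oscillation_nonneg[of T r] by simp
  have main: "measure lebesgue T * (norm (F ?p - F r))\<^sup>2 \<le> ?C1 * (2 * error T + 3 * oscillation T r)"
  \<comment> \<open>The tangent estimate divides by \<open>M\<close>. If \<open>M\<close> is zero,
    the averaged gradient equals \<open>r\<close>.\<close>
  proof (cases "M = 0")
    case True
    then have "?p = r" using pr by simp
    then show ?thesis using eo local_const_nonneg[OF kappa] by simp
  next
    case False
    then have M1: "M > 0" using M0 by simp
    have V0: "volume_ratio \<ge> 0" using kappa by (simp add: volume_ratio_def)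
    have C0: "C\<^sub>F \<ge> 0" using C_F_ge_1 by simp
    have \<psi>0: "?\<psi> (M / 2) \<ge> 0" using M1 by (intro shifted_nonneg) auto
    have "(norm (F ?p - F r))\<^sup>2 \<le> C\<^sub>F * ?\<psi> (norm (?p - r))" by (rule F_map_diff_le_shifted)
    \<comment> \<open>The argument becomes a multiple of \<open>M / 2\<close>, the point at which
      the tangent estimate is stated.\<close>
    also have "\<dots> \<le> C\<^sub>F * ?\<psi> (2 * ?K * (M / 2))"
      using pr C0 by (intro mult_left_mono shifted_mono) auto
    also have "\<dots> \<le> C\<^sub>F * ((2 * ?K) ^ (k + 2) * ?\<psi> (M / 2))"
      using K1 M1 C0 by (intro mult_left_mono shifted_scale) auto
    finally have "measure lebesgue T * (norm (F ?p - F r))\<^sup>2 \<le> (volume_ratio * measure lebesgue Ts) * (C\<^sub>F * ((2 * ?K) ^ (k + 2) * ?\<psi> (M / 2)))"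
      using content_patch_le[OF d T Ts(1)] V0 by (intro mult_mono) auto
    also have "\<dots> = C\<^sub>F * volume_ratio * (2 * ?K) ^ (k + 2) * (measure lebesgue Ts * ?\<psi> (M / 2))"
      by (simp only: mult_ac)
    also have "\<dots> \<le> C\<^sub>F * volume_ratio * (2 * ?K) ^ (k + 2) * (2 ^ (k + 2) * C\<^sub>F * (2 * error T + 3 * oscillation T r))"
      using element_tangent_estimate[OF Ts M1] V0 C0 K1 by (intro mult_left_mono) auto
    also have "\<dots> = ?C1 * (2 * error T + 3 * oscillation T r)"
    proof -
      have "?C1 = C\<^sub>F\<^sup>2 * volume_ratio * (2 * ?K) ^ (k + 2) * 2 ^ (k + 2)"
        unfolding local_const_def C\<^sub>F_def volume_ratio_def chain_bound_def ..
      then show ?thesis by (simp only: power2_eq_square mult_ac)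
    qed
    finally show ?thesis .
  qed
  have j1: "set_integrable lebesgue (interior T) (\<lambda>x. 2 * (norm (F ?p - F r))\<^sup>2)"
    by (rule set_integrable_const_element[OF T])
  have j2: "set_integrable lebesgue (interior T) (\<lambda>x. 2 * (norm (F (G x) - F r))\<^sup>2)"
    by (intro set_integrable_mult_right square_integrable_diff T)
  have "averaging_error T \<le> (LINT x:interior T|lebesgue. 2 * (norm (F ?p - F r))\<^sup>2 + 2 * (norm (F (G x) - F r))\<^sup>2)"
    unfolding averaging_error_eq[OF T]
  proof (rule set_integral_mono[OF square_integrable_diff(1)[OF T] set_integral_add(1)[OF j1 j2]])
    show "(norm (F ?p - F (G x)))\<^sup>2 \<le> 2 * (norm (F ?p - F r))\<^sup>2 + 2 * (norm (F (G x) - F r))\<^sup>2" for x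
      using sq_norm_diff_le[of "F ?p" "F (G x)" "F r"] by (simp add: norm_minus_commute)
  qed
  also have "\<dots> = 2 * (measure lebesgue T * (norm (F ?p - F r))\<^sup>2) + 2 * (LINT x:interior T|lebesgue. (norm (F (G x) - F r))\<^sup>2)"
    unfolding set_integral_add(2)[OF j1 j2] integral_const_interior[OF T] by simp
  also have "\<dots> \<le> 2 * (?C1 * (2 * error T + 3 * oscillation T r)) + 2 * oscillation T r"
    using main element_oscillation_le[OF patch_self[OF T], of r] by linarith
  also have "\<dots> \<le> stability_const \<kappa> k DIM('a) * (error T + oscillation T r)"
  proof -
    have "2 * (?C1 * (2 * error T + 3 * oscillation T r)) \<le> 6 * ?C1 * (error T + oscillation T r)"
      using mult_left_mono[OF error_nonneg[of T], of ?C1] local_const_nonneg[OF kappa, of k "DIM('a)"] error_nonneg[of T]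
      by (simp add: algebra_simps)
    moreover have "2 * oscillation T r \<le> 2 * (error T + oscillation T r)" using error_nonneg[of T] by simp
    ultimately show ?thesis unfolding stability_const_def by (simp add: algebra_simps)
  qed
  finally show ?thesis .
qed

end

text \<open>Some inscribed ball has more than half the supremal diameter, whether or not the
  supremum is attained. Its diameter is \<open>2 * R\<close>, hence the factor
  \<open>4\<close>.\<close>

lemma shape_from_chunkiness:
  fixes \<T> :: "real \<Rightarrow> 'a::euclidean_space set set"
  assumes conf: "conforming_triangulation \<Omega> (\<T> h)" and bdd: "bdd_above (aspect_ratios \<T>)"
    and h: "h > 0" and T: "T \<in> \<T> h"
  shows "\<exists>z R. R > 0 \<and> ball z R \<subseteq> T \<and> diameter T \<le> max 1 (4 * chunkiness \<T>) * R"
proof -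
  interpret full_simplex T
    using conf T by (simp add: conforming_triangulation_def full_simplex_def)
  let ?X = "{diameter (ball x r) | x r. ball x r \<subseteq> T}"
  have bX: "bdd_above ?X"
  proof (rule bdd_aboveI)
    fix y assume "y \<in> ?X"
    then obtain z r where "y = diameter (ball z r)" "ball z r \<subseteq> T" by blast
    then show "y \<le> diameter T" using diameter_subset[OF _ bounded_T, of "ball z r"] by simp
  qed
  obtain z0 where "z0 \<in> interior T" using interior_ne by blast
  then obtain r0 where r0: "r0 > 0" "ball z0 r0 \<subseteq> T" by (auto simp: mem_interior)
  have "diameter (ball z0 r0) \<in> ?X" using r0 by blast
  then have "diameter (ball z0 r0) \<le> inradius_diam T"
    unfolding inradius_diam_def by (rule cSup_upper[OF _ bX])
  then have \<rho>: "inradius_diam T > 0" using r0 by (simp add: diameter_ball)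
  have "?X \<noteq> {}" using r0 by blast
  then obtain y where "y \<in> ?X" "inradius_diam T / 2 < y"
    using less_cSupE[of "inradius_diam T / 2" ?X] \<rho> unfolding inradius_diam_def by auto
  then obtain z R where R: "ball z R \<subseteq> T" "inradius_diam T / 2 < diameter (ball z R)" by blast
  have R0: "R > 0" using R(2) \<rho> by (auto simp: diameter_ball split: if_splits)
  then have R4: "inradius_diam T \<le> 4 * R" using R(2) by (simp add: diameter_ball)
  have "diameter T / inradius_diam T \<le> chunkiness \<T>"
    unfolding chunkiness_def using h T by (intro cSup_upper bdd) (auto simp: aspect_ratios_def)
  then have le: "diameter T \<le> chunkiness \<T> * inradius_diam T" using \<rho> by (simp add: divide_le_eq)
  have "diameter T \<ge> 0" by (rule diameter_ge_0[OF bounded_T])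
  then have "chunkiness \<T> \<ge> 0" using le \<rho> by (metis mult_less_0_iff not_less order_less_le_trans)
  then have "chunkiness \<T> * inradius_diam T \<le> chunkiness \<T> * (4 * R)" using R4 by (rule mult_left_mono[rotated])
  also have "\<dots> \<le> max 1 (4 * chunkiness \<T>) * R" using R0 by simp
  finally show ?thesis using le R(1) R0 by force
qed

text \<open>The repeated factor, \<open>A\<close> in the next proof, compares the diameter of the
  patch with that of \<open>T\<close>. Its square covers the power \<open>2 * \<beta>\<close>; the
  last power compares the volume of the ball of translations with that of the patch.\<close>

definition nikolskii_const :: "real \<Rightarrow> nat \<Rightarrow> real" where
  "nikolskii_const \<kappa> d = (1 + 2 * \<kappa> ^ (star_bound \<kappa> d)\<^sup>2)\<^sup>2 * ((1 + 2 * \<kappa> ^ (star_bound \<kappa> d)\<^sup>2) * \<kappa>) ^ d"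

section \<open>Passage to the infimum and to the Nikolskii seminorm\<close>

context averaging_problem begin

lemma oscillation_INF_le:
  assumes T: "T \<in> \<T>" and d: "DIM('a) \<ge> 2" and \<beta>: "0 < \<beta>" "\<beta> \<le> 1"
    and N: "(\<lambda>x. F (G x)) \<in> nikolskii_space \<beta> 2 (interior (element_patch \<T> T))"
  shows "(INF r. oscillation T r) \<le> nikolskii_const \<kappa> DIM('a) *
    (diameter T powr (2 * \<beta>) * (nikolskii_seminorm \<beta> 2 (interior (element_patch \<T> T)) (\<lambda>x. F (G x)))\<^sup>2)"
proof -
  let ?\<omega> = "element_patch \<T> T" and ?h = "diameter T"
  let ?U = "interior (element_patch \<T> T)"
  let ?S = "nikolskii_seminorm \<beta> 2 ?U (\<lambda>x. F (G x))"
  define A where "A = 1 + 2 * \<kappa> ^ chain_bound"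
  define D where "D = A * ?h"
  have A1: "A \<ge> 1" using kappa by (simp add: A_def)
  have h: "?h > 0" by (rule diameter_pos[OF T])
  have dist\<omega>: "dist x y \<le> D" if xy: "x \<in> ?\<omega>" "y \<in> ?\<omega>" for x y
  proof -
    have near: "\<exists>p\<in>T. dist x p \<le> \<kappa> ^ chain_bound * ?h" if z: "x \<in> ?\<omega>" for x
    proof -
      obtain T' where T': "T' \<in> patch T" "x \<in> T'" using z unfolding element_patch_eq by blast
      then obtain p where p: "p \<in> T" "p \<in> T'" "T' \<in> \<T>" by (auto simp: patch_def)
      then have "dist x p \<le> diameter T'" using dist_le_diameter T' by blast
      then show ?thesis using diameter_patch_le(2)[OF d T T'(1)] p by force
    qed
    obtain p q where pq: "p \<in> T" "dist x p \<le> \<kappa> ^ chain_bound * ?h" "q \<in> T" "dist y q \<le> \<kappa> ^ chain_bound * ?h"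
      using near xy by meson
    have "dist x y \<le> dist x p + dist p q + dist y q"
      using dist_triangle[of x y p] dist_triangle[of p y q] by (simp add: dist_commute)
    then show ?thesis using pq dist_le_diameter[OF T pq(1,3)] by (simp add: D_def A_def algebra_simps)
  qed
  have bU: "bounded ?U"
  proof -
    have "bounded (\<Union>(patch T))"
      using finite_patch bounded_element by (intro bounded_Union) (auto simp: patch_def)
    then show ?thesis using interior_subset bounded_subset by (metis element_patch_eq)
  qed
  have intT: "interior T \<subseteq> ?U"
    using patch_self[OF T] by (intro interior_mono) (auto simp: element_patch_eq)
  let ?V = "unit_ball_vol (real DIM('a))"
  have mU: "measure lebesgue T \<le> measure lebesgue ?U"
  proof -
    interpret full_simplex T using full T by blast
    have "measure lebesgue T = measure lebesgue (interior T)"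
      using integral_const_interior[OF T, of 1] by (simp add: set_lebesgue_integral_def)
    also have "\<dots> \<le> measure lebesgue ?U"
      using intT bU by (intro measure_mono_fmeasurable) (auto intro: lmeasurable_open)
    finally show ?thesis .
  qed
  have ball: "measure lebesgue (cball (0::'a) D) \<le> (A * \<kappa>) ^ DIM('a) * measure lebesgue ?U"
  proof -
    have "D \<ge> 0" using A1 h by (simp add: D_def)
    then have "measure lebesgue (cball (0::'a) D) = ?V * D ^ DIM('a)" by (simp add: content_cball)
    also have "\<dots> = (A * \<kappa>) ^ DIM('a) * (?V * (?h / \<kappa>) ^ DIM('a))"
      using kappa by (simp add: D_def power_mult_distrib power_divide)
    also have "\<dots> \<le> (A * \<kappa>) ^ DIM('a) * measure lebesgue ?U"
      using content_element_ge[OF T] mU A1 kappa by (intro mult_left_mono) auto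
    finally show ?thesis .
  qed
  \<comment> \<open>As \<open>A \<ge> 1\<close> and \<open>\<beta> \<le> 1\<close>, the exponent on
    \<open>A\<close> may be raised to \<open>2\<close>, which makes the constant independent of
    \<open>\<beta>\<close>.\<close>
  have Dp: "D powr (2 * \<beta>) \<le> A\<^sup>2 * ?h powr (2 * \<beta>)"
  proof -
    have "A powr (2 * \<beta>) \<le> A powr 2" using A1 \<beta> by (intro powr_mono) auto
    then have "A powr (2 * \<beta>) \<le> A\<^sup>2" using A1 by simp
    then show ?thesis using A1 h by (simp add: D_def powr_mult mult_right_mono)
  qed
  define Q where "Q = nikolskii_const \<kappa> DIM('a) * (?h powr (2 * \<beta>) * ?S\<^sup>2)"
  have Q: "Q = A\<^sup>2 * ?h powr (2 * \<beta>) * ?S\<^sup>2 * (A * \<kappa>) ^ DIM('a)"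
    by (simp add: Q_def nikolskii_const_def A_def chain_bound_def)
  have KQ: "D powr (2 * \<beta>) * ?S\<^sup>2 * measure lebesgue (cball (0::'a) D) \<le> Q * measure lebesgue ?U"
  proof -
    have "D powr (2 * \<beta>) * ?S\<^sup>2 * measure lebesgue (cball (0::'a) D) \<le>
        (A\<^sup>2 * ?h powr (2 * \<beta>) * ?S\<^sup>2) * ((A * \<kappa>) ^ DIM('a) * measure lebesgue ?U)"
      using ball Dp by (intro mult_mono) auto
    then show ?thesis unfolding Q by (simp add: mult_ac)
  qed
  have bdd: "bdd_below (range (oscillation T))" using oscillation_nonneg by (intro bdd_belowI[of _ 0]) auto
  \<comment> \<open>\<open>nikolskii_oscillation\<close> asks for a strict inequality, which fails
    at \<open>Q\<close> itself when the seminorm is zero. The comparison vector is the value of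
    \<open>G\<close> at the point found there.\<close>
  have "(INF r. oscillation T r) \<le> Q + \<epsilon>" if "\<epsilon> > 0" for \<epsilon>
  proof -
    have "measure lebesgue ?U > 0" using mU content_pos[OF T] by linarith
    then have "\<epsilon> * measure lebesgue ?U > 0" using that by simp
    then have "D powr (2 * \<beta>) * ?S\<^sup>2 * measure lebesgue (cball (0::'a) D) < (Q + \<epsilon>) * measure lebesgue ?U"
      using KQ by (simp add: distrib_right)
    moreover have "dist x y \<le> D" if "x \<in> ?U" "y \<in> ?U" for x y
      using dist\<omega> that interior_subset by blast
    ultimately obtain y where y: "(LINT x:?U|lebesgue. (norm (F (G x) - F (G y)))\<^sup>2) \<le> Q + \<epsilon>"
      using nikolskii_oscillation[OF N _ bU _ \<beta>(1), of D "Q + \<epsilon>"] by auto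
    have "oscillation T (G y) = (LINT x:?U|lebesgue. (norm (F (G x) - F (G y)))\<^sup>2)"
      unfolding oscillation_def
    proof (rule set_integral_negligible_diff[OF interior_subset])
      have "(\<Union>T'\<in>patch T. interior T') \<subseteq> ?U"
        using interiors_subset_patch by (intro interior_maximal) auto
      then show "negligible (?\<omega> - ?U)" by (intro negligible_subset[OF negligible_patch_diff[of T]]) auto
      have "set_integrable lebesgue ?\<omega> (\<lambda>x. (norm (F (G x) - F (G y)))\<^sup>2)"
        by (intro set_integrable_patch square_integrable_diff) (simp add: patch_def)
      then show "set_integrable lebesgue ?U (\<lambda>x. (norm (F (G x) - F (G y)))\<^sup>2)"
        by (rule set_integrable_subset) (auto simp: interior_subset)
    qed
    moreover have "(INF r. oscillation T r) \<le> oscillation T (G y)" by (rule cINF_lower[OF bdd]) simp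
    ultimately show ?thesis using y by linarith
  qed
  then show ?thesis unfolding Q_def[symmetric] by (rule field_le_epsilon)
qed

definition "total_const = stability_const \<kappa> k DIM('a) * (1 + nikolskii_const \<kappa> DIM('a))"

lemma total_const:
  shows "total_const \<ge> 1" "stability_const \<kappa> k DIM('a) \<le> total_const"
    "stability_const \<kappa> k DIM('a) * nikolskii_const \<kappa> DIM('a) \<le> total_const"
    "stability_const \<kappa> k DIM('a) \<ge> 0"
proof -
  have s: "stability_const \<kappa> k DIM('a) \<ge> 2" unfolding stability_const_def using local_const_nonneg[OF kappa] by simp
  have n: "nikolskii_const \<kappa> DIM('a) \<ge> 0" unfolding nikolskii_const_def using kappa by simp
  have p: "stability_const \<kappa> k DIM('a) * nikolskii_const \<kappa> DIM('a) \<ge> 0" using s n by simp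
  then show "total_const \<ge> 1" "stability_const \<kappa> k DIM('a) \<le> total_const"
    "stability_const \<kappa> k DIM('a) * nikolskii_const \<kappa> DIM('a) \<le> total_const" "stability_const \<kappa> k DIM('a) \<ge> 0"
    using s unfolding total_const_def by (simp_all add: distrib_left)
qed

lemma averaging_error_total:
  assumes T: "T \<in> \<T>"
  shows "averaging_error T \<le> total_const * error T + total_const * (INF r. oscillation T r)"
    and "\<lbrakk>0 < \<beta>; \<beta> \<le> 1; (\<lambda>x. F (G x)) \<in> nikolskii_space \<beta> 2 (interior (element_patch \<T> T))\<rbrakk> \<Longrightarrow>
      averaging_error T \<le> total_const * error T + total_const * diameter T powr (2 * \<beta>) *
        (nikolskii_seminorm \<beta> 2 (interior (element_patch \<T> T)) (\<lambda>x. F (G x)))\<^sup>2"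
proof -
  let ?c = "stability_const \<kappa> k DIM('a)"
  let ?J = "INF r. oscillation T r"
  note c = total_const
  have e0: "error T \<ge> 0" by (rule error_nonneg)
  have J0: "?J \<ge> 0" using oscillation_nonneg by (intro cINF_greatest) auto
  have ce: "?c * error T \<le> total_const * error T" "?c * ?J \<le> total_const * ?J" "error T \<le> total_const * error T"
    using c e0 J0 mult_right_mono[OF c(1) e0] by (auto intro: mult_right_mono)
  have dim: "DIM('a) = 1 \<or> DIM('a) \<ge> 2" using DIM_positive[where 'a='a] by linarith
  have inf: "averaging_error T \<le> ?c * error T + ?c * ?J" if d: "DIM('a) \<ge> 2"
  proof -
    have c0: "?c > 0" unfolding stability_const_def using local_const_nonneg[OF kappa, of k "DIM('a)"] by simp
    \<comment> \<open>Solving for the oscillation turns the family of estimates into a lower bound,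
      which passes to the infimum.\<close>
    have "(averaging_error T - ?c * error T) / ?c \<le> ?J"
    proof (rule cINF_greatest)
      fix r
      show "(averaging_error T - ?c * error T) / ?c \<le> oscillation T r"
        using averaging_error_le[OF T d, of r] c0 by (simp add: divide_le_eq algebra_simps)
    qed simp
    then show ?thesis using c0 by (simp add: divide_le_eq algebra_simps)
  qed
  show "averaging_error T \<le> total_const * error T + total_const * ?J"
    using dim
  proof
    assume "DIM('a) = 1"
    then show ?thesis using averaging_error_le_dim1[OF T] ce J0 c(1) by (smt (verit) mult_nonneg_nonneg)
  next
    assume "DIM('a) \<ge> 2"
    then show ?thesis using inf ce by linarith
  qed
  assume \<beta>: "0 < \<beta>" "\<beta> \<le> 1" and N: "(\<lambda>x. F (G x)) \<in> nikolskii_space \<beta> 2 (interior (element_patch \<T> T))"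
  let ?R = "diameter T powr (2 * \<beta>) * (nikolskii_seminorm \<beta> 2 (interior (element_patch \<T> T)) (\<lambda>x. F (G x)))\<^sup>2"
  have R0: "?R \<ge> 0" by simp
  have "averaging_error T \<le> total_const * error T + total_const * ?R"
    using dim
  proof
    assume "DIM('a) = 1"
    then show ?thesis using averaging_error_le_dim1[OF T] ce(3) mult_nonneg_nonneg[of total_const ?R] c(1) R0 by linarith
  next
    assume d: "DIM('a) \<ge> 2"
    have "?c * ?J \<le> ?c * (nikolskii_const \<kappa> DIM('a) * ?R)"
      using oscillation_INF_le[OF T d \<beta> N] c(4) by (rule mult_left_mono)
    also have "\<dots> \<le> total_const * ?R"
      using mult_right_mono[OF c(3) R0] by (simp only: mult.assoc)
    finally show ?thesis using inf[OF d] ce(1) by linarith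
  qed
  then show "averaging_error T \<le> total_const * error T + total_const * diameter T powr (2 * \<beta>) *
        (nikolskii_seminorm \<beta> 2 (interior (element_patch \<T> T)) (\<lambda>x. F (G x)))\<^sup>2"
    by (simp only: mult.assoc)
qed

end

theorem proposition6p2:
  fixes \<omega>\<^sub>0 D\<^sub>2 N\<^sub>2 c\<^sub>0 :: real
  shows "\<exists>c>0. \<forall>(\<phi> :: real \<Rightarrow> real) (\<Omega> :: 'a::euclidean_space set) \<Gamma>\<^sub>D \<Gamma>\<^sub>N (\<T> :: real \<Rightarrow> 'a set set).
    N_function \<phi> \<and> Delta2_condition \<phi> \<and> Nabla2_condition \<phi> \<and>
    continuous_on UNIV (\<lambda>x::'a. \<phi> (norm x)) \<and> C_on 2 (UNIV - {0}) (\<lambda>x::'a. \<phi> (norm x)) \<and>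
    C_on 2 {0<..} \<phi> \<and> deriv_equivalence c\<^sub>0 \<phi> \<and>
    Delta2 \<phi> = D\<^sub>2 \<and> Nabla2 \<phi> = N\<^sub>2 \<and>
    simplicial_lipschitz_domain \<Omega> \<and> boundary_partition \<Omega> \<Gamma>\<^sub>D \<Gamma>\<^sub>N \<and>
    (\<forall>h>0. conforming_triangulation \<Omega> (\<T> h) \<and> mesh_resolves \<Omega> \<Gamma>\<^sub>D \<Gamma>\<^sub>N (\<T> h)) \<and>
    bdd_above (aspect_ratios \<T>) \<and> chunkiness \<T> = \<omega>\<^sub>0
    \<longrightarrow> (\<forall>h>0. \<forall>v\<^sub>h \<in> S1cr_D \<Omega> \<Gamma>\<^sub>D (\<T> h). \<forall>v \<in> W11_D \<Omega> \<Gamma>\<^sub>D. \<forall>G. \<forall>T \<in> \<T> h.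
      has_weak_gradient \<Omega> v G \<and> (\<lambda>x. F_map \<phi> (G x)) \<in> Lp_space 2 \<Omega> \<longrightarrow>
      (let \<omega>\<^sub>T = element_patch (\<T> h) T;
           lhs = (Lp_norm 2 T
             (\<lambda>x. F_map \<phi> (grad (node_averaging \<Gamma>\<^sub>D (\<T> h) v\<^sub>h) x) - F_map \<phi> (G x)))\<^sup>2;
           err = (Lp_norm 2 \<omega>\<^sub>T (\<lambda>x. F_map \<phi> (grad v\<^sub>h x) - F_map \<phi> (G x)))\<^sup>2
       in lhs \<le> c * err + c * (INF r. (Lp_norm 2 \<omega>\<^sub>T (\<lambda>x. F_map \<phi> (G x) - F_map \<phi> r))\<^sup>2) \<and>
          (\<forall>\<beta>. 0 < \<beta> \<and> \<beta> \<le> 1 \<and>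
               (\<lambda>x. F_map \<phi> (G x)) \<in> nikolskii_space \<beta> 2 (interior \<omega>\<^sub>T) \<longrightarrow>
             lhs \<le> c * err + c * diameter T powr (2 * \<beta>) *
               (nikolskii_seminorm \<beta> 2 (interior \<omega>\<^sub>T) (\<lambda>x. F_map \<phi> (G x)))\<^sup>2)))"
proof -
  \<comment> \<open>The constants are fixed before \<open>\<phi>\<close>, the domain and the meshes.
    The maximum with \<open>1\<close>, and \<open>nat\<close> in \<open>k\<close>, give meaningful
    values also for parameters that no mesh and no \<open>\<phi>\<close> realize.\<close>
  define \<kappa> where "\<kappa> = max 1 (4 * \<omega>\<^sub>0)"
  define k where "k = nat \<lceil>c\<^sub>0\<rceil>"
  define c where "c = stability_const \<kappa> k DIM('a) * (1 + nikolskii_const \<kappa> DIM('a))"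
  have k: "c\<^sub>0 \<le> real k" unfolding k_def by linarith
  have "stability_const \<kappa> k DIM('a) \<ge> 2"
    unfolding stability_const_def using local_const_nonneg[of \<kappa> k "DIM('a)"] by (simp add: \<kappa>_def)
  moreover have "nikolskii_const \<kappa> DIM('a) \<ge> 0" unfolding nikolskii_const_def by (simp add: \<kappa>_def)
  ultimately have "c > 0" unfolding c_def by (intro mult_pos_pos) auto
  then show ?thesis
  proof (intro exI[of _ c] conjI allI impI ballI, assumption)
    fix \<phi> :: "real \<Rightarrow> real" and \<Omega> \<Gamma>\<^sub>D \<Gamma>\<^sub>N :: "'a set" and \<T> :: "real \<Rightarrow> 'a set set" and h :: real
      and v\<^sub>h v :: "'a \<Rightarrow> real" and G :: "'a \<Rightarrow> 'a" and T :: "'a set"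
    assume A: "N_function \<phi> \<and> Delta2_condition \<phi> \<and> Nabla2_condition \<phi> \<and>
      continuous_on UNIV (\<lambda>x::'a. \<phi> (norm x)) \<and> C_on 2 (UNIV - {0}) (\<lambda>x::'a. \<phi> (norm x)) \<and>
      C_on 2 {0<..} \<phi> \<and> deriv_equivalence c\<^sub>0 \<phi> \<and>
      Delta2 \<phi> = D\<^sub>2 \<and> Nabla2 \<phi> = N\<^sub>2 \<and>
      simplicial_lipschitz_domain \<Omega> \<and> boundary_partition \<Omega> \<Gamma>\<^sub>D \<Gamma>\<^sub>N \<and>
      (\<forall>h>0. conforming_triangulation \<Omega> (\<T> h) \<and> mesh_resolves \<Omega> \<Gamma>\<^sub>D \<Gamma>\<^sub>N (\<T> h)) \<and>
      bdd_above (aspect_ratios \<T>) \<and> chunkiness \<T> = \<omega>\<^sub>0"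
      and h: "h > 0" and vh: "v\<^sub>h \<in> S1cr_D \<Omega> \<Gamma>\<^sub>D (\<T> h)" and v: "v \<in> W11_D \<Omega> \<Gamma>\<^sub>D" and T: "T \<in> \<T> h"
      and G: "has_weak_gradient \<Omega> v G \<and> (\<lambda>x. F_map \<phi> (G x)) \<in> Lp_space 2 \<Omega>"
    have conf: "conforming_triangulation \<Omega> (\<T> h)" using A h by blast
    interpret regular_N_function \<phi> k using A k by (intro regular_N_functionI) auto
    interpret averaging_problem \<Omega> "\<T> h" \<kappa> \<phi> k \<Gamma>\<^sub>D \<Gamma>\<^sub>N v\<^sub>h v G
    proof
      show "simplicial_lipschitz_domain \<Omega>" "conforming_triangulation \<Omega> (\<T> h)" "\<kappa> \<ge> 1"
        "v\<^sub>h \<in> S1cr_D \<Omega> \<Gamma>\<^sub>D (\<T> h)" "v \<in> W11_D \<Omega> \<Gamma>\<^sub>D" "has_weak_gradient \<Omega> v G"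
        "mesh_resolves \<Omega> \<Gamma>\<^sub>D \<Gamma>\<^sub>N (\<T> h)" "(\<lambda>x. F_map \<phi> (G x)) \<in> Lp_space 2 \<Omega>"
        using A h vh v G conf by (auto simp: \<kappa>_def)
      show "\<exists>z R. R > 0 \<and> ball z R \<subseteq> T' \<and> diameter T' \<le> \<kappa> * R" if "T' \<in> \<T> h" for T'
        using shape_from_chunkiness[of \<Omega> \<T> h T'] A h that conf by (auto simp: \<kappa>_def)
    qed
    have tc: "total_const = c" unfolding total_const_def c_def ..
    show "let \<omega>\<^sub>T = element_patch (\<T> h) T;
           lhs = (Lp_norm 2 T
             (\<lambda>x. F_map \<phi> (grad (node_averaging \<Gamma>\<^sub>D (\<T> h) v\<^sub>h) x) - F_map \<phi> (G x)))\<^sup>2;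
           err = (Lp_norm 2 \<omega>\<^sub>T (\<lambda>x. F_map \<phi> (grad v\<^sub>h x) - F_map \<phi> (G x)))\<^sup>2
       in lhs \<le> c * err + c * (INF r. (Lp_norm 2 \<omega>\<^sub>T (\<lambda>x. F_map \<phi> (G x) - F_map \<phi> r))\<^sup>2) \<and>
          (\<forall>\<beta>. 0 < \<beta> \<and> \<beta> \<le> 1 \<and>
               (\<lambda>x. F_map \<phi> (G x)) \<in> nikolskii_space \<beta> 2 (interior \<omega>\<^sub>T) \<longrightarrow>
             lhs \<le> c * err + c * diameter T powr (2 * \<beta>) *
               (nikolskii_seminorm \<beta> 2 (interior \<omega>\<^sub>T) (\<lambda>x. F_map \<phi> (G x)))\<^sup>2)"
      unfolding Let_def Lp_norm_2_squared averaging_error_def[symmetric] error_def[symmetric]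
        oscillation_def[symmetric] tc[symmetric]
      using averaging_error_total[OF T] by blast
  qed
qed

end
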